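(* For every odd integer $m\ge5$, the Oliveira minimal Möbius band of total curvature $2m\pi$ has Morse index $m-1$.
   Context: **Oliveira minimal Möbius bands.** For an odd integer $m\ge5$, the oriented double cover of the Oliveira minimal Möbius band of total curvature $\int(-\kappa)=2m\pi$ is $\mathbb{C}\setminus\{0\}$ with Weierstrass data $$\mathcal{G}_m(z)=z^{m-1}\frac{z+1}{z-1},\qquad \eta_m=i\frac{(z-1)^2}{z^{m+1}}dz,$$ i.e. with immersion $\tilde X=\mathrm{Re}\int\left(\tfrac12(1-\mathcal{G}_m^2),\tfrac i2(1+\mathcal{G}_m^2),\mathcal{G}_m\right)\eta_m$, which is invariant under the fixed-point-free anti-holomorphic involution $\tau(z)=-1/\overline z$; the surface is the induced complete immersion of the Möbius band $(\mathbb{C}\setminus\{0\})/\langle\tau\rangle$ in $\mathbb{R}^3$. **Morse index.** For a complete nonorientable minimal immersion $X:M\to\mathbb{R}^3$, let $\pi:\tilde M\to M$ be the oriented double cover with the induced metric and Gauss curvature $\kappa$, let $\tau$ be the change of sheets involution, and let $\tilde Q(u,u)=\int_{\tilde M}|\nabla u|^2+2\kappa u^2$. The Morse index of $M$ is the supremum, over relatively compact domains $\Omega\subset M$, of the maximal dimension of a space of functions in $H^1_0(\pi^{-1}(\Omega))$ that are odd with respect to $\tau$ ($u\circ\tau=-u$) and on which $\tilde Q$ is negative definite. *)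

theory Defs
  imports
    "HOL-Complex_Analysis.Complex_Analysis"
    "HOL-Library.Function_Algebras"
    "HOL-Library.Extended_Nat"
begin

section \<open>Immersed surfaces parametrized by a plane domain\<close>

text \<open>
  A surface is given by a map \<open>X\<close> from an open set of the complex plane, whose real
  coordinates are \<open>x = Re z\<close> and \<open>y = Im z\<close>.  A tangent vector \<open>a \<partial>\<^sub>x + b \<partial>\<^sub>y\<close>
  is written as the complex number \<open>a + \<i> b\<close>.
\<close>

definition dir_deriv :: "complex \<Rightarrow> (complex \<Rightarrow> 'b::real_normed_vector) \<Rightarrow> complex \<Rightarrow> 'b" where
  "dir_deriv v f z = frechet_derivative f (at z) v"

definition fst_form :: "(complex \<Rightarrow> real^3) \<Rightarrow> complex \<Rightarrow> complex \<Rightarrow> complex \<Rightarrow> real" where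
  "fst_form X z v w = dir_deriv v X z \<bullet> dir_deriv w X z"

definition unit_normal :: "(complex \<Rightarrow> real^3) \<Rightarrow> complex \<Rightarrow> real^3" where
  "unit_normal X z = sgn (cross3 (dir_deriv 1 X z) (dir_deriv \<i> X z))"

definition snd_form :: "(complex \<Rightarrow> real^3) \<Rightarrow> complex \<Rightarrow> complex \<Rightarrow> complex \<Rightarrow> real" where
  "snd_form X z v w = dir_deriv w (dir_deriv v X) z \<bullet> unit_normal X z"

definition gram_det :: "(complex \<Rightarrow> real^3) \<Rightarrow> complex \<Rightarrow> real" where
  "gram_det X z = fst_form X z 1 1 * fst_form X z \<i> \<i> - (fst_form X z 1 \<i>)\<^sup>2"

definition gauss_curvature :: "(complex \<Rightarrow> real^3) \<Rightarrow> complex \<Rightarrow> real" where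
  "gauss_curvature X z =
     (snd_form X z 1 1 * snd_form X z \<i> \<i> - (snd_form X z 1 \<i>)\<^sup>2) / gram_det X z"

definition area_density :: "(complex \<Rightarrow> real^3) \<Rightarrow> complex \<Rightarrow> real" where
  "area_density X z = sqrt (gram_det X z)"

text \<open>
  The squared norm, in the induced metric, of the covector \<open>Re p dx + Im p dy\<close>, i.e.
  \<open>g\<^sup>i\<^sup>j p\<^sub>i p\<^sub>j\<close> for the inverse \<open>g\<^sup>i\<^sup>j\<close> of the first fundamental form.  For
  \<open>p = (u\<^sub>x, u\<^sub>y)\<close> this is the squared norm of the Riemannian gradient of \<open>u\<close>.
\<close>
definition covector_norm_sq :: "(complex \<Rightarrow> real^3) \<Rightarrow> complex \<Rightarrow> complex \<Rightarrow> real" where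
  "covector_norm_sq X z p =
     (fst_form X z \<i> \<i> * (Re p)\<^sup>2 - 2 * fst_form X z 1 \<i> * (Re p * Im p)
        + fst_form X z 1 1 * (Im p)\<^sup>2) / gram_det X z"


section \<open>The Sobolev spaces \<open>H\<^sup>1\<close> and \<open>H\<^sup>1\<^sub>0\<close>\<close>

text \<open>
  Functions stand for their classes modulo equality almost everywhere; the values outside
  the open set \<open>W\<close> under consideration are irrelevant.  As in Gilbarg and Trudinger,
  test functions are \<open>C\<^sup>1\<close> with compact support in \<open>W\<close>; by mollification, smooth test
  functions give the same weak derivatives and the same closure.
\<close>

definition test_functions :: "complex set \<Rightarrow> (complex \<Rightarrow> real) set" where
  "test_functions W =
     {\<phi>. (\<forall>z. \<phi> differentiable (at z)) \<and> (\<forall>v. continuous_on UNIV (dir_deriv v \<phi>)) \<and>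
         (\<exists>K. compact K \<and> K \<subseteq> W \<and> (\<forall>z. z \<notin> K \<longrightarrow> \<phi> z = 0))}"

definition locally_integrable_on ::
    "(complex \<Rightarrow> 'b::{banach, second_countable_topology}) \<Rightarrow> complex set \<Rightarrow> bool" where
  "locally_integrable_on f W \<longleftrightarrow> (\<forall>K. compact K \<and> K \<subseteq> W \<longrightarrow> set_integrable lborel K f)"

text \<open>The function \<open>p\<close> represents the weak differential \<open>Re p dx + Im p dy\<close> of \<open>u\<close>.\<close>
definition has_weak_gradient_on ::
    "(complex \<Rightarrow> real) \<Rightarrow> (complex \<Rightarrow> complex) \<Rightarrow> complex set \<Rightarrow> bool" where
  "has_weak_gradient_on u p W \<longleftrightarrow>
     locally_integrable_on u W \<and> locally_integrable_on p W \<and>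
     (\<forall>\<phi> \<in> test_functions W. \<forall>v.
        (LINT z:W|lborel. u z * dir_deriv v \<phi> z) = - (LINT z:W|lborel. (p z \<bullet> v) * \<phi> z))"

text \<open>Unique up to equality almost everywhere on \<open>W\<close>, if there is one.\<close>
definition weak_gradient :: "complex set \<Rightarrow> (complex \<Rightarrow> real) \<Rightarrow> complex \<Rightarrow> complex" where
  "weak_gradient W u = (SOME p. has_weak_gradient_on u p W)"

definition H1 :: "(complex \<Rightarrow> real^3) \<Rightarrow> complex set \<Rightarrow> (complex \<Rightarrow> real) set" where
  "H1 X W =
     {u. (\<exists>p. has_weak_gradient_on u p W) \<and>
         set_integrable lborel W (\<lambda>z. (u z)\<^sup>2 * area_density X z) \<and>
         set_integrable lborel W
           (\<lambda>z. covector_norm_sq X z (weak_gradient W u z) * area_density X z)}"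

definition H1_norm_sq :: "(complex \<Rightarrow> real^3) \<Rightarrow> complex set \<Rightarrow> (complex \<Rightarrow> real) \<Rightarrow> real" where
  "H1_norm_sq X W u =
     (LINT z:W|lborel.
        ((u z)\<^sup>2 + covector_norm_sq X z (weak_gradient W u z)) * area_density X z)"

definition H10 :: "(complex \<Rightarrow> real^3) \<Rightarrow> complex set \<Rightarrow> (complex \<Rightarrow> real) set" where
  "H10 X W =
     {u \<in> H1 X W. \<exists>\<phi>. (\<forall>n::nat. \<phi> n \<in> test_functions W) \<and>
        (\<lambda>n. H1_norm_sq X W (\<lambda>z. u z - \<phi> n z)) \<longlonglongrightarrow> 0}"


section \<open>The quotient by an involution\<close>

definition sheet_proj :: "(complex \<Rightarrow> complex) \<Rightarrow> complex \<Rightarrow> complex set" where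
  "sheet_proj \<tau> z = {z, \<tau> z}"

text \<open>For an involution \<open>\<tau>\<close> of \<open>S\<close>: the quotient of \<open>S\<close> by \<open>\<tau>\<close>, with the quotient topology.\<close>
definition quotient_surface :: "complex set \<Rightarrow> (complex \<Rightarrow> complex) \<Rightarrow> complex set topology" where
  "quotient_surface S \<tau> =
     topology (\<lambda>U. U \<subseteq> sheet_proj \<tau> ` S \<and>
                   openin (top_of_set S) {z \<in> S. sheet_proj \<tau> z \<in> U})"

lemma openin_quotient_surface:
  "openin (quotient_surface S \<tau>) U \<longleftrightarrow>
     U \<subseteq> sheet_proj \<tau> ` S \<and> openin (top_of_set S) {z \<in> S. sheet_proj \<tau> z \<in> U}"
proof -
  let ?P = "\<lambda>U. U \<subseteq> sheet_proj \<tau> ` S \<and> openin (top_of_set S) {z \<in> S. sheet_proj \<tau> z \<in> U}"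
  have "istopology ?P"
    unfolding istopology_def
  proof (intro conjI allI impI)
    fix U V assume U: "?P U" and V: "?P V"
    have eq: "{z \<in> S. sheet_proj \<tau> z \<in> U \<inter> V} =
          {z \<in> S. sheet_proj \<tau> z \<in> U} \<inter> {z \<in> S. sheet_proj \<tau> z \<in> V}"
      by blast
    show "U \<inter> V \<subseteq> sheet_proj \<tau> ` S"
      using U by blast
    show "openin (top_of_set S) {z \<in> S. sheet_proj \<tau> z \<in> U \<inter> V}"
      unfolding eq using U V by (blast intro: openin_Int)
  next
    fix \<K> assume K: "\<forall>K\<in>\<K>. ?P K"
    have eq: "{z \<in> S. sheet_proj \<tau> z \<in> \<Union>\<K>} = (\<Union>K\<in>\<K>. {z \<in> S. sheet_proj \<tau> z \<in> K})"
      by blast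
    show "\<Union>\<K> \<subseteq> sheet_proj \<tau> ` S"
      using K by blast
    show "openin (top_of_set S) {z \<in> S. sheet_proj \<tau> z \<in> \<Union>\<K>}"
      unfolding eq using K by blast
  qed
  then show ?thesis
    by (simp add: quotient_surface_def topology_inverse')
qed

lemma quotient_map_sheet_proj:
  "quotient_map (top_of_set S) (quotient_surface S \<tau>) (sheet_proj \<tau>)"
proof -
  have "topspace (quotient_surface S \<tau>) = sheet_proj \<tau> ` S"
  proof
    show "topspace (quotient_surface S \<tau>) \<subseteq> sheet_proj \<tau> ` S"
      using openin_quotient_surface openin_topspace by blast
    have eq: "{z \<in> S. sheet_proj \<tau> z \<in> sheet_proj \<tau> ` S} = S" by blast
    have "openin (quotient_surface S \<tau>) (sheet_proj \<tau> ` S)"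
      unfolding openin_quotient_surface eq by simp
    then show "sheet_proj \<tau> ` S \<subseteq> topspace (quotient_surface S \<tau>)"
      by (rule openin_subset)
  qed
  then show ?thesis
    by (auto simp: quotient_map_def openin_quotient_surface)
qed

definition relatively_compact_domain :: "'a topology \<Rightarrow> 'a set \<Rightarrow> bool" where
  "relatively_compact_domain M \<Omega> \<longleftrightarrow>
     \<Omega> \<noteq> {} \<and> openin M \<Omega> \<and> connectedin M \<Omega> \<and> compactin M (M closure_of \<Omega>)"


section \<open>The Morse index of a nonorientable minimal surface\<close>

global_interpretation fun_space:
  vector_space "\<lambda>(c::real) (f::complex \<Rightarrow> real) z. c * f z"
  by unfold_locales (auto simp: fun_eq_iff algebra_simps)

definition index_form :: "(complex \<Rightarrow> real^3) \<Rightarrow> complex set \<Rightarrow> (complex \<Rightarrow> real) \<Rightarrow> real" where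
  "index_form X W u =
     (LINT z:W|lborel.
        (covector_norm_sq X z (weak_gradient W u z) + 2 * gauss_curvature X z * (u z)\<^sup>2)
          * area_density X z)"

definition odd_on :: "complex set \<Rightarrow> (complex \<Rightarrow> complex) \<Rightarrow> (complex \<Rightarrow> real) \<Rightarrow> bool" where
  "odd_on W \<tau> u \<longleftrightarrow> (AE z in lborel. z \<in> W \<longrightarrow> u (\<tau> z) = - u z)"

text \<open>
  Working with functions instead of classes does not change the dimensions: a function that
  vanishes almost everywhere on \<open>W\<close> has \<open>index_form X W u = 0\<close>, so it lies in no space
  below unless it is \<open>0\<close>.  Restricting to finite dimension loses nothing: an infinite-dimensional
  space of this kind contains such spaces of every finite dimension.
\<close>
definition negative_spaces ::
    "complex set \<Rightarrow> (complex \<Rightarrow> complex) \<Rightarrow> (complex \<Rightarrow> real^3) \<Rightarrow> (complex \<Rightarrow> real) set set" where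
  "negative_spaces W \<tau> X =
     {V. fun_space.subspace V \<and> (\<exists>B. finite B \<and> V = fun_space.span B) \<and>
         (\<forall>u\<in>V. u \<in> H10 X W \<and> odd_on W \<tau> u) \<and>
         (\<forall>u\<in>V. u \<noteq> 0 \<longrightarrow> index_form X W u < 0)}"

text \<open>
  \<open>S\<close> is the oriented double cover, \<open>\<tau>\<close> the change of sheets involution and \<open>X\<close> the lift
  to \<open>S\<close> of the immersion of \<open>quotient_surface S \<tau>\<close>.
\<close>
definition morse_index :: "complex set \<Rightarrow> (complex \<Rightarrow> complex) \<Rightarrow> (complex \<Rightarrow> real^3) \<Rightarrow> enat" where
  "morse_index S \<tau> X =
     (SUP \<Omega> \<in> {\<Omega>. relatively_compact_domain (quotient_surface S \<tau>) \<Omega>}.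
        SUP V \<in> negative_spaces {z \<in> S. sheet_proj \<tau> z \<in> \<Omega>} \<tau> X. enat (fun_space.dim V))"


section \<open>Weierstrass representation and the Oliveira surfaces\<close>

text \<open>
  The data are a meromorphic function \<open>G\<close> and a one-form \<open>f dz\<close>.  Where a pole of \<open>G\<close> is
  cancelled by a zero of \<open>f\<close>, the pointwise products carry an arbitrary value at the
  pole; \<open>remove_sings\<close> replaces it by the limit, so that the integrand is the
  holomorphic form meant by the Weierstrass representation.
\<close>
definition weierstrass_form ::
    "(complex \<Rightarrow> complex) \<Rightarrow> (complex \<Rightarrow> complex) \<Rightarrow> 3 \<Rightarrow> complex \<Rightarrow> complex" where
  "weierstrass_form G f k =
     remove_sings (\<lambda>z. (vector [1/2 * (1 - (G z)\<^sup>2) * f z,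
                                \<i>/2 * (1 + (G z)\<^sup>2) * f z,
                                G z * f z] :: complex^3) $ k)"

text \<open>
  The real part of the integral along a path in \<open>S\<close> from \<open>z\<^sub>0\<close> to \<open>z\<close>; the choice of the path
  does not matter when the three forms have no real periods, and a change of \<open>z\<^sub>0\<close> is a
  translation of the surface.
\<close>
definition weierstrass_map ::
    "complex set \<Rightarrow> complex \<Rightarrow> (complex \<Rightarrow> complex) \<Rightarrow> (complex \<Rightarrow> complex) \<Rightarrow> complex \<Rightarrow> real^3" where
  "weierstrass_map S z\<^sub>0 G f z =
     (let \<gamma> = (SOME \<gamma>. valid_path \<gamma> \<and> path_image \<gamma> \<subseteq> S \<and> pathstart \<gamma> = z\<^sub>0 \<and> pathfinish \<gamma> = z)
      in \<chi> k. Re (contour_integral \<gamma> (weierstrass_form G f k)))"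

definition oliveira_gauss :: "nat \<Rightarrow> complex \<Rightarrow> complex" where
  "oliveira_gauss m z = z ^ (m - 1) * ((z + 1) / (z - 1))"

definition oliveira_eta :: "nat \<Rightarrow> complex \<Rightarrow> complex" where
  "oliveira_eta m z = \<i> * ((z - 1)\<^sup>2 / z ^ (m + 1))"

definition oliveira_immersion :: "nat \<Rightarrow> complex \<Rightarrow> real^3" where
  "oliveira_immersion m = weierstrass_map (- {0}) 1 (oliveira_gauss m) (oliveira_eta m)"

definition antipodal :: "complex \<Rightarrow> complex" where
  "antipodal z = - 1 / cnj z"

end

(*
  The index form is conformally invariant: in the coordinate z it is the integral of
  |grad u|^2 - rho u^2, where rho |dz|^2 is twice the spherical metric pulled back by the Gauss
  map G.  Let el be the height of the Gauss map above the plane of the great circle that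
  corresponds to the real values of G.  It is an odd Jacobi function, and its zero set
  cuts the double cover into 2m nodal cells.  Each of them is mapped bijectively onto an open
  hemisphere: G has degree m and all its finite critical values are real.  The involution
  permutes the cells without fixing any, so there are m pairs, called petals below.

  Upper bound: in the coordinate log (G / i) a cell is the strip |Im| < pi/2 and rho becomes
  2 sech^2, and there the integral of |grad f|^2 - 2 sech^2 f^2 is at least - 1/pi times the
  square of the integral of sech^2 f.  For odd u, m - 1 linear conditions make the integrals of
  rho u over the cells proportional to those of rho el; subtracting a multiple of el, which is
  orthogonal to everything for the index form, makes them all vanish, so the form is nonnegative.

  Lower bound: the restrictions of el to the petals span an m-dimensional space of odd functions
  on which the form vanishes.  For petals the pairings of these restrictions with odd test
  functions satisfy no linear relation except that their sum is zero, because neighbouring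
  petals are separated by an arc on which el has nonzero gradient.  So for m - 1 of the petals
  there is a dual family of odd test functions, and a small multiple of it, subtracted
  from the restrictions, makes the form negative definite.
*)
theory Submission
  imports Defs "HOL-Real_Asymp.Real_Asymp" "HOL-Computational_Algebra.Fundamental_Theorem_Algebra"
begin

text \<open>With the weight \<open>sech2\<close> the strip is the round hemisphere in Mercator
  coordinates, so the strip inequality says that the first positive Neumann eigenvalue of a
  hemisphere is 2; the constant 1/pi is that 2 divided by the weighted area 2 pi. One obstacle is
  that the nodal set of \<open>el\<close> has singular points. Therefore no boundary integral is
  taken: the functions \<open>hc n (el z)\<close> vanish near the nodal set, and the flux through
  the boundary of a petal is defined as the integral of a divergence. Nor is the adjacency of the
  petals worked out: the finite singular points are real, and every petal meets the open upper half
  plane, which is connected, so a quantity that agrees on adjacent petals is constant. Another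
  obstacle is that the index refers to weak gradients of \<open>H10\<close> functions; the estimates
  are proved for C1 functions and passed to the limit. In the lower bound the form vanishes on the
  restrictions of \<open>el\<close>, so the coupling with the dual family, linear in the small
  factor t, outweighs the form of the family itself, which enters with t squared.\<close>

section \<open>Linear algebra: homogeneous systems and dual families\<close>

lemma homogeneous_system_nontrivial:
  fixes x :: "'b \<Rightarrow> 'i \<Rightarrow> real"
  assumes "finite I" "finite B" "card I < card B"
  shows "\<exists>c. (\<exists>b\<in>B. c b \<noteq> 0) \<and> (\<forall>i\<in>I. (\<Sum>b\<in>B. c b * x b i) = 0)"
  using assms
proof (induction I arbitrary: x B rule: finite_induct)
  case empty
  then have "B \<noteq> {}" by auto
  then show ?case by (intro exI[of _ "\<lambda>_. 1"]) auto
next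
  case (insert i I)
  show ?case
  proof (cases "\<forall>b\<in>B. x b i = 0")
    case True
    have "card I < card B" using insert by simp
    then obtain c where "\<exists>b\<in>B. c b \<noteq> 0" "\<forall>i\<in>I. (\<Sum>b\<in>B. c b * x b i) = 0"
      using insert.IH[OF insert.prems(1)] by blast
    then show ?thesis using True by (intro exI[of _ c]) auto
  next
    case False
    then obtain b0 where b0: "b0 \<in> B" "x b0 i \<noteq> 0" by blast
    \<comment> \<open>Gaussian elimination: equation \<open>i\<close> is solved for the unknown
      \<open>b0\<close>, and \<open>y\<close> holds the coefficients of the other equations after
      the substitution; \<open>s\<close> below recovers the value of \<open>b0\<close>.\<close>
    define y where "y b j = x b j - x b i / x b0 i * x b0 j" for b j
    have "card I < card (B - {b0})" using insert b0 by (simp add: card_Diff_singleton)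
    then obtain c where c: "\<exists>b\<in>B - {b0}. c b \<noteq> 0"
        "\<forall>j\<in>I. (\<Sum>b\<in>B - {b0}. c b * y b j) = 0"
      using insert.IH[of "B - {b0}" y] insert.prems by auto
    define s where "s = (\<Sum>b\<in>B - {b0}. c b * x b i) / x b0 i"
    define c' where "c' = c(b0 := - s)"
    have sum: "(\<Sum>b\<in>B. c' b * x b j) = (\<Sum>b\<in>B - {b0}. c b * x b j) - s * x b0 j" for j
    proof -
      have "(\<Sum>b\<in>B. c' b * x b j) = c' b0 * x b0 j + (\<Sum>b\<in>B - {b0}. c' b * x b j)"
        using b0 insert.prems by (simp add: sum.remove)
      also have "(\<Sum>b\<in>B - {b0}. c' b * x b j) = (\<Sum>b\<in>B - {b0}. c b * x b j)"
        by (intro sum.cong) (auto simp: c'_def)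
      finally show ?thesis by (simp add: c'_def)
    qed
    have "(\<Sum>b\<in>B. c' b * x b j) = 0" if "j \<in> I" for j
    proof -
      have "0 = (\<Sum>b\<in>B - {b0}. c b * y b j)" using c that by simp
      also have "\<dots> = (\<Sum>b\<in>B - {b0}. c b * x b j) - s * x b0 j"
        by (simp add: y_def s_def algebra_simps sum_subtractf sum_distrib_left sum_divide_distrib)
      finally show ?thesis using sum by simp
    qed
    moreover have "(\<Sum>b\<in>B. c' b * x b i) = 0"
      unfolding sum s_def using b0 by simp
    moreover have "\<exists>b\<in>B. c' b \<noteq> 0" using c by (auto simp: c'_def)
    ultimately show ?thesis by (intro exI[of _ c']) auto
  qed
qed

text \<open>If the new functional vanished on the common kernel of the earlier ones, it would be a
  combination of them, against independence; a vector of that kernel, normalised, is the new dual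
  element. \<open>V\<close> is a plain set of functions closed under adding multiples, so that the
  odd test functions can be inserted directly.\<close>

lemma dual_basis_exists:
  fixes L :: "'i \<Rightarrow> ('a \<Rightarrow> real) \<Rightarrow> real"
  assumes "finite I"
    and zero: "(\<lambda>_. 0) \<in> V"
    and clos: "\<And>f g s. f \<in> V \<Longrightarrow> g \<in> V \<Longrightarrow> (\<lambda>z. f z + s * g z) \<in> V"
    and lin: "\<And>i f g s. i \<in> I \<Longrightarrow> f \<in> V \<Longrightarrow> g \<in> V \<Longrightarrow> L i (\<lambda>z. f z + s * g z) = L i f + s * L i g"
    and indep: "\<And>c. (\<forall>f\<in>V. (\<Sum>i\<in>I. c i * L i f) = 0) \<Longrightarrow> \<forall>i\<in>I. c i = 0"
  shows "\<exists>\<psi>. \<forall>j\<in>I. \<psi> j \<in> V \<and> (\<forall>i\<in>I. L i (\<psi> j) = (if i = j then 1 else 0))"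
  using assms(1) lin indep
proof (induction I rule: finite_induct)
  case empty
  then show ?case by simp
next
  case (insert k I)
  have "\<forall>i\<in>I. c i = 0" if "\<forall>f\<in>V. (\<Sum>i\<in>I. c i * L i f) = 0" for c
  proof -
    have "(\<Sum>i\<in>insert k I. (c(k := 0)) i * L i f) = (\<Sum>i\<in>I. c i * L i f)" for f
      using insert.hyps by (simp add: sum.insert) (intro sum.cong, auto)
    then have "\<forall>f\<in>V. (\<Sum>i\<in>insert k I. (c(k := 0)) i * L i f) = 0"
      using that by simp
    then have "\<forall>i\<in>insert k I. (c(k := 0)) i = 0"
      by (rule insert.prems(2))
    then show ?thesis using insert.hyps by (metis fun_upd_other insertI2)
  qed
  then obtain \<psi> where psi: "\<forall>j\<in>I. \<psi> j \<in> V \<and> (\<forall>i\<in>I. L i (\<psi> j) = (if i = j then 1 else 0))"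
    using insert.IH[OF insert.prems(1)] by blast
  note lin' = insert.prems(1)
  have comb: "(\<lambda>z. f z - (\<Sum>i\<in>J. c i * \<psi> i z)) \<in> V \<and>
      (\<forall>l\<in>insert k I. L l (\<lambda>z. f z - (\<Sum>i\<in>J. c i * \<psi> i z)) = L l f - (\<Sum>i\<in>J. c i * L l (\<psi> i)))"
    if "f \<in> V" "J \<subseteq> I" for f c J
  proof -
    have "finite J" using that insert.hyps finite_subset by blast
    then show ?thesis using that(2)
    proof (induction J rule: finite_induct)
      case empty
      then show ?case using that by simp
    next
      case (insert j J)
      define g where "g = (\<lambda>z. f z - (\<Sum>i\<in>J. c i * \<psi> i z))"
      have g: "g \<in> V" "\<And>l. l \<in> insert k I \<Longrightarrow> L l g = L l f - (\<Sum>i\<in>J. c i * L l (\<psi> i))"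
        using insert by (auto simp: g_def)
      have eq: "(\<lambda>z. f z - (\<Sum>i\<in>insert j J. c i * \<psi> i z)) = (\<lambda>z. g z + (- c j) * \<psi> j z)"
        using insert by (auto simp: g_def)
      have "\<psi> j \<in> V" using psi insert by auto
      then have "(\<lambda>z. g z + (- c j) * \<psi> j z) \<in> V"
        "\<And>l. l \<in> insert k I \<Longrightarrow> L l (\<lambda>z. g z + (- c j) * \<psi> j z) = L l g + (- c j) * L l (\<psi> j)"
        using clos[OF g(1), of "\<psi> j" "- c j"] lin'[OF _ g(1), of _ "\<psi> j" "- c j"] by blast+
      then show ?case unfolding eq using g(2) insert.hyps by simp
    qed
  qed
  have "\<exists>\<xi>\<in>V. (\<forall>i\<in>I. L i \<xi> = 0) \<and> L k \<xi> \<noteq> 0"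
  proof (rule ccontr)
    assume *: "\<not> ?thesis"
    \<comment> \<open>The coefficients of the relation that would express \<open>L k\<close> by the
      other functionals, with -1 at \<open>k\<close> itself.\<close>
    define c where "c i = (if i = k then -1 else L k (\<psi> i))" for i
    have "(\<Sum>i\<in>insert k I. c i * L i f) = 0" if "f \<in> V" for f
    proof -
      \<comment> \<open>Projection of \<open>f\<close> to the common kernel of the functionals
        indexed by \<open>I\<close>.\<close>
      define g where "g = (\<lambda>z. f z - (\<Sum>i\<in>I. L i f * \<psi> i z))"
      have g: "g \<in> V" "\<And>l. l \<in> insert k I \<Longrightarrow> L l g = L l f - (\<Sum>i\<in>I. L i f * L l (\<psi> i))"
        using comb[OF that, of I "\<lambda>i. L i f"] by (auto simp: g_def)
      have "L l g = 0" if "l \<in> I" for l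
      proof -
        have "(\<Sum>i\<in>I. L i f * L l (\<psi> i)) = (\<Sum>i\<in>I. if i = l then L i f else 0)"
          using psi that by (intro sum.cong) auto
        then show ?thesis using g(2)[of l] that insert.hyps by simp
      qed
      then have "L k g = 0" using * g by auto
      then have "L k f = (\<Sum>i\<in>I. L i f * L k (\<psi> i))" using g(2)[of k] by simp
      also have "\<dots> = (\<Sum>i\<in>I. c i * L i f)"
        using insert.hyps by (intro sum.cong) (auto simp: c_def)
      finally show ?thesis using insert.hyps by (simp add: c_def)
    qed
    then have "c k = 0" using insert.prems(2) by blast
    then show False by (simp add: c_def)
  qed
  then obtain \<xi>0 where chi0: "\<xi>0 \<in> V" "\<forall>i\<in>I. L i \<xi>0 = 0" "L k \<xi>0 \<noteq> 0" by blast
  define \<xi> where "\<xi> = (\<lambda>z. 0 + (1 / L k \<xi>0) * \<xi>0 z)"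
  have z0: "L i (\<lambda>_. 0) = 0" if "i \<in> insert k I" for i
    using insert.prems(1)[OF that zero zero, of 1] by simp
  have chi: "\<xi> \<in> V" "\<forall>i\<in>I. L i \<xi> = 0" "L k \<xi> = 1"
    unfolding \<xi>_def
    using clos[OF zero chi0(1), of "1 / L k \<xi>0"] insert.prems(1)[OF _ zero chi0(1), of _ "1 / L k \<xi>0"] z0 chi0 by auto
  \<comment> \<open>The old dual elements are corrected by multiples of \<open>\<xi>\<close>, which
    removes their value under \<open>L k\<close> and changes none of the earlier values.\<close>
  define \<psi>' where "\<psi>' i = (if i = k then \<xi> else (\<lambda>z. \<psi> i z + (- L k (\<psi> i)) * \<xi> z))" for i
  show ?case
  proof (rule exI[of _ \<psi>'], intro ballI conjI)
    fix j assume j: "j \<in> insert k I"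
    show "\<psi>' j \<in> V" using psi chi clos[of "\<psi> j" \<xi> "- L k (\<psi> j)"] j by (auto simp: \<psi>'_def)
    fix i assume i: "i \<in> insert k I"
    show "L i (\<psi>' j) = (if i = j then 1 else 0)"
    proof (cases "j = k")
      case True
      then show ?thesis using chi i insert.hyps by (auto simp: \<psi>'_def)
    next
      case False
      then have "j \<in> I" using j by simp
      have "L i (\<psi>' j) = L i (\<psi> j) + (- L k (\<psi> j)) * L i \<xi>"
        using False insert.prems(1)[OF i _ chi(1), of "\<psi> j" "- L k (\<psi> j)"] psi \<open>j \<in> I\<close> by (simp add: \<psi>'_def)
      then show ?thesis using chi i psi \<open>j \<in> I\<close> insert.hyps False by auto
    qed
  qed
qed

section \<open>Test functions and weak gradients\<close>

text \<open>The gradient as a complex number: directional derivatives become inner products in the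
  plane, and the modulus is the Euclidean norm.\<close>

definition grad :: "(complex \<Rightarrow> real) \<Rightarrow> complex \<Rightarrow> complex" where
  "grad \<phi> z = Complex (dir_deriv 1 \<phi> z) (dir_deriv \<i> \<phi> z)"

lemma dir_deriv_eq: "(f has_derivative D) (at z) \<Longrightarrow> dir_deriv v f z = D v"
  unfolding dir_deriv_def by (metis frechet_derivative_at)

lemma dir_deriv_grad:
  assumes "\<phi> differentiable (at z)"
  shows "dir_deriv v \<phi> z = grad \<phi> z \<bullet> v"
proof -
  obtain D where D: "(\<phi> has_derivative D) (at z)" using assms by (auto simp: differentiable_def)
  interpret bounded_linear D using D by (rule has_derivative_bounded_linear)
  have "v = Re v *\<^sub>R 1 + Im v *\<^sub>R \<i>"
    by (simp add: complex_eq_iff)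
  then have "D v = Re v * D 1 + Im v * D \<i>"
    by (metis add scale real_scaleR_def)
  then show ?thesis
    by (simp add: grad_def dir_deriv_eq[OF D] inner_complex_def)
qed

lemma has_derivative_grad:
  assumes "\<phi> differentiable (at z)"
  shows "(\<phi> has_derivative (\<lambda>v. grad \<phi> z \<bullet> v)) (at z)"
  using assms dir_deriv_grad[OF assms] frechet_derivative_works[of \<phi> "at z"]
  unfolding dir_deriv_def by (metis (no_types, lifting) ext)

lemma grad_eqI:
  assumes "(\<phi> has_derivative (\<lambda>v. g \<bullet> v)) (at z)"
  shows "grad \<phi> z = g"
  using dir_deriv_eq[OF assms] by (simp add: grad_def complex_eq_iff inner_complex_def)

lemma test_functionsI:
  assumes "\<And>z. (\<phi> has_derivative (\<lambda>v. g z \<bullet> v)) (at z)" "continuous_on UNIV g"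
    and "compact K" "K \<subseteq> W" "\<And>z. z \<notin> K \<Longrightarrow> \<phi> z = 0"
  shows "\<phi> \<in> test_functions W"
proof -
  have "dir_deriv v \<phi> = (\<lambda>z. g z \<bullet> v)" for v
    using dir_deriv_eq[OF assms(1)] by auto
  then have "continuous_on UNIV (dir_deriv v \<phi>)" for v
    using assms(2) by (auto intro!: continuous_intros)
  then show ?thesis
    unfolding test_functions_def using assms by (auto simp: differentiable_def)
qed

lemma test_functionsE:
  assumes "\<phi> \<in> test_functions W"
  obtains K where "\<And>z. (\<phi> has_derivative (\<lambda>v. grad \<phi> z \<bullet> v)) (at z)" "continuous_on UNIV (grad \<phi>)"
    "compact K" "K \<subseteq> W" "\<And>z. z \<notin> K \<Longrightarrow> \<phi> z = 0" "\<And>z. z \<notin> K \<Longrightarrow> grad \<phi> z = 0"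
proof -
  obtain K where K: "compact K" "K \<subseteq> W" "\<And>z. z \<notin> K \<Longrightarrow> \<phi> z = 0"
    using assms unfolding test_functions_def by blast
  have d: "\<phi> differentiable (at z)" for z using assms unfolding test_functions_def by blast
  have c: "continuous_on UNIV (grad \<phi>)"
    using assms unfolding test_functions_def grad_def Complex_eq
    by (auto intro!: continuous_intros)
  have g0: "grad \<phi> z = 0" if "z \<notin> K" for z
  proof (rule grad_eqI)
    have "open (- K)" using K by (simp add: compact_imp_closed open_Compl)
    have "((\<lambda>_. 0) has_derivative (\<lambda>v. 0)) (at z)"
      by simp
    then show "(\<phi> has_derivative (\<lambda>v. 0 \<bullet> v)) (at z)"
      using K(3) that by (simp add: inner_zero_left) (rule has_derivative_transform_within_open[OF _ \<open>open (-K)\<close>], auto)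
  qed
  show ?thesis by (rule that[OF has_derivative_grad[OF d] c K g0])
qed

lemma test_continuous: "\<phi> \<in> test_functions W \<Longrightarrow> continuous_on UNIV \<phi>"
  by (erule test_functionsE) (meson continuous_at_imp_continuous_on has_derivative_continuous)

lemma test_zero: "(\<lambda>_. 0) \<in> test_functions W"
  by (rule test_functionsI[where g="\<lambda>_. 0" and K="{}"]) auto

lemma test_mono: "V \<subseteq> W \<Longrightarrow> test_functions V \<subseteq> test_functions W"
  unfolding test_functions_def by blast

lemma test_lin:
  assumes "\<phi> \<in> test_functions W" "\<psi> \<in> test_functions W"
  shows "(\<lambda>z. \<phi> z + s * \<psi> z) \<in> test_functions W"
    and "grad (\<lambda>z. \<phi> z + s * \<psi> z) = (\<lambda>z. grad \<phi> z + s *\<^sub>R grad \<psi> z)"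
proof -
  obtain K1 where 1: "\<And>z. (\<phi> has_derivative (\<lambda>v. grad \<phi> z \<bullet> v)) (at z)" "continuous_on UNIV (grad \<phi>)"
    "compact K1" "K1 \<subseteq> W" "\<And>z. z \<notin> K1 \<Longrightarrow> \<phi> z = 0"
    using test_functionsE[OF assms(1)] by metis
  obtain K2 where 2: "\<And>z. (\<psi> has_derivative (\<lambda>v. grad \<psi> z \<bullet> v)) (at z)" "continuous_on UNIV (grad \<psi>)"
    "compact K2" "K2 \<subseteq> W" "\<And>z. z \<notin> K2 \<Longrightarrow> \<psi> z = 0"
    using test_functionsE[OF assms(2)] by metis
  have d: "((\<lambda>z. \<phi> z + s * \<psi> z) has_derivative (\<lambda>v. (grad \<phi> z + s *\<^sub>R grad \<psi> z) \<bullet> v)) (at z)" for z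
    by (rule derivative_eq_intros 1 2 refl)+ (auto simp: inner_add_left)
  show "(\<lambda>z. \<phi> z + s * \<psi> z) \<in> test_functions W"
    by (rule test_functionsI[OF d, where K="K1 \<union> K2"])
      (use 1 2 in \<open>auto intro!: continuous_intros\<close>)
  show "grad (\<lambda>z. \<phi> z + s * \<psi> z) = (\<lambda>z. grad \<phi> z + s *\<^sub>R grad \<psi> z)"
    using grad_eqI[OF d] by auto
qed

lemma test_mult:
  assumes "\<phi> \<in> test_functions W"
    and h: "\<And>z. (h has_derivative (\<lambda>v. H z \<bullet> v)) (at z)" "continuous_on UNIV H"
  shows "(\<lambda>z. \<phi> z * h z) \<in> test_functions W"
    and "grad (\<lambda>z. \<phi> z * h z) = (\<lambda>z. h z *\<^sub>R grad \<phi> z + \<phi> z *\<^sub>R H z)"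
proof -
  obtain K where 1: "\<And>z. (\<phi> has_derivative (\<lambda>v. grad \<phi> z \<bullet> v)) (at z)" "continuous_on UNIV (grad \<phi>)"
    "compact K" "K \<subseteq> W" "\<And>z. z \<notin> K \<Longrightarrow> \<phi> z = 0"
    using test_functionsE[OF assms(1)] by metis
  have ch: "continuous_on UNIV h" using h(1) by (meson continuous_at_imp_continuous_on has_derivative_continuous)
  have d: "((\<lambda>z. \<phi> z * h z) has_derivative (\<lambda>v. (h z *\<^sub>R grad \<phi> z + \<phi> z *\<^sub>R H z) \<bullet> v)) (at z)" for z
    by (rule derivative_eq_intros 1 h refl)+ (auto simp: inner_add_left algebra_simps)
  show "(\<lambda>z. \<phi> z * h z) \<in> test_functions W"
    by (rule test_functionsI[OF d, where K="K"])
      (use 1 h test_continuous[OF assms(1)] ch in \<open>auto intro!: continuous_intros\<close>)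
  show "grad (\<lambda>z. \<phi> z * h z) = (\<lambda>z. h z *\<^sub>R grad \<phi> z + \<phi> z *\<^sub>R H z)"
    using grad_eqI[OF d] by auto
qed

lemma integrable_compact_support:
  fixes f :: "complex \<Rightarrow> 'b::{banach,second_countable_topology}"
  assumes "continuous_on UNIV f" "compact K" "\<And>z. z \<notin> K \<Longrightarrow> f z = 0"
  shows "integrable lborel f"
proof -
  have "integrable lborel (\<lambda>x. indicator K x *\<^sub>R f x)"
    using borel_integrable_compact[OF assms(2) continuous_on_subset[OF assms(1)]] by auto
  also have "(\<lambda>x. indicator K x *\<^sub>R f x) = f"
    using assms(3) by (auto simp: indicator_def fun_eq_iff)
  finally show ?thesis .
qed

text \<open>A difference quotient integrates to 0 by translation invariance, and the quotients
  converge dominatedly to the directional derivative. This is the form in which the divergence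
  theorem in the plane is used throughout.\<close>

lemma integral_dir_deriv_zero:
  assumes F: "F \<in> test_functions UNIV"
  shows "(\<integral>z. grad F z \<bullet> v \<partial>lborel) = 0"
proof -
  obtain K where K: "\<And>z. (F has_derivative (\<lambda>v. grad F z \<bullet> v)) (at z)" "continuous_on UNIV (grad F)"
    "compact K" "\<And>z. z \<notin> K \<Longrightarrow> F z = 0" "\<And>z. z \<notin> K \<Longrightarrow> grad F z = 0"
    using test_functionsE[OF assms(1)] by metis
  have cF: "continuous_on UNIV F" by (rule test_continuous[OF F])
  obtain R where R: "\<And>z. z \<in> K \<Longrightarrow> norm z \<le> R"
    using compact_imp_bounded[OF K(3)] bounded_iff by blast
  have "bounded (grad F ` K)"
    using K compact_continuous_image continuous_on_subset compact_imp_bounded by (metis subset_UNIV)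
  then obtain M where M: "\<And>z. z \<in> K \<Longrightarrow> norm (grad F z) \<le> M" and M0: "M > 0"
    unfolding bounded_pos by auto
  have M': "norm (grad F z) \<le> M" for z using M K(5)[of z] M0 by (cases "z \<in> K") auto
  define v' where "v' n = (1 / real (Suc n)) *\<^sub>R v" for n
  define s where "s n z = real (Suc n) * (F (z + v' n) - F z)" for n z
  \<comment> \<open>All translates are by at most \<open>norm v\<close>, so every difference
    quotient is supported in this one ball, which provides the dominating function.\<close>
  define B where "B = cball (0::complex) (R + norm v)"
  have intF: "integrable lborel F" by (rule integrable_compact_support[OF cF K(3,4)])
  have trans: "has_bochner_integral lborel (\<lambda>z. F (z + w)) (\<integral>z. F z \<partial>lborel)" for w
  proof -
    have m: "F \<in> borel_measurable borel" using cF by (rule borel_measurable_continuous_onI)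
    have "integrable lborel (\<lambda>z. F (w + z))"
      using integrable_distr_eq[of "(+) w" lborel borel F] m intF by (simp add: lborel_distr_plus)
    moreover have "(\<integral>z. F (w + z) \<partial>lborel) = (\<integral>z. F z \<partial>lborel)"
      using integral_distr[of "(+) w" lborel borel F] m by (simp add: lborel_distr_plus)
    ultimately have "has_bochner_integral lborel (\<lambda>z. F (w + z)) (\<integral>z. F z \<partial>lborel)"
      by (simp add: has_bochner_integral_iff)
    then show ?thesis by (simp add: add.commute)
  qed
  have zero: "(\<integral>z. s n z \<partial>lborel) = 0" for n
    unfolding s_def using trans[of "v' n"] intF
    by (simp add: has_bochner_integral_iff)
  have lim: "(\<lambda>n. s n z) \<longlonglongrightarrow> grad F z \<bullet> v" for z
  proof -
    have "((\<lambda>t. F (z + t *\<^sub>R v)) has_real_derivative (grad F z \<bullet> v)) (at 0)"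
    proof -
      have "((\<lambda>t. F (z + t *\<^sub>R v)) has_derivative (\<lambda>t. grad F z \<bullet> (t *\<^sub>R v))) (at 0)"
        by (rule has_derivative_compose[of "\<lambda>t. z + t *\<^sub>R v" _ 0 UNIV F "\<lambda>v. grad F z \<bullet> v", simplified])
          (auto intro!: derivative_eq_intros K(1))
      then show ?thesis by (simp add: has_field_derivative_def mult.commute[of _ "grad F z \<bullet> v"] mult_commute_abs)
    qed
    then have "((\<lambda>t. (F (z + t *\<^sub>R v) - F z) / t) \<longlongrightarrow> grad F z \<bullet> v) (at 0)"
      by (simp add: DERIV_def)
    moreover have "filterlim (\<lambda>n. 1 / real (Suc n)) (at 0) sequentially"
      using LIMSEQ_inverse_real_of_nat by (auto simp: filterlim_at inverse_eq_divide)
    ultimately have "(\<lambda>n. (F (z + (1 / real (Suc n)) *\<^sub>R v) - F z) / (1 / real (Suc n))) \<longlonglongrightarrow> grad F z \<bullet> v"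
      by (rule filterlim_compose)
    then show ?thesis by (simp add: s_def v'_def mult.commute)
  qed
  have bnd: "norm (s n z) \<le> M * norm v * indicator B z" for n z
  proof (cases "z \<in> B")
    case True
    have "norm (F (z + v' n) - F z) \<le> M * norm (z + v' n - z)"
      proof (rule differentiable_bound[where S=UNIV and f'="\<lambda>z v. grad F z \<bullet> v"])
      show "onorm (\<lambda>v. grad F x \<bullet> v) \<le> M" for x
      proof (rule onorm_le)
        fix v show "norm (grad F x \<bullet> v) \<le> M * norm v"
          using Cauchy_Schwarz_ineq2[of "grad F x" v] mult_right_mono[OF M'[of x] norm_ge_zero[of v]] by simp
      qed
    qed (use K(1) in auto)
    then have "real (Suc n) * \<bar>F (z + v' n) - F z\<bar> \<le> real (Suc n) * (M * (norm v / real (Suc n)))"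
      by (intro mult_left_mono) (auto simp: v'_def)
    then show ?thesis using True by (simp add: s_def abs_mult del: of_nat_Suc)
  next
    case False
    then have zR: "norm z > R + norm v" by (simp add: B_def)
    have "norm (v' n) \<le> norm v" by (simp add: v'_def divide_le_eq) (simp add: mult_le_cancel_left1)
    then have "norm (z + v' n) > R" using zR norm_triangle_ineq2[of z "- v' n"] by simp
    moreover have "norm z > R" using zR norm_ge_zero[of v] by linarith
    ultimately have "z \<notin> K" "z + v' n \<notin> K" using R by force+
    then show ?thesis using K(4) False by (simp add: s_def)
  qed
  have "(\<lambda>n. \<integral>z. s n z \<partial>lborel) \<longlonglongrightarrow> (\<integral>z. grad F z \<bullet> v \<partial>lborel)"
  proof (rule integral_dominated_convergence[where w="\<lambda>z. M * norm v * indicator B z"])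
    show "(\<lambda>z. grad F z \<bullet> v) \<in> borel_measurable lborel"
      by (simp, rule borel_measurable_continuous_onI) (use K in \<open>auto intro!: continuous_intros\<close>)
    show "s n \<in> borel_measurable lborel" for n
      unfolding s_def by (simp, rule borel_measurable_continuous_onI)
        (auto intro!: continuous_intros continuous_on_compose2[OF cF])
    show "integrable lborel (\<lambda>z. M * norm v * indicator B z)"
      using emeasure_lborel_cball_finite[of "0::complex" "R + norm v"]
      by (intro integrable_mult_right integrable_real_indicator) (auto simp: B_def)
  qed (use lim bnd in auto)
  then show ?thesis using zero LIMSEQ_unique by (simp add: LIMSEQ_const_iff)
qed


section \<open>The fundamental lemma\<close>

lemma AE_lborel_negligible:
  fixes N :: "'a::euclidean_space set"
  assumes "negligible N"
  shows "AE z in lborel. z \<notin> N"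
proof -
  have "AE z in lebesgue. z \<notin> N"
    using assms by (intro AE_not_in) (simp add: negligible_iff_null_sets)
  then show ?thesis by (simp add: AE_completion_iff)
qed

text \<open>A C1 step: zero up to 0, positive after it, tending to 1. On the positive axis it is
  rational, so its derivative and limits are explicit; C1 is all that \<open>test_functions\<close>
  asks for.\<close>

definition smooth_step :: "real \<Rightarrow> real" where
  "smooth_step x = (if x \<in> {..0} then 0 else x\<^sup>2 / (1 + x\<^sup>2))"

definition smooth_step' :: "real \<Rightarrow> real" where
  "smooth_step' x = (if x \<in> {..0} then 0 else 2 * x / (1 + x\<^sup>2)\<^sup>2)"

lemma smooth_step_deriv: "(smooth_step has_real_derivative smooth_step' x) (at x)"
proof -
  have pos: "1 + x\<^sup>2 > 0" for x :: real using zero_le_power2[of x] by linarith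
  have 1: "((\<lambda>x::real. x\<^sup>2 / (1 + x\<^sup>2)) has_real_derivative 2 * x / (1 + x\<^sup>2)\<^sup>2) (at x within S)" for x S
    using pos[of x] by (auto intro!: derivative_eq_intros simp: power2_eq_square divide_simps add_nonneg_eq_0_iff) (simp add: algebra_simps)
  have "(smooth_step has_vector_derivative smooth_step' x) (at x within UNIV)"
    unfolding smooth_step_def[abs_def] smooth_step'_def
    by (rule has_vector_derivative_If_within_closures[where T="{0..}"])
      (use 1 in \<open>auto simp: has_real_derivative_iff_has_vector_derivative[symmetric] has_vector_derivative_const\<close>)
  then show ?thesis by (simp add: has_real_derivative_iff_has_vector_derivative)
qed

lemma smooth_step'_continuous: "continuous_on UNIV smooth_step'"
proof -
  have pos: "1 + x\<^sup>2 > 0" for x :: real using zero_le_power2[of x] by linarith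
  have "continuous_on ({..0} \<union> {0..}) (\<lambda>x::real. if x \<in> {..0} then 0 else 2 * x / (1 + x\<^sup>2)\<^sup>2)"
    by (rule continuous_on_If) (use pos in \<open>auto intro!: continuous_intros simp: less_imp_neq[symmetric]\<close>)
  moreover have "{..0} \<union> {0..} = (UNIV::real set)" by auto
  ultimately show ?thesis by (simp add: smooth_step'_def[abs_def])
qed

lemma smooth_step_bounds: "0 \<le> smooth_step x" "smooth_step x \<le> 1"
proof -
  have pos: "1 + x\<^sup>2 > 0" using zero_le_power2[of x] by linarith
  show "0 \<le> smooth_step x" "smooth_step x \<le> 1" using pos by (auto simp: smooth_step_def)
qed

lemma smooth_step_0: "x \<le> 0 \<Longrightarrow> smooth_step x = 0" "x \<le> 0 \<Longrightarrow> smooth_step' x = 0"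
  by (auto simp: smooth_step_def smooth_step'_def)

lemma smooth_step_tendsto: "x > 0 \<Longrightarrow> (\<lambda>n. smooth_step (real n * x)) \<longlonglongrightarrow> 1"
proof -
  assume x: "x > 0"
  have "((\<lambda>n. (real n * x)\<^sup>2 / (1 + (real n * x)\<^sup>2)) \<longlongrightarrow> 1) sequentially"
    using x by real_asymp
  moreover have "eventually (\<lambda>n. smooth_step (real n * x) = (real n * x)\<^sup>2 / (1 + (real n * x)\<^sup>2)) sequentially"
    using x by (intro eventually_sequentiallyI[of 1]) (auto simp: smooth_step_def mult_le_0_iff)
  ultimately show ?thesis
    by (subst tendsto_cong) 
qed

text \<open>A product of four steps that vanishes outside \<open>cbox a b\<close>; the steepness
  \<open>n\<close> drives it to the indicator of the open box.\<close>

definition box_cutoff :: "complex \<Rightarrow> complex \<Rightarrow> nat \<Rightarrow> complex \<Rightarrow> real" where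
  "box_cutoff a b n z =
     smooth_step (real n * (Re z - Re a)) * smooth_step (real n * (Re b - Re z)) *
     (smooth_step (real n * (Im z - Im a)) * smooth_step (real n * (Im b - Im z)))"

lemma box_cutoff_test:
  assumes "cbox a b \<subseteq> W"
  shows "box_cutoff a b n \<in> test_functions W"
proof -
  define p where "p = (\<lambda>a b x. smooth_step (real n * (x - a)) * smooth_step (real n * (b - x)))"
  define p' where "p' = (\<lambda>a b x. smooth_step' (real n * (x - a)) * real n * smooth_step (real n * (b - x))
      - smooth_step (real n * (x - a)) * smooth_step' (real n * (b - x)) * real n)"
  have cs: "continuous_on UNIV smooth_step"
    using smooth_step_deriv by (meson DERIV_continuous_on has_field_derivative_at_within)
  have dp: "(p a b has_real_derivative p' a b x) (at x)" for a b x
    unfolding p_def p'_def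
    by (rule derivative_eq_intros DERIV_chain2[OF smooth_step_deriv] refl)+ (simp add: algebra_simps)
  have cp: "continuous_on UNIV (p a b)" "continuous_on UNIV (p' a b)" for a b
    unfolding p_def p'_def
    by (auto intro!: continuous_intros continuous_on_compose2[OF cs] continuous_on_compose2[OF smooth_step'_continuous])
  have dRe: "((\<lambda>z. p (Re a) (Re b) (Re z)) has_derivative (\<lambda>v. p' (Re a) (Re b) (Re z) * Re v)) (at z)" for z
    by (rule has_derivative_compose[OF _ dp[unfolded has_field_derivative_def], of Re Re, simplified]) (auto intro: derivative_eq_intros)
  have dIm: "((\<lambda>z. p (Im a) (Im b) (Im z)) has_derivative (\<lambda>v. p' (Im a) (Im b) (Im z) * Im v)) (at z)" for z
    by (rule has_derivative_compose[OF _ dp[unfolded has_field_derivative_def], of Im Im, simplified]) (auto intro: derivative_eq_intros)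
  define g where "g z = Complex (p' (Re a) (Re b) (Re z) * p (Im a) (Im b) (Im z))
      (p (Re a) (Re b) (Re z) * p' (Im a) (Im b) (Im z))" for z
  have eq: "box_cutoff a b n = (\<lambda>z. p (Re a) (Re b) (Re z) * p (Im a) (Im b) (Im z))"
    by (auto simp: box_cutoff_def p_def)
  show ?thesis
  proof (rule test_functionsI[where g=g and K="cbox a b"])
    show "(box_cutoff a b n has_derivative (\<lambda>v. g z \<bullet> v)) (at z)" for z
      unfolding eq
      by (rule has_derivative_eq_rhs[OF has_derivative_mult[OF dRe dIm]])
        (auto simp: g_def inner_complex_def algebra_simps)
    show "continuous_on UNIV g"
      unfolding g_def Complex_eq
      by (intro continuous_intros continuous_on_compose2[OF cp(1)] continuous_on_compose2[OF cp(2)]) auto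
    show "box_cutoff a b n z = 0" if "z \<notin> cbox a b" for z
    proof -
      have "Re z < Re a \<or> Re z > Re b \<or> Im z < Im a \<or> Im z > Im b"
        using that by (auto simp: in_cbox_complex_iff)
      then have "real n * (Re z - Re a) \<le> 0 \<or> real n * (Re b - Re z) \<le> 0
          \<or> real n * (Im z - Im a) \<le> 0 \<or> real n * (Im b - Im z) \<le> 0"
        by (auto simp: mult_nonneg_nonpos)
      then show ?thesis using smooth_step_0(1) by (auto simp: box_cutoff_def)
    qed
  qed (use assms in auto)
qed

lemma box_cutoff_props:
  shows "0 \<le> box_cutoff a b n z" "box_cutoff a b n z \<le> 1"
    "(\<lambda>n. box_cutoff a b n z) \<longlonglongrightarrow> indicator (box a b) z"
proof -
  note bs = smooth_step_bounds
  show "0 \<le> box_cutoff a b n z" unfolding box_cutoff_def using bs by simp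
  show "box_cutoff a b n z \<le> 1" unfolding box_cutoff_def
    by (intro mult_le_one mult_nonneg_nonneg bs)
  show "(\<lambda>n. box_cutoff a b n z) \<longlonglongrightarrow> indicator (box a b) z"
  proof (cases "z \<in> box a b")
    case True
    then have "(\<lambda>n. box_cutoff a b n z) \<longlonglongrightarrow> 1 * 1 * (1 * 1)"
      unfolding box_cutoff_def by (intro tendsto_mult smooth_step_tendsto) (auto simp: in_box_complex_iff)
    then show ?thesis using True by simp
  next
    case False
    then have "Re z \<le> Re a \<or> Re z \<ge> Re b \<or> Im z \<le> Im a \<or> Im z \<ge> Im b"
      by (auto simp: in_box_complex_iff)
    then have "real n * (Re z - Re a) \<le> 0 \<or> real n * (Re b - Re z) \<le> 0
          \<or> real n * (Im z - Im a) \<le> 0 \<or> real n * (Im b - Im z) \<le> 0" for n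
      by (auto simp: mult_nonneg_nonpos)
    then have "box_cutoff a b n z = 0" for n
      using smooth_step_0(1) unfolding box_cutoff_def by (metis mult_eq_0_iff)
    then show ?thesis using False by simp
  qed
qed

text \<open>Cutoffs show that the extension \<open>g\<close> of \<open>f\<close> by 0 integrates to
  0 over every open box. Boxes form an intersection stable generator of the Borel sets, so the same
  holds for every Borel set, in particular for the sets where \<open>g\<close> is positive and where
  it is negative.\<close>

lemma fundamental_lemma_box:
  fixes f :: "complex \<Rightarrow> real"
  assumes f: "set_integrable lborel (cbox a b) f"
    and zero: "\<And>\<psi>. \<psi> \<in> test_functions (cbox a b) \<Longrightarrow> (LINT z:cbox a b|lborel. f z * \<psi> z) = 0"
  shows "AE z in lborel. z \<in> cbox a b \<longrightarrow> f z = 0"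
proof -
  define g where "g z = indicator (cbox a b) z * f z" for z
  have ig: "integrable lborel g" using f by (simp add: g_def[abs_def] set_integrable_def)
  have fr: "AE z in lborel. z \<notin> cbox a b - box a b"
    by (rule AE_lborel_negligible[OF negligible_frontier_interval])
  have box0: "(\<integral>z. indicator (box c d) z * g z \<partial>lborel) = 0" for c d
  proof (cases "box c d \<inter> box a b = {}")
    case True
    from fr have "AE z in lborel. indicator (box c d) z * g z = 0"
      by eventually_elim (use True in \<open>auto simp: g_def indicator_def split: if_splits\<close>)
    then show ?thesis by (simp add: integral_eq_zero_AE)
  next
    case False
    obtain c' d' where cd: "box c d \<inter> box a b = box c' d'"
      unfolding box_Int_box by blast
    have ne: "box c' d' \<noteq> {}" using False cd by simp
    have ne2: "box a b \<noteq> {}" using False by auto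
    have "box c' d' \<subseteq> box a b" using cd by blast
    then have "closure (box c' d') \<subseteq> closure (box a b)" by (rule closure_mono)
    then have sub: "cbox c' d' \<subseteq> cbox a b" by (simp only: closure_box[OF ne] closure_box[OF ne2])
    have t: "box_cutoff c' d' n \<in> test_functions (cbox a b)" for n
      by (rule box_cutoff_test[OF sub])
    have "(\<lambda>n. \<integral>z. g z * box_cutoff c' d' n z \<partial>lborel) \<longlonglongrightarrow> (\<integral>z. g z * indicator (box c' d') z \<partial>lborel)"
    proof (rule integral_dominated_convergence[where w="\<lambda>z. norm (g z)"])
      show "(\<lambda>z. g z * box_cutoff c' d' n z) \<in> borel_measurable lborel" for n
        using ig borel_measurable_continuous_onI[OF test_continuous[OF t]] by auto
      show "AE z in lborel. norm (g z * box_cutoff c' d' n z) \<le> norm (g z)" for n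
        using box_cutoff_props[of c' d' n] by (auto simp: abs_mult mult_left_le)
      show "AE z in lborel. (\<lambda>n. g z * box_cutoff c' d' n z) \<longlonglongrightarrow> g z * indicator (box c' d') z"
        by (auto intro!: tendsto_intros box_cutoff_props)
    qed (use ig in auto)
    moreover have "(\<integral>z. g z * box_cutoff c' d' n z \<partial>lborel) = 0" for n
      using zero[OF t[of n]] by (simp add: set_lebesgue_integral_def g_def mult.assoc)
    ultimately have *: "(\<integral>z. g z * indicator (box c' d') z \<partial>lborel) = 0"
      by (simp add: LIMSEQ_const_iff)
    from fr have "AE z in lborel. indicator (box c d) z * g z = g z * indicator (box c' d') z"
      by eventually_elim (auto simp: g_def indicator_def cd[symmetric] split: if_splits)
    then show ?thesis using * ig by (subst integral_cong_AE) auto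
  qed
  have A0: "(\<integral>z. indicator A z * g z \<partial>lborel) = 0" if "A \<in> sets borel" for A
  proof -
    have "Int_stable (range (\<lambda>(a::complex, b). box a b))"
      by (auto simp: Int_stable_def box_Int_box)
    moreover have "range (\<lambda>(a::complex, b). box a b) \<subseteq> Pow UNIV" by auto
    moreover have "A \<in> sigma_sets UNIV (range (\<lambda>(a::complex, b). box a b))"
      using that unfolding borel_eq_box by simp
    ultimately show ?thesis
    proof (induction rule: sigma_sets_induct_disjoint)
      case (basic A) then show ?case using box0 by auto
    next
      case empty then show ?case by simp
    next
      case (compl A)
      then have [measurable]: "A \<in> sets borel" by (simp add: borel_eq_box)
      have "(\<integral>z. g z \<partial>lborel) = 0"
      proof -
        from fr have "AE z in lborel. g z = indicator (box a b) z * g z"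
          by eventually_elim (auto simp: g_def indicator_def split: if_splits)
        then show ?thesis using box0[of a b] ig by (subst integral_cong_AE) auto
      qed
      moreover have "indicator (UNIV - A) z * g z = g z - indicator A z * g z" for z
        by (auto simp: indicator_def)
      ultimately show ?case
        using compl.IH ig by (simp add: integrable_mult_indicator[of A lborel g, simplified])
    next
      case (union A)
      then have [measurable]: "A i \<in> sets borel" for i by (auto simp: borel_eq_box)
      have "set_integrable lborel (\<Union>i. A i) g"
        unfolding set_integrable_def by (rule integrable_mult_indicator) (use ig in auto)
      then have "(\<Sum>i. LINT z:A i|lborel. g z) = (LINT z:(\<Union>i. A i)|lborel. g z)"
        using union(1) by (intro lebesgue_integral_countable_add[symmetric]) (auto simp: disjoint_family_on_def)
      then show ?case using union.IH by (simp add: set_lebesgue_integral_def)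
    qed
  qed
  have [measurable]: "g \<in> borel_measurable borel" using ig by auto
  have "(\<integral>z. indicator {z. g z > 0} z * g z \<partial>lborel) = 0" "(\<integral>z. indicator {z. g z < 0} z * g z \<partial>lborel) = 0"
    by (rule A0, measurable)+
  then have "(\<integral>z. \<bar>g z\<bar> \<partial>lborel) = 0"
  proof -
    assume a: "(\<integral>z. indicator {z. g z > 0} z * g z \<partial>lborel) = 0" "(\<integral>z. indicator {z. g z < 0} z * g z \<partial>lborel) = 0"
    have "\<bar>g z\<bar> = indicator {z. g z > 0} z * g z - indicator {z. g z < 0} z * g z" for z
      by (auto simp: indicator_def)
    then show ?thesis
      using a ig integrable_mult_indicator[of "{z. g z > 0}" lborel g] integrable_mult_indicator[of "{z. g z < 0}" lborel g]
      by simp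
  qed
  then have "AE z in lborel. g z = 0"
    using integral_nonneg_eq_0_iff_AE[of lborel "\<lambda>z. \<bar>g z\<bar>"] ig by simp
  then show ?thesis by eventually_elim (auto simp: g_def)
qed

text \<open>An open set is a countable union of closed boxes, so the exceptional sets of the boxes
  add up to a null set.\<close>

lemma fundamental_lemma:
  fixes f :: "complex \<Rightarrow> real"
  assumes W: "open W" and f: "locally_integrable_on f W"
    and zero: "\<And>\<psi>. \<psi> \<in> test_functions W \<Longrightarrow> (LINT z:W|lborel. f z * \<psi> z) = 0"
  shows "AE z in lborel. z \<in> W \<longrightarrow> f z = 0"
proof -
  obtain D where D: "countable D" "D \<subseteq> Pow W" "\<And>X. X \<in> D \<Longrightarrow> \<exists>a b. X = cbox a b" "\<Union>D = W"
    using open_countable_Union_open_cbox[OF W] by blast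
  have "AE z in lborel. z \<in> X \<longrightarrow> f z = 0" if X: "X \<in> D" for X
  proof -
    obtain a b where ab: "X = cbox a b" using D X by blast
    have sub: "cbox a b \<subseteq> W" using D X ab by blast
    show ?thesis unfolding ab
    proof (rule fundamental_lemma_box)
      show "set_integrable lborel (cbox a b) f"
        using f sub by (auto simp: locally_integrable_on_def)
      fix \<psi> assume p: "\<psi> \<in> test_functions (cbox a b)"
      then have "\<psi> z = 0" if "z \<notin> cbox a b" for z
        using that unfolding test_functions_def by blast
      then have "(LINT z:cbox a b|lborel. f z * \<psi> z) = (LINT z:W|lborel. f z * \<psi> z)"
        unfolding set_lebesgue_integral_def using sub
        by (intro Bochner_Integration.integral_cong) (auto simp: indicator_def)
      then show "(LINT z:cbox a b|lborel. f z * \<psi> z) = 0"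
        using zero p test_mono[OF sub] by auto
    qed
  qed
  then have "AE z in lborel. \<forall>X\<in>D. z \<in> X \<longrightarrow> f z = 0"
    using AE_ball_countable[OF D(1), of "\<lambda>z X. z \<in> X \<longrightarrow> f z = 0" lborel] by blast
  then show ?thesis by eventually_elim (use D in auto)
qed


section \<open>Weak gradients\<close>

lemma locally_integrable_continuous:
  fixes f :: "complex \<Rightarrow> 'b::{banach,second_countable_topology}"
  assumes "continuous_on UNIV f"
  shows "locally_integrable_on f W"
  unfolding locally_integrable_on_def set_integrable_def
  using borel_integrable_compact continuous_on_subset[OF assms] by blast

lemma set_integral_compact_support:
  fixes f :: "complex \<Rightarrow> 'b::{banach,second_countable_topology}"
  assumes "K \<subseteq> W" "\<And>z. z \<notin> K \<Longrightarrow> f z = 0"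
  shows "(LINT z:W|lborel. f z) = (LINT z|lborel. f z)" "(LINT z:W|lborel. f z) = (LINT z:K|lborel. f z)"
    "set_integrable lborel W f \<longleftrightarrow> integrable lborel f"
    "set_integrable lborel K f \<longleftrightarrow> integrable lborel f"
proof -
  have "(\<lambda>z. indicator W z *\<^sub>R f z) = f" "(\<lambda>z. indicator K z *\<^sub>R f z) = f"
    using assms by (auto simp: indicator_def fun_eq_iff)
  then show "(LINT z:W|lborel. f z) = (LINT z|lborel. f z)" "(LINT z:W|lborel. f z) = (LINT z:K|lborel. f z)"
    "set_integrable lborel W f \<longleftrightarrow> integrable lborel f" "set_integrable lborel K f \<longleftrightarrow> integrable lborel f"
    by (simp_all add: set_lebesgue_integral_def set_integrable_def)
qed

text \<open>Integration by parts: the product of the two test functions has compact support, so its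
  derivative integrates to 0.\<close>

lemma has_weak_gradient_test:
  assumes "\<phi> \<in> test_functions W"
  shows "has_weak_gradient_on \<phi> (grad \<phi>) W"
proof -
  obtain K where K: "\<And>z. (\<phi> has_derivative (\<lambda>v. grad \<phi> z \<bullet> v)) (at z)" "continuous_on UNIV (grad \<phi>)"
    "compact K" "K \<subseteq> W" "\<And>z. z \<notin> K \<Longrightarrow> \<phi> z = 0" "\<And>z. z \<notin> K \<Longrightarrow> grad \<phi> z = 0"
    using test_functionsE[OF assms] by metis
  have c: "continuous_on UNIV \<phi>" by (rule test_continuous[OF assms])
  have "(LINT z:W|lborel. \<phi> z * dir_deriv v \<psi> z) = - (LINT z:W|lborel. (grad \<phi> z \<bullet> v) * \<psi> z)"
    if p: "\<psi> \<in> test_functions W" for \<psi> v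
  proof -
    obtain L where L: "\<And>z. (\<psi> has_derivative (\<lambda>v. grad \<psi> z \<bullet> v)) (at z)" "continuous_on UNIV (grad \<psi>)"
      using test_functionsE[OF p] by metis
    have dd: "dir_deriv v \<psi> z = grad \<psi> z \<bullet> v" for z
      using dir_deriv_eq[OF L(1)] .
    have c': "continuous_on UNIV \<psi>" by (rule test_continuous[OF p])
    have m: "(\<lambda>z. \<phi> z * \<psi> z) \<in> test_functions UNIV"
      "grad (\<lambda>z. \<phi> z * \<psi> z) = (\<lambda>z. \<psi> z *\<^sub>R grad \<phi> z + \<phi> z *\<^sub>R grad \<psi> z)"
      using test_mult[OF assms L] test_mono[of W UNIV] by auto
    have i1: "integrable lborel (\<lambda>z. \<phi> z * (grad \<psi> z \<bullet> v))"
      by (rule integrable_compact_support[OF _ K(3)]) (use K L c in \<open>auto intro!: continuous_intros\<close>)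
    have i2: "integrable lborel (\<lambda>z. (grad \<phi> z \<bullet> v) * \<psi> z)"
      by (rule integrable_compact_support[OF _ K(3)]) (use K L c c' in \<open>auto intro!: continuous_intros\<close>)
    have "0 = (\<integral>z. (\<psi> z *\<^sub>R grad \<phi> z + \<phi> z *\<^sub>R grad \<psi> z) \<bullet> v \<partial>lborel)"
      using integral_dir_deriv_zero[OF m(1), of v] m(2) by simp
    also have "\<dots> = (\<integral>z. (grad \<phi> z \<bullet> v) * \<psi> z + \<phi> z * (grad \<psi> z \<bullet> v) \<partial>lborel)"
      by (simp add: inner_add_left mult.commute)
    also have "\<dots> = (\<integral>z. (grad \<phi> z \<bullet> v) * \<psi> z \<partial>lborel) + (\<integral>z. \<phi> z * (grad \<psi> z \<bullet> v) \<partial>lborel)"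
      using i1 i2 by simp
    finally show ?thesis
      using set_integral_compact_support(1)[OF K(4), of "\<lambda>z. \<phi> z * (grad \<psi> z \<bullet> v)"]
        set_integral_compact_support(1)[OF K(4), of "\<lambda>z. (grad \<phi> z \<bullet> v) * \<psi> z"] K(5,6)
      by (simp add: dd)
  qed
  then show ?thesis
    unfolding has_weak_gradient_on_def
    using locally_integrable_continuous[OF c] locally_integrable_continuous[OF K(2)] by blast
qed

lemma set_integrable_bounded_mult:
  fixes f :: "complex \<Rightarrow> real"
  assumes "set_integrable lborel K f" "compact K" "continuous_on UNIV \<psi>"
  shows "set_integrable lborel K (\<lambda>z. f z * \<psi> z)"
proof -
  have "bounded (\<psi> ` K)"
    using assms compact_continuous_image continuous_on_subset compact_imp_bounded by (metis subset_UNIV)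
  then obtain M where M: "\<And>z. z \<in> K \<Longrightarrow> norm (\<psi> z) \<le> M" "M > 0" unfolding bounded_pos by auto
  have mp: "\<psi> \<in> borel_measurable borel" by (rule borel_measurable_continuous_onI[OF assms(3)])
  have mf: "(\<lambda>z. indicator K z * f z) \<in> borel_measurable borel"
    using assms(1) by (auto simp: set_integrable_def)
  show ?thesis unfolding set_integrable_def
  proof (rule Bochner_Integration.integrable_bound[where f="\<lambda>z. M *\<^sub>R (indicator K z *\<^sub>R f z)"])
    show "integrable lborel (\<lambda>z. M *\<^sub>R (indicator K z *\<^sub>R f z))"
      using assms(1) unfolding set_integrable_def by (rule integrable_scaleR_right)
    have "(\<lambda>z. (indicator K z * f z) * \<psi> z) \<in> borel_measurable borel"
      using mf mp by (rule borel_measurable_times)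
    then show "(\<lambda>z. indicator K z *\<^sub>R (f z * \<psi> z)) \<in> borel_measurable lborel"
      by (simp add: mult.assoc)
    have "\<bar>f z\<bar> * \<bar>\<psi> z\<bar> \<le> M * \<bar>f z\<bar>" if "z \<in> K" for z
      using mult_left_mono[OF M(1)[OF that], of "\<bar>f z\<bar>"] by (simp add: mult.commute)
    then show "AE z in lborel. norm (indicator K z *\<^sub>R (f z * \<psi> z)) \<le> norm (M *\<^sub>R (indicator K z *\<^sub>R f z))"
      using M(2) by (auto simp: indicator_def abs_mult)
  qed
qed

lemma locally_integrable_test_mult:
  fixes f :: "complex \<Rightarrow> real"
  assumes "locally_integrable_on f W" "\<psi> \<in> test_functions W"
  shows "set_integrable lborel W (\<lambda>z. f z * \<psi> z)" "set_integrable lborel W (\<lambda>z. f z * (grad \<psi> z \<bullet> v))"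
proof -
  obtain K where K: "\<And>z. (\<psi> has_derivative (\<lambda>v. grad \<psi> z \<bullet> v)) (at z)" "continuous_on UNIV (grad \<psi>)"
    "compact K" "K \<subseteq> W" "\<And>z. z \<notin> K \<Longrightarrow> \<psi> z = 0" "\<And>z. z \<notin> K \<Longrightarrow> grad \<psi> z = 0"
    using test_functionsE[OF assms(2)] by metis
  have f: "set_integrable lborel K f" using assms K by (auto simp: locally_integrable_on_def)
  show "set_integrable lborel W (\<lambda>z. f z * \<psi> z)"
    using set_integral_compact_support(3,4)[OF K(4), of "\<lambda>z. f z * \<psi> z"] K(5)
      set_integrable_bounded_mult[OF f K(3) test_continuous[OF assms(2)]] by simp
  show "set_integrable lborel W (\<lambda>z. f z * (grad \<psi> z \<bullet> v))"
    using set_integral_compact_support(3,4)[OF K(4), of "\<lambda>z. f z * (grad \<psi> z \<bullet> v)"] K(6)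
      set_integrable_bounded_mult[OF f K(3), of "\<lambda>z. grad \<psi> z \<bullet> v"] K(2)
    by (simp add: continuous_on_inner)
qed

lemma locally_integrable_inner:
  assumes "locally_integrable_on p W"
  shows "locally_integrable_on (\<lambda>z. p z \<bullet> (v::complex)) W"
  unfolding locally_integrable_on_def set_integrable_def
proof (intro allI impI)
  fix K assume "compact K \<and> K \<subseteq> W"
  then have "integrable lborel (\<lambda>z. indicator K z *\<^sub>R p z)"
    using assms by (auto simp: locally_integrable_on_def set_integrable_def)
  then have "integrable lborel (\<lambda>z. (indicator K z *\<^sub>R p z) \<bullet> v)" by (rule integrable_inner_left)
  then show "integrable lborel (\<lambda>z. indicator K z *\<^sub>R (p z \<bullet> v))"
    by (simp only: inner_scaleR_left real_scaleR_def)
qed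

lemma locally_integrable_diff:
  assumes "locally_integrable_on f W" "locally_integrable_on g W"
  shows "locally_integrable_on (\<lambda>z. f z - g z) W"
  using assms unfolding locally_integrable_on_def by (auto intro: set_integral_diff)

lemma has_weak_gradient_diff:
  assumes u: "has_weak_gradient_on u p W" and w: "has_weak_gradient_on w q W"
  shows "has_weak_gradient_on (\<lambda>z. u z - w z) (\<lambda>z. p z - q z) W"
  unfolding has_weak_gradient_on_def
proof (intro conjI ballI allI)
  show "locally_integrable_on (\<lambda>z. u z - w z) W" "locally_integrable_on (\<lambda>z. p z - q z) W"
    using u w by (auto simp: has_weak_gradient_on_def intro: locally_integrable_diff)
  fix \<phi> v assume t: "\<phi> \<in> test_functions W"
  have dd: "dir_deriv v \<phi> z = grad \<phi> z \<bullet> v" for z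
    using test_functionsE[OF t] dir_deriv_eq by metis
  have li: "locally_integrable_on u W" "locally_integrable_on w W"
    "locally_integrable_on (\<lambda>z. p z \<bullet> v) W" "locally_integrable_on (\<lambda>z. q z \<bullet> v) W"
    using u w by (auto simp: has_weak_gradient_on_def intro: locally_integrable_inner)
  note I = locally_integrable_test_mult[OF li(1) t] locally_integrable_test_mult[OF li(2) t]
    locally_integrable_test_mult[OF li(3) t] locally_integrable_test_mult[OF li(4) t]
  have "(LINT z:W|lborel. u z * dir_deriv v \<phi> z) = - (LINT z:W|lborel. (p z \<bullet> v) * \<phi> z)"
    "(LINT z:W|lborel. w z * dir_deriv v \<phi> z) = - (LINT z:W|lborel. (q z \<bullet> v) * \<phi> z)"
    using u w t unfolding has_weak_gradient_on_def by blast+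
  then show "(LINT z:W|lborel. (u z - w z) * dir_deriv v \<phi> z) = - (LINT z:W|lborel. ((p z - q z) \<bullet> v) * \<phi> z)"
    using I by (simp add: dd left_diff_distrib inner_diff_left set_integral_diff)
qed

text \<open>The difference of two weak gradients is a weak gradient of 0, and the fundamental lemma
  applies to its two components.\<close>

lemma weak_gradient_unique:
  assumes W: "open W" and p: "has_weak_gradient_on u p W" and q: "has_weak_gradient_on u q W"
  shows "AE z in lborel. z \<in> W \<longrightarrow> p z = q z"
proof -
  have d: "has_weak_gradient_on (\<lambda>z. 0) (\<lambda>z. p z - q z) W"
    using has_weak_gradient_diff[OF p q] by simp
  have "AE z in lborel. z \<in> W \<longrightarrow> (p z - q z) \<bullet> v = 0" for v
  proof (rule fundamental_lemma[OF W])
    show "locally_integrable_on (\<lambda>z. (p z - q z) \<bullet> v) W"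
      using d by (auto simp: has_weak_gradient_on_def intro: locally_integrable_inner)
    fix \<psi> assume "\<psi> \<in> test_functions W"
    then have "(LINT z:W|lborel. 0 * dir_deriv v \<psi> z) = - (LINT z:W|lborel. ((p z - q z) \<bullet> v) * \<psi> z)"
      using d unfolding has_weak_gradient_on_def by blast
    then show "(LINT z:W|lborel. ((p z - q z) \<bullet> v) * \<psi> z) = 0"
      by (simp add: set_lebesgue_integral_def)
  qed
  from this[of 1] this[of \<i>] show ?thesis
    by eventually_elim (auto simp: inner_complex_def complex_eq_iff)
qed

text \<open>The choice in \<open>weak_gradient\<close> is harmless: it agrees almost everywhere with
  any known weak gradient, for instance with \<open>grad\<close> on test functions.\<close>

lemma weak_gradient_AE:
  assumes "open W" "has_weak_gradient_on u p W"
  shows "AE z in lborel. z \<in> W \<longrightarrow> weak_gradient W u z = p z"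
    and "has_weak_gradient_on u (weak_gradient W u) W"
proof -
  show 1: "has_weak_gradient_on u (weak_gradient W u) W"
    unfolding weak_gradient_def by (rule someI[of "\<lambda>p. has_weak_gradient_on u p W" p]) (rule assms(2))
  show "AE z in lborel. z \<in> W \<longrightarrow> weak_gradient W u z = p z"
    by (rule weak_gradient_unique[OF assms(1) 1 assms(2)])
qed

section \<open>Geometry of the immersion\<close>

lemma has_derivative_vector_3:
  fixes f1 f2 f3 :: "'a::real_normed_vector \<Rightarrow> real"
  assumes "(f1 has_derivative D1) (at z)" "(f2 has_derivative D2) (at z)" "(f3 has_derivative D3) (at z)"
  shows "((\<lambda>z. vector [f1 z, f2 z, f3 z] :: real^3) has_derivative (\<lambda>v. vector [D1 v, D2 v, D3 v])) (at z)"
proof -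
  have eq: "(vector [x, y, w] :: real^3) = x *\<^sub>R axis 1 1 + y *\<^sub>R axis 2 1 + w *\<^sub>R axis 3 1" for x y w
    by (simp add: vec_eq_iff forall_3 axis_def)
  show ?thesis unfolding eq
    by (rule derivative_eq_intros assms refl)+ simp
qed

lemma has_derivative_Re_field:
  assumes "(P has_field_derivative p) (at z)"
  shows "((\<lambda>z. Re (P z) + c) has_derivative (\<lambda>v. Re (p * v))) (at z)"
proof -
  have "((\<lambda>z. Re (P z)) has_derivative (\<lambda>v. Re (p * v))) (at z)"
    using assms unfolding has_field_derivative_def by (rule has_derivative_Re)
  then show ?thesis by (rule has_derivative_add[where g'="\<lambda>_. 0", simplified]) simp
qed

text \<open>Weierstrass data in homogeneous form: the Gauss map is \<open>a / b\<close>, the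
  one-form is \<open>c\<close> times the square of \<open>b\<close>, and \<open>a\<close> and
  \<open>b\<close> have no common zero. A pole of the Gauss map is a mere zero of \<open>b\<close>,
  so the computations need no case distinction there.\<close>

locale weierstrass_data =
  fixes U :: "complex set" and X :: "complex \<Rightarrow> real^3"
    and P1 P2 P3 a b a' b' c c' :: "complex \<Rightarrow> complex" and k1 k2 k3 :: real
  assumes U: "open U"
    and X: "\<And>z. z \<in> U \<Longrightarrow> X z = vector [Re (P1 z) + k1, Re (P2 z) + k2, Re (P3 z) + k3]"
    and P1: "\<And>z. z \<in> U \<Longrightarrow> (P1 has_field_derivative c z * (1/2 * ((b z)\<^sup>2 - (a z)\<^sup>2))) (at z)"
    and P2: "\<And>z. z \<in> U \<Longrightarrow> (P2 has_field_derivative c z * (\<i>/2 * ((b z)\<^sup>2 + (a z)\<^sup>2))) (at z)"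
    and P3: "\<And>z. z \<in> U \<Longrightarrow> (P3 has_field_derivative c z * (a z * b z)) (at z)"
    and a: "\<And>z. z \<in> U \<Longrightarrow> (a has_field_derivative a' z) (at z)"
    and b: "\<And>z. z \<in> U \<Longrightarrow> (b has_field_derivative b' z) (at z)"
    and c: "\<And>z. z \<in> U \<Longrightarrow> (c has_field_derivative c' z) (at z)"
    and nz: "\<And>z. z \<in> U \<Longrightarrow> c z \<noteq> 0" "\<And>z. z \<in> U \<Longrightarrow> a z \<noteq> 0 \<or> b z \<noteq> 0"
begin

text \<open>\<open>f1\<close>, \<open>f2\<close>, \<open>f3\<close> are the coefficients of the
  three holomorphic forms, \<open>g1\<close>, \<open>g2\<close>, \<open>g3\<close> their
  derivatives, and \<open>lam\<close> is the conformal factor of the induced metric, as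
  \<open>first_form\<close> confirms.\<close>

definition "f1 z = c z * (1/2 * ((b z)\<^sup>2 - (a z)\<^sup>2))"
definition "f2 z = c z * (\<i>/2 * ((b z)\<^sup>2 + (a z)\<^sup>2))"
definition "f3 z = c z * (a z * b z)"
definition "g1 z = c' z * (1/2 * ((b z)\<^sup>2 - (a z)\<^sup>2)) + c z * (b z * b' z - a z * a' z)"
definition "g2 z = c' z * (\<i>/2 * ((b z)\<^sup>2 + (a z)\<^sup>2)) + c z * (\<i> * (b z * b' z + a z * a' z))"
definition "g3 z = c' z * (a z * b z) + c z * (a' z * b z + a z * b' z)"
definition "lam z = (cmod (c z) * ((cmod (a z))\<^sup>2 + (cmod (b z))\<^sup>2) / 2)\<^sup>2"

lemma dX:
  assumes "z \<in> U"
  shows "(X has_derivative (\<lambda>v. vector [Re (f1 z * v), Re (f2 z * v), Re (f3 z * v)])) (at z)"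
proof -
  have "((\<lambda>z. vector [Re (P1 z) + k1, Re (P2 z) + k2, Re (P3 z) + k3] :: real^3) has_derivative
      (\<lambda>v. vector [Re (f1 z * v), Re (f2 z * v), Re (f3 z * v)])) (at z)"
    unfolding f1_def f2_def f3_def
    by (intro has_derivative_vector_3 has_derivative_Re_field P1 P2 P3 assms)
  then show ?thesis
    by (rule has_derivative_transform_within_open[OF _ U assms]) (simp add: X)
qed

lemma ddX:
  assumes "z \<in> U"
  shows "(dir_deriv v X has_derivative (\<lambda>w. vector [Re (g1 z * v * w), Re (g2 z * v * w), Re (g3 z * v * w)])) (at z)"
proof -
  have d: "(f1 has_field_derivative g1 z) (at z)" "(f2 has_field_derivative g2 z) (at z)"
      "(f3 has_field_derivative g3 z) (at z)"
    unfolding f1_def[abs_def] f2_def[abs_def] f3_def[abs_def] g1_def g2_def g3_def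
    by (rule derivative_eq_intros a b c assms refl | simp add: field_simps power2_eq_square)+
  have d': "((\<lambda>z. f z * v) has_field_derivative g * v) (at z)" if "(f has_field_derivative g) (at z)" for f g
    using that by (rule DERIV_cmult_right)
  have "((\<lambda>z. vector [Re (f1 z * v) + 0, Re (f2 z * v) + 0, Re (f3 z * v) + 0] :: real^3) has_derivative
     (\<lambda>w. vector [Re (g1 z * v * w), Re (g2 z * v * w), Re (g3 z * v * w)])) (at z)"
    by (intro has_derivative_vector_3 has_derivative_Re_field d' d)
  then show ?thesis
    by (rule has_derivative_transform_within_open[OF _ U assms]) (simp add: dir_deriv_eq[OF dX])
qed

text \<open>Conformality of the immersion: the real part of this identity says that the two
  coordinate tangent vectors have equal length, the imaginary part that they are orthogonal.\<close>

lemma null: "(f1 z)\<^sup>2 + (f2 z)\<^sup>2 + (f3 z)\<^sup>2 = 0"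
  by (simp add: f1_def f2_def f3_def power2_eq_square field_simps)

lemma norm_f: "(cmod (f1 z))\<^sup>2 + (cmod (f2 z))\<^sup>2 + (cmod (f3 z))\<^sup>2 = 2 * lam z"
proof -
  \<comment> \<open>In these terms \<open>f1\<close> and \<open>f2\<close> are, up to a unit, half
    the difference and half the sum, and the parallelogram law leads to the square of
    \<open>cmod p + cmod q\<close>.\<close>
  define p q where "p = c z * (b z)\<^sup>2" and "q = c z * (a z)\<^sup>2"
  have 1: "(cmod (p - q))\<^sup>2 + (cmod (p + q))\<^sup>2 = 2 * ((cmod p)\<^sup>2 + (cmod q)\<^sup>2)"
    unfolding cmod_power2 by (simp add: power2_eq_square algebra_simps)
  have f12: "f1 z = (p - q) / 2" "f2 z = \<i> * ((p + q) / 2)"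
    by (simp_all add: f1_def f2_def p_def q_def field_simps)
  have "(cmod (f1 z))\<^sup>2 = (cmod (p - q))\<^sup>2 / 4" "(cmod (f2 z))\<^sup>2 = (cmod (p + q))\<^sup>2 / 4"
    unfolding f12 by (simp_all add: norm_mult norm_divide power_divide)
  moreover have "(cmod (f3 z))\<^sup>2 = cmod p * cmod q"
    by (simp add: f3_def p_def q_def norm_mult norm_power power2_eq_square)
  ultimately have "(cmod (f1 z))\<^sup>2 + (cmod (f2 z))\<^sup>2 + (cmod (f3 z))\<^sup>2 = ((cmod (p - q))\<^sup>2 + (cmod (p + q))\<^sup>2)/4 + cmod p * cmod q"
    by simp
  also have "\<dots> = (cmod p + cmod q)\<^sup>2 / 2" unfolding 1 by (simp add: power2_eq_square field_simps)
  also have "cmod p + cmod q = cmod (c z) * ((cmod (a z))\<^sup>2 + (cmod (b z))\<^sup>2)"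
    by (simp add: p_def q_def norm_mult norm_power field_simps)
  finally show ?thesis by (simp add: lam_def power_divide)
qed

lemma ReIm_f:
  "(Re (f1 z))\<^sup>2 + (Re (f2 z))\<^sup>2 + (Re (f3 z))\<^sup>2 = lam z"
  "(Im (f1 z))\<^sup>2 + (Im (f2 z))\<^sup>2 + (Im (f3 z))\<^sup>2 = lam z"
  "Re (f1 z) * Im (f1 z) + Re (f2 z) * Im (f2 z) + Re (f3 z) * Im (f3 z) = 0"
proof -
  have *: "Re ((f1 z)\<^sup>2 + (f2 z)\<^sup>2 + (f3 z)\<^sup>2) = 0" "Im ((f1 z)\<^sup>2 + (f2 z)\<^sup>2 + (f3 z)\<^sup>2) = 0"
    using null[of z] by simp_all
  show "Re (f1 z) * Im (f1 z) + Re (f2 z) * Im (f2 z) + Re (f3 z) * Im (f3 z) = 0"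
  proof -
    have "2 * (Re (f1 z) * Im (f1 z) + Re (f2 z) * Im (f2 z) + Re (f3 z) * Im (f3 z)) = 0"
      using *(2) by (simp add: power2_eq_square algebra_simps)
    then show ?thesis by simp
  qed
  show "(Re (f1 z))\<^sup>2 + (Re (f2 z))\<^sup>2 + (Re (f3 z))\<^sup>2 = lam z"
    "(Im (f1 z))\<^sup>2 + (Im (f2 z))\<^sup>2 + (Im (f3 z))\<^sup>2 = lam z"
    using *(1) norm_f[of z] unfolding cmod_power2 by (simp_all add: power2_eq_square)
qed

lemma lam_pos: "z \<in> U \<Longrightarrow> lam z > 0"
  using nz[of z] by (auto simp: lam_def add_pos_nonneg add_nonneg_pos add_nonneg_eq_0_iff intro!: zero_less_power2[THEN iffD2])

lemma dir1: "z \<in> U \<Longrightarrow> dir_deriv 1 X z = vector [Re (f1 z), Re (f2 z), Re (f3 z)]"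
  and diri: "z \<in> U \<Longrightarrow> dir_deriv \<i> X z = vector [- Im (f1 z), - Im (f2 z), - Im (f3 z)]"
  by (simp_all add: dir_deriv_eq[OF dX])

lemma first_form:
  assumes "z \<in> U"
  shows "fst_form X z 1 1 = lam z" "fst_form X z \<i> \<i> = lam z" "fst_form X z 1 \<i> = 0"
  using ReIm_f[of z]
  by (simp_all add: fst_form_def dir1[OF assms] diri[OF assms] inner_vec_def sum_3 power2_eq_square)

lemma gram: "z \<in> U \<Longrightarrow> gram_det X z = (lam z)\<^sup>2"
  by (simp add: gram_det_def first_form power2_eq_square)

lemma area: "z \<in> U \<Longrightarrow> area_density X z = lam z"
  using lam_pos[of z] by (simp add: area_density_def gram)

lemma covector_area:
  assumes "z \<in> U"
  shows "covector_norm_sq X z p * area_density X z = (cmod p)\<^sup>2"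
  using lam_pos[OF assms] assms
  by (simp add: covector_norm_sq_def first_form gram area cmod_power2) (simp add: field_simps power2_eq_square)

text \<open>Up to its sign the right-hand side is the density of the spherical area pulled back by
  the Gauss map \<open>a / b\<close>, with the powers of \<open>b\<close> cancelled.\<close>

lemma gauss_area:
  assumes z: "z \<in> U"
  shows "gauss_curvature X z * area_density X z =
    - 4 * (cmod (a' z * b z - a z * b' z))\<^sup>2 / ((cmod (a z))\<^sup>2 + (cmod (b z))\<^sup>2)\<^sup>2"
proof -
  define w where "w = a' z * b z - a z * b' z"
  define n where "n = cross3 (dir_deriv 1 X z) (dir_deriv \<i> X z)"
  have n: "complex_of_real (n $ 1) = (f2 z * cnj (f3 z) - f3 z * cnj (f2 z)) / (2 * \<i>)"
    "complex_of_real (n $ 2) = (f3 z * cnj (f1 z) - f1 z * cnj (f3 z)) / (2 * \<i>)"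
    "complex_of_real (n $ 3) = (f1 z * cnj (f2 z) - f2 z * cnj (f1 z)) / (2 * \<i>)"
    unfolding n_def dir1[OF z] diri[OF z]
    by (simp_all add: cross3_def complex_eq_iff Re_divide Im_divide power2_eq_square algebra_simps)
  \<comment> \<open>The complex pairing of the second derivative of the holomorphic curve with the
    unnormalised normal. The second fundamental form is the real part of its products with the two
    tangent vectors, divided by \<open>lam z\<close>.\<close>
  define s where "s = g1 z * n $ 1 + g2 z * n $ 2 + g3 z * n $ 3"
  \<comment> \<open>Differentiating nullity shows that the derivative vector is orthogonal to
    \<open>(f1, f2, f3)\<close>; since the latter is null, their cross product is a multiple of
    it.\<close>
  have c1: "g2 z * f3 z - g3 z * f2 z = - \<i> * c z * w * f1 z"
    and c2: "g3 z * f1 z - g1 z * f3 z = - \<i> * c z * w * f2 z"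
    and c3: "g1 z * f2 z - g2 z * f1 z = - \<i> * c z * w * f3 z"
    by (simp_all add: f1_def f2_def f3_def g1_def g2_def g3_def w_def power2_eq_square field_simps)
  have "2 * \<i> * s = (g2 z * f3 z - g3 z * f2 z) * cnj (f1 z) + (g3 z * f1 z - g1 z * f3 z) * cnj (f2 z)
      + (g1 z * f2 z - g2 z * f1 z) * cnj (f3 z)"
    unfolding s_def n by (simp add: field_simps)
  also have "\<dots> = - \<i> * c z * w * (f1 z * cnj (f1 z) + f2 z * cnj (f2 z) + f3 z * cnj (f3 z))"
    unfolding c1 c2 c3 by (simp add: algebra_simps)
  also have "f1 z * cnj (f1 z) + f2 z * cnj (f2 z) + f3 z * cnj (f3 z) = complex_of_real (2 * lam z)"
    unfolding norm_f[symmetric] by (simp only: of_real_add complex_norm_square)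
  finally have s: "s = - (c z * w * complex_of_real (lam z))"
  proof -
    assume e: "2 * \<i> * s = - \<i> * c z * w * complex_of_real (2 * lam z)"
    have "s = (2 * \<i> * s) / (2 * \<i>)" by simp
    also have "\<dots> = - (c z * w * complex_of_real (lam z))" unfolding e by simp
    finally show ?thesis .
  qed
  have nn: "(norm n)\<^sup>2 = (lam z)\<^sup>2"
  proof -
    have "(norm n)\<^sup>2 = gram_det X z"
      unfolding n_def norm_cross gram_det_def fst_form_def by (simp only: power2_norm_eq_inner)
    then show ?thesis by (simp add: gram[OF z])
  qed
  then have nl: "norm n = lam z" using lam_pos[OF z] by (simp add: power2_eq_iff_nonneg)
  have sf: "snd_form X z v u = Re (s * v * u) / lam z" for v u
    unfolding snd_form_def unit_normal_def n_def[symmetric] sgn_div_norm nl dir_deriv_eq[OF ddX[OF z]] s_def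
    by (simp add: inner_vec_def sum_3 divide_inverse algebra_simps)
  \<comment> \<open>The second fundamental form is trace free, so its determinant is minus a sum of
    two squares.\<close>
  have alg: "(x / l * (- x / l) - (- y / l)\<^sup>2) / l\<^sup>2 * l = - ((x\<^sup>2 + y\<^sup>2) / l\<^sup>2) / l" if "l > 0" for x y l :: real
    using that by (simp add: divide_simps power2_eq_square)
  have r: "Re (s * 1 * 1) = Re s" "Re (s * \<i> * \<i>) = - Re s" "Re (s * 1 * \<i>) = - Im s"
    by simp_all
  have "gauss_curvature X z * area_density X z =
      (Re s / lam z * (- Re s / lam z) - (- Im s / lam z)\<^sup>2) / (lam z)\<^sup>2 * lam z"
    unfolding gauss_curvature_def sf gram[OF z] area[OF z] r ..
  also have "\<dots> = - (((Re s)\<^sup>2 + (Im s)\<^sup>2) / (lam z)\<^sup>2) / lam z"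
    by (rule alg[OF lam_pos[OF z]])
  also have "((Re s)\<^sup>2 + (Im s)\<^sup>2) / (lam z)\<^sup>2 = (cmod (c z))\<^sup>2 * (cmod w)\<^sup>2"
    unfolding cmod_power2[symmetric] s using lam_pos[OF z] by (simp add: norm_mult power_mult_distrib)
  also have "- ((cmod (c z))\<^sup>2 * (cmod w)\<^sup>2) / lam z = - 4 * (cmod w)\<^sup>2 / ((cmod (a z))\<^sup>2 + (cmod (b z))\<^sup>2)\<^sup>2"
    using nz(1)[OF z] by (simp add: lam_def power_mult_distrib power_divide)
  finally show ?thesis by (simp add: w_def)
qed

end

text \<open>By the convention for division by 0, \<open>antipodal\<close> fixes 0 and is an
  involution of the whole plane.\<close>

lemma antipodal_involution: "antipodal (antipodal z) = z" "antipodal z = 0 \<longleftrightarrow> z = 0"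
  by (auto simp: antipodal_def)

section \<open>The Oliveira surface: primitives of its forms, metric and curvature\<close>

locale oliveira =
  fixes m :: nat
  assumes odd_m: "odd m" and m5: "m \<ge> 5"
begin

text \<open>The Gauss map is \<open>pa z / (z - 1)\<close>, its derivative \<open>wr z / (z - 1)\<^sup>2\<close>, and the induced metric
  \<open>lam0 |dz|\<^sup>2\<close>.\<close>
definition pa :: "complex \<Rightarrow> complex" where "pa z = z ^ (m - 1) * (z + 1)"
definition pa' :: "complex \<Rightarrow> complex" where "pa' z = of_nat (m - 1) * z ^ (m - 2) * (z + 1) + z ^ (m - 1)"
definition wr :: "complex \<Rightarrow> complex" where "wr z = pa' z * (z - 1) - pa z"
definition sg :: "complex \<Rightarrow> real" where "sg z = (cmod (pa z))\<^sup>2 + (cmod (z - 1))\<^sup>2"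
text \<open>The 8 is twice the 4 of the spherical metric; clearing the powers of
  \<open>z - 1\<close> leaves a function that is continuous at the pole of the Gauss map.\<close>

definition rho :: "complex \<Rightarrow> real" where "rho z = 8 * (cmod (wr z))\<^sup>2 / (sg z)\<^sup>2"
abbreviation X :: "complex \<Rightarrow> real^3" where "X \<equiv> oliveira_immersion m"
definition lam0 :: "complex \<Rightarrow> real" where "lam0 z = (cmod (\<i> / z ^ (m + 1)) * sg z / 2)\<^sup>2"

text \<open>\<open>PA\<close> and \<open>PB\<close> are primitives of
  \<open>\<i> / z ^ (m + 1)\<close> times the squares of \<open>z - 1\<close> and of
  \<open>pa z\<close>. For m at least 5 the power -1 does not occur in either, so there are no
  periods and no logarithm.\<close>

definition PA :: "complex \<Rightarrow> complex" where
  "PA z = \<i> * (2 / (of_nat (m - 1) * z ^ (m - 1)) - 1 / (of_nat (m - 2) * z ^ (m - 2)) - 1 / (of_nat m * z ^ m))"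
definition PB :: "complex \<Rightarrow> complex" where
  "PB z = \<i> * (z ^ m / of_nat m + 2 * z ^ (m - 1) / of_nat (m - 1) + z ^ (m - 2) / of_nat (m - 2))"

lemma m_eq: obtains n where "m = n + 3" "odd (n + 3)" "n \<ge> 2"
  by (rule that[of "m - 3"]) (use odd_m m5 in auto)

lemma pa_deriv: "(pa has_field_derivative pa' z) (at z)"
  unfolding pa_def[abs_def] pa'_def by (rule derivative_eq_intros refl)+ (use m5 in \<open>simp add: diff_diff_left numeral_2_eq_2\<close>)

lemma PA_deriv:
  assumes "z \<noteq> 0"
  shows "(PA has_field_derivative \<i> / z ^ (m + 1) * (z - 1)\<^sup>2) (at z)"
proof (rule m_eq)
  fix n assume m: "m = n + 3"
  have [simp]: "(2 + of_nat n :: complex) \<noteq> 0" "(1 + of_nat n :: complex) \<noteq> 0" "(3 + of_nat n :: complex) \<noteq> 0"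
    by (metis of_nat_add of_nat_numeral of_nat_1 of_nat_eq_0_iff add_is_0 zero_neq_numeral zero_neq_one)+
  have d: "((\<lambda>z. 1 / (of_nat (Suc k) * z ^ Suc k)) has_field_derivative - 1 / z ^ (k + 2)) (at z)" for k
  proof -
    have "((\<lambda>z. 1 / (of_nat (Suc k) * z ^ Suc k)) has_field_derivative
        - (of_nat (Suc k) * (of_nat (Suc k) * z ^ k)) / (of_nat (Suc k) * z ^ Suc k)\<^sup>2) (at z)"
      using assms by (auto intro!: derivative_eq_intros simp: power2_eq_square simp del: of_nat_Suc power_Suc)
    also have "- (of_nat (Suc k) * (of_nat (Suc k) * z ^ k)) / (of_nat (Suc k) * z ^ Suc k)\<^sup>2 = - 1 / z ^ (k + 2)"
      using assms by (simp add: field_simps power2_eq_square del: of_nat_Suc)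
    finally show ?thesis .
  qed
  have "((\<lambda>z. \<i> * (2 * (1 / (of_nat (Suc (n+1)) * z ^ Suc (n+1))) - 1 / (of_nat (Suc n) * z ^ Suc n)
      - 1 / (of_nat (Suc (n+2)) * z ^ Suc (n+2)))) has_field_derivative
      \<i> * (2 * (- 1 / z ^ ((n+1) + 2)) - (- 1 / z ^ (n + 2)) - (- 1 / z ^ ((n+2) + 2)))) (at z)"
    by (intro DERIV_cmult DERIV_diff d)
  also have "(\<lambda>z. \<i> * (2 * (1 / (of_nat (Suc (n+1)) * z ^ Suc (n+1))) - 1 / (of_nat (Suc n) * z ^ Suc n)
      - 1 / (of_nat (Suc (n+2)) * z ^ Suc (n+2)))) = PA"
    unfolding PA_def[abs_def] by (simp add: m eval_nat_numeral)
  also have "\<i> * (2 * (- 1 / z ^ ((n+1) + 2)) - (- 1 / z ^ (n + 2)) - (- 1 / z ^ ((n+2) + 2)))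
      = \<i> / z ^ (m + 1) * (z - 1)\<^sup>2"
    using assms by (simp add: m eval_nat_numeral field_simps)
  finally show ?thesis .
qed

lemma PB_deriv:
  assumes "z \<noteq> 0"
  shows "(PB has_field_derivative \<i> / z ^ (m + 1) * (pa z)\<^sup>2) (at z)"
proof (rule m_eq)
  fix n assume m: "m = n + 3"
  have d: "((\<lambda>z. z ^ Suc k / of_nat (Suc k)) has_field_derivative z ^ k) (at z)" for k
    by (rule derivative_eq_intros refl | simp del: of_nat_Suc)+
  have "((\<lambda>z. \<i> * (z ^ Suc (n+2) / of_nat (Suc (n+2)) + 2 * (z ^ Suc (n+1) / of_nat (Suc (n+1)))
      + z ^ Suc n / of_nat (Suc n))) has_field_derivative
      \<i> * (z ^ (n+2) + 2 * z ^ (n+1) + z ^ n)) (at z)"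
    by (intro DERIV_cmult DERIV_add d)
  also have "(\<lambda>z. \<i> * (z ^ Suc (n+2) / of_nat (Suc (n+2)) + 2 * (z ^ Suc (n+1) / of_nat (Suc (n+1)))
      + z ^ Suc n / of_nat (Suc n))) = PB"
    unfolding PB_def[abs_def] by (simp add: m eval_nat_numeral)
  also have "\<i> * (z ^ (n+2) + 2 * z ^ (n+1) + z ^ n) = \<i> / z ^ (m + 1) * (pa z)\<^sup>2"
    using assms unfolding pa_def by (simp add: m eval_nat_numeral field_simps)
  finally show ?thesis .
qed

definition "P1 z = (PA z - PB z) / 2"
definition "P2 z = \<i> * (PA z + PB z) / 2"
definition "P3 z = \<i> * (z + 1 / z)"

lemma P_deriv:
  assumes "z \<noteq> 0"
  shows "(P1 has_field_derivative \<i> / z ^ (m + 1) * (1/2 * ((z - 1)\<^sup>2 - (pa z)\<^sup>2))) (at z)"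
    "(P2 has_field_derivative \<i> / z ^ (m + 1) * (\<i>/2 * ((z - 1)\<^sup>2 + (pa z)\<^sup>2))) (at z)"
    "(P3 has_field_derivative \<i> / z ^ (m + 1) * (pa z * (z - 1))) (at z)"
proof -
  have e1: "(c * u - c * v) / 2 = c * (1/2 * (u - v))" and e2: "\<i> * (c * u + c * v) / 2 = c * (\<i>/2 * (u + v))" for c u v :: complex
    by (simp_all add: field_simps)
  show "(P1 has_field_derivative \<i> / z ^ (m + 1) * (1/2 * ((z - 1)\<^sup>2 - (pa z)\<^sup>2))) (at z)"
    unfolding P1_def[abs_def]
    by (rule DERIV_cdivide[OF DERIV_diff[OF PA_deriv[OF assms] PB_deriv[OF assms]], THEN DERIV_cong]) (rule e1)
  show "(P2 has_field_derivative \<i> / z ^ (m + 1) * (\<i>/2 * ((z - 1)\<^sup>2 + (pa z)\<^sup>2))) (at z)"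
    unfolding P2_def[abs_def]
    by (rule DERIV_cdivide[OF DERIV_cmult[OF DERIV_add[OF PA_deriv[OF assms] PB_deriv[OF assms]]], THEN DERIV_cong]) (rule e2)
  have "(P3 has_field_derivative \<i> * (1 - 1 / z\<^sup>2)) (at z)"
    unfolding P3_def[abs_def] using assms by (auto intro!: derivative_eq_intros simp: power2_eq_square)
  also have "\<i> * (1 - 1 / z\<^sup>2) = \<i> / z ^ (m + 1) * (pa z * (z - 1))"
  proof (rule m_eq)
    fix n assume "m = n + 3"
    then show ?thesis using assms unfolding pa_def by (simp add: eval_nat_numeral field_simps)
  qed
  finally show "(P3 has_field_derivative \<i> / z ^ (m + 1) * (pa z * (z - 1))) (at z)" .
qed

text \<open>Off 0 and 1 the pointwise products equal the right-hand side, which is continuous at 1,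
  where the pole of the Gauss map is cancelled; so it is the limit that \<open>remove_sings\<close>
  takes.\<close>

lemma weierstrass_form_eq:
  assumes "z \<noteq> 0"
  shows "weierstrass_form (oliveira_gauss m) (oliveira_eta m) 1 z = \<i> / z ^ (m + 1) * (1/2 * ((z - 1)\<^sup>2 - (pa z)\<^sup>2))"
    "weierstrass_form (oliveira_gauss m) (oliveira_eta m) 2 z = \<i> / z ^ (m + 1) * (\<i>/2 * ((z - 1)\<^sup>2 + (pa z)\<^sup>2))"
    "weierstrass_form (oliveira_gauss m) (oliveira_eta m) 3 z = \<i> / z ^ (m + 1) * (pa z * (z - 1))"
proof -
  have main: "remove_sings f z = h z"
    if c: "continuous_on (-{0}) h" and eq: "\<And>w. w \<noteq> 0 \<Longrightarrow> w \<noteq> 1 \<Longrightarrow> f w = h w" for f h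
  proof (rule remove_sings_eqI)
    have "isCont h z" using c assms by (simp add: continuous_on_eq_continuous_at open_Compl)
    then have "h \<midarrow>z\<rightarrow> h z" by (simp add: isCont_def)
    moreover have "eventually (\<lambda>w. w \<in> - {0, 1} - {z}) (at z)"
    proof -
      have "open (- ({0, 1} - {z}))" by (intro open_Compl finite_imp_closed finite_Diff) auto
      then show ?thesis using assms eventually_at_in_open[of "- ({0,1} - {z})" z] by (auto elim: eventually_mono)
    qed
    then have "eventually (\<lambda>w. h w = f w) (at z)" by eventually_elim (use eq in auto)
    ultimately show "f \<midarrow>z\<rightarrow> h z" by (rule Lim_transform_eventually)
  qed
  show "weierstrass_form (oliveira_gauss m) (oliveira_eta m) 1 z = \<i> / z ^ (m + 1) * (1/2 * ((z - 1)\<^sup>2 - (pa z)\<^sup>2))"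
    unfolding weierstrass_form_def
    by (rule main[where h="\<lambda>z. \<i> / z ^ (m + 1) * (1/2 * ((z - 1)\<^sup>2 - (pa z)\<^sup>2))"])
      (auto simp: oliveira_gauss_def oliveira_eta_def pa_def field_simps intro!: continuous_intros)
  show "weierstrass_form (oliveira_gauss m) (oliveira_eta m) 2 z = \<i> / z ^ (m + 1) * (\<i>/2 * ((z - 1)\<^sup>2 + (pa z)\<^sup>2))"
    unfolding weierstrass_form_def
    by (rule main[where h="\<lambda>z. \<i> / z ^ (m + 1) * (\<i>/2 * ((z - 1)\<^sup>2 + (pa z)\<^sup>2))"])
      (auto simp: oliveira_gauss_def oliveira_eta_def pa_def field_simps intro!: continuous_intros)
  show "weierstrass_form (oliveira_gauss m) (oliveira_eta m) 3 z = \<i> / z ^ (m + 1) * (pa z * (z - 1))"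
    unfolding weierstrass_form_def
    by (rule main[where h="\<lambda>z. \<i> / z ^ (m + 1) * (pa z * (z - 1))"])
      (auto simp: oliveira_gauss_def oliveira_eta_def pa_def field_simps power2_eq_square intro!: continuous_intros)
qed

text \<open>Each form has a primitive on the punctured plane, so the integral depends only on the
  end points, and any path that \<open>SOME\<close> selects will do once one exists.\<close>

lemma immersion_eq:
  assumes "z \<noteq> 0"
  shows "X z = vector [Re (P1 z) + - Re (P1 1), Re (P2 z) + - Re (P2 1), Re (P3 z) + - Re (P3 1)]"
proof -
  define Q where "Q \<gamma> \<longleftrightarrow> valid_path \<gamma> \<and> path_image \<gamma> \<subseteq> -{0} \<and> pathstart \<gamma> = 1 \<and> pathfinish \<gamma> = z" for \<gamma> :: "real \<Rightarrow> complex"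
  have "\<exists>\<gamma>. Q \<gamma>"
  proof -
    have "connected (- {0::complex})" by (simp add: connected_punctured_universe)
    then show ?thesis
      using connected_open_polynomial_connected[of "-{0::complex}" 1 z] assms valid_path_polynomial_function
      by (auto simp: Q_def open_Compl)
  qed
  then have Q: "Q (SOME \<gamma>. Q \<gamma>)" by (rule someI_ex)
  have ci: "contour_integral (SOME \<gamma>. Q \<gamma>) w = P z - P 1"
    if "\<And>z. z \<noteq> 0 \<Longrightarrow> (P has_field_derivative w z) (at z)" for P w
  proof -
    have "(w has_contour_integral P (pathfinish (SOME \<gamma>. Q \<gamma>)) - P (pathstart (SOME \<gamma>. Q \<gamma>))) (SOME \<gamma>. Q \<gamma>)"
      by (rule contour_integral_primitive[of "-{0}"]) (use Q that in \<open>auto simp: Q_def intro: has_field_derivative_at_within\<close>)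
    then show ?thesis using Q by (auto simp: Q_def intro: contour_integral_unique)
  qed
  have "X z = (\<chi> k. Re (contour_integral (SOME \<gamma>. Q \<gamma>) (weierstrass_form (oliveira_gauss m) (oliveira_eta m) k)))"
    by (simp add: oliveira_immersion_def weierstrass_map_def Q_def Let_def)
  then show ?thesis
    using ci[of P1 "weierstrass_form (oliveira_gauss m) (oliveira_eta m) 1"]
      ci[of P2 "weierstrass_form (oliveira_gauss m) (oliveira_eta m) 2"]
      ci[of P3 "weierstrass_form (oliveira_gauss m) (oliveira_eta m) 3"] P_deriv
    by (simp add: vec_eq_iff forall_3 weierstrass_form_eq)
qed

text \<open>At 1, the only zero of the second square, \<open>pa\<close> has the value 2.\<close>

lemma sg_pos: "sg z > 0"
proof (cases "z = 1")
  case True then show ?thesis by (simp add: sg_def pa_def)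
next
  case False
  then have "cmod (z - 1) > 0" by simp
  then show ?thesis unfolding sg_def by (simp add: add_nonneg_pos)
qed

sublocale W: weierstrass_data "-{0}" X P1 P2 P3 pa "\<lambda>z. z - 1" pa' "\<lambda>_. 1" "\<lambda>z. \<i> / z ^ (m + 1)"
  "\<lambda>z. - \<i> * of_nat (m + 1) / z ^ (m + 2)" "- Re (P1 1)" "- Re (P2 1)" "- Re (P3 1)"
proof
  show "((\<lambda>z. \<i> / z ^ (m + 1)) has_field_derivative - \<i> * of_nat (m + 1) / z ^ (m + 2)) (at z)" if "z \<in> -{0}" for z :: complex
  proof -
    have "((\<lambda>z. \<i> / z ^ (m + 1)) has_field_derivative - (\<i> * (of_nat (m + 1) * z ^ m)) / (z ^ (m + 1) * z ^ (m + 1))) (at z)"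
      using that by (auto intro!: derivative_eq_intros simp del: of_nat_Suc power_Suc of_nat_add)
    also have "- (\<i> * (of_nat (m + 1) * z ^ m)) / (z ^ (m + 1) * z ^ (m + 1)) = - \<i> * of_nat (m + 1) / z ^ (m + 2)"
      using that by (simp add: field_simps)
    finally show ?thesis .
  qed
  show "pa z \<noteq> 0 \<or> z - 1 \<noteq> 0" if "z \<in> -{0}" for z
    using sg_pos[of z] unfolding sg_def by (metis add.right_neutral norm_zero power_zero_numeral less_irrefl)
  show "X z = vector [Re (P1 z) + - Re (P1 1), Re (P2 z) + - Re (P2 1), Re (P3 z) + - Re (P3 1)]" if "z \<in> -{0}" for z
    using that by (intro immersion_eq) auto
qed (use P_deriv pa_deriv in \<open>auto intro!: derivative_eq_intros simp del: power_Suc of_nat_Suc\<close>)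

lemma area_eq: "z \<noteq> 0 \<Longrightarrow> area_density X z = lam0 z"
  using W.area[of z] unfolding W.lam_def lam0_def sg_def by simp

lemma covector_eq: "z \<noteq> 0 \<Longrightarrow> covector_norm_sq X z p * area_density X z = (cmod p)\<^sup>2"
  using W.covector_area[of z p] by simp

lemma gauss_eq: "z \<noteq> 0 \<Longrightarrow> 2 * gauss_curvature X z * area_density X z = - rho z"
  using W.gauss_area[of z] by (simp add: rho_def sg_def wr_def)

end

section \<open>Conformal change of variables and Fubini in the plane\<close>

text \<open>The change of variables formula with determinants is applied in \<open>real^2\<close>;
  these isometries carry integrals over the complex plane there and back.\<close>

definition to_vec2 :: "complex \<Rightarrow> real^2" where "to_vec2 z = vector [Re z, Im z]"
definition of_vec2 :: "real^2 \<Rightarrow> complex" where "of_vec2 v = Complex (v $ 1) (v $ 2)"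

lemma vec2_inverse [simp]: "of_vec2 (to_vec2 z) = z" "to_vec2 (of_vec2 v) = v"
  by (simp_all add: to_vec2_def of_vec2_def vec_eq_iff forall_2)

lemma bounded_linear_vec2: "bounded_linear to_vec2" "bounded_linear of_vec2"
proof -
  have "linear to_vec2" "linear of_vec2"
    by (rule linearI; simp add: to_vec2_def of_vec2_def vec_eq_iff forall_2 complex_eq_iff)+
  then show "bounded_linear to_vec2" "bounded_linear of_vec2"
    by (simp_all add: linear_conv_bounded_linear)
qed

lemma continuous_vec2: "continuous_on A to_vec2" "continuous_on B of_vec2"
  using bounded_linear_vec2 linear_continuous_on by auto

lemma measurable_vec2 [measurable]: "to_vec2 \<in> borel_measurable borel" "of_vec2 \<in> borel_measurable borel"
  using continuous_vec2 borel_measurable_continuous_onI by blast+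

lemma distr_to_vec2: "distr lborel borel to_vec2 = lborel"
proof (rule lborel_eqI[symmetric])
  fix l u :: "real^2" assume le: "\<And>b. b \<in> Basis \<Longrightarrow> l \<bullet> b \<le> u \<bullet> b"
  have B: "(Basis :: (real^2) set) = {axis 1 1, axis 2 1}"
    by (auto simp: Basis_vec_def UNIV_2)
  have ne: "(axis 1 1 :: real^2) \<noteq> axis 2 1" by (simp add: axis_eq_axis)
  have le': "l $ 1 \<le> u $ 1" "l $ 2 \<le> u $ 2"
    using le[of "axis 1 1"] le[of "axis 2 1"] by (simp_all add: B inner_axis)
  have "to_vec2 -` box l u = box (of_vec2 l) (of_vec2 u)"
    by (auto simp: mem_box B to_vec2_def of_vec2_def inner_axis Basis_complex_def)
  then have "emeasure (distr lborel borel to_vec2) (box l u) = emeasure lborel (box (of_vec2 l) (of_vec2 u))"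
    by (simp add: emeasure_distr)
  also have "\<dots> = ennreal (\<Prod>b\<in>Basis. (of_vec2 u - of_vec2 l) \<bullet> b)"
    by (rule emeasure_lborel_box) (use le' in \<open>auto simp: Basis_complex_def of_vec2_def\<close>)
  also have "(\<Prod>b\<in>Basis. (of_vec2 u - of_vec2 l) \<bullet> b) = (\<Prod>b\<in>Basis. (u - l) \<bullet> b)"
    using ne by (simp add: B Basis_complex_def of_vec2_def inner_axis complex_eq_iff)
  finally show "emeasure (distr lborel borel to_vec2) (box l u) = ennreal (\<Prod>b\<in>Basis. (u - l) \<bullet> b)" .
qed simp

lemma set_integral_vec2:
  fixes f :: "complex \<Rightarrow> real"
  assumes [measurable]: "f \<in> borel_measurable borel" "A \<in> sets borel"
  shows "set_integrable lborel (to_vec2 ` A) (f \<circ> of_vec2) \<longleftrightarrow> set_integrable lborel A f"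
    "(LINT v:to_vec2 ` A|lborel. (f \<circ> of_vec2) v) = (LINT z:A|lborel. f z)"
proof -
  have im: "to_vec2 ` A = of_vec2 -` A"
    by (auto simp: image_iff) (metis vec2_inverse(2))
  have [measurable]: "of_vec2 -` A \<in> sets borel"
    using measurable_sets[OF measurable_vec2(2) assms(2)] by simp
  have m: "(\<lambda>v. indicator (of_vec2 -` A) v *\<^sub>R f (of_vec2 v)) \<in> borel_measurable borel" by measurable
  have ind: "indicator (of_vec2 -` A) (to_vec2 z) = (indicator A z :: real)" for z
    by (simp add: indicator_def)
  have "integrable lborel (\<lambda>v. indicator (of_vec2 -` A) v *\<^sub>R f (of_vec2 v)) \<longleftrightarrow>
      integrable lborel (\<lambda>z. indicator A z *\<^sub>R f z)"
    using integrable_distr_eq[of to_vec2 lborel borel, OF _ m] by (simp add: distr_to_vec2 ind)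
  then show "set_integrable lborel (to_vec2 ` A) (f \<circ> of_vec2) \<longleftrightarrow> set_integrable lborel A f"
    unfolding set_integrable_def im by simp
  have "(\<integral>v. indicator (of_vec2 -` A) v *\<^sub>R f (of_vec2 v) \<partial>lborel) = (\<integral>z. indicator A z *\<^sub>R f z \<partial>lborel)"
    using integral_distr[of to_vec2 lborel borel, OF _ m] by (simp add: distr_to_vec2 ind)
  then show "(LINT v:to_vec2 ` A|lborel. (f \<circ> of_vec2) v) = (LINT z:A|lborel. f z)"
    unfolding set_lebesgue_integral_def im by simp
qed

lemma set_integrable_borel_iff:
  fixes f :: "'a::euclidean_space \<Rightarrow> real"
  assumes "(\<lambda>x. indicator A x *\<^sub>R f x) \<in> borel_measurable borel"
  shows "f absolutely_integrable_on A \<longleftrightarrow> set_integrable lborel A f"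
  unfolding set_integrable_def using assms by (simp add: integrable_completion)

lemma set_integrable_vec2_iff:
  fixes f :: "complex \<Rightarrow> real"
  assumes A: "open A" and f: "f \<in> borel_measurable borel"
  shows "(f \<circ> of_vec2) absolutely_integrable_on A \<longleftrightarrow> set_integrable lborel A (f \<circ> of_vec2)"
proof (rule set_integrable_borel_iff)
  have [measurable]: "A \<in> sets borel" "f \<circ> of_vec2 \<in> borel_measurable borel"
    using A measurable_comp[OF measurable_vec2(2) f] by auto
  show "(\<lambda>x. indicator A x *\<^sub>R (f \<circ> of_vec2) x) \<in> borel_measurable borel" by measurable
qed

text \<open>Holomorphic and antiholomorphic derivatives are both covered: half of the cells below
  are parametrised through \<open>antipodal\<close>, which reverses orientation.\<close>

definition conformal_factor :: "(complex \<Rightarrow> complex) \<Rightarrow> complex \<Rightarrow> bool" where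
  "conformal_factor D c \<longleftrightarrow> (\<forall>h. D h = c * h) \<or> (\<forall>h. D h = c * cnj h)"

text \<open>The Jacobian determinant of a conformal or anticonformal map is plus or minus the
  squared modulus of its factor.\<close>

theorem conformal_change_of_variables:
  fixes f :: "complex \<Rightarrow> real" and g :: "complex \<Rightarrow> complex"
  assumes S: "open S" and f: "f \<in> borel_measurable borel"
    and g: "\<And>z. z \<in> S \<Longrightarrow> (g has_derivative g' z) (at z)"
    and conf: "\<And>z. z \<in> S \<Longrightarrow> conformal_factor (g' z) (c z)"
    and c: "continuous_on S c" and inj: "inj_on g S"
  shows "set_integrable lborel S (\<lambda>z. (cmod (c z))\<^sup>2 * f (g z)) \<longleftrightarrow> set_integrable lborel (g ` S) f"
    and "set_integrable lborel (g ` S) f \<Longrightarrow>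
      (LINT z:S|lborel. (cmod (c z))\<^sup>2 * f (g z)) = (LINT z:g ` S|lborel. f z)"
proof -
  have cg: "continuous_on S g"
    using g by (meson continuous_at_imp_continuous_on has_derivative_continuous)
  have ogS: "open (g ` S)"
    by (rule invariance_of_domain[OF cg S inj])
  define T where "T = to_vec2 ` S"
  define gv where "gv = to_vec2 \<circ> g \<circ> of_vec2"
  have TS: "of_vec2 ` T = S" by (auto simp: T_def image_image)
  have gvT: "gv ` T = to_vec2 ` g ` S" by (auto simp: gv_def T_def image_image)
  have oT: "open T"
  proof -
    have "T = of_vec2 -` S" unfolding T_def by (auto simp: image_iff) (metis vec2_inverse(2))
    then show ?thesis using continuous_vec2(2) S by (metis open_vimage)
  qed
  have dv: "(gv has_derivative (to_vec2 \<circ> g' (of_vec2 v) \<circ> of_vec2)) (at v within T)" if "v \<in> T" for v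
  proof -
    have *: "(to_vec2 has_derivative to_vec2) (at z)" "(of_vec2 has_derivative of_vec2) (at w)" for z w
      using bounded_linear_vec2 by (auto intro: bounded_linear_imp_has_derivative)
    have "(g has_derivative g' (of_vec2 v)) (at (of_vec2 v))" using g that TS by blast
    then have "(gv has_derivative (to_vec2 \<circ> (g' (of_vec2 v) \<circ> of_vec2))) (at v)"
      unfolding gv_def comp_assoc by (intro diff_chain_at *)
    then show ?thesis by (simp add: comp_assoc has_derivative_at_withinI)
  qed
  have det: "\<bar>det (matrix (to_vec2 \<circ> g' (of_vec2 v) \<circ> of_vec2))\<bar> = (cmod (c (of_vec2 v)))\<^sup>2" if "v \<in> T" for v
  proof -
    have "conformal_factor (g' (of_vec2 v)) (c (of_vec2 v))" using conf that TS by blast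
    then have "det (matrix (to_vec2 \<circ> g' (of_vec2 v) \<circ> of_vec2)) = (cmod (c (of_vec2 v)))\<^sup>2 \<or>
      det (matrix (to_vec2 \<circ> g' (of_vec2 v) \<circ> of_vec2)) = - (cmod (c (of_vec2 v)))\<^sup>2"
      unfolding conformal_factor_def det_2 matrix_def cmod_power2
      by (auto simp: to_vec2_def of_vec2_def axis_def power2_eq_square algebra_simps)
    then show ?thesis by auto
  qed
  have injT: "inj_on gv T"
    using inj unfolding gv_def inj_on_def T_def by auto (metis vec2_inverse(1))
  \<comment> \<open>The formula invoked below concerns vector valued functions, hence the
    one-dimensional vector.\<close>
  define F where "F = (\<lambda>v. (vec (f (of_vec2 v)) :: real^1))"
  define h where "h z = (cmod (c z))\<^sup>2 * f (g z)" for z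
  have cov: "(\<lambda>x. \<bar>det (matrix (to_vec2 \<circ> g' (of_vec2 x) \<circ> of_vec2))\<bar> *\<^sub>R F (gv x)) absolutely_integrable_on T \<and>
      integral T (\<lambda>x. \<bar>det (matrix (to_vec2 \<circ> g' (of_vec2 x) \<circ> of_vec2))\<bar> *\<^sub>R F (gv x)) = b
     \<longleftrightarrow> F absolutely_integrable_on (gv ` T) \<and> integral (gv ` T) F = b" for b
    by (rule has_absolute_integral_change_of_variables[OF _ dv injT]) (use oT in auto)
  have e1: "(\<lambda>x. \<bar>det (matrix (to_vec2 \<circ> g' (of_vec2 x) \<circ> of_vec2))\<bar> *\<^sub>R F (gv x)) absolutely_integrable_on T \<longleftrightarrow>
      (\<lambda>x. vec ((h \<circ> of_vec2) x) :: real^1) absolutely_integrable_on T"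
    by (rule set_integrable_cong) (auto simp: det F_def gv_def h_def vec_eq_iff)
  have e2: "integral T (\<lambda>x. \<bar>det (matrix (to_vec2 \<circ> g' (of_vec2 x) \<circ> of_vec2))\<bar> *\<^sub>R F (gv x)) =
      integral T (\<lambda>x. vec ((h \<circ> of_vec2) x) :: real^1)"
    by (rule integral_cong) (auto simp: det F_def gv_def h_def vec_eq_iff)
  have cov': "(h \<circ> of_vec2) absolutely_integrable_on T \<and> integral T (h \<circ> of_vec2) = b
     \<longleftrightarrow> (f \<circ> of_vec2) absolutely_integrable_on (to_vec2 ` g ` S) \<and> integral (to_vec2 ` g ` S) (f \<circ> of_vec2) = b" for b
  proof -
    have F: "F = (\<lambda>v. vec ((f \<circ> of_vec2) v))" by (simp add: F_def)
    have v: "(vec x :: real^1) = vec y \<longleftrightarrow> x = y" for x y :: real by (simp add: vec_eq_iff)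
    show ?thesis
      using cov[of "vec b"] unfolding e1 e2 gvT unfolding F
      unfolding absolutely_integrable_on_1_iff integral_on_1_eq[of T] integral_on_1_eq[of "to_vec2 ` g ` S"]
      by (simp add: v o_def)
  qed
  \<comment> \<open>\<open>g\<close> and \<open>c\<close> are controlled on \<open>S\<close> only;
    cutting off outside makes the integrand Borel measurable on the whole plane, which the passage
    between the two kinds of integral requires.\<close>
  define h0 where "h0 z = indicator S z * h z" for z
  have mg: "(\<lambda>z. if z \<in> S then g z else 0) \<in> borel_measurable borel"
    by (rule borel_measurable_continuous_on_if) (use S cg in auto)
  have mc: "(\<lambda>z. if z \<in> S then c z else 0) \<in> borel_measurable borel"
    by (rule borel_measurable_continuous_on_if) (use S c in auto)
  have mh: "h0 \<in> borel_measurable borel"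
  proof -
    have "(\<lambda>z. (cmod (if z \<in> S then c z else 0))\<^sup>2 * f (if z \<in> S then g z else 0)) \<in> borel_measurable borel"
      using mg mc f by measurable
    moreover have "(\<lambda>z. (cmod (if z \<in> S then c z else 0))\<^sup>2 * f (if z \<in> S then g z else 0)) = h0"
      by (auto simp: h0_def h_def indicator_def fun_eq_iff)
    ultimately show ?thesis by simp
  qed
  have SB: "S \<in> sets borel" "g ` S \<in> sets borel" using S ogS by auto
  have hh: "(h \<circ> of_vec2) absolutely_integrable_on T \<longleftrightarrow> set_integrable lborel S h"
  proof -
    have "(h \<circ> of_vec2) absolutely_integrable_on T \<longleftrightarrow> (h0 \<circ> of_vec2) absolutely_integrable_on T"
      by (rule set_integrable_cong) (auto simp: h0_def T_def)
    also have "\<dots> \<longleftrightarrow> set_integrable lborel T (h0 \<circ> of_vec2)"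
      by (rule set_integrable_vec2_iff[OF oT mh])
    also have "\<dots> \<longleftrightarrow> set_integrable lborel S h0"
      unfolding T_def by (rule set_integral_vec2[OF mh SB(1)])
    also have "\<dots> \<longleftrightarrow> set_integrable lborel S h"
      by (rule set_integrable_cong) (auto simp: h0_def)
    finally show ?thesis .
  qed
  have ff: "(f \<circ> of_vec2) absolutely_integrable_on (to_vec2 ` g ` S) \<longleftrightarrow> set_integrable lborel (g ` S) f"
  proof -
    have "open (gv ` T)"
    proof -
      have "continuous_on T gv" by (rule has_derivative_continuous_on[OF dv])
      then show ?thesis using oT injT by (rule invariance_of_domain)
    qed
    then have "(f \<circ> of_vec2) absolutely_integrable_on (to_vec2 ` g ` S) \<longleftrightarrow> set_integrable lborel (to_vec2 ` g ` S) (f \<circ> of_vec2)"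
      unfolding gvT by (rule set_integrable_vec2_iff[OF _ f])
    then show ?thesis using set_integral_vec2(1)[OF f SB(2)] by simp
  qed
  show iff: "set_integrable lborel S (\<lambda>z. (cmod (c z))\<^sup>2 * f (g z)) \<longleftrightarrow> set_integrable lborel (g ` S) f"
    using cov' hh ff unfolding h_def[abs_def] by blast
  assume i: "set_integrable lborel (g ` S) f"
  then have ih: "set_integrable lborel S h" using iff by (simp add: h_def[abs_def])
  have ih0: "set_integrable lborel S h0" using ih by (subst set_integrable_cong[where f'=h]) (auto simp: h0_def)
  have "(LINT z:S|lborel. h z) = (LINT z:S|lborel. h0 z)"
    by (rule set_lebesgue_integral_cong) (use SB in \<open>auto simp: h0_def\<close>)
  also have "\<dots> = (LINT v:T|lborel. (h0 \<circ> of_vec2) v)"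
    unfolding T_def by (rule set_integral_vec2(2)[OF mh SB(1), symmetric])
  also have "\<dots> = integral T (h0 \<circ> of_vec2)"
    unfolding T_def by (rule set_borel_integral_eq_integral(2)) (simp only: set_integral_vec2(1)[OF mh SB(1)] ih0)
  also have "\<dots> = integral T (h \<circ> of_vec2)"
    by (rule integral_cong) (auto simp: h0_def T_def)
  also have "\<dots> = integral (to_vec2 ` g ` S) (f \<circ> of_vec2)"
    using cov' hh ih by blast
  also have "\<dots> = (LINT v:to_vec2 ` g ` S|lborel. (f \<circ> of_vec2) v)"
    by (rule set_borel_integral_eq_integral(2)[symmetric]) (simp only: set_integral_vec2(1)[OF f SB(2)] i)
  also have "\<dots> = (LINT z:g ` S|lborel. f z)"
    by (rule set_integral_vec2(2)[OF f SB(2)])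
  finally show "(LINT z:S|lborel. (cmod (c z))\<^sup>2 * f (g z)) = (LINT z:g ` S|lborel. f z)"
    by (simp add: h_def[abs_def])
qed

lemma distr_Complex: "distr lborel borel (\<lambda>(x, y). Complex x y) = lborel"
proof (rule lborel_eqI[symmetric])
  have c: "continuous_on UNIV (\<lambda>(x, y). Complex x y)"
    unfolding Complex_eq split_beta by (intro continuous_intros)
  then have [measurable]: "(\<lambda>(x, y). Complex x y) \<in> borel_measurable borel"
    by (rule borel_measurable_continuous_onI)
  fix l u :: complex assume le: "\<And>b. b \<in> Basis \<Longrightarrow> l \<bullet> b \<le> u \<bullet> b"
  have le': "Re l \<le> Re u" "Im l \<le> Im u"
    using le[of 1] le[of \<i>] by (simp_all add: Basis_complex_def)
  have B: "(Basis :: (real \<times> real) set) = {(1, 0), (0, 1)}" by (auto simp: Basis_prod_def)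
  have "(\<lambda>(x, y). Complex x y) -` box l u = box (Re l, Im l) (Re u, Im u)"
    by (auto simp: in_box_complex_iff mem_box B)
  then have "emeasure (distr lborel borel (\<lambda>(x, y). Complex x y)) (box l u) = emeasure lborel (box (Re l, Im l) (Re u, Im u))"
    by (simp add: emeasure_distr)
  also have "\<dots> = ennreal (\<Prod>b\<in>Basis. ((Re u, Im u) - (Re l, Im l)) \<bullet> b)"
    by (rule emeasure_lborel_box) (use le' in \<open>auto simp: B\<close>)
  also have "(\<Prod>b\<in>Basis. ((Re u, Im u) - (Re l, Im l)) \<bullet> b) = (\<Prod>b\<in>Basis. (u - l) \<bullet> b)"
    by (simp add: B Basis_complex_def complex_eq_iff)
  finally show "emeasure (distr lborel borel (\<lambda>(x, y). Complex x y)) (box l u) = ennreal (\<Prod>b\<in>Basis. (u - l) \<bullet> b)" .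
qed simp

lemma integral_rectangle:
  fixes f :: "complex \<Rightarrow> real"
  assumes f: "continuous_on (cbox (Complex a c) (Complex b d)) f"
  shows "set_integrable lborel (cbox (Complex a c) (Complex b d)) f"
    and "(LINT z:cbox (Complex a c) (Complex b d)|lborel. f z) =
      integral {a..b} (\<lambda>s. integral {c..d} (\<lambda>t. f (Complex s t)))"
proof -
  let ?P = "cbox (Complex a c) (Complex b d)"
  let ?C = "\<lambda>(x::real, y::real). Complex x y"
  show i: "set_integrable lborel ?P f"
    unfolding set_integrable_def by (rule borel_integrable_compact) (use f in auto)
  have c: "continuous_on UNIV ?C"
    unfolding Complex_eq split_beta by (intro continuous_intros)
  then have [measurable]: "?C \<in> borel_measurable borel"
    by (rule borel_measurable_continuous_onI)
  have m: "(\<lambda>z. indicator ?P z *\<^sub>R f z) \<in> borel_measurable borel"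
    using i by (auto simp: set_integrable_def)
  have ind: "indicator ?P (Complex x y) = (indicator (cbox (a, c) (b, d)) (x, y) :: real)" for x y
    by (auto simp: indicator_def in_cbox_complex_iff)
  have "(LINT z:?P|lborel. f z) = (\<integral>p. indicator ?P (?C p) *\<^sub>R f (?C p) \<partial>lborel)"
    unfolding set_lebesgue_integral_def
    using integral_distr[of ?C lborel borel, OF _ m] by (simp add: distr_Complex)
  also have "\<dots> = (LINT p:cbox (a, c) (b, d)|lborel. f (?C p))"
    unfolding set_lebesgue_integral_def by (rule Bochner_Integration.integral_cong) (auto simp: ind)
  finally have 1: "(LINT z:?P|lborel. f z) = (LINT p:cbox (a, c) (b, d)|lborel. f (?C p))" .
  have cc: "continuous_on (cbox (a, c) (b, d)) (\<lambda>p. f (?C p))"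
    by (rule continuous_on_compose2[OF f continuous_on_subset[OF c]]) (auto simp: in_cbox_complex_iff)
  have "set_integrable lborel (cbox (a, c) (b, d)) (\<lambda>p. f (?C p))"
    unfolding set_integrable_def by (rule borel_integrable_compact) (use cc in auto)
  then have "(LINT p:cbox (a, c) (b, d)|lborel. f (?C p)) = integral (cbox (a, c) (b, d)) (\<lambda>p. f (?C p))"
    by (rule set_borel_integral_eq_integral)
  also have "\<dots> = integral (cbox a b) (\<lambda>x. integral (cbox c d) (\<lambda>y. f (?C (x, y))))"
    by (rule integral_prod_continuous[OF cc])
  finally show "(LINT z:?P|lborel. f z) = integral {a..b} (\<lambda>s. integral {c..d} (\<lambda>t. f (Complex s t)))"
    using 1 by simp
qed

section \<open>A sharp Poincare inequality on a strip\<close>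

text \<open>The substitution \<open>u = h \<eta>\<close> by a positive solution \<open>h\<close> of \<open>h'' = - l w h\<close> with a node at \<open>0\<close>
  turns the difference of the two sides into a square plus a boundary term.\<close>

lemma nodal_half:
  fixes u u' h h' w :: "real \<Rightarrow> real"
  assumes q: "0 < q"
    and u: "\<And>x. x \<in> {0..q} \<Longrightarrow> (u has_real_derivative u' x) (at x within {0..q})"
    and cu': "continuous_on {0..q} u'" and u0: "u 0 = 0"
    and h: "\<And>x. (h has_real_derivative h' x) (at x)"
    and h': "\<And>x. (h' has_real_derivative - l * w x * h x) (at x)"
    and h0: "h 0 = 0" "h' 0 > 0" and hpos: "\<And>x. x \<in> {0<..q} \<Longrightarrow> h x > 0" and hq: "h' q \<ge> 0"
    and w: "continuous_on {0..q} w"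
  shows "integral {0..q} (\<lambda>x. l * w x * (u x)\<^sup>2) \<le> integral {0..q} (\<lambda>x. (u' x)\<^sup>2)"
proof -
  have cu: "continuous_on {0..q} u" using u by (rule DERIV_continuous_on)
  have ch: "continuous_on A h" "continuous_on A h'" for A
    by (rule DERIV_continuous_on[OF has_field_derivative_at_within[OF h]]
        DERIV_continuous_on[OF has_field_derivative_at_within[OF h']])+
  define K where "K x = (u' x)\<^sup>2 - l * w x * (u x)\<^sup>2" for x
  have cK: "continuous_on {0..q} K"
    unfolding K_def by (intro continuous_intros cu cu' w)
  \<comment> \<open>The boundary term of the substitution. It is singular at the node, so the
    estimate is first made on \<open>{e..q}\<close>.\<close>
  define V where "V x = h' x / h x * (u x)\<^sup>2" for x
  have step: "- V e \<le> integral {e..q} K" if e: "0 < e" "e < q" for e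
  proof -
    define V' where "V' x = (- l * w x * h x * h x - h' x * h' x) / (h x)\<^sup>2 * (u x)\<^sup>2 + h' x / h x * (2 * u x * u' x)" for x
    have "(V' has_integral V q - V e) {e..q}"
    proof (rule fundamental_theorem_of_calculus)
      show "e \<le> q" using e by simp
      fix x assume x: "x \<in> {e..q}"
      then have hx: "h x \<noteq> 0" using hpos[of x] e by auto
      have du: "(u has_real_derivative u' x) (at x within {e..q})"
        by (rule DERIV_subset[OF u]) (use x e in auto)
      have "(V has_real_derivative V' x) (at x within {e..q})"
        unfolding V_def[abs_def] V'_def
        by (rule derivative_eq_intros du has_field_derivative_at_within[OF h] has_field_derivative_at_within[OF h'] refl hx)+
          (simp add: power2_eq_square)
      then show "(V has_vector_derivative V' x) (at x within {e..q})"
        by (simp add: has_real_derivative_iff_has_vector_derivative)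
    qed
    moreover have "(K has_integral integral {e..q} K) {e..q}"
      using cK e by (intro integrable_integral integrable_continuous_interval continuous_on_subset[OF cK]) auto
    moreover have "V' x \<le> K x" if x: "x \<in> {e..q}" for x
    proof -
      have hx: "h x \<noteq> 0" using hpos[of x] e x by auto
      have "K x - V' x = (u' x - h' x / h x * u x)\<^sup>2"
        using hx by (simp add: K_def V'_def power2_eq_square field_simps)
      then show ?thesis using zero_le_power2[of "u' x - h' x / h x * u x"] by linarith
    qed
    ultimately have "V q - V e \<le> integral {e..q} K" by (rule has_integral_le)
    moreover have "V q \<ge> 0" using hpos[of q] hq q by (simp add: V_def)
    ultimately show ?thesis by simp
  qed
  have lim1: "((\<lambda>e. integral {e..q} K) \<longlongrightarrow> integral {0..q} K) (at_right 0)"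
  proof -
    have K: "K integrable_on {0..q}" by (rule integrable_continuous_interval[OF cK])
    have "continuous_on {0..q} (\<lambda>x. integral {0..x} K)" by (rule indefinite_integral_continuous_1[OF K])
    then have "((\<lambda>x. integral {0..x} K) \<longlongrightarrow> integral {0..0} K) (at 0 within {0..q})"
      unfolding continuous_on using q by (meson atLeastAtMost_iff less_imp_le order_refl)
    then have "((\<lambda>x. integral {0..x} K) \<longlongrightarrow> 0) (at_right 0)"
      using q by (simp add: at_within_Icc_at_right)
    then have "((\<lambda>x. integral {0..q} K - integral {0..x} K) \<longlongrightarrow> integral {0..q} K - 0) (at_right 0)"
      by (intro tendsto_intros)
    moreover have "eventually (\<lambda>x. integral {0..q} K - integral {0..x} K = integral {x..q} K) (at_right 0)"
    proof (rule eventually_at_rightI[of 0 q])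
      fix x assume "x \<in> {0<..<q}"
      then show "integral {0..q} K - integral {0..x} K = integral {x..q} K"
        using Henstock_Kurzweil_Integration.integral_combine[of 0 x q K] K by auto
    qed (rule q)
    ultimately show ?thesis unfolding diff_0_right by (rule Lim_transform_eventually)
  qed
  \<comment> \<open>Near the node \<open>u\<close> is at most of order e and \<open>h\<close> is
    exactly of order e, so the boundary term is of order e.\<close>
  have lim2: "((\<lambda>e. - V e) \<longlongrightarrow> - 0) (at_right 0)"
  proof (rule tendsto_minus)
    have "((\<lambda>e. (u e - u 0) / (e - 0)) \<longlongrightarrow> u' 0) (at 0 within {0..q})"
      using u[of 0] q by (simp add: has_field_derivative_iff)
    then have 1: "((\<lambda>e. u e / e) \<longlongrightarrow> u' 0) (at_right 0)"
      using q u0 by (simp add: at_within_Icc_at_right)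
    have "((\<lambda>e. (h e - h 0) / (e - 0)) \<longlongrightarrow> h' 0) (at 0 within {0<..})"
      using has_field_derivative_at_within[OF h[of 0], of "{0<..}"] by (simp add: has_field_derivative_iff)
    then have 2: "((\<lambda>e. h e / e) \<longlongrightarrow> h' 0) (at_right 0)" using h0 by simp
    have 3: "(h' \<longlongrightarrow> h' 0) (at_right 0)"
      using ch(2)[of UNIV] by (simp add: continuous_on_eq_continuous_within continuous_within filterlim_at_split)
    have "((\<lambda>e. h' e * (u e / e)\<^sup>2 * e / (h e / e)) \<longlongrightarrow> h' 0 * (u' 0)\<^sup>2 * 0 / h' 0) (at_right 0)"
      using h0(2) by (intro tendsto_intros 1 2 3) auto
    moreover have "eventually (\<lambda>e. h' e * (u e / e)\<^sup>2 * e / (h e / e) = V e) (at_right 0)"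
      by (rule eventually_at_rightI[of 0 1]) (auto simp: V_def power2_eq_square field_simps)
    ultimately have "(V \<longlongrightarrow> h' 0 * (u' 0)\<^sup>2 * 0 / h' 0) (at_right 0)"
      by (rule Lim_transform_eventually)
    then show "(V \<longlongrightarrow> 0) (at_right 0)" by simp
  qed
  have "- 0 \<le> integral {0..q} K"
    by (rule tendsto_le[OF _ lim1 lim2]) (use q step in \<open>auto intro!: eventually_at_rightI[of 0 q]\<close>)
  moreover have "integral {0..q} K = integral {0..q} (\<lambda>x. (u' x)\<^sup>2) - integral {0..q} (\<lambda>x. l * w x * (u x)\<^sup>2)"
    unfolding K_def
    by (rule Henstock_Kurzweil_Integration.integral_diff)
      (intro integrable_continuous_interval continuous_intros cu cu' w)+
  ultimately show ?thesis by simp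
qed

text \<open>The two halves of the interval are treated separately, with \<open>f - f 0\<close> as
  the function that vanishes at the node of \<open>h\<close>; as \<open>w\<close> is even, the same
  \<open>h\<close> serves on both sides.\<close>

lemma nodal_symmetric:
  fixes f f' h h' w :: "real \<Rightarrow> real"
  assumes q: "0 < q"
    and f: "\<And>x. x \<in> {-q..q} \<Longrightarrow> (f has_real_derivative f' x) (at x within {-q..q})"
    and cf': "continuous_on {-q..q} f'"
    and h: "\<And>x. (h has_real_derivative h' x) (at x)"
    and h': "\<And>x. (h' has_real_derivative - l * w x * h x) (at x)"
    and h0: "h 0 = 0" "h' 0 > 0" and hpos: "\<And>x. x \<in> {0<..q} \<Longrightarrow> h x > 0" and hq: "h' q \<ge> 0"
    and w: "continuous_on UNIV w" "\<And>x. w (- x) = w x"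
  shows "integral {-q..q} (\<lambda>x. l * w x * (f x - f 0)\<^sup>2) \<le> integral {-q..q} (\<lambda>x. (f' x)\<^sup>2)"
proof -
  have cf: "continuous_on {-q..q} f" using f by (rule DERIV_continuous_on)
  have split: "integral {-q..q} g = integral {0..q} (\<lambda>x. g (- x)) + integral {0..q} g"
    if "continuous_on {-q..q} g" for g :: "real \<Rightarrow> real"
  proof -
    have "integral {-q..q} g = integral {-q..0} g + integral {0..q} g"
      using q integrable_continuous_interval[OF that] by (simp add: Henstock_Kurzweil_Integration.integral_combine)
    also have "integral {-q..0} g = integral {0..q} (\<lambda>x. g (- x))"
      using Henstock_Kurzweil_Integration.integral_reflect_real[of q 0 "\<lambda>x. g (- x)"] by simp
    finally show ?thesis .
  qed
  have cw: "continuous_on A w" for A using w(1) continuous_on_subset by blast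
  have c1: "continuous_on {-q..q} (\<lambda>x. l * w x * (f x - f 0)\<^sup>2)" "continuous_on {-q..q} (\<lambda>x. (f' x)\<^sup>2)"
    by (intro continuous_intros cw cf cf')+
  have d1: "((\<lambda>x. f x - f 0) has_real_derivative f' x) (at x within {0..q})" if "x \<in> {0..q}" for x
  proof -
    have "(f has_real_derivative f' x) (at x within {0..q})"
      by (rule DERIV_subset[OF f]) (use that in auto)
    then show ?thesis
      using DERIV_diff[of f "f' x" x "{0..q}" "\<lambda>_. f 0" 0] by simp
  qed
  have d2: "((\<lambda>x. f (- x) - f 0) has_real_derivative - f' (- x)) (at x within {0..q})" if x: "x \<in> {0..q}" for x
  proof -
    have "(f has_real_derivative f' (- x)) (at (- x) within uminus ` {0..q})"
      by (rule DERIV_subset[OF f]) (use x in auto)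
    then have "((\<lambda>x. f (- x)) has_real_derivative f' (- x) * (- 1)) (at x within {0..q})"
      using DERIV_image_chain[of f "f' (-x)" uminus x "{0..q}" "-1"] DERIV_minus[OF DERIV_ident, of x "{0..q}"]
      by (simp add: o_def)
    then show ?thesis
      using DERIV_diff[of "\<lambda>x. f (- x)" "- f' (- x)" x "{0..q}" "\<lambda>_. f 0" 0] by simp
  qed
  have c2: "continuous_on {0..q} f'" "continuous_on {0..q} (\<lambda>x. - f' (- x))"
    by (auto intro!: continuous_intros continuous_on_compose2[OF cf'] intro: continuous_on_subset[OF cf'])
  have z: "f 0 - f 0 = 0" "f (- 0) - f 0 = 0" by simp_all
  note half = nodal_half[OF q _ _ _ h h' h0 hpos hq cw]
  have 1: "integral {0..q} (\<lambda>x. l * w x * (f x - f 0)\<^sup>2) \<le> integral {0..q} (\<lambda>x. (f' x)\<^sup>2)"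
    by (rule half[OF d1 c2(1) z(1)])
  have 2: "integral {0..q} (\<lambda>x. l * w x * (f (- x) - f 0)\<^sup>2) \<le> integral {0..q} (\<lambda>x. (- f' (- x))\<^sup>2)"
    by (rule half[OF d2 c2(2) z(2)])
  show ?thesis
    unfolding split[OF c1(1)] split[OF c1(2)] using 1 2 w(2) by simp
qed

text \<open>The comparison function is \<open>sin\<close> with l = 1, and
  \<open>q \<le> pi / 2\<close> makes its derivative nonnegative at \<open>q\<close>. So the
  constant 1 is available up to the full width pi of the strip.\<close>

lemma wirtinger:
  fixes f f' :: "real \<Rightarrow> real"
  assumes q: "0 < q" "q \<le> pi / 2"
    and f: "\<And>x. x \<in> {-q..q} \<Longrightarrow> (f has_real_derivative f' x) (at x within {-q..q})"
    and cf': "continuous_on {-q..q} f'"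
  shows "integral {-q..q} (\<lambda>x. (f x - f 0)\<^sup>2) \<le> integral {-q..q} (\<lambda>x. (f' x)\<^sup>2)"
  using nodal_symmetric[OF q(1) f cf', of sin cos 1 "\<lambda>_. 1"] q
  by (simp add: cos_ge_zero sin_gt_zero DERIV_sin DERIV_cos)

lemma tanh_deriv: "(tanh has_real_derivative 1 - (tanh x)\<^sup>2) (at (x::real) within A)"
  by (rule derivative_eq_intros refl | simp)+

lemma tanh_sq_less_1: "(tanh x)\<^sup>2 < (1::real)"
  using tanh_real_bounds[of x] by (simp add: abs_square_less_1 abs_less_iff)

text \<open>The comparison function \<open>tanh\<close> satisfies h'' = - 2 (1 - tanh^2) h: it is
  the height along a meridian of the sphere in Mercator coordinates, an eigenfunction of the
  Laplacian for the eigenvalue 2.\<close>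

lemma legendre:
  fixes f f' :: "real \<Rightarrow> real"
  assumes q: "0 < q"
    and f: "\<And>x. x \<in> {-q..q} \<Longrightarrow> (f has_real_derivative f' x) (at x within {-q..q})"
    and cf': "continuous_on {-q..q} f'"
  shows "integral {-q..q} (\<lambda>x. 2 * (1 - (tanh x)\<^sup>2) * (f x - f 0)\<^sup>2) \<le> integral {-q..q} (\<lambda>x. (f' x)\<^sup>2)"
proof (rule nodal_symmetric[OF q f cf', of tanh "\<lambda>x. 1 - (tanh x)\<^sup>2" 2 "\<lambda>x. 1 - (tanh x)\<^sup>2"])
  show "((\<lambda>x. 1 - (tanh x)\<^sup>2) has_real_derivative - 2 * (1 - (tanh x)\<^sup>2) * tanh x) (at x)" for x :: real
    by (auto intro!: derivative_eq_intros tanh_deriv simp: algebra_simps)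
  show "continuous_on UNIV (\<lambda>x::real. 1 - (tanh x)\<^sup>2)"
    by (auto intro!: continuous_intros)
qed (use tanh_deriv tanh_sq_less_1 q in \<open>auto simp: less_imp_le\<close>)

text \<open>The weighted mean minimises the right-hand side over all \<open>c\<close>; the
  difference of the two sides is a square divided by the total weight.\<close>

lemma weighted_variance:
  fixes f w :: "real \<Rightarrow> real"
  assumes f: "continuous_on {a..b} f" and w: "continuous_on {a..b} w"
    and M: "M = integral {a..b} w" "M > 0"
  shows "integral {a..b} (\<lambda>x. w x * (f x)\<^sup>2) - (integral {a..b} (\<lambda>x. w x * f x))\<^sup>2 / M
    \<le> integral {a..b} (\<lambda>x. w x * (f x - c)\<^sup>2)"
proof -
  define A where "A = integral {a..b} (\<lambda>x. w x * f x)"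
  define B where "B = integral {a..b} (\<lambda>x. w x * (f x)\<^sup>2)"
  have i: "(w has_integral M) {a..b}" "((\<lambda>x. w x * f x) has_integral A) {a..b}"
    "((\<lambda>x. w x * (f x)\<^sup>2) has_integral B) {a..b}"
    unfolding M A_def B_def
    by (intro integrable_integral integrable_continuous_interval continuous_intros f w)+
  have "((\<lambda>x. w x * (f x)\<^sup>2 - 2 * c * (w x * f x) + c\<^sup>2 * w x) has_integral B - 2 * c * A + c\<^sup>2 * M) {a..b}"
    by (intro has_integral_add has_integral_diff has_integral_mult_right i)
  also have "(\<lambda>x. w x * (f x)\<^sup>2 - 2 * c * (w x * f x) + c\<^sup>2 * w x) = (\<lambda>x. w x * (f x - c)\<^sup>2)"
    by (auto simp: power2_eq_square algebra_simps)
  finally have "integral {a..b} (\<lambda>x. w x * (f x - c)\<^sup>2) = B - 2 * c * A + c\<^sup>2 * M"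
    by (rule integral_unique)
  moreover have "B - 2 * c * A + c\<^sup>2 * M - (B - A\<^sup>2 / M) = (A - c * M)\<^sup>2 / M"
    using M by (simp add: power2_eq_square field_simps)
  moreover have "(A - c * M)\<^sup>2 / M \<ge> 0" using M by simp
  ultimately show ?thesis unfolding A_def[symmetric] B_def[symmetric] by linarith
qed

text \<open>The ground state of - d^2/dx^2 - 2 sech^2 is sech, with eigenvalue -1. Its logarithmic
  derivative is - tanh, which leads to the square of \<open>g' x + tanh x * g x\<close>; the end
  point terms appear because \<open>g\<close> is free at the ends.\<close>

lemma poschl_teller:
  fixes g g' :: "real \<Rightarrow> real"
  assumes R: "0 < R"
    and g: "\<And>x. x \<in> {-R..R} \<Longrightarrow> (g has_real_derivative g' x) (at x within {-R..R})"
    and cg': "continuous_on {-R..R} g'"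
  shows "integral {-R..R} (\<lambda>x. 2 * (1 - (tanh x)\<^sup>2) * (g x)\<^sup>2)
    \<le> integral {-R..R} (\<lambda>x. (g' x)\<^sup>2) + integral {-R..R} (\<lambda>x. (g x)\<^sup>2) + (g R)\<^sup>2 + (g (-R))\<^sup>2"
proof -
  have cg: "continuous_on {-R..R} g" using g by (rule DERIV_continuous_on)
  have ct: "continuous_on {-R..R} (\<lambda>x. 1 - (tanh x)\<^sup>2)" by (auto intro!: continuous_intros)
  define V where "V x = - (tanh x * (g x)\<^sup>2)" for x
  define V' where "V' x = - ((1 - (tanh x)\<^sup>2) * (g x)\<^sup>2 + tanh x * (2 * g x * g' x))" for x
  have "(V' has_integral V R - V (-R)) {-R..R}"
  proof (rule fundamental_theorem_of_calculus)
    fix x assume x: "x \<in> {-R..R}"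
    have "(V has_real_derivative V' x) (at x within {-R..R})"
      unfolding V_def[abs_def] V'_def
      by (rule derivative_eq_intros tanh_deriv g[OF x] refl)+ (simp add: algebra_simps)
    then show "(V has_vector_derivative V' x) (at x within {-R..R})"
      by (simp add: has_real_derivative_iff_has_vector_derivative)
  qed (use R in simp)
  moreover have "((\<lambda>x. (g' x)\<^sup>2 + (g x)\<^sup>2 - 2 * (1 - (tanh x)\<^sup>2) * (g x)\<^sup>2) has_integral
      integral {-R..R} (\<lambda>x. (g' x)\<^sup>2) + integral {-R..R} (\<lambda>x. (g x)\<^sup>2) - integral {-R..R} (\<lambda>x. 2 * (1 - (tanh x)\<^sup>2) * (g x)\<^sup>2)) {-R..R}"
    by (intro has_integral_add has_integral_diff integrable_integral integrable_continuous_interval continuous_intros cg cg' ct)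
  moreover have "V' x \<le> (g' x)\<^sup>2 + (g x)\<^sup>2 - 2 * (1 - (tanh x)\<^sup>2) * (g x)\<^sup>2" for x
  proof -
    have "(g' x)\<^sup>2 + (g x)\<^sup>2 - 2 * (1 - (tanh x)\<^sup>2) * (g x)\<^sup>2 - V' x = (g' x + tanh x * g x)\<^sup>2"
      by (simp add: V'_def power2_eq_square algebra_simps)
    then show ?thesis using zero_le_power2[of "g' x + tanh x * g x"] by linarith
  qed
  ultimately have "V R - V (-R) \<le> integral {-R..R} (\<lambda>x. (g' x)\<^sup>2) + integral {-R..R} (\<lambda>x. (g x)\<^sup>2) - integral {-R..R} (\<lambda>x. 2 * (1 - (tanh x)\<^sup>2) * (g x)\<^sup>2)"
    by (rule has_integral_le)
  moreover have "V R - V (-R) \<ge> - ((g R)\<^sup>2 + (g (-R))\<^sup>2)"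
  proof -
    have "tanh R * ((g R)\<^sup>2 + (g (-R))\<^sup>2) \<le> 1 * ((g R)\<^sup>2 + (g (-R))\<^sup>2)"
      using tanh_real_bounds[of R] by (intro mult_right_mono) auto
    then show ?thesis by (simp add: V_def algebra_simps)
  qed
  ultimately show ?thesis by linarith
qed


text \<open>On each vertical segment \<open>f\<close> is split into its mean and a remainder
  \<open>G\<close>. Along horizontal lines the inequality for the remainder fails by at most its own
  square integral, which the vertical derivative pays for by the Wirtinger inequality, since the
  segments are shorter than pi. The mean depends on one variable and obeys the Legendre inequality.
  The terms \<open>e R\<close> and \<open>e (-R)\<close> are what is left of the end points.\<close>

lemma rectangle_inequality:
  fixes f :: "complex \<Rightarrow> real" and g :: "complex \<Rightarrow> complex"
  assumes R: "0 < R" and q: "0 < q" "q < pi / 2"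
    and f: "\<And>\<zeta>. \<bar>Im \<zeta>\<bar> < pi / 2 \<Longrightarrow> (f has_derivative (\<lambda>v. g \<zeta> \<bullet> v)) (at \<zeta>)"
    and g: "continuous_on {\<zeta>. \<bar>Im \<zeta>\<bar> < pi / 2} g"
  defines "P \<equiv> cbox (Complex (-R) (-q)) (Complex R q)"
    and "e \<equiv> \<lambda>s. integral {-q..q} (\<lambda>t. (Im (g (Complex s t)))\<^sup>2)"
    and "w \<equiv> \<lambda>s. 1 - (tanh s)\<^sup>2"
  shows "2 * (LINT \<zeta>:P|lborel. w (Re \<zeta>) * (f \<zeta>)\<^sup>2) \<le> (LINT \<zeta>:P|lborel. (cmod (g \<zeta>))\<^sup>2)
    + (LINT \<zeta>:P|lborel. w (Re \<zeta>) * f \<zeta>)\<^sup>2 / (2 * q * tanh R) + e R + e (-R)"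
proof -
  define I where "I = {-R..R}"
  define J where "J = {-q..q}"
  let ?S = "{\<zeta>. \<bar>Im \<zeta>\<bar> < pi / 2}"
  have cf: "continuous_on ?S f"
    by (rule continuous_at_imp_continuous_on) (use f has_derivative_continuous in blast)
  have JS: "Complex s t \<in> ?S" if "t \<in> J" for s t
    using that q by (auto simp: J_def)
  have cC: "continuous_on A (\<lambda>x. Complex (u x) (v x))" if "continuous_on A u" "continuous_on A v"
    for A :: "'z::topological_space set" and u v
    unfolding Complex_eq using that by (intro continuous_intros)
  have pair: "continuous_on (I \<times> J) (\<lambda>(s, t). h (Complex s t))" if "continuous_on ?S h" for h :: "complex \<Rightarrow> 'z::topological_space"
    unfolding split_beta by (rule continuous_on_compose2[OF that cC]) (use JS in \<open>auto intro!: continuous_intros\<close>)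
  have ct: "continuous_on J (\<lambda>t. h (Complex s t))" if "continuous_on ?S h" for h :: "complex \<Rightarrow> 'z::topological_space" and s
    by (rule continuous_on_compose2[OF that cC]) (use JS in \<open>auto intro!: continuous_intros\<close>)
  have cs: "continuous_on I (\<lambda>s. h (Complex s t))" if "continuous_on ?S h" "t \<in> J" for h :: "complex \<Rightarrow> 'z::topological_space" and t
    by (rule continuous_on_compose2[OF that(1) cC]) (use JS that in \<open>auto intro!: continuous_intros\<close>)
  have cw: "continuous_on A w" for A by (auto simp: w_def intro!: continuous_intros)
  have PS: "P \<subseteq> ?S" using q by (auto simp: P_def in_cbox_complex_iff)
  have par: "continuous_on I (\<lambda>s. integral J (\<lambda>t. h (Complex s t)))" if "continuous_on ?S h" for h :: "complex \<Rightarrow> real"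
    using integral_continuous_on_param[of I "-q" q "\<lambda>s t. h (Complex s t)"] pair[OF that] by (simp add: J_def)
  have ds: "((\<lambda>s. f (Complex s t)) has_real_derivative Re (g (Complex s t))) (at s within A)" if "t \<in> J" for s t A
  proof -
    have "((\<lambda>s. Complex s t) has_derivative (\<lambda>h. of_real h)) (at s within A)"
      unfolding Complex_eq by (auto intro!: derivative_eq_intros)
    then have "((\<lambda>s. f (Complex s t)) has_derivative (\<lambda>h. g (Complex s t) \<bullet> of_real h)) (at s within A)"
      using has_derivative_compose[of "\<lambda>s. Complex s t" _ s A f "\<lambda>v. g (Complex s t) \<bullet> v"]
        f[of "Complex s t"] JS[OF that, of s] by auto
    then show ?thesis
      by (simp add: has_field_derivative_def inner_complex_def mult_commute_abs)
  qed
  have dt: "((\<lambda>t. f (Complex s t)) has_real_derivative Im (g (Complex s t))) (at t within A)" if "t \<in> J" for s t A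
  proof -
    have "((\<lambda>t. Complex s t) has_derivative (\<lambda>h. \<i> * of_real h)) (at t within A)"
      unfolding Complex_eq by (auto intro!: derivative_eq_intros)
    then have "((\<lambda>t. f (Complex s t)) has_derivative (\<lambda>h. g (Complex s t) \<bullet> (\<i> * of_real h))) (at t within A)"
      using has_derivative_compose[of "\<lambda>t. Complex s t" _ t A f "\<lambda>v. g (Complex s t) \<bullet> v"]
        f[of "Complex s t"] JS[OF that, of s] by auto
    then show ?thesis
      by (simp add: has_field_derivative_def inner_complex_def mult_commute_abs)
  qed
  \<comment> \<open>\<open>L\<close> is the length of a vertical segment, and \<open>M\<close> below
    is the integral of \<open>w\<close> over \<open>{-R..R}\<close>.\<close>
  define L where "L = 2 * q"
  have L: "L > 0" using q by (simp add: L_def)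
  define M where "M = 2 * tanh R"
  have M: "M > 0" using R by (simp add: M_def)
  define F where "F s = integral J (\<lambda>t. f (Complex s t))" for s
  define F' where "F' s = integral J (\<lambda>t. Re (g (Complex s t)))" for s
  define A where "A s = integral J (\<lambda>t. (f (Complex s t))\<^sup>2)" for s
  define B where "B s = integral J (\<lambda>t. (Re (g (Complex s t)))\<^sup>2)" for s
  have cRg: "continuous_on ?S (\<lambda>\<zeta>. Re (g \<zeta>))" and cIg: "continuous_on ?S (\<lambda>\<zeta>. Im (g \<zeta>))"
    using g by (auto intro: continuous_intros)
  have cf2: "continuous_on ?S (\<lambda>\<zeta>. (f \<zeta>)\<^sup>2)" and cR2: "continuous_on ?S (\<lambda>\<zeta>. (Re (g \<zeta>))\<^sup>2)"
    and cI2: "continuous_on ?S (\<lambda>\<zeta>. (Im (g \<zeta>))\<^sup>2)"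
    using cf g by (auto intro!: continuous_intros)
  have cF: "continuous_on I F" "continuous_on I F'" "continuous_on I A" "continuous_on I B" "continuous_on I e"
    unfolding F_def F'_def A_def B_def e_def J_def[symmetric] by (intro par cf cRg cf2 cR2 cI2)+
  have dF: "(F has_real_derivative F' s) (at s within I)" if "s \<in> I" for s
    unfolding F_def[abs_def] F'_def J_def box_real(2)[symmetric]
  proof (rule leibniz_rule_field_derivative)
    show "((\<lambda>x. f (Complex x t)) has_real_derivative Re (g (Complex x t))) (at x within I)" if "t \<in> cbox (-q) q" for x t
      using that ds by (auto simp: J_def)
    show "(\<lambda>t. f (Complex x t)) integrable_on cbox (-q) q" for x
      using ct[OF cf] by (auto simp: J_def intro: integrable_continuous_interval)
    show "continuous_on (I \<times> cbox (-q) q) (\<lambda>(x, t). Re (g (Complex x t)))"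
      using pair[OF cRg] by (simp add: J_def)
  qed (use that in \<open>auto simp: I_def\<close>)
  define G where "G s t = f (Complex s t) - F s / L" for s t
  define G' where "G' s t = Re (g (Complex s t)) - F' s / L" for s t
  have var: "integral J (\<lambda>t. (h t - integral J h / L)\<^sup>2) = integral J (\<lambda>t. (h t)\<^sup>2) - (integral J h)\<^sup>2 / L"
    if h: "continuous_on J h" for h
  proof -
    let ?H = "integral J h"
    have "((\<lambda>t. (h t)\<^sup>2 - 2 * (?H / L) * h t + (?H / L)\<^sup>2) has_integral
       integral J (\<lambda>t. (h t)\<^sup>2) - 2 * (?H / L) * ?H + L * (?H / L)\<^sup>2) J"
      using has_integral_const_real[of "(?H / L)\<^sup>2" "-q" q] h q unfolding J_def
      by (intro has_integral_add has_integral_diff has_integral_mult_right integrable_integral integrable_continuous_interval continuous_intros)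
        (auto simp: L_def)
    also have "(\<lambda>t. (h t)\<^sup>2 - 2 * (?H / L) * h t + (?H / L)\<^sup>2) = (\<lambda>t. (h t - ?H / L)\<^sup>2)"
      by (auto simp: power2_eq_square algebra_simps)
    finally have "integral J (\<lambda>t. (h t - ?H / L)\<^sup>2) = integral J (\<lambda>t. (h t)\<^sup>2) - 2 * (?H / L) * ?H + L * (?H / L)\<^sup>2"
      by (rule integral_unique)
    also have "\<dots> = integral J (\<lambda>t. (h t)\<^sup>2) - ?H\<^sup>2 / L"
      using L by (simp add: power2_eq_square field_simps)
    finally show ?thesis .
  qed
  have a: "integral J (\<lambda>t. (G s t)\<^sup>2) = A s - (F s)\<^sup>2 / L" for s
    using var[OF ct[OF cf, of s]] by (simp add: G_def A_def F_def)
  have b: "integral J (\<lambda>t. (G' s t)\<^sup>2) = B s - (F' s)\<^sup>2 / L" for s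
    using var[OF ct[OF cRg, of s]] by (simp add: G'_def B_def F'_def)
  \<comment> \<open>The Wirtinger inequality subtracts the value at 0; subtracting the mean instead
    only lowers the left-hand side.\<close>
  have c: "A s - (F s)\<^sup>2 / L \<le> e s" for s
  proof -
    have "A s - (F s)\<^sup>2 / L \<le> integral J (\<lambda>t. 1 * (f (Complex s t) - f (Complex s 0))\<^sup>2)"
      using weighted_variance[of "-q" q "\<lambda>t. f (Complex s t)" "\<lambda>_. 1" L "f (Complex s 0)"] ct[OF cf, of s] q L
      by (simp add: J_def A_def F_def L_def)
    also have "\<dots> \<le> e s"
      using wirtinger[of q "\<lambda>t. f (Complex s t)" "\<lambda>t. Im (g (Complex s t))"] q dt ct[OF cIg, of s]
      by (simp add: J_def e_def)
    finally show ?thesis .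
  qed
  have cG: "continuous_on (I \<times> J) (\<lambda>(s, t). G s t)" "continuous_on (I \<times> J) (\<lambda>(s, t). G' s t)"
    unfolding G_def G'_def
    using pair[OF cf] pair[OF cRg] L continuous_on_compose2[OF cF(1) continuous_on_fst[OF continuous_on_id], of "I \<times> J"]
       continuous_on_compose2[OF cF(2) continuous_on_fst[OF continuous_on_id], of "I \<times> J"]
    by (auto simp: split_beta intro!: continuous_intros)
  have swap: "integral J (\<lambda>t. integral I (\<lambda>s. h s t)) = integral I (\<lambda>s. integral J (h s))"
    if "continuous_on (I \<times> J) (\<lambda>(s, t). h s t)" for h :: "real \<Rightarrow> real \<Rightarrow> real"
    using integral_swap_continuous[of "-R" "-q" R q h] that by (simp add: I_def J_def cbox_Pair_eq)
  have pc: "continuous_on J (\<lambda>t. integral I (\<lambda>s. h s t))"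
    if "continuous_on (I \<times> J) (\<lambda>(s, t). h s t)" for h :: "real \<Rightarrow> real \<Rightarrow> real"
  proof -
    have "continuous_on (J \<times> I) (\<lambda>p. (\<lambda>(s, t). h s t) (snd p, fst p))"
      by (rule continuous_on_compose2[OF that]) (auto intro!: continuous_intros)
    then have "continuous_on (J \<times> I) (\<lambda>(t, s). h s t)" by (simp add: split_beta)
    then show ?thesis
      using integral_continuous_on_param[of J "-R" R "\<lambda>t s. h s t"] by (simp add: I_def)
  qed
  have cwI: "continuous_on (I \<times> J) (\<lambda>p. w (fst p))"
    by (rule continuous_on_compose2[OF cw[of UNIV]]) (auto intro!: continuous_intros)
  have c1: "continuous_on (I \<times> J) (\<lambda>(s, t). 2 * w s * (G s t)\<^sup>2)"
    and c2: "continuous_on (I \<times> J) (\<lambda>(s, t). (G s t)\<^sup>2)"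
    and c3: "continuous_on (I \<times> J) (\<lambda>(s, t). (G' s t)\<^sup>2)"
    using cG cwI by (auto simp: split_beta intro!: continuous_intros)
  have cGt: "continuous_on J (G s)" for s
    unfolding G_def using ct[OF cf, of s] L by (auto intro!: continuous_intros)
  have d: "integral I (\<lambda>s. 2 * w s * (G s t)\<^sup>2) \<le> integral I (\<lambda>s. (G' s t)\<^sup>2) + integral I (\<lambda>s. (G s t)\<^sup>2)
      + (G R t)\<^sup>2 + (G (-R) t)\<^sup>2" if t: "t \<in> J" for t
  proof -
    have "((\<lambda>s. G s t) has_real_derivative G' s t) (at s within I)" if "s \<in> I" for s
      unfolding G_def G'_def by (intro DERIV_diff DERIV_cdivide ds t dF that)
    moreover have "continuous_on I (\<lambda>s. G' s t)"
      unfolding G'_def using cs[OF cRg t] cF(2) L by (auto intro!: continuous_intros)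
    ultimately show ?thesis
      using poschl_teller[OF R, of "\<lambda>s. G s t" "\<lambda>s. G' s t"] by (simp add: I_def w_def)
  qed
  have "integral J (\<lambda>t. integral I (\<lambda>s. 2 * w s * (G s t)\<^sup>2)) \<le>
     integral J (\<lambda>t. integral I (\<lambda>s. (G' s t)\<^sup>2) + integral I (\<lambda>s. (G s t)\<^sup>2) + (G R t)\<^sup>2 + (G (-R) t)\<^sup>2)"
    using d unfolding J_def
    by (intro integral_le integrable_continuous_interval continuous_intros
       pc[OF c1, unfolded J_def] pc[OF c2, unfolded J_def] pc[OF c3, unfolded J_def] cGt[unfolded J_def]) auto
  also have "\<dots> = integral J (\<lambda>t. integral I (\<lambda>s. (G' s t)\<^sup>2)) + integral J (\<lambda>t. integral I (\<lambda>s. (G s t)\<^sup>2))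
      + integral J (\<lambda>t. (G R t)\<^sup>2) + integral J (\<lambda>t. (G (-R) t)\<^sup>2)"
    unfolding J_def
    by (intro integral_unique has_integral_add integrable_integral integrable_continuous_interval continuous_intros
       pc[OF c2, unfolded J_def] pc[OF c3, unfolded J_def] cGt[unfolded J_def])
  finally have d1: "integral I (\<lambda>s. integral J (\<lambda>t. 2 * w s * (G s t)\<^sup>2)) \<le> integral I (\<lambda>s. B s - (F' s)\<^sup>2 / L)
     + integral I (\<lambda>s. A s - (F s)\<^sup>2 / L) + (A R - (F R)\<^sup>2 / L) + (A (-R) - (F (-R))\<^sup>2 / L)"
    unfolding swap[OF c1] swap[OF c2] swap[OF c3] a b .
  have iI: "h integrable_on I" if "continuous_on I h" for h :: "real \<Rightarrow> real"
    using that integrable_continuous_interval unfolding I_def by blast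
  have "integral I (\<lambda>s. A s - (F s)\<^sup>2 / L) \<le> integral I e"
    by (intro integral_le iI continuous_intros cF c) (use L in auto)
  moreover have "integral I (\<lambda>s. B s - (F' s)\<^sup>2 / L) = integral I B - integral I (\<lambda>s. (F' s)\<^sup>2) / L"
    using L by (subst Henstock_Kurzweil_Integration.integral_diff) (auto intro!: iI continuous_intros cF)
  moreover have "integral I (\<lambda>s. integral J (\<lambda>t. 2 * w s * (G s t)\<^sup>2)) = 2 * integral I (\<lambda>s. w s * A s) - 2 / L * integral I (\<lambda>s. w s * (F s)\<^sup>2)"
  proof -
    have "integral J (\<lambda>t. 2 * w s * (G s t)\<^sup>2) = 2 * (w s * A s) - 2 / L * (w s * (F s)\<^sup>2)" for s
    proof -
      have "integral J (\<lambda>t. 2 * w s * (G s t)\<^sup>2) = 2 * w s * (A s - (F s)\<^sup>2 / L)"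
        unfolding a[symmetric] by (rule integral_mult_right)
      then show ?thesis by (simp add: right_diff_distrib)
    qed
    then show ?thesis
      using L by (simp, subst Henstock_Kurzweil_Integration.integral_diff) (auto intro!: iI continuous_intros cF cw)
  qed
  ultimately have d2: "2 * integral I (\<lambda>s. w s * A s) - 2 / L * integral I (\<lambda>s. w s * (F s)\<^sup>2) \<le>
      integral I B - integral I (\<lambda>s. (F' s)\<^sup>2) / L + integral I e + e R + e (-R)"
    using d1 c[of R] c[of "-R"] by linarith
  have iw: "integral I w = M"
  proof -
    have "(w has_integral tanh R - tanh (-R)) I"
      unfolding I_def w_def
      by (rule fundamental_theorem_of_calculus)
        (use R tanh_deriv in \<open>auto simp: has_real_derivative_iff_has_vector_derivative[symmetric]\<close>)
    then show ?thesis by (simp add: M_def integral_unique)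
  qed
  have e1: "2 * (integral I (\<lambda>s. w s * (F s)\<^sup>2) - (integral I (\<lambda>s. w s * F s))\<^sup>2 / M) \<le> integral I (\<lambda>s. (F' s)\<^sup>2)"
  proof -
    have "2 * (integral I (\<lambda>s. w s * (F s)\<^sup>2) - (integral I (\<lambda>s. w s * F s))\<^sup>2 / M) \<le> 2 * integral I (\<lambda>s. w s * (F s - F 0)\<^sup>2)"
      using weighted_variance[of "-R" R F w M "F 0"] cF(1) cw iw M by (simp add: I_def)
    also have "\<dots> = integral I (\<lambda>x. 2 * (1 - (tanh x)\<^sup>2) * (F x - F 0)\<^sup>2)"
      unfolding w_def mult.assoc by (rule integral_mult_right[symmetric])
    also have "\<dots> \<le> integral I (\<lambda>s. (F' s)\<^sup>2)"
      using legendre[OF R, of F F'] dF cF(2) by (simp add: I_def)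
    finally show ?thesis .
  qed
  have e2: "2 / L * integral I (\<lambda>s. w s * (F s)\<^sup>2) - 2 * (integral I (\<lambda>s. w s * F s))\<^sup>2 / (L * M) \<le> integral I (\<lambda>s. (F' s)\<^sup>2) / L"
    using divide_right_mono[OF e1, of L] L by (simp add: diff_divide_distrib right_diff_distrib mult.commute)
  have final: "2 * integral I (\<lambda>s. w s * A s) \<le> integral I B + integral I e + 2 * (integral I (\<lambda>s. w s * F s))\<^sup>2 / (L * M) + e R + e (-R)"
    using d2 e2 by linarith
  have cwS: "continuous_on ?S (\<lambda>\<zeta>. w (Re \<zeta>))"
    unfolding w_def by (intro continuous_intros) auto
  have rect: "(LINT \<zeta>:P|lborel. h \<zeta>) = integral I (\<lambda>s. integral J (\<lambda>t. h (Complex s t)))" if "continuous_on ?S h" for h :: "complex \<Rightarrow> real"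
    using integral_rectangle(2)[of "-R" "-q" R q h] continuous_on_subset[OF that PS] by (simp add: P_def I_def J_def)
  have "(LINT \<zeta>:P|lborel. w (Re \<zeta>) * (f \<zeta>)\<^sup>2) = integral I (\<lambda>s. w s * A s)"
    using rect[of "\<lambda>\<zeta>. w (Re \<zeta>) * (f \<zeta>)\<^sup>2"] continuous_on_mult[OF cwS cf2] by (simp add: A_def)
  moreover have "(LINT \<zeta>:P|lborel. w (Re \<zeta>) * f \<zeta>) = integral I (\<lambda>s. w s * F s)"
    using rect[of "\<lambda>\<zeta>. w (Re \<zeta>) * f \<zeta>"] continuous_on_mult[OF cwS cf] by (simp add: F_def)
  moreover have "(LINT \<zeta>:P|lborel. (cmod (g \<zeta>))\<^sup>2) = integral I B + integral I e"
  proof -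
    have "integral J (\<lambda>t. (cmod (g (Complex s t)))\<^sup>2) = B s + e s" for s
      unfolding cmod_power2 B_def e_def J_def[symmetric]
      by (rule Henstock_Kurzweil_Integration.integral_add)
        (use ct[OF cR2, of s] ct[OF cI2, of s] in \<open>auto simp: J_def intro: integrable_continuous_interval\<close>)
    moreover have "continuous_on ?S (\<lambda>\<zeta>. (cmod (g \<zeta>))\<^sup>2)"
      by (intro continuous_intros g)
    ultimately have "(LINT \<zeta>:P|lborel. (cmod (g \<zeta>))\<^sup>2) = integral I (\<lambda>s. B s + e s)"
      by (simp only: rect)
    also have "\<dots> = integral I B + integral I e"
      by (intro Henstock_Kurzweil_Integration.integral_add iI cF)
    finally show ?thesis .
  qed
  moreover have "2 * x / (L * M) = x / (2 * q * tanh R)" for x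
    by (simp add: L_def M_def)
  ultimately show ?thesis using final by simp
qed


section \<open>Exhaustion of the infinite strip by rectangles\<close>

definition strip :: "complex set" where "strip = {\<zeta>. \<bar>Im \<zeta>\<bar> < pi / 2}"

definition sech2 :: "complex \<Rightarrow> real" where "sech2 \<zeta> = 1 - (tanh (Re \<zeta>))\<^sup>2"

lemma open_strip: "open strip"
proof -
  have "strip = (\<lambda>\<zeta>. \<bar>Im \<zeta>\<bar>) -` {..<pi/2}" by (auto simp: strip_def)
  moreover have "open ((\<lambda>\<zeta>. \<bar>Im \<zeta>\<bar>) -` {..<pi/2})"
    by (intro open_vimage continuous_intros)
  ultimately show ?thesis by simp
qed

lemma continuous_sech2: "continuous_on A sech2"
  unfolding sech2_def by (intro continuous_intros) auto

lemma sech2_bounds: "0 < sech2 \<zeta>" "sech2 \<zeta> \<le> 1"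
  using tanh_sq_less_1 by (auto simp: sech2_def)

text \<open>For the lengths \<open>R\<close> only a lower bound is asked for: they will be chosen so
  that the end point terms are small.\<close>

lemma rectangles_tendsto:
  fixes h :: "complex \<Rightarrow> real"
  assumes h: "set_integrable lborel strip h"
    and R: "\<And>n. R n \<ge> real n" and q: "\<And>n. q n < pi / 2" "q \<longlonglongrightarrow> pi / 2"
  shows "(\<lambda>n. LINT \<zeta>:cbox (Complex (- R n) (- q n)) (Complex (R n) (q n))|lborel. h \<zeta>)
    \<longlonglongrightarrow> (LINT \<zeta>:strip|lborel. h \<zeta>)"
proof -
  define P where "P n = cbox (Complex (- R n) (- q n)) (Complex (R n) (q n))" for n
  have PS: "P n \<subseteq> strip" for n using q(1)[of n] by (auto simp: P_def strip_def in_cbox_complex_iff)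
  have ev: "eventually (\<lambda>n. \<zeta> \<in> P n) sequentially" if "\<zeta> \<in> strip" for \<zeta>
  proof -
    have "eventually (\<lambda>n. \<bar>Im \<zeta>\<bar> < q n) sequentially"
      using order_tendstoD(1)[OF q(2)] that by (simp add: strip_def)
    moreover have "eventually (\<lambda>n. real n \<ge> \<bar>Re \<zeta>\<bar>) sequentially"
      by real_asymp
    ultimately show ?thesis
      by eventually_elim (use R in \<open>auto simp: P_def in_cbox_complex_iff abs_le_iff intro: order_trans; smt (verit)\<close>)
  qed
  have "(\<lambda>n. \<integral>\<zeta>. indicator (P n) \<zeta> *\<^sub>R h \<zeta> \<partial>lborel) \<longlonglongrightarrow> (\<integral>\<zeta>. indicator strip \<zeta> *\<^sub>R h \<zeta> \<partial>lborel)"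
  proof (rule integral_dominated_convergence[where w="\<lambda>\<zeta>. norm (indicator strip \<zeta> *\<^sub>R h \<zeta>)"])
    show "integrable lborel (\<lambda>\<zeta>. norm (indicator strip \<zeta> *\<^sub>R h \<zeta>))" "(\<lambda>\<zeta>. indicator strip \<zeta> *\<^sub>R h \<zeta>) \<in> borel_measurable lborel"
      using h by (auto simp: set_integrable_def)
    show "(\<lambda>\<zeta>. indicator (P n) \<zeta> *\<^sub>R h \<zeta>) \<in> borel_measurable lborel" for n
    proof -
      have "set_integrable lborel (P n) h"
        by (rule set_integrable_subset[OF h _ PS]) (simp add: P_def)
      then show ?thesis by (auto simp: set_integrable_def)
    qed
    show "AE \<zeta> in lborel. norm (indicator (P n) \<zeta> *\<^sub>R h \<zeta>) \<le> norm (indicator strip \<zeta> *\<^sub>R h \<zeta>)" for n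
      using PS[of n] by (auto simp: indicator_def)
    show "AE \<zeta> in lborel. (\<lambda>n. indicator (P n) \<zeta> *\<^sub>R h \<zeta>) \<longlonglongrightarrow> indicator strip \<zeta> *\<^sub>R h \<zeta>"
    proof (rule AE_I2)
      fix \<zeta>
      have "eventually (\<lambda>n. indicator (P n) \<zeta> *\<^sub>R h \<zeta> = indicator strip \<zeta> *\<^sub>R h \<zeta>) sequentially"
      proof (cases "\<zeta> \<in> strip")
        case True
        from ev[OF True] show ?thesis by eventually_elim (use True in simp)
      next
        case False
        then have "\<zeta> \<notin> P n" for n using PS by blast
        then show ?thesis using False by simp
      qed
      then show "(\<lambda>n. indicator (P n) \<zeta> *\<^sub>R h \<zeta>) \<longlonglongrightarrow> indicator strip \<zeta> *\<^sub>R h \<zeta>"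
        by (rule tendsto_eventually)
    qed
  qed
  then show ?thesis by (simp add: set_lebesgue_integral_def P_def)
qed

lemma integrable_sech2: "set_integrable lborel strip sech2"
proof -
  define q where "q n = pi / 2 - 1 / (real n + 1)" for n
  define P where "P n = cbox (Complex (- real n) (- q n)) (Complex (real n) (q n))" for n
  have q0: "0 < q n" "q n < pi / 2" for n
  proof -
    have "1 / (real n + 1) \<le> 1" by simp
    then show "0 < q n" using pi_gt3 unfolding q_def by linarith
    show "q n < pi / 2" by (simp add: q_def)
  qed
  have qm: "q n \<le> q k" if "n \<le> k" for n k
    using that by (simp add: q_def frac_le)
  have PS: "P n \<subseteq> strip" for n using q0(2)[of n] by (auto simp: P_def strip_def in_cbox_complex_iff)
  have PP: "P n \<subseteq> P k" if "n \<le> k" for n k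
    using qm[OF that] that by (auto simp: P_def in_cbox_complex_iff)
  have val: "(LINT \<zeta>:P n|lborel. sech2 \<zeta>) = 2 * q n * (2 * tanh (real n))" for n
  proof -
    have "((\<lambda>s. 1 - (tanh s)\<^sup>2) has_integral tanh (real n) - tanh (- real n)) {- real n..real n}"
      by (rule fundamental_theorem_of_calculus)
        (use tanh_deriv in \<open>auto simp: has_real_derivative_iff_has_vector_derivative[symmetric]\<close>)
    then have 1: "((\<lambda>s. 2 * q n * (1 - (tanh s)\<^sup>2)) has_integral 2 * q n * (tanh (real n) - tanh (- real n))) {- real n..real n}"
      by (rule has_integral_mult_right)
    have "(LINT \<zeta>:P n|lborel. sech2 \<zeta>) = integral {- real n..real n} (\<lambda>s. integral {- q n..q n} (\<lambda>t. 1 - (tanh s)\<^sup>2))"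
      unfolding P_def by (subst integral_rectangle[OF continuous_sech2]) (simp add: sech2_def)
    also have "\<dots> = integral {- real n..real n} (\<lambda>s. 2 * q n * (1 - (tanh s)\<^sup>2))"
      using q0[of n] by simp
    also have "\<dots> = 2 * q n * (tanh (real n) - tanh (- real n))" using 1 by (rule integral_unique)
    finally show ?thesis by simp
  qed
  have lim_q: "q \<longlonglongrightarrow> pi / 2" unfolding q_def by real_asymp
  have lim_t: "(\<lambda>n. tanh (real n)) \<longlonglongrightarrow> 1"
    by (rule filterlim_compose[OF tanh_real_at_top filterlim_real_sequentially])
  have "integrable lborel (\<lambda>\<zeta>. indicator strip \<zeta> *\<^sub>R sech2 \<zeta>)"
  proof (rule integrable_monotone_convergence[where f="\<lambda>n \<zeta>. indicator (P n) \<zeta> *\<^sub>R sech2 \<zeta>"])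
    show "integrable lborel (\<lambda>\<zeta>. indicator (P n) \<zeta> *\<^sub>R sech2 \<zeta>)" for n
      using integral_rectangle(1)[OF continuous_sech2] unfolding P_def set_integrable_def by blast
    show "AE \<zeta> in lborel. mono (\<lambda>n. indicator (P n) \<zeta> *\<^sub>R sech2 \<zeta>)"
      using PP sech2_bounds(1) by (auto simp: mono_def indicator_def less_imp_le)
    \<comment> \<open>The limit is 2 pi, the area of a hemisphere.\<close>
    show "(\<lambda>n. \<integral>\<zeta>. indicator (P n) \<zeta> *\<^sub>R sech2 \<zeta> \<partial>lborel) \<longlonglongrightarrow> 2 * (pi / 2) * (2 * 1)"
      using val unfolding set_lebesgue_integral_def
      by (simp only: real_scaleR_def) (intro tendsto_intros lim_q lim_t)
    show "(\<lambda>\<zeta>. indicator strip \<zeta> *\<^sub>R sech2 \<zeta>) \<in> borel_measurable lborel"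
    proof -
      have [measurable]: "strip \<in> sets borel" "sech2 \<in> borel_measurable borel"
        using open_strip borel_measurable_continuous_onI[OF continuous_sech2] by auto
      show ?thesis by measurable
    qed
    show "AE \<zeta> in lborel. (\<lambda>n. indicator (P n) \<zeta> *\<^sub>R sech2 \<zeta>) \<longlonglongrightarrow> indicator strip \<zeta> *\<^sub>R sech2 \<zeta>"
    proof (rule AE_I2)
      fix \<zeta>
      have "eventually (\<lambda>n. indicator (P n) \<zeta> *\<^sub>R sech2 \<zeta> = indicator strip \<zeta> *\<^sub>R sech2 \<zeta>) sequentially"
      proof (cases "\<zeta> \<in> strip")
        case True
        have "eventually (\<lambda>n. \<bar>Im \<zeta>\<bar> < q n) sequentially"
          using order_tendstoD(1)[OF lim_q] True by (simp add: strip_def)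
        moreover have "eventually (\<lambda>n. real n \<ge> \<bar>Re \<zeta>\<bar>) sequentially"
          by real_asymp
        ultimately show ?thesis
          by eventually_elim (use True in \<open>auto simp: P_def in_cbox_complex_iff indicator_def abs_le_iff\<close>)
      next
        case False
        then have "\<zeta> \<notin> P n" for n using PS by blast
        then show ?thesis using False by simp
      qed
      then show "(\<lambda>n. indicator (P n) \<zeta> *\<^sub>R sech2 \<zeta>) \<longlonglongrightarrow> indicator strip \<zeta> *\<^sub>R sech2 \<zeta>"
        by (rule tendsto_eventually)
    qed
  qed
  then show ?thesis by (simp add: set_integrable_def)
qed

text \<open>Since |x| is at most 1 + x^2, the weight and the weighted square together dominate the
  product.\<close>

lemma set_integrable_mult_of_square:
  fixes w f :: "complex \<Rightarrow> real"
  assumes S: "S \<in> sets borel" and w: "set_integrable lborel S w" "\<And>z. z \<in> S \<Longrightarrow> w z \<ge> 0"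
    and f: "set_integrable lborel S (\<lambda>z. w z * (f z)\<^sup>2)"
    and m: "(\<lambda>z. indicator S z * f z) \<in> borel_measurable borel"
  shows "set_integrable lborel S (\<lambda>z. w z * f z)"
  unfolding set_integrable_def
proof (rule Bochner_Integration.integrable_bound)
  have lb: "borel_measurable (lborel :: complex measure) = (borel_measurable borel :: (complex \<Rightarrow> real) set)"
    by (rule measurable_cong_sets) simp_all
  show "integrable lborel (\<lambda>z. indicator S z *\<^sub>R w z + indicator S z *\<^sub>R (w z * (f z)\<^sup>2))"
    using w(1) f unfolding set_integrable_def by (rule Bochner_Integration.integrable_add)
  have "(\<lambda>z. indicator S z *\<^sub>R w z) \<in> borel_measurable borel"
    using w(1) by (auto simp: set_integrable_def)
  then have "(\<lambda>z. (indicator S z *\<^sub>R w z) * (indicator S z * f z)) \<in> borel_measurable borel"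
    using m by (rule borel_measurable_times)
  moreover have "(\<lambda>z. (indicator S z *\<^sub>R w z) * (indicator S z * f z)) = (\<lambda>z. indicator S z *\<^sub>R (w z * f z))"
    by (auto simp: indicator_def)
  ultimately show "(\<lambda>z. indicator S z *\<^sub>R (w z * f z)) \<in> borel_measurable lborel"
    by (simp only: lb)
  have "\<bar>x\<bar> \<le> 1 + x\<^sup>2" for x :: real
  proof -
    have "0 \<le> (\<bar>x\<bar> - 1)\<^sup>2" by simp
    then have "2 * \<bar>x\<bar> \<le> 1 + x\<^sup>2" by (simp add: power2_eq_square algebra_simps)
    then show ?thesis using abs_ge_zero[of x] by linarith
  qed
  then have "\<bar>w z * f z\<bar> \<le> w z + w z * (f z)\<^sup>2" if "z \<in> S" for z
    using mult_left_mono[of "\<bar>f z\<bar>" "1 + (f z)\<^sup>2" "w z"] w(2)[OF that] by (simp add: abs_mult algebra_simps)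
  then show "AE z in lborel. norm (indicator S z *\<^sub>R (w z * f z)) \<le> norm (indicator S z *\<^sub>R w z + indicator S z *\<^sub>R (w z * (f z)\<^sup>2))"
    by (intro AE_I2) (force simp: indicator_def)
qed

text \<open>The limit of the rectangle inequality. No condition is imposed on \<open>f\<close> at
  the edges of the strip, so the estimate is of Neumann type and applies to functions that do not
  vanish on the boundary of a cell.\<close>

theorem strip_inequality:
  fixes f :: "complex \<Rightarrow> real" and g :: "complex \<Rightarrow> complex"
  assumes f: "\<And>\<zeta>. \<zeta> \<in> strip \<Longrightarrow> (f has_derivative (\<lambda>v. g \<zeta> \<bullet> v)) (at \<zeta>)"
    and g: "continuous_on strip g"
    and i1: "set_integrable lborel strip (\<lambda>\<zeta>. (cmod (g \<zeta>))\<^sup>2)"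
    and i2: "set_integrable lborel strip (\<lambda>\<zeta>. sech2 \<zeta> * (f \<zeta>)\<^sup>2)"
  shows "set_integrable lborel strip (\<lambda>\<zeta>. sech2 \<zeta> * f \<zeta>)"
    and "2 * (LINT \<zeta>:strip|lborel. sech2 \<zeta> * (f \<zeta>)\<^sup>2) \<le> (LINT \<zeta>:strip|lborel. (cmod (g \<zeta>))\<^sup>2)
      + (LINT \<zeta>:strip|lborel. sech2 \<zeta> * f \<zeta>)\<^sup>2 / pi"
proof -
  have cf: "continuous_on strip f"
    by (rule continuous_at_imp_continuous_on) (use f has_derivative_continuous in blast)
  have mf: "(\<lambda>z. indicator strip z * f z) \<in> borel_measurable borel"
    using borel_measurable_continuous_on_indicator[OF _ cf] open_strip by simp
  show i3: "set_integrable lborel strip (\<lambda>\<zeta>. sech2 \<zeta> * f \<zeta>)"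
    by (rule set_integrable_mult_of_square[OF _ integrable_sech2 _ i2 mf]) (use open_strip sech2_bounds less_imp_le in auto)
  define q where "q n = pi / 2 - 1 / (real n + 1)" for n
  have q0: "0 < q n" "q n < pi / 2" for n
  proof -
    have "1 / (real n + 1) \<le> 1" by simp
    then show "0 < q n" using pi_gt3 unfolding q_def by linarith
    show "q n < pi / 2" by (simp add: q_def)
  qed
  have lim_q: "q \<longlonglongrightarrow> pi / 2" unfolding q_def by real_asymp
  define e where "e n s = integral {- q n..q n} (\<lambda>t. (Im (g (Complex s t)))\<^sup>2)" for n s
  define E where "E = (LINT \<zeta>:strip|lborel. (cmod (g \<zeta>))\<^sup>2)"
  have ce: "continuous_on A (e n)" for A n
  proof -
    have "continuous_on (UNIV \<times> cbox (- q n) (q n)) (\<lambda>(s, t). (Im (g (Complex s t)))\<^sup>2)"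
      unfolding split_beta Complex_eq
      by (intro continuous_intros continuous_on_compose2[OF g])
        (use q0[of n] in \<open>auto simp: strip_def abs_less_iff intro!: continuous_intros\<close>)
    from integral_continuous_on_param[OF this] show ?thesis
      unfolding e_def by (auto intro: continuous_on_subset)
  qed
  have e0: "e n s \<ge> 0" for n s
    unfolding e_def by (rule Henstock_Kurzweil_Integration.integral_nonneg)
      (use q0[of n] in \<open>auto intro!: integrable_continuous_interval continuous_intros continuous_on_compose2[OF g]
        simp: Complex_eq strip_def abs_less_iff\<close>)
  have ie: "integral {-T..T} (e n) \<le> E" for T n
  proof -
    define P where "P = cbox (Complex (- T) (- q n)) (Complex T (q n))"
    have PS: "P \<subseteq> strip" using q0(2)[of n] by (auto simp: P_def strip_def in_cbox_complex_iff)
    have cI: "continuous_on P (\<lambda>\<zeta>. (Im (g \<zeta>))\<^sup>2)"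
      by (intro continuous_intros continuous_on_subset[OF g PS])
    have "integral {-T..T} (e n) = (LINT \<zeta>:P|lborel. (Im (g \<zeta>))\<^sup>2)"
      unfolding e_def P_def using integral_rectangle(2)[OF cI[unfolded P_def]] by simp
    also have "\<dots> \<le> (LINT \<zeta>:strip|lborel. (cmod (g \<zeta>))\<^sup>2)"
      unfolding set_lebesgue_integral_def
    proof (rule integral_mono)
      show "integrable lborel (\<lambda>\<zeta>. indicator P \<zeta> *\<^sub>R (Im (g \<zeta>))\<^sup>2)"
        using integral_rectangle(1)[OF cI[unfolded P_def]] by (simp add: set_integrable_def P_def)
      show "integrable lborel (\<lambda>\<zeta>. indicator strip \<zeta> *\<^sub>R (cmod (g \<zeta>))\<^sup>2)"
        using i1 by (simp add: set_integrable_def)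
      show "indicator P \<zeta> *\<^sub>R (Im (g \<zeta>))\<^sup>2 \<le> indicator strip \<zeta> *\<^sub>R (cmod (g \<zeta>))\<^sup>2" for \<zeta>
        using PS by (auto simp: indicator_def cmod_power2)
    qed
    finally show ?thesis by (simp add: E_def)
  qed
  \<comment> \<open>\<open>e n\<close> is nonnegative with integral at most \<open>E\<close>, so
    \<open>e n s + e n (- s)\<close> cannot stay above a positive constant for all large
    \<open>s\<close>; this selects rectangles with negligible end point terms.\<close>
  have "\<exists>R. R \<ge> real n + 1 \<and> e n R + e n (- R) \<le> 1 / (real n + 1)" for n
  proof (rule ccontr)
    assume neg: "\<not> ?thesis"
    define \<eta> where "\<eta> = 1 / (real n + 1)"
    have \<eta>: "\<eta> > 0" by (simp add: \<eta>_def)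
    define a where "a = real n + 1"
    \<comment> \<open>On an interval of this length the lower bound \<open>\<eta>\<close> would
      force the integral up to \<open>E + 1\<close>.\<close>
    define T where "T = a + (E + 1) / \<eta>"
    have "E \<ge> 0" unfolding E_def set_lebesgue_integral_def by (rule Bochner_Integration.integral_nonneg) simp
    then have T: "T \<ge> a" "a \<ge> 0" using \<eta> by (auto simp: T_def a_def)
    have i: "h integrable_on {u..v}" if "continuous_on UNIV h" for h :: "real \<Rightarrow> real" and u v
      using that by (intro integrable_continuous_interval) (auto intro: continuous_on_subset)
    have cr: "continuous_on UNIV (\<lambda>x. e n (- x))"
      by (rule continuous_on_compose2[OF ce[of UNIV]]) (auto intro: continuous_intros)
    have "(E + 1) / \<eta> * \<eta> = integral {a..T} (\<lambda>x. \<eta>)" using T by (simp add: T_def)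
    also have "\<dots> \<le> integral {a..T} (\<lambda>x. e n x + e n (- x))"
      using neg by (intro integral_le i continuous_intros ce cr) (force simp: a_def \<eta>_def)
    also have "\<dots> \<le> integral {0..T} (\<lambda>x. e n x + e n (- x))"
      by (rule integral_subset_le) (use T e0 in \<open>auto intro!: i continuous_intros ce cr add_nonneg_nonneg\<close>)
    also have "\<dots> = integral {0..T} (e n) + integral {0..T} (\<lambda>x. e n (- x))"
      by (rule Henstock_Kurzweil_Integration.integral_add) (intro i ce cr)+
    also have "integral {0..T} (\<lambda>x. e n (- x)) = integral {-T..0} (e n)"
      using Henstock_Kurzweil_Integration.integral_reflect_real[of T 0 "\<lambda>x. e n (- x)"] by simp
    also have "integral {0..T} (e n) + integral {-T..0} (e n) = integral {-T..T} (e n)"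
      using Henstock_Kurzweil_Integration.integral_combine[of "-T" 0 T "e n"] T i[OF ce] by simp
    also have "\<dots> \<le> E" by (rule ie)
    finally show False using \<eta> by simp
  qed
  then obtain R where R: "\<And>n. R n \<ge> real n + 1" "\<And>n. e n (R n) + e n (- R n) \<le> 1 / (real n + 1)"
    by metis
  define P where "P n = cbox (Complex (- R n) (- q n)) (Complex (R n) (q n))" for n
  have R': "R n \<ge> real n" "R n > 0" for n using R(1)[of n] by linarith+
  have lims: "(\<lambda>n. LINT \<zeta>:P n|lborel. h \<zeta>) \<longlonglongrightarrow> (LINT \<zeta>:strip|lborel. h \<zeta>)" if "set_integrable lborel strip h" for h :: "complex \<Rightarrow> real"
    unfolding P_def by (rule rectangles_tendsto[OF that R'(1) q0(2) lim_q])
  have lim_t: "(\<lambda>n. tanh (R n)) \<longlonglongrightarrow> 1"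
  proof (rule filterlim_compose[OF tanh_real_at_top])
    show "filterlim R at_top sequentially"
      using filterlim_at_top_mono[OF filterlim_real_sequentially always_eventually] R'(1) by blast
  qed
  have ineq: "2 * (LINT \<zeta>:P n|lborel. sech2 \<zeta> * (f \<zeta>)\<^sup>2) \<le> (LINT \<zeta>:P n|lborel. (cmod (g \<zeta>))\<^sup>2)
      + (LINT \<zeta>:P n|lborel. sech2 \<zeta> * f \<zeta>)\<^sup>2 / (2 * q n * tanh (R n)) + 1 / (real n + 1)" for n
    using rectangle_inequality[of "R n" "q n" f g] R'(2)[of n] q0[of n] f g R(2)[of n]
    unfolding strip_def P_def e_def sech2_def by fastforce
  have "2 * (LINT \<zeta>:strip|lborel. sech2 \<zeta> * (f \<zeta>)\<^sup>2) \<le> (LINT \<zeta>:strip|lborel. (cmod (g \<zeta>))\<^sup>2)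
      + (LINT \<zeta>:strip|lborel. sech2 \<zeta> * f \<zeta>)\<^sup>2 / (2 * (pi / 2) * 1) + 0"
  proof (rule LIMSEQ_le)
    show "(\<lambda>n. 2 * (LINT \<zeta>:P n|lborel. sech2 \<zeta> * (f \<zeta>)\<^sup>2)) \<longlonglongrightarrow> 2 * (LINT \<zeta>:strip|lborel. sech2 \<zeta> * (f \<zeta>)\<^sup>2)"
      by (intro tendsto_intros lims i2)
    have z: "(\<lambda>n. 1 / (real n + 1)) \<longlonglongrightarrow> 0" by real_asymp
    show "(\<lambda>n. (LINT \<zeta>:P n|lborel. (cmod (g \<zeta>))\<^sup>2)
      + (LINT \<zeta>:P n|lborel. sech2 \<zeta> * f \<zeta>)\<^sup>2 / (2 * q n * tanh (R n)) + 1 / (real n + 1)) \<longlonglongrightarrow>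
      (LINT \<zeta>:strip|lborel. (cmod (g \<zeta>))\<^sup>2)
      + (LINT \<zeta>:strip|lborel. sech2 \<zeta> * f \<zeta>)\<^sup>2 / (2 * (pi / 2) * 1) + 0"
      by (intro tendsto_add tendsto_divide tendsto_power tendsto_mult tendsto_const lims i1 i3 lim_q lim_t z) simp
  qed (use ineq in blast)
  then show "2 * (LINT \<zeta>:strip|lborel. sech2 \<zeta> * (f \<zeta>)\<^sup>2) \<le> (LINT \<zeta>:strip|lborel. (cmod (g \<zeta>))\<^sup>2)
      + (LINT \<zeta>:strip|lborel. sech2 \<zeta> * f \<zeta>)\<^sup>2 / pi"
    by simp
qed

section \<open>The inverse branches of the Gauss map\<close>

text \<open>Take disjoint neighbourhoods of the \<open>m\<close> preimages on which \<open>f\<close>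
  is injective. Over the intersection of their images each of them contains a preimage of any given
  point; these are already \<open>m\<close> in number, so there are no others and the neighbourhoods
  are the sheets.\<close>

lemma covering_space_of_constant_fibre_card:
  fixes f :: "complex \<Rightarrow> complex"
  assumes f: "f holomorphic_on U" and U: "open U" and S: "open S" and fU: "f ` U \<subseteq> S"
    and d: "\<And>z. z \<in> U \<Longrightarrow> deriv f z \<noteq> 0"
    and card: "\<And>w. w \<in> S \<Longrightarrow> card {z \<in> U. f z = w} = m" and m: "m > 0"
  shows "covering_space U f S"
proof
  show cont: "continuous_on U f" using f by (rule holomorphic_on_imp_continuous_on)
  show "f ` U = S"
  proof
    show "S \<subseteq> f ` U"
    proof
      fix w assume "w \<in> S"
      then have "{z \<in> U. f z = w} \<noteq> {}" using card[of w] m by (metis card.empty less_irrefl)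
      then show "w \<in> f ` U" by blast
    qed
  qed (rule fU)
  fix w0 assume w0: "w0 \<in> S"
  define A where "A = {z \<in> U. f z = w0}"
  have cA: "card A = m" using card[OF w0] by (simp add: A_def)
  then have finA: "finite A" using m by (intro card_ge_0_finite) simp
  have "\<exists>r>0. ball \<alpha> r \<subseteq> U \<and> inj_on f (ball \<alpha> r)" if "\<alpha> \<in> A" for \<alpha>
    using has_complex_derivative_locally_injective[OF f _ U d, of \<alpha>] that by (auto simp: A_def)
  then obtain r1 where r1: "\<And>\<alpha>. \<alpha> \<in> A \<Longrightarrow> r1 \<alpha> > 0" "\<And>\<alpha>. \<alpha> \<in> A \<Longrightarrow> ball \<alpha> (r1 \<alpha>) \<subseteq> U"
     "\<And>\<alpha>. \<alpha> \<in> A \<Longrightarrow> inj_on f (ball \<alpha> (r1 \<alpha>))" by metis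
  obtain \<delta> where \<delta>: "\<delta> > 0" "\<And>x y. x \<in> A \<Longrightarrow> y \<in> A \<Longrightarrow> x \<noteq> y \<Longrightarrow> dist x y \<ge> \<delta>"
  proof -
    have "\<exists>d>0. \<forall>y\<in>A. y \<noteq> x \<longrightarrow> d \<le> dist x y" for x
      using finite_set_avoid[OF finA, of x] by auto
    then obtain d where d: "\<And>x. d x > 0" "\<And>x y. y \<in> A \<Longrightarrow> y \<noteq> x \<Longrightarrow> d x \<le> dist x y" by metis
    show thesis
    proof (rule that[of "Min (insert 1 (d ` A))"])
      show "Min (insert 1 (d ` A)) > 0" using finA d(1) by simp
      fix x y assume "x \<in> A" "y \<in> A" "x \<noteq> y"
      then have "Min (insert 1 (d ` A)) \<le> d x" using finA by (intro Min_le) auto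
      also have "\<dots> \<le> dist x y" using d(2)[of y x] \<open>x \<noteq> y\<close> \<open>y \<in> A\<close> by simp
      finally show "Min (insert 1 (d ` A)) \<le> dist x y" .
    qed
  qed
  define B where "B \<alpha> = ball \<alpha> (min (r1 \<alpha>) (\<delta> / 2))" for \<alpha>
  have B: "B \<alpha> \<subseteq> U" "inj_on f (B \<alpha>)" "open (B \<alpha>)" "\<alpha> \<in> B \<alpha>" if "\<alpha> \<in> A" for \<alpha>
  proof -
    have "B \<alpha> \<subseteq> ball \<alpha> (r1 \<alpha>)" by (auto simp: B_def)
    then show "B \<alpha> \<subseteq> U" "inj_on f (B \<alpha>)" using r1[OF that] by (auto intro: inj_on_subset)
    show "open (B \<alpha>)" "\<alpha> \<in> B \<alpha>" using r1[OF that] \<delta>(1) by (auto simp: B_def)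
  qed
  have disj: "B x \<inter> B y = {}" if "x \<in> A" "y \<in> A" "x \<noteq> y" for x y
  proof -
    have False if "z \<in> B x" "z \<in> B y" for z
    proof -
      have "dist x z < \<delta> / 2" "dist y z < \<delta> / 2" using that by (auto simp: B_def)
      then have "dist x y < \<delta>" using dist_triangle2[of x y z] by linarith
      then show False using \<delta>(2)[of x y] \<open>x \<in> A\<close> \<open>y \<in> A\<close> \<open>x \<noteq> y\<close> by simp
    qed
    then show ?thesis by blast
  qed
  define T where "T = S \<inter> (\<Inter>\<alpha>\<in>A. f ` B \<alpha>)"
  have oT: "open T"
    unfolding T_def
    by (intro open_Int S open_INT finA ballI invariance_of_domain)
       (use B cont in \<open>auto intro: continuous_on_subset\<close>)
  define V where "V \<alpha> = B \<alpha> \<inter> f -` T" for \<alpha>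
  have fV: "f ` V \<alpha> = T" if "\<alpha> \<in> A" for \<alpha>
  proof
    show "T \<subseteq> f ` V \<alpha>"
    proof
      fix x assume x: "x \<in> T"
      then have "x \<in> f ` B \<alpha>" using that by (auto simp: T_def)
      then obtain y where "y \<in> B \<alpha>" "x = f y" by blast
      then show "x \<in> f ` V \<alpha>" using x by (auto simp: V_def)
    qed
  qed (auto simp: V_def)
  have oV: "open (V \<alpha>)" if "\<alpha> \<in> A" for \<alpha>
  proof -
    have "continuous_on (B \<alpha>) f" using cont B(1)[OF that] by (rule continuous_on_subset)
    then have "open (f -` T \<inter> B \<alpha>)" using continuous_on_open_vimage[OF B(3)[OF that]] oT by blast
    then show ?thesis by (simp add: V_def Int_commute)
  qed
  have fib: "U \<inter> f -` T = (\<Union>\<alpha>\<in>A. V \<alpha>)"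
  proof
    show "(\<Union>\<alpha>\<in>A. V \<alpha>) \<subseteq> U \<inter> f -` T" using B by (auto simp: V_def)
    show "U \<inter> f -` T \<subseteq> (\<Union>\<alpha>\<in>A. V \<alpha>)"
    proof
      fix z assume z: "z \<in> U \<inter> f -` T"
      define w where "w = f z"
      have w: "w \<in> T" "w \<in> S" using z by (auto simp: w_def T_def)
      then have "\<exists>x. x \<in> B \<alpha> \<and> f x = w" if "\<alpha> \<in> A" for \<alpha> using that by (auto simp: T_def)
      then obtain x where x: "\<And>\<alpha>. \<alpha> \<in> A \<Longrightarrow> x \<alpha> \<in> B \<alpha>" "\<And>\<alpha>. \<alpha> \<in> A \<Longrightarrow> f (x \<alpha>) = w" by metis
      have "inj_on x A" using x(1) disj by (fastforce simp: inj_on_def)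
      then have "card (x ` A) = m" using cA by (simp add: card_image)
      moreover have "x ` A \<subseteq> {z \<in> U. f z = w}" using x B(1) by auto
      moreover have "finite {z \<in> U. f z = w}" by (rule card_ge_0_finite) (use card[OF w(2)] m in simp)
      ultimately have "x ` A = {z \<in> U. f z = w}" using card[OF w(2)] by (metis card_subset_eq)
      then have "z \<in> x ` A" using z by (auto simp: w_def)
      then show "z \<in> (\<Union>\<alpha>\<in>A. V \<alpha>)" using x(1) z by (auto simp: V_def)
    qed
  qed
  have hom: "\<exists>q. homeomorphism (V \<alpha>) T f q" if "\<alpha> \<in> A" for \<alpha>
  proof -
    have "V \<alpha> \<subseteq> B \<alpha>" by (auto simp: V_def)
    then have "continuous_on (V \<alpha>) f" "inj_on f (V \<alpha>)"
      using B[OF that] cont by (auto intro: continuous_on_subset inj_on_subset)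
    then show ?thesis
      using invariance_of_domain_homeomorphism[OF oV[OF that], of f] fV[OF that] by auto
  qed
  show "\<exists>T. w0 \<in> T \<and> openin (top_of_set S) T \<and>
      (\<exists>v. \<Union> v = U \<inter> f -` T \<and> (\<forall>u\<in>v. openin (top_of_set U) u) \<and> pairwise disjnt v \<and>
        (\<forall>u\<in>v. \<exists>q. homeomorphism u T f q))"
  proof (intro exI[of _ T] exI[of _ "V ` A"] conjI ballI)
    show "w0 \<in> T" using B(4) w0 by (force simp: T_def A_def)
    show "openin (top_of_set S) T" using oT by (intro open_subset) (auto simp: T_def)
    show "\<Union> (V ` A) = U \<inter> f -` T" using fib by simp
    show "openin (top_of_set U) u" if u: "u \<in> V ` A" for u
    proof -
      obtain \<alpha> where a: "\<alpha> \<in> A" "u = V \<alpha>" using u by blast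
      then have "u \<subseteq> U" using B(1) by (auto simp: V_def)
      then show ?thesis using oV[OF a(1)] a(2) by (intro open_subset) auto
    qed
    show "pairwise disjnt (V ` A)"
      using disj by (auto simp: pairwise_def disjnt_def V_def)
    show "\<exists>q. homeomorphism u T f q" if "u \<in> V ` A" for u using that hom by blast
  qed
qed

context oliveira
begin

definition GG :: "complex \<Rightarrow> complex" where "GG z = pa z / (z - 1)"

text \<open>The preimage of the upper half plane under the Gauss map, with the division cleared by
  \<open>cnj (z - 1)\<close>; openness is then immediate, and the pole is excluded without a case
  distinction.\<close>

definition upper :: "complex set" where "upper = {z. 0 < Im (pa z * cnj (z - 1))}"

lemma continuous_pa: "continuous_on A pa"
  unfolding pa_def by (intro continuous_intros)

lemma continuous_pa': "continuous_on A pa'"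
  unfolding pa'_def by (intro continuous_intros)

lemma continuous_wr: "continuous_on A wr"
  unfolding wr_def by (intro continuous_intros continuous_pa continuous_pa')

lemma open_upper: "open upper"
proof -
  have "upper = (\<lambda>z. Im (pa z * cnj (z - 1))) -` {0<..}" by (auto simp: upper_def)
  moreover have "open ((\<lambda>z. Im (pa z * cnj (z - 1))) -` {0<..})"
    by (intro open_vimage continuous_intros continuous_pa)
  ultimately show ?thesis by simp
qed

lemma upper_nz: "z \<in> upper \<Longrightarrow> z \<noteq> 1" "z \<in> upper \<Longrightarrow> z \<noteq> 0" "z \<in> upper \<Longrightarrow> pa z \<noteq> 0"
proof -
  show "z \<in> upper \<Longrightarrow> z \<noteq> 1" "z \<in> upper \<Longrightarrow> pa z \<noteq> 0" by (auto simp: upper_def)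
  then show "z \<in> upper \<Longrightarrow> z \<noteq> 0" using m5 by (auto simp: pa_def)
qed

lemma Im_GG: "z \<noteq> 1 \<Longrightarrow> Im (GG z) = Im (pa z * cnj (z - 1)) / (cmod (z - 1))\<^sup>2"
  unfolding GG_def by (simp add: complex_div_cnj[of "pa z"] complex_mod_mult_cnj[symmetric])

lemma upper_iff: "z \<noteq> 1 \<Longrightarrow> z \<in> upper \<longleftrightarrow> Im (GG z) > 0"
  by (simp add: Im_GG upper_def zero_less_divide_iff)

lemma GG_deriv: "z \<noteq> 1 \<Longrightarrow> (GG has_field_derivative wr z / (z - 1)\<^sup>2) (at z)"
  unfolding GG_def[abs_def] by (auto intro!: derivative_eq_intros pa_deriv simp: wr_def power2_eq_square)

lemma pa_real: "z \<in> \<real> \<Longrightarrow> pa z * cnj (z - 1) \<in> \<real>"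
  by (auto simp: pa_def elim!: Reals_cases)

lemma upper_not_real: "z \<in> upper \<Longrightarrow> Im z \<noteq> 0"
  using pa_real[of z] by (auto simp: upper_def complex_is_Real_iff)

lemma wr_eq: "wr z = z ^ (m - 2) * (of_nat (m - 1) * z\<^sup>2 - 2 * z - of_nat (m - 1))"
proof (rule m_eq)
  fix n assume m: "m = n + 3"
  show ?thesis unfolding wr_def pa_def pa'_def unfolding m
    by (simp add: power2_eq_square algebra_simps eval_nat_numeral)
qed

text \<open>Apart from 0 the zeros of \<open>wr\<close> are the roots of a real quadratic with
  positive discriminant, hence real. So the Gauss map is locally injective off the real
  axis.\<close>

lemma wr_nz:
  assumes "Im z \<noteq> 0"
  shows "wr z \<noteq> 0"
proof
  assume "wr z = 0"
  moreover have "z \<noteq> 0" using assms by auto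
  ultimately have 0: "of_nat (m - 1) * z\<^sup>2 - 2 * z - of_nat (m - 1) = 0" by (simp add: wr_eq)
  define k where "k = real (m - 1)"
  have k: "k > 0" using m5 by (simp add: k_def)
  define x y where "x = Re z" and "y = Im z"
  have "of_nat (m - 1) = complex_of_real k" by (simp add: k_def)
  with 0 have *: "complex_of_real k * z\<^sup>2 - 2 * z - complex_of_real k = 0" by simp
  have "Im (complex_of_real k * z\<^sup>2 - 2 * z - complex_of_real k) = 0" unfolding * by simp
  then have "2 * y * (k * x - 1) = 0"
    by (simp add: x_def y_def power2_eq_square algebra_simps)
  \<comment> \<open>A nonreal root would have real part 1/k, and the real part of the equation would
    then be negative.\<close>
  then have kx: "k * x = 1" using assms by (simp add: y_def)
  have "Re (complex_of_real k * z\<^sup>2 - 2 * z - complex_of_real k) = 0" unfolding * by simp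
  then have "k * x * x - k * y * y - 2 * x - k = 0"
    by (simp add: x_def y_def power2_eq_square algebra_simps)
  then have "- x - k * y\<^sup>2 - k = 0" unfolding kx by (simp add: power2_eq_square)
  moreover have "x > 0" using kx k zero_less_mult_pos[of k x] by simp
  ultimately show False using k mult_nonneg_nonneg[of k "y\<^sup>2"] zero_le_power2[of y] by linarith
qed

text \<open>The fibre is the root set of z^m + z^(m-1) - w (z - 1): every root lies in
  \<open>upper\<close> because its Gauss value is \<open>w\<close>, and a double root would be a
  nonreal critical point.\<close>

lemma fibre_card:
  assumes w: "Im w > 0"
  shows "card {z \<in> upper. GG z = w} = m"
proof -
  define P where "P = monom 1 m + monom 1 (m - 1) - [:- w, w:]"
  have poly: "poly P z = pa z - w * (z - 1)" for z
  proof (rule m_eq)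
    fix n assume m: "m = n + 3"
    show ?thesis unfolding P_def pa_def unfolding m by (simp add: poly_monom algebra_simps power_add eval_nat_numeral)
  qed
  have pd: "poly (pderiv P) z = pa' z - w" for z
  proof -
    have "(poly P has_field_derivative poly (pderiv P) z) (at z)" by (rule poly_DERIV)
    moreover have "((\<lambda>z. pa z - w * (z - 1)) has_field_derivative pa' z - w) (at z)"
      by (auto intro!: derivative_eq_intros pa_deriv)
    moreover have "poly P = (\<lambda>z. pa z - w * (z - 1))" using poly by auto
    ultimately show ?thesis using DERIV_unique by simp
  qed
  have deg: "degree P = m"
  proof -
    have "degree (monom (1::complex) m + (monom 1 (m - 1) - [:- w, w:])) = degree (monom (1::complex) m)"
    proof (rule degree_add_eq_left)
      have "degree (monom (1::complex) (m - 1) - [:- w, w:]) \<le> m - 1"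
        by (rule degree_diff_le) (use m5 in \<open>auto simp: degree_monom_eq intro: order_trans[OF degree_pCons_le]\<close>)
      then show "degree (monom (1::complex) (m - 1) - [:- w, w:]) < degree (monom (1::complex) m)"
        using m5 by (simp add: degree_monom_eq)
    qed
    then show ?thesis by (simp add: P_def degree_monom_eq add_diff_eq)
  qed
  then have P0: "P \<noteq> 0" using m5 by auto
  have root: "poly P z = 0 \<longleftrightarrow> z \<in> upper \<and> GG z = w" for z
  proof
    assume "poly P z = 0"
    then have p: "pa z = w * (z - 1)" by (simp add: poly)
    have "z \<noteq> 1" using p by (auto simp: pa_def)
    then have "GG z = w" using p by (simp add: GG_def)
    then show "z \<in> upper \<and> GG z = w" using upper_iff[OF \<open>z \<noteq> 1\<close>] w by simp
  next
    assume "z \<in> upper \<and> GG z = w"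
    then show "poly P z = 0" using upper_nz(1)[of z] by (auto simp: poly GG_def)
  qed
  have "rsquarefree P"
    unfolding rsquarefree_roots
  proof (intro allI notI)
    fix z assume z: "poly P z = 0 \<and> poly (pderiv P) z = 0"
    then have "wr z = 0" by (simp add: poly pd wr_def)
    moreover have "z \<in> upper" using z root by blast
    ultimately show False using wr_nz upper_not_real by blast
  qed
  then have "smult (lead_coeff P) (\<Prod>z|poly P z = 0. [:-z, 1:]) = P"
    by (rule complex_poly_decompose_rsquarefree)
  then have "degree P = degree (\<Prod>z|poly P z = 0. [:-z, 1:])"
    using P0 by (metis degree_smult_eq leading_coeff_0_iff)
  also have "\<dots> = (\<Sum>z|poly P z = 0. degree [:-z, 1:])"
    by (rule degree_prod_sum_eq) auto
  also have "\<dots> = card {z. poly P z = 0}" by simp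
  finally show ?thesis using deg root by simp
qed

lemma GG_covering: "covering_space upper GG {w. Im w > 0}"
proof (rule covering_space_of_constant_fibre_card[where m=m])
  show "GG holomorphic_on upper"
    using GG_deriv upper_nz(1) open_upper by (auto simp: holomorphic_on_open)
  show "deriv GG z \<noteq> 0" if "z \<in> upper" for z
    using DERIV_imp_deriv[OF GG_deriv] upper_nz(1)[OF that] wr_nz upper_not_real[OF that] by simp
  show "GG ` upper \<subseteq> {w. Im w > 0}" using upper_iff upper_nz(1) by auto
qed (use fibre_card open_upper m5 in \<open>auto simp: open_halfspace_Im_gt\<close>)

text \<open>A branch is an inverse of the Gauss map, in the coordinate \<open>\<zeta>\<close> of the upper half plane given
  by \<open>w = \<i> exp \<zeta>\<close>; the branches are labelled by their values at \<open>w = \<i>\<close>.\<close>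
definition fib :: "complex set" where "fib = {z \<in> upper. GG z = \<i>}"

definition is_branch :: "complex \<Rightarrow> (complex \<Rightarrow> complex) \<Rightarrow> bool" where
  "is_branch \<alpha> g \<longleftrightarrow> continuous_on strip g \<and> g \<in> strip \<rightarrow> upper \<and> g 0 = \<alpha> \<and> (\<forall>\<zeta>\<in>strip. GG (g \<zeta>) = \<i> * exp \<zeta>)"

definition branch :: "complex \<Rightarrow> complex \<Rightarrow> complex" where
  "branch \<alpha> = (SOME g. is_branch \<alpha> g)"

definition dom :: "complex \<Rightarrow> complex set" where "dom \<alpha> = branch \<alpha> ` strip"

lemma card_fib: "card fib = m" "finite fib"
proof -
  show "card fib = m" using fibre_card[of \<i>] by (simp add: fib_def)
  then show "finite fib" using m5 by (intro card_ge_0_finite) simp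
qed

lemma convex_strip: "convex strip"
proof -
  have "strip = {\<zeta>. Im \<zeta> < pi / 2} \<inter> {\<zeta>. Im \<zeta> > - (pi / 2)}" by (auto simp: strip_def)
  moreover have "convex ({\<zeta>. Im \<zeta> < pi / 2} \<inter> {\<zeta>. Im \<zeta> > - (pi / 2)})"
    by (intro convex_Int convex_halfspace_Im_lt convex_halfspace_Im_gt)
  ultimately show ?thesis by (simp only:)
qed

lemma strip_0: "0 \<in> strip" by (simp add: strip_def)

lemma iexp_upper: "\<zeta> \<in> strip \<Longrightarrow> Im (\<i> * exp \<zeta>) > 0"
  by (simp add: Re_exp strip_def cos_gt_zero_pi abs_less_iff)

lemma iexp_inj: "inj_on (\<lambda>\<zeta>. \<i> * exp \<zeta>) strip"
proof (rule inj_onI)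
  fix x y assume xy: "x \<in> strip" "y \<in> strip" "\<i> * exp x = \<i> * exp y"
  then have "Ln (exp x) = Ln (exp y)" by simp
  then show "x = y" using xy(1,2) by (simp add: strip_def)
qed

lemma iexp_surj: "Im w > 0 \<Longrightarrow> \<exists>\<zeta>\<in>strip. \<i> * exp \<zeta> = w"
proof -
  assume w: "Im w > 0"
  then have "Re (- \<i> * w) > 0" by simp
  then have "\<bar>Im (Ln (- \<i> * w))\<bar> < pi / 2" using Re_Ln_pos_lt by (metis complex.sel(1) less_irrefl zero_complex.simps(1))
  moreover have "\<i> * exp (Ln (- \<i> * w)) = w" using w by (subst exp_Ln) auto
  ultimately show ?thesis by (auto simp: strip_def)
qed

text \<open>The strip is simply connected, so the map to the upper half plane lifts through the
  covering. The base point is arbitrary because \<open>dom_cover\<close> starts the lift at a given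
  point of \<open>upper\<close>.\<close>

lemma branch_lift:
  assumes "a \<in> upper" "\<zeta>0 \<in> strip" "\<i> * exp \<zeta>0 = GG a"
  shows "\<exists>g. continuous_on strip g \<and> g \<in> strip \<rightarrow> upper \<and> g \<zeta>0 = a \<and> (\<forall>\<zeta>\<in>strip. GG (g \<zeta>) = \<i> * exp \<zeta>)"
proof -
  have "simply_connected strip" "locally path_connected strip"
    using convex_strip by (auto simp: convex_imp_simply_connected convex_imp_locally_path_connected)
  then obtain g where "continuous_on strip g" "g \<in> strip \<rightarrow> upper" "g \<zeta>0 = a"
      "\<And>y. y \<in> strip \<Longrightarrow> GG (g y) = \<i> * exp y"
    by (rule covering_space_lift_strong[OF GG_covering assms(1,2), where f="\<lambda>\<zeta>. \<i> * exp \<zeta>"])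
      (use iexp_upper assms in \<open>auto intro!: continuous_intros simp del: Im_i_times\<close>)
  then show ?thesis by blast
qed

lemma branch_props:
  assumes "\<alpha> \<in> fib"
  shows "is_branch \<alpha> (branch \<alpha>)"
proof -
  have "\<alpha> \<in> upper" "\<i> * exp 0 = GG \<alpha>" using assms by (auto simp: fib_def)
  from branch_lift[OF this(1) strip_0 this(2)] have "\<exists>g. is_branch \<alpha> g"
    by (simp add: is_branch_def)
  then show ?thesis unfolding branch_def by (rule someI_ex)
qed

lemma branchD:
  assumes "\<alpha> \<in> fib"
  shows "continuous_on strip (branch \<alpha>)" "\<zeta> \<in> strip \<Longrightarrow> branch \<alpha> \<zeta> \<in> upper" "branch \<alpha> 0 = \<alpha>"
    "\<zeta> \<in> strip \<Longrightarrow> GG (branch \<alpha> \<zeta>) = \<i> * exp \<zeta>"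
  using branch_props[OF assms] by (auto simp: is_branch_def)

lemma branch_inj:
  assumes "\<alpha> \<in> fib"
  shows "inj_on (branch \<alpha>) strip"
proof (rule inj_onI)
  fix x y assume xy: "x \<in> strip" "y \<in> strip" "branch \<alpha> x = branch \<alpha> y"
  then have "\<i> * exp x = \<i> * exp y" using branchD(4)[OF assms] by metis
  then show "x = y" using iexp_inj xy(1,2) by (auto simp: inj_on_def)
qed

text \<open>Through a point of \<open>upper\<close> there is a lift, whose value at 0 is the label
  of a branch; uniqueness of lifts identifies the two.\<close>

lemma dom_cover: "(\<Union>\<alpha>\<in>fib. dom \<alpha>) = upper"
proof
  show "(\<Union>\<alpha>\<in>fib. dom \<alpha>) \<subseteq> upper" using branchD(2) by (auto simp: dom_def)
  show "upper \<subseteq> (\<Union>\<alpha>\<in>fib. dom \<alpha>)"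
  proof
    fix a assume a: "a \<in> upper"
    then have "Im (GG a) > 0" using upper_iff upper_nz(1) by auto
    then obtain \<zeta>0 where z: "\<zeta>0 \<in> strip" "\<i> * exp \<zeta>0 = GG a" using iexp_surj by blast
    obtain g where g: "continuous_on strip g" "g \<in> strip \<rightarrow> upper" "g \<zeta>0 = a" "\<forall>\<zeta>\<in>strip. GG (g \<zeta>) = \<i> * exp \<zeta>"
      using branch_lift[OF a z] by blast
    define \<alpha> where "\<alpha> = g 0"
    have al: "\<alpha> \<in> fib" using g strip_0 by (auto simp: \<alpha>_def fib_def)
    have "g \<zeta>0 = branch \<alpha> \<zeta>0"
      by (rule covering_space_lift_unique[OF GG_covering, of g 0 "branch \<alpha>" strip "\<lambda>\<zeta>. \<i> * exp \<zeta>"])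
        (use g branchD[OF al] iexp_upper strip_0 z convex_connected[OF convex_strip] in
          \<open>auto intro!: continuous_intros simp: \<alpha>_def simp del: Im_i_times\<close>)
    then show "a \<in> (\<Union>\<alpha>\<in>fib. dom \<alpha>)" using al z g(3) by (auto simp: dom_def)
  qed
qed

text \<open>At a common point both branches have the same parameter, as the Gauss value determines
  it; and two lifts that meet once are equal.\<close>

lemma dom_disjoint:
  assumes ab: "\<alpha> \<in> fib" "\<beta> \<in> fib" "\<alpha> \<noteq> \<beta>"
  shows "dom \<alpha> \<inter> dom \<beta> = {}"
proof (rule ccontr)
  assume "dom \<alpha> \<inter> dom \<beta> \<noteq> {}"
  then obtain x y where xy: "x \<in> strip" "y \<in> strip" "branch \<alpha> x = branch \<beta> y" by (auto simp: dom_def)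
  then have "\<i> * exp x = \<i> * exp y" using branchD(4)[OF ab(1)] branchD(4)[OF ab(2)] by metis
  then have "x = y" using iexp_inj xy(1,2) by (auto simp: inj_on_def)
  have "branch \<alpha> 0 = branch \<beta> 0"
    by (rule covering_space_lift_unique[OF GG_covering, of "branch \<alpha>" x "branch \<beta>" strip "\<lambda>\<zeta>. \<i> * exp \<zeta>"])
      (use branchD[OF ab(1)] branchD[OF ab(2)] iexp_upper strip_0 xy \<open>x = y\<close> convex_connected[OF convex_strip] in
        \<open>auto intro!: continuous_intros simp del: Im_i_times\<close>)
  then show False using branchD(3) ab by metis
qed

text \<open>The quotient of the Gauss map by its derivative, that is, the derivative of an inverse
  branch with respect to the logarithm of the Gauss value.\<close>

definition rr :: "complex \<Rightarrow> complex" where "rr z = pa z * (z - 1) / wr z"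

text \<open>The branch is continuous and injective, so the difference quotients of the Gauss map may
  be evaluated along it; their limit is nonzero because \<open>wr\<close> has no zero in
  \<open>upper\<close>, and division gives the derivative of the inverse.\<close>

lemma branch_deriv:
  assumes "\<alpha> \<in> fib" "\<zeta> \<in> strip"
  shows "(branch \<alpha> has_field_derivative rr (branch \<alpha> \<zeta>)) (at \<zeta>)"
proof -
  let ?k = "branch \<alpha>" and ?E = "\<lambda>\<zeta>. \<i> * exp \<zeta>"
  define z where "z = ?k \<zeta>"
  have z: "z \<in> upper" using branchD(2)[OF assms] by (simp add: z_def)
  have G: "(GG has_field_derivative wr z / (z - 1)\<^sup>2) (at z)" by (rule GG_deriv[OF upper_nz(1)[OF z]])
  have ck: "isCont ?k \<zeta>" using branchD(1)[OF assms(1)] open_strip assms(2) by (simp add: continuous_on_eq_continuous_at)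
  have ev: "eventually (\<lambda>x. x \<in> strip \<and> x \<noteq> \<zeta>) (at \<zeta>)"
    using eventually_at_in_open[OF open_strip assms(2)] by (auto elim: eventually_mono)
  have fk: "filterlim ?k (at z) (at \<zeta>)"
  proof -
    have "eventually (\<lambda>x. ?k x \<noteq> z) (at \<zeta>)"
      using ev by eventually_elim (use branch_inj[OF assms(1)] assms(2) in \<open>auto simp: z_def inj_on_def\<close>)
    then show ?thesis using ck by (simp add: filterlim_at isCont_def z_def)
  qed
  have "((\<lambda>y. (GG y - GG z) / (y - z)) \<longlongrightarrow> wr z / (z - 1)\<^sup>2) (at z)"
    using G by (simp add: has_field_derivative_iff)
  then have 1: "((\<lambda>x. (GG (?k x) - GG z) / (?k x - z)) \<longlongrightarrow> wr z / (z - 1)\<^sup>2) (at \<zeta>)"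
    using fk by (rule filterlim_compose)
  have "(?E has_field_derivative ?E \<zeta>) (at \<zeta>)" by (auto intro!: derivative_eq_intros)
  then have 2: "((\<lambda>x. (?E x - ?E \<zeta>) / (x - \<zeta>)) \<longlongrightarrow> ?E \<zeta>) (at \<zeta>)"
    by (simp add: has_field_derivative_iff)
  have nz: "wr z / (z - 1)\<^sup>2 \<noteq> 0" using wr_nz upper_not_real[OF z] upper_nz(1)[OF z] by simp
  have "((\<lambda>x. ((?E x - ?E \<zeta>) / (x - \<zeta>)) / ((GG (?k x) - GG z) / (?k x - z))) \<longlongrightarrow> ?E \<zeta> / (wr z / (z - 1)\<^sup>2)) (at \<zeta>)"
    by (intro tendsto_divide 1 2 nz)
  moreover have "eventually (\<lambda>x. ((?E x - ?E \<zeta>) / (x - \<zeta>)) / ((GG (?k x) - GG z) / (?k x - z)) = (?k x - ?k \<zeta>) / (x - \<zeta>)) (at \<zeta>)"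
    using ev
  proof eventually_elim
    fix x assume x: "x \<in> strip \<and> x \<noteq> \<zeta>"
    then have "GG (?k x) = ?E x" "GG z = ?E \<zeta>" using branchD(4)[OF assms(1)] assms(2) by (auto simp: z_def)
    moreover have "?E x \<noteq> ?E \<zeta>" using x iexp_inj assms(2) by (auto simp: inj_on_def)
    ultimately show "((?E x - ?E \<zeta>) / (x - \<zeta>)) / ((GG (?k x) - GG z) / (?k x - z)) = (?k x - ?k \<zeta>) / (x - \<zeta>)"
      by (simp add: z_def)
  qed
  ultimately have "((\<lambda>x. (?k x - ?k \<zeta>) / (x - \<zeta>)) \<longlongrightarrow> ?E \<zeta> / (wr z / (z - 1)\<^sup>2)) (at \<zeta>)"
    by (rule Lim_transform_eventually)
  moreover have "?E \<zeta> / (wr z / (z - 1)\<^sup>2) = rr z"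
  proof -
    have "?E \<zeta> = pa z / (z - 1)" using branchD(4)[OF assms] by (simp add: z_def GG_def)
    then show ?thesis using upper_nz(1)[OF z] by (simp add: rr_def power2_eq_square)
  qed
  ultimately show ?thesis by (simp add: has_field_derivative_iff z_def)
qed

text \<open>On a branch the Gauss value has modulus exp (Re \<zeta>), and the spherical metric
  becomes |d\<zeta>|^2 / cosh^2 (Re \<zeta>) as in Mercator coordinates; the factor 2 is the one in
  \<open>rho\<close>.\<close>

lemma rho_branch:
  assumes "\<alpha> \<in> fib" "\<zeta> \<in> strip"
  shows "(cmod (rr (branch \<alpha> \<zeta>)))\<^sup>2 * rho (branch \<alpha> \<zeta>) = 2 * sech2 \<zeta>"
proof -
  define z where "z = branch \<alpha> \<zeta>"
  have z: "z \<in> upper" using branchD(2)[OF assms] by (simp add: z_def)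
  define b where "b = (cmod (z - 1))\<^sup>2"
  have b: "b > 0" using upper_nz(1)[OF z] by (simp add: b_def)
  define x where "x = exp (Re \<zeta>)"
  have x: "x > 0" by (simp add: x_def)
  have "pa z = \<i> * exp \<zeta> * (z - 1)"
    using branchD(4)[OF assms] upper_nz(1)[OF z] by (simp add: z_def GG_def field_simps)
  then have a: "(cmod (pa z))\<^sup>2 = x\<^sup>2 * b"
    by (simp add: norm_mult power_mult_distrib b_def x_def)
  have w: "(cmod (wr z))\<^sup>2 > 0" using wr_nz upper_not_real[OF z] by simp
  have "(cmod (rr z))\<^sup>2 * rho z = 8 * ((cmod (pa z))\<^sup>2 * b) / (sg z)\<^sup>2"
    using w by (simp add: rr_def rho_def norm_mult norm_divide power_mult_distrib power_divide b_def)
  also have "\<dots> = 8 * x\<^sup>2 / (1 + x\<^sup>2)\<^sup>2"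
  proof -
    have "sg z = b * (1 + x\<^sup>2)" unfolding sg_def b_def[symmetric] a by (simp add: algebra_simps)
    then show ?thesis using b unfolding a by (simp add: power_mult_distrib power2_eq_square)
  qed
  also have "\<dots> = 2 * sech2 \<zeta>"
  proof -
    have p: "x * x + 1 > 0" using x by (simp add: add_pos_pos)
    have t: "tanh (Re \<zeta>) = (x\<^sup>2 - 1) / (x\<^sup>2 + 1)"
    proof -
      have "tanh (Re \<zeta>) = (x - inverse x) / (x + inverse x)"
        by (simp add: tanh_altdef x_def exp_minus)
      moreover have "x - inverse x = (x\<^sup>2 - 1) / x" "x + inverse x = (x\<^sup>2 + 1) / x"
        using x by (simp_all add: field_simps power2_eq_square)
      ultimately show ?thesis using x by simp
    qed
    show ?thesis unfolding sech2_def t using p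
      by (simp add: power2_eq_square divide_simps) (simp add: algebra_simps)
  qed
  finally show ?thesis by (simp add: z_def)
qed

end

section \<open>The Jacobi function vanishing on the real circle of Gauss values\<close>

context oliveira
begin

text \<open>The second coordinate of the stereographic preimage of the Gauss map, and its gradient.\<close>
definition el :: "complex \<Rightarrow> real" where "el z = 2 * Im (pa z * cnj (z - 1)) / sg z"

definition gel :: "complex \<Rightarrow> complex" where
  "gel z = 2 * \<i> * ((pa z)\<^sup>2 + (z - 1)\<^sup>2) * cnj (wr z) / (of_real (sg z))\<^sup>2"

lemma continuous_sg: "continuous_on A sg"
  unfolding sg_def[abs_def] by (intro continuous_intros continuous_pa)

lemma continuous_el: "continuous_on A el"
  unfolding el_def[abs_def] by (intro continuous_intros continuous_pa continuous_sg) (use sg_pos less_imp_neq in fastforce)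

lemma continuous_gel: "continuous_on A gel"
  unfolding gel_def[abs_def] by (intro continuous_intros continuous_pa continuous_sg continuous_wr) (use sg_pos less_imp_neq in fastforce)

lemma continuous_rho: "continuous_on A rho"
  unfolding rho_def[abs_def] by (intro continuous_intros continuous_wr continuous_sg) (use sg_pos less_imp_neq in fastforce)

lemma rho_nonneg: "rho z \<ge> 0"
  by (simp add: rho_def)

lemma sg_has_derivative:
  "(sg has_derivative (\<lambda>v. 2 * Re ((cnj (pa z) * pa' z + cnj (z - 1)) * v))) (at z)"
proof -
  have dpa: "(pa has_derivative (\<lambda>v. pa' z * v)) (at z)"
    using pa_deriv by (simp add: has_field_derivative_def)
  have n: "(cmod w)\<^sup>2 = w \<bullet> w" for w by (simp add: power2_norm_eq_inner)
  show ?thesis unfolding sg_def[abs_def] n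
    by (rule derivative_eq_intros dpa refl)+ (simp add: inner_complex_def algebra_simps)
qed

lemma el_has_derivative: "(el has_derivative (\<lambda>v. gel z \<bullet> v)) (at z)"
proof -
  have dpa: "(pa has_derivative (\<lambda>v. pa' z * v)) (at z)"
    using pa_deriv by (simp add: has_field_derivative_def)
  have s: "sg z \<noteq> 0" using sg_pos[of z] by simp
  have "((\<lambda>z. pa z * cnj (z - 1)) has_derivative (\<lambda>v. pa z * cnj v + pa' z * v * cnj (z - 1))) (at z)"
    by (rule derivative_eq_intros dpa refl)+ simp
  then have "((\<lambda>z. 2 * Im (pa z * cnj (z - 1))) has_derivative (\<lambda>v. 2 * Im (pa z * cnj v + pa' z * v * cnj (z - 1)))) (at z)"
    by (intro has_derivative_mult_right has_derivative_Im)
  from has_derivative_divide[OF this sg_has_derivative s]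
  have *: "(el has_derivative (\<lambda>v. - (2 * Im (pa z * cnj (z - 1))) * (inverse (sg z) * (2 * Re ((cnj (pa z) * pa' z + cnj (z - 1)) * v)) * inverse (sg z))
      + 2 * Im (pa z * cnj v + pa' z * v * cnj (z - 1)) / sg z)) (at z)"
    unfolding el_def[abs_def] .
  define a b c where "a = pa z" and "b = z - 1" and "c = pa' z"
  have S: "sg z = (Re a)\<^sup>2 + (Im a)\<^sup>2 + ((Re b)\<^sup>2 + (Im b)\<^sup>2)"
    by (simp add: sg_def a_def b_def cmod_power2)
  \<comment> \<open>The quotient rule with denominators cleared: a polynomial identity in real and
    imaginary parts once \<open>sg z\<close> is written as the sum of squares
    \<open>S\<close>.\<close>
  have key: "sg z * (2 * Im (a * cnj v + c * v * cnj b)) - 2 * Im (a * cnj b) * (2 * Re ((cnj a * c + cnj b) * v))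
      = (2 * \<i> * (a\<^sup>2 + b\<^sup>2) * cnj (c * b - a)) \<bullet> v" for v
    unfolding S by (simp add: inner_complex_def power2_eq_square algebra_simps)
  show ?thesis
  proof (rule has_derivative_eq_rhs[OF *], rule ext)
    fix v
    have "gel z \<bullet> v = ((2 * \<i> * (a\<^sup>2 + b\<^sup>2) * cnj (c * b - a)) /\<^sub>R (sg z)\<^sup>2) \<bullet> v"
      by (simp add: gel_def a_def b_def c_def wr_def scaleR_conv_of_real divide_inverse mult.commute)
    also have "\<dots> = inverse ((sg z)\<^sup>2) * ((2 * \<i> * (a\<^sup>2 + b\<^sup>2) * cnj (c * b - a)) \<bullet> v)"
      by (rule inner_scaleR_left)
    also have "\<dots> = (sg z * (2 * Im (a * cnj v + c * v * cnj b)) - 2 * Im (a * cnj b) * (2 * Re ((cnj a * c + cnj b) * v))) / (sg z)\<^sup>2"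
      unfolding key[symmetric] by (simp only: divide_inverse mult.commute)
    also have "\<dots> = - (2 * Im (a * cnj b)) * (inverse (sg z) * (2 * Re ((cnj a * c + cnj b) * v)) * inverse (sg z))
      + 2 * Im (a * cnj v + c * v * cnj b) / sg z"
    proof -
      have "(S * x - y * t) / S\<^sup>2 = - y * (inverse S * t * inverse S) + x / S" if "S \<noteq> 0" for S x y t :: real
        using that by (simp add: power2_eq_square field_simps)
      from this[OF s] show ?thesis .
    qed
    finally show "- (2 * Im (pa z * cnj (z - 1))) * (inverse (sg z) * (2 * Re ((cnj (pa z) * pa' z + cnj (z - 1)) * v)) * inverse (sg z))
      + 2 * Im (pa z * cnj v + pa' z * v * cnj (z - 1)) / sg z = gel z \<bullet> v"
      by (simp add: a_def b_def c_def)
  qed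
qed

lemma wr_deriv: "(wr has_field_derivative deriv wr z) (at z)" and continuous_deriv_wr: "continuous_on A (deriv wr)"
proof -
  have "pa' holomorphic_on UNIV" "pa holomorphic_on UNIV"
    unfolding pa'_def[abs_def] pa_def[abs_def] by (intro holomorphic_intros)+
  then have h: "wr holomorphic_on UNIV"
    unfolding wr_def[abs_def] by (intro holomorphic_intros)
  then show "(wr has_field_derivative deriv wr z) (at z)"
    by (meson UNIV_I holomorphic_derivI open_UNIV)
  have "deriv wr holomorphic_on UNIV" using h by (intro holomorphic_deriv) auto
  then show "continuous_on A (deriv wr)"
    using holomorphic_on_imp_continuous_on continuous_on_subset by blast
qed

definition dgel :: "complex \<Rightarrow> complex \<Rightarrow> complex" where
  "dgel z v = (4 * \<i> * (pa z * pa' z + (z - 1)) * cnj (wr z) * v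
      + 2 * \<i> * ((pa z)\<^sup>2 + (z - 1)\<^sup>2) * cnj (deriv wr z) * cnj v) /\<^sub>R (sg z)\<^sup>2
    - (4 * Re ((cnj (pa z) * pa' z + cnj (z - 1)) * v) / (sg z)^3) *\<^sub>R (2 * \<i> * ((pa z)\<^sup>2 + (z - 1)\<^sup>2) * cnj (wr z))"

lemma gel_has_derivative: "(gel has_derivative dgel z) (at z)"
proof -
  have s: "sg z \<noteq> 0" using sg_pos[of z] by simp
  have dpa: "(pa has_derivative (\<lambda>v. pa' z * v)) (at z)"
    using pa_deriv by (simp add: has_field_derivative_def)
  have dwr: "(wr has_derivative (\<lambda>v. deriv wr z * v)) (at z)"
    using wr_deriv by (simp add: has_field_derivative_def)
  have eq: "gel = (\<lambda>z. inverse ((sg z)\<^sup>2) *\<^sub>R (2 * \<i> * ((pa z)\<^sup>2 + (z - 1)\<^sup>2) * cnj (wr z)))"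
    by (auto simp: gel_def scaleR_conv_of_real divide_inverse)
  have 1: "((\<lambda>z. inverse ((sg z)\<^sup>2)) has_derivative (\<lambda>v. - (4 * Re ((cnj (pa z) * pa' z + cnj (z - 1)) * v) / (sg z)^3))) (at z)"
    by (rule derivative_eq_intros sg_has_derivative refl | (use s in simp; fail))+
      (use s in \<open>simp add: fun_eq_iff divide_simps power2_eq_square power3_eq_cube\<close>)
  have 2: "((\<lambda>z. 2 * \<i> * ((pa z)\<^sup>2 + (z - 1)\<^sup>2) * cnj (wr z)) has_derivative
      (\<lambda>v. 2 * \<i> * ((pa z)\<^sup>2 + (z - 1)\<^sup>2) * cnj (deriv wr z * v) + 2 * \<i> * (2 * pa z * (pa' z * v) + 2 * (z - 1) * v) * cnj (wr z))) (at z)"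
    by (rule derivative_eq_intros dpa dwr refl)+ (simp add: fun_eq_iff algebra_simps power2_eq_square)
  show ?thesis
    unfolding eq
    by (rule has_derivative_eq_rhs[OF has_derivative_scaleR[OF 1 2]])
      (simp add: dgel_def fun_eq_iff algebra_simps)
qed

text \<open>The left-hand side is the Laplacian of \<open>el\<close>, as the trace of the derivative
  of its gradient. A linear coordinate on the unit sphere is an eigenfunction for the eigenvalue 2;
  pulling back by a conformal map brings in the conformal factor, twice which is
  \<open>rho\<close>.\<close>

lemma div_gel: "Re (dgel z 1) + Im (dgel z \<i>) = - rho z * el z"
proof -
  define a b c w s where "a = pa z" and "b = z - 1" and "c = pa' z" and "w = c * b - a" and "s = sg z"
  have s: "s > 0" using sg_pos[of z] by (simp add: s_def)
  have wr: "wr z = w" by (simp add: wr_def a_def b_def c_def w_def)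
  have S: "of_real s = a * cnj a + b * cnj b"
    by (simp only: s_def sg_def a_def b_def of_real_add complex_norm_square)
  define n where "n = 2 * \<i> * (a\<^sup>2 + b\<^sup>2)"
  define n' where "n' = 4 * \<i> * (a * c + b)"
  define g where "g = cnj a * c + cnj b"
  have d: "dgel z v = (n' * cnj w * v + n * cnj (deriv wr z) * cnj v) /\<^sub>R s\<^sup>2 - (4 * Re (g * v) / s^3) *\<^sub>R (n * cnj w)" for v
    by (simp add: dgel_def wr a_def b_def c_def n_def n'_def g_def s_def)
  have "Re (dgel z 1) + Im (dgel z \<i>) = 2 * Re (n' * cnj w) / s\<^sup>2 - 4 * Re (n * cnj w * g) / s^3"
  proof -
    have "Re ((u * 1 + \<gamma> * cnj 1) /\<^sub>R s2 - (4 * Re (g * 1) / s3) *\<^sub>R q) + Im ((u * \<i> + \<gamma> * cnj \<i>) /\<^sub>R s2 - (4 * Re (g * \<i>) / s3) *\<^sub>R q)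
      = 2 * Re u / s2 - 4 * Re (q * g) / s3" for u \<gamma> q g :: complex and s2 s3 :: real
      by (simp add: divide_inverse algebra_simps)
    then show ?thesis unfolding d .
  qed
  also have "\<dots> = 2 / s^3 * Re (cnj w * (n' * of_real s - 2 * n * g))"
  proof -
    have e1: "2 * Re u / s\<^sup>2 - 4 * Re q / s^3 = 2 / s^3 * (s * Re u - 2 * Re q)" for u q :: complex
      using s by (simp add: field_simps power2_eq_square power3_eq_cube)
    have e2: "Re (cnj w * (n' * of_real s - 2 * n * g)) = s * Re (n' * cnj w) - 2 * Re (n * cnj w * g)"
      by (simp add: algebra_simps)
    show ?thesis unfolding e2 by (rule e1)
  qed
  \<comment> \<open>All terms cancel except a multiple of \<open>w\<close>, so the derivative of the
    Gauss map factors out and, with its conjugate, gives the squared modulus in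
    \<open>rho\<close>.\<close>
  also have "n' * of_real s - 2 * n * g = 4 * \<i> * w * (a * cnj b - b * cnj a)"
    unfolding S n_def n'_def g_def w_def by (simp add: power2_eq_square algebra_simps)
  also have "a * cnj b - b * cnj a = 2 * \<i> * of_real (Im (a * cnj b))"
    by (simp add: complex_eq_iff)
  also have "cnj w * (4 * \<i> * w * (2 * \<i> * of_real (Im (a * cnj b)))) = of_real (- 8 * (cmod w)\<^sup>2 * Im (a * cnj b))"
  proof -
    have "W * (4 * \<i> * w * (2 * \<i> * t)) = - 8 * (w * W) * t" for W t
      by (simp add: algebra_simps)
    then have "cnj w * (4 * \<i> * w * (2 * \<i> * of_real (Im (a * cnj b)))) = - 8 * (w * cnj w) * of_real (Im (a * cnj b))" .
    also have "w * cnj w = of_real ((cmod w)\<^sup>2)" by (rule complex_norm_square[symmetric])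
    finally show ?thesis by (simp only: of_real_mult of_real_minus of_real_numeral)
  qed
  also have "2 / s^3 * Re (of_real (- 8 * (cmod w)\<^sup>2 * Im (a * cnj b))) = - rho z * el z"
  proof -
    have "2 / s^3 * (- 8 * W * t) = - (8 * W / s\<^sup>2) * (2 * t / s)" for W t :: real
      by (simp add: power2_eq_square power3_eq_cube)
    then show ?thesis
      unfolding rho_def el_def wr a_def[symmetric] b_def[symmetric] s_def[symmetric] Re_complex_of_real .
  qed
  finally show ?thesis .
qed

lemma continuous_dgel: "continuous_on A (\<lambda>z. dgel z v)"
  unfolding dgel_def[abs_def]
  by (intro continuous_intros continuous_pa continuous_pa' continuous_sg continuous_wr continuous_deriv_wr)
    (use sg_pos less_imp_neq in fastforce)+

text \<open>The weak form of the Jacobi equation: the field \<open>gel\<close> multiplied by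
  \<open>\<phi>\<close> has compact support, so its divergence integrates to 0.\<close>

lemma jacobi:
  assumes "\<phi> \<in> test_functions W"
  shows "integrable lborel (\<lambda>z. grad \<phi> z \<bullet> gel z)" "integrable lborel (\<lambda>z. rho z * el z * \<phi> z)"
    "(\<integral>z. grad \<phi> z \<bullet> gel z \<partial>lborel) = (\<integral>z. rho z * el z * \<phi> z \<partial>lborel)"
proof -
  obtain K where K: "\<And>z. (\<phi> has_derivative (\<lambda>v. grad \<phi> z \<bullet> v)) (at z)" "continuous_on UNIV (grad \<phi>)"
    "compact K" "\<And>z. z \<notin> K \<Longrightarrow> \<phi> z = 0" "\<And>z. z \<notin> K \<Longrightarrow> grad \<phi> z = 0"
    using test_functionsE[OF assms] by metis
  have cp: "continuous_on UNIV \<phi>" by (rule test_continuous[OF assms])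
  show 1: "integrable lborel (\<lambda>z. grad \<phi> z \<bullet> gel z)"
    by (rule integrable_compact_support[OF _ K(3)]) (use K continuous_gel in \<open>auto intro!: continuous_intros\<close>)
  show 2: "integrable lborel (\<lambda>z. rho z * el z * \<phi> z)"
    by (rule integrable_compact_support[OF _ K(3)]) (use K continuous_el continuous_rho cp in \<open>auto intro!: continuous_intros\<close>)
  have lin: "linear (dgel z)" for z
    using gel_has_derivative has_derivative_linear by blast
  have dec: "dgel z v = Re v *\<^sub>R dgel z 1 + Im v *\<^sub>R dgel z \<i>" for z v
  proof -
    have "v = Re v *\<^sub>R 1 + Im v *\<^sub>R \<i>" by (simp add: complex_eq_iff)
    then have "dgel z v = dgel z (Re v *\<^sub>R 1 + Im v *\<^sub>R \<i>)" by (rule arg_cong)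
    then show ?thesis by (simp only: linear_add[OF lin] linear_scale[OF lin])
  qed
  \<comment> \<open>Stated for a linear functional so that one argument serves both components:
    \<open>Re\<close> in direction 1 and \<open>Im\<close> in direction \<open>\<i>\<close> add up
    to the divergence.\<close>
  have zero: "(\<integral>z. (f (gel z) *\<^sub>R grad \<phi> z + \<phi> z *\<^sub>R Complex (f (dgel z 1)) (f (dgel z \<i>))) \<bullet> v \<partial>lborel) = 0"
    and int: "integrable lborel (\<lambda>z. (f (gel z) *\<^sub>R grad \<phi> z + \<phi> z *\<^sub>R Complex (f (dgel z 1)) (f (dgel z \<i>))) \<bullet> v)"
    if f: "bounded_linear f" for f :: "complex \<Rightarrow> real" and v
  proof -
    interpret f: bounded_linear f by (rule f)
    have d: "((\<lambda>z. f (gel z)) has_derivative (\<lambda>v. Complex (f (dgel z 1)) (f (dgel z \<i>)) \<bullet> v)) (at z)" for z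
    proof (rule has_derivative_eq_rhs[OF f.has_derivative[OF gel_has_derivative]], rule ext)
      fix v show "f (dgel z v) = Complex (f (dgel z 1)) (f (dgel z \<i>)) \<bullet> v"
        using arg_cong[OF dec[of z v], of f] by (simp only: f.add f.scaleR inner_complex_def complex.sel real_scaleR_def mult.commute)
    qed
    have c: "continuous_on UNIV (\<lambda>z. Complex (f (dgel z 1)) (f (dgel z \<i>)))"
      unfolding Complex_eq
      by (intro continuous_on_add continuous_on_mult continuous_on_of_real continuous_on_const f.continuous_on continuous_dgel)
    have t: "(\<lambda>z. \<phi> z * f (gel z)) \<in> test_functions UNIV"
      by (rule subsetD[OF test_mono[OF subset_UNIV] test_mult(1)[OF assms d c]])
    have g: "grad (\<lambda>z. \<phi> z * f (gel z)) = (\<lambda>z. f (gel z) *\<^sub>R grad \<phi> z + \<phi> z *\<^sub>R Complex (f (dgel z 1)) (f (dgel z \<i>)))"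
      by (rule test_mult(2)[OF assms d c])
    show "(\<integral>z. (f (gel z) *\<^sub>R grad \<phi> z + \<phi> z *\<^sub>R Complex (f (dgel z 1)) (f (dgel z \<i>))) \<bullet> v \<partial>lborel) = 0"
      using integral_dir_deriv_zero[OF t, of v] unfolding g .
    show "integrable lborel (\<lambda>z. (f (gel z) *\<^sub>R grad \<phi> z + \<phi> z *\<^sub>R Complex (f (dgel z 1)) (f (dgel z \<i>))) \<bullet> v)"
    proof (rule integrable_compact_support[OF _ K(3)])
      have "continuous_on UNIV (\<lambda>z. f (gel z))" by (intro f.continuous_on continuous_gel)
      then show "continuous_on UNIV (\<lambda>z. (f (gel z) *\<^sub>R grad \<phi> z + \<phi> z *\<^sub>R Complex (f (dgel z 1)) (f (dgel z \<i>))) \<bullet> v)"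
        by (intro continuous_on_inner continuous_on_add continuous_on_scaleR K(2) cp c continuous_on_const)
    qed (simp add: K)
  qed
  note R = zero[OF bounded_linear_Re, of 1] int[OF bounded_linear_Re, of 1]
  note I = zero[OF bounded_linear_Im, of \<i>] int[OF bounded_linear_Im, of \<i>]
  have "0 = (\<integral>z. (Re (gel z) *\<^sub>R grad \<phi> z + \<phi> z *\<^sub>R Complex (Re (dgel z 1)) (Re (dgel z \<i>))) \<bullet> 1
     + (Im (gel z) *\<^sub>R grad \<phi> z + \<phi> z *\<^sub>R Complex (Im (dgel z 1)) (Im (dgel z \<i>))) \<bullet> \<i> \<partial>lborel)"
    using R I by (subst Bochner_Integration.integral_add) auto
  also have "\<dots> = (\<integral>z. grad \<phi> z \<bullet> gel z - rho z * el z * \<phi> z \<partial>lborel)"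
  proof (rule Bochner_Integration.integral_cong)
    fix z
    have "(Re (gel z) *\<^sub>R grad \<phi> z + \<phi> z *\<^sub>R Complex (Re (dgel z 1)) (Re (dgel z \<i>))) \<bullet> 1
       + (Im (gel z) *\<^sub>R grad \<phi> z + \<phi> z *\<^sub>R Complex (Im (dgel z 1)) (Im (dgel z \<i>))) \<bullet> \<i>
       = grad \<phi> z \<bullet> gel z + \<phi> z * (Re (dgel z 1) + Im (dgel z \<i>))"
      by (simp add: inner_complex_def algebra_simps)
    then show "(Re (gel z) *\<^sub>R grad \<phi> z + \<phi> z *\<^sub>R Complex (Re (dgel z 1)) (Re (dgel z \<i>))) \<bullet> 1
       + (Im (gel z) *\<^sub>R grad \<phi> z + \<phi> z *\<^sub>R Complex (Im (dgel z 1)) (Im (dgel z \<i>))) \<bullet> \<i>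
       = grad \<phi> z \<bullet> gel z - rho z * el z * \<phi> z"
      unfolding div_gel by (simp add: algebra_simps)
  qed simp
  also have "\<dots> = (\<integral>z. grad \<phi> z \<bullet> gel z \<partial>lborel) - (\<integral>z. rho z * el z * \<phi> z \<partial>lborel)"
    using 1 2 by simp
  finally show "(\<integral>z. grad \<phi> z \<bullet> gel z \<partial>lborel) = (\<integral>z. rho z * el z * \<phi> z \<partial>lborel)" by simp
qed

text \<open>A linear coordinate on the unit sphere has gradient of length at most 1, and
  \<open>rho z / 2\<close> is the conformal factor of the pullback. As \<open>rho\<close> is
  integrable, \<open>el\<close> has finite energy.\<close>

lemma gel_bound: "(cmod (gel z))\<^sup>2 \<le> rho z / 2"
proof -
  have s: "sg z > 0" by (rule sg_pos)
  have "cmod ((pa z)\<^sup>2 + (z - 1)\<^sup>2) \<le> sg z"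
    using norm_triangle_ineq[of "(pa z)\<^sup>2" "(z - 1)\<^sup>2"] by (simp add: sg_def norm_power)
  then have "(cmod ((pa z)\<^sup>2 + (z - 1)\<^sup>2))\<^sup>2 \<le> (sg z)\<^sup>2" by (intro power_mono) auto
  then have "4 * ((cmod ((pa z)\<^sup>2 + (z - 1)\<^sup>2))\<^sup>2 * (cmod (wr z))\<^sup>2) / ((sg z)\<^sup>2)\<^sup>2 \<le> 4 * ((sg z)\<^sup>2 * (cmod (wr z))\<^sup>2) / ((sg z)\<^sup>2)\<^sup>2"
    by (intro divide_right_mono mult_left_mono mult_right_mono) auto
  also have "\<dots> = rho z / 2"
    using s by (simp add: rho_def power2_eq_square)
  finally show ?thesis
    using s by (simp add: gel_def norm_mult norm_divide norm_power power_mult_distrib power_divide)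
qed

lemma el_bound: "\<bar>el z\<bar> \<le> 1"
proof -
  have s: "sg z > 0" by (rule sg_pos)
  have "\<bar>Im (pa z * cnj (z - 1))\<bar> \<le> cmod (pa z) * cmod (z - 1)"
    using abs_Im_le_cmod[of "pa z * cnj (z - 1)"] by (simp add: norm_mult del: complex_cnj_diff)
  moreover have "2 * (cmod (pa z) * cmod (z - 1)) \<le> sg z"
    using zero_le_power2[of "cmod (pa z) - cmod (z - 1)"] by (simp add: sg_def power2_diff)
  ultimately have *: "2 * \<bar>Im (pa z * cnj (z - 1))\<bar> \<le> sg z" by linarith
  have "\<bar>2 * t / sg z\<bar> = 2 * \<bar>t\<bar> / sg z" for t using s by (simp add: abs_mult)
  then show ?thesis using s * unfolding el_def by (simp only: divide_le_eq_1_pos)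
qed

text \<open>The Gauss map commutes with the antipodal maps: by the first two equations it passes
  from G to -1 / cnj G. Oddness of \<open>m\<close> enters through the sign of the power m -
  1.\<close>

lemma antipodal_pa:
  assumes z: "z \<noteq> 0"
  shows "pa (antipodal z) = cnj (z - 1) / cnj z ^ m" "antipodal z - 1 = - cnj (pa z) / cnj z ^ m"
    "wr (antipodal z) = cnj (wr z) / cnj z ^ (2 * m - 2)"
proof -
  obtain k where k: "m = 2 * k + 1" using odd_m by (elim oddE)
  define w where "w = cnj z"
  have w: "w \<noteq> 0" using z by (simp add: w_def)
  have k2: "k \<ge> 2" using m5 k by simp
  have t: "antipodal z = - 1 / w" by (simp add: antipodal_def w_def)
  have pw: "(- 1 / w) ^ (2 * k) = 1 / w ^ (2 * k)" by (simp add: power_divide)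
  have "pa (antipodal z) = (w - 1) / w ^ (2 * k + 1)"
    unfolding pa_def t using w unfolding k by (simp add: pw field_simps)
  then show "pa (antipodal z) = cnj (z - 1) / cnj z ^ m" by (simp add: w_def k)
  show "antipodal z - 1 = - cnj (pa z) / cnj z ^ m"
    unfolding pa_def t using w unfolding k w_def by (simp add: field_simps)
  obtain j where j: "k = j + 1" using k2 by (metis le_add_diff_inverse2 one_le_numeral order.trans)
  have m2: "m - 2 = 2 * j + 1" "2 * m - 2 = 2 * (2 * j + 1) + 2" by (simp_all add: k j)
  have pw': "(- 1 / w) ^ (2 * j + 1) = - 1 / w ^ (2 * j + 1)" by (simp add: power_divide)
  have "wr (antipodal z) = (- 1 / w ^ (2 * j + 1)) * (of_nat (m - 1) * (- 1 / w)\<^sup>2 - 2 * (- 1 / w) - of_nat (m - 1))"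
    unfolding wr_eq t m2 pw' ..
  also have "\<dots> = w ^ (2 * j + 1) * (of_nat (m - 1) * w\<^sup>2 - 2 * w - of_nat (m - 1)) / w ^ (2 * (2 * j + 1) + 2)"
  proof -
    have e: "w ^ (2 * (2 * j + 1) + 2) = w ^ (2 * j + 1) * w ^ (2 * j + 1) * w\<^sup>2"
      by (simp add: power_add mult_2 power2_eq_square)
    have "(- 1 / W) * (c * (- 1 / w)\<^sup>2 - 2 * (- 1 / w) - c) = W * (c * w\<^sup>2 - 2 * w - c) / (W * W * w\<^sup>2)" if "W \<noteq> 0" for W c :: complex
      using that w by (simp add: divide_simps power2_eq_square)
    then show ?thesis unfolding e using w by simp
  qed
  also have "\<dots> = cnj (wr z) / cnj z ^ (2 * m - 2)"
    unfolding wr_eq m2 w_def by simp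
  finally show "wr (antipodal z) = cnj (wr z) / cnj z ^ (2 * m - 2)" .
qed

text \<open>Antipodal points of the sphere have opposite heights. In the second equation 1 / |z|^4
  is the Jacobian of \<open>antipodal\<close>, so \<open>rho\<close> is invariant as a
  density.\<close>

lemma antipodal_el: "z \<noteq> 0 \<Longrightarrow> el (antipodal z) = - el z"
  and antipodal_rho: "z \<noteq> 0 \<Longrightarrow> rho (antipodal z) / cmod z ^ 4 = rho z"
proof -
  assume z: "z \<noteq> 0"
  define r where "r = cmod z ^ m"
  have r: "r > 0" using z by (simp add: r_def)
  have sgt: "sg (antipodal z) = sg z / r\<^sup>2"
    unfolding sg_def antipodal_pa(1,2)[OF z]
    by (simp add: norm_divide norm_power power_divide r_def add_divide_distrib del: complex_cnj_diff)
  have "pa (antipodal z) * cnj (antipodal z - 1) = - (pa z * cnj (z - 1)) / (z ^ m * cnj z ^ m)"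
    unfolding antipodal_pa(1,2)[OF z] by (simp add: mult.commute)
  also have "z ^ m * cnj z ^ m = of_real (r\<^sup>2)"
    unfolding power_mult_distrib[symmetric] complex_norm_square[symmetric] r_def
    by (simp add: power_mult[symmetric] mult.commute)
  finally have *: "pa (antipodal z) * cnj (antipodal z - 1) = - (pa z * cnj (z - 1)) / of_real (r\<^sup>2)" .
  then have **: "Im (pa (antipodal z) * cnj (antipodal z - 1)) = - Im (pa z * cnj (z - 1)) / r\<^sup>2"
    by (simp only: Im_divide_of_real uminus_complex.simps)
  show "el (antipodal z) = - el z"
  proof -
    have "2 * (- t / r\<^sup>2) / (S / r\<^sup>2) = - (2 * t / S)" for t S using r by simp
    then show ?thesis unfolding el_def sgt ** .
  qed
  have "cmod z ^ (2 * m - 2) * cmod z ^ 2 = r\<^sup>2"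
  proof -
    have "cmod z ^ (2 * m - 2) * cmod z ^ 2 = cmod z ^ (m * 2)"
      unfolding power_add[symmetric] using m5 by (intro arg_cong[of _ _ "power (cmod z)"]) linarith
    then show ?thesis by (simp add: r_def power_mult)
  qed
  then have q: "cmod z ^ (2 * m - 2) = r\<^sup>2 / (cmod z)\<^sup>2" using z by (simp add: field_simps)
  have "rho (antipodal z) = 8 * ((cmod (wr z))\<^sup>2 / (r\<^sup>2 / (cmod z)\<^sup>2)\<^sup>2) / (sg z / r\<^sup>2)\<^sup>2"
  proof -
    have "cmod (wr (antipodal z)) = cmod (wr z) / (r\<^sup>2 / (cmod z)\<^sup>2)"
      unfolding q[symmetric] antipodal_pa(3)[OF z] by (simp only: norm_divide norm_power complex_mod_cnj)
    then show ?thesis unfolding rho_def sgt by (simp only: power_divide)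
  qed
  also have "\<dots> = rho z * cmod z ^ 4"
  proof -
    have "8 * (W / (R / c\<^sup>2)\<^sup>2) / (S / R)\<^sup>2 = 8 * W / S\<^sup>2 * c ^ 4" if "R \<noteq> 0" "c \<noteq> 0" "S \<noteq> 0" for W R S c :: real
      using that by (simp add: field_simps power2_eq_square power4_eq_xxxx)
    from this[of "r\<^sup>2" "cmod z" "sg z" "(cmod (wr z))\<^sup>2"] show ?thesis
      using r z sg_pos[of z] by (simp add: rho_def)
  qed
  finally show "rho (antipodal z) / cmod z ^ 4 = rho z" using z by simp
qed

lemma antipodal_deriv:
  assumes "z \<noteq> 0"
  shows "(antipodal has_derivative (\<lambda>h. (1 / (cnj z)\<^sup>2) * cnj h)) (at z)"
proof -
  have "((\<lambda>w. - 1 / w) has_derivative (\<lambda>h. h / (cnj z)\<^sup>2)) (at (cnj z))"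
    using assms by (auto intro!: derivative_eq_intros simp: fun_eq_iff power2_eq_square field_simps)
  then have "((\<lambda>w. - 1 / cnj w) has_derivative (\<lambda>h. cnj h / (cnj z)\<^sup>2)) (at z)"
    using has_derivative_compose[of cnj cnj z UNIV "\<lambda>w. - 1 / w" "\<lambda>h. h / (cnj z)\<^sup>2"]
    by (auto intro!: derivative_eq_intros)
  then show ?thesis by (simp add: antipodal_def[abs_def])
qed

definition lower :: "complex set" where "lower = {z. Im (pa z * cnj (z - 1)) < 0}"

lemma el_sign: "el z > 0 \<longleftrightarrow> z \<in> upper" "el z < 0 \<longleftrightarrow> z \<in> lower"
  using sg_pos[of z] by (auto simp: el_def upper_def lower_def zero_less_divide_iff divide_less_0_iff)

lemma antipodal_upper: "z \<noteq> 0 \<Longrightarrow> antipodal z \<in> lower \<longleftrightarrow> z \<in> upper" "z \<noteq> 0 \<Longrightarrow> antipodal z \<in> upper \<longleftrightarrow> z \<in> lower"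
  using antipodal_el[of z] el_sign[of z] el_sign[of "antipodal z"] by auto

lemma lower_eq: "lower = antipodal ` upper"
proof
  show "lower \<subseteq> antipodal ` upper"
  proof
    fix z assume z: "z \<in> lower"
    have "z \<noteq> 0" using z m5 by (auto simp: lower_def pa_def)
    then have "antipodal z \<in> upper" using antipodal_upper(2) z by blast
    then show "z \<in> antipodal ` upper" using antipodal_involution(1)[of z] by (metis image_eqI)
  qed
qed (use antipodal_upper(1) upper_nz(2) in auto)

text \<open>Off the real axis the Gauss map is locally invertible, and the nodal set is locally the
  image of a piece of the real line under the differentiable inverse; the real axis itself is a null
  set.\<close>

lemma nodal_negligible: "negligible {z. el z = 0}"
proof -
  define N where "N = {z. el z = 0} - \<real>"
  have neg_real: "negligible (\<real> :: complex set)"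
  proof -
    have "(\<real> :: complex set) = {z. \<i> \<bullet> z = 0}" by (auto simp: inner_complex_def complex_is_Real_iff)
    then show ?thesis using negligible_hyperplane[of \<i> 0] by simp
  qed
  have "negligible N"
  proof (subst locally_negligible_alt, rule ballI)
    fix x assume x: "x \<in> N"
    then have xr: "Im x \<noteq> 0" by (auto simp: N_def complex_is_Real_iff)
    then have x1: "x \<noteq> 1" by auto
    have hol: "GG holomorphic_on - {1}"
      using GG_deriv by (auto simp: holomorphic_on_open open_Compl)
    have dn: "deriv GG x \<noteq> 0" using DERIV_imp_deriv[OF GG_deriv[OF x1]] wr_nz[OF xr] x1 by simp
    obtain r where r: "r > 0" "ball x r \<subseteq> - {1}" "inj_on GG (ball x r)"
      using has_complex_derivative_locally_injective[OF hol _ _ dn] x1 by (auto simp: open_Compl)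
    obtain g where g: "g holomorphic_on (GG ` ball x r)" "\<And>z. z \<in> ball x r \<Longrightarrow> g (GG z) = z"
      by (rule holomorphic_has_inverse[OF holomorphic_on_subset[OF hol r(2)] open_ball r(3)]) (rule that)
    have "N \<inter> ball x r \<subseteq> g ` (GG ` ball x r \<inter> \<real>)"
    proof
      fix z assume z: "z \<in> N \<inter> ball x r"
      then have "z \<noteq> 1" "el z = 0" using r by (auto simp: N_def)
      then have "Im (pa z * cnj (z - 1)) = 0" using sg_pos[of z] by (simp add: el_def)
      then have "GG z \<in> \<real>" using Im_GG[OF \<open>z \<noteq> 1\<close>] by (simp add: complex_is_Real_iff)
      then show "z \<in> g ` (GG ` ball x r \<inter> \<real>)" using g(2)[of z] z by (metis IntD2 IntI image_eqI)
    qed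
    moreover have "negligible (g ` (GG ` ball x r \<inter> \<real>))"
    proof (rule negligible_differentiable_image_negligible)
      show "negligible (GG ` ball x r \<inter> \<real>)" using neg_real by (rule negligible_subset) auto
      show "g differentiable_on (GG ` ball x r \<inter> \<real>)"
        using holomorphic_on_imp_differentiable_on[OF g(1)] by (rule differentiable_on_subset) auto
    qed simp
    ultimately have "negligible (N \<inter> ball x r)" by (rule negligible_subset[rotated])
    then show "\<exists>U. openin (top_of_set N) U \<and> x \<in> U \<and> negligible U"
      using x r(1) by (intro exI[of _ "N \<inter> ball x r"]) (auto intro: openin_open_Int)
  qed
  then have "negligible (N \<union> \<real>)" using neg_real by (rule negligible_Un)
  then show ?thesis by (rule negligible_subset) (auto simp: N_def)
qed

lemma AE_upper_lower: "AE z in lborel. z \<in> upper \<or> z \<in> lower"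
proof -
  have "AE z in lborel. z \<notin> {z. el z = 0}" by (rule AE_lborel_negligible[OF nodal_negligible])
  then show ?thesis by eventually_elim (use el_sign in force)
qed

end

section \<open>Cells: the preimages of the two open hemispheres\<close>

context oliveira
begin

text \<open>The parametrisation of a cell by the strip. The flag distinguishes the two cells that
  the involution exchanges: \<open>True\<close> for the one where \<open>el\<close> is positive,
  \<open>False\<close> for its antipodal image.\<close>

definition kap :: "complex \<Rightarrow> bool \<Rightarrow> complex \<Rightarrow> complex" where
  "kap \<alpha> b \<zeta> = (if b then branch \<alpha> \<zeta> else antipodal (branch \<alpha> \<zeta>))"

definition kfac :: "complex \<Rightarrow> bool \<Rightarrow> complex \<Rightarrow> complex" where
  "kfac \<alpha> b \<zeta> = (if b then rr (branch \<alpha> \<zeta>) else cnj (rr (branch \<alpha> \<zeta>)) / (cnj (branch \<alpha> \<zeta>))\<^sup>2)"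

definition cell :: "complex \<Rightarrow> bool \<Rightarrow> complex set" where "cell \<alpha> b = kap \<alpha> b ` strip"

definition cells :: "(complex \<times> bool) set" where "cells = fib \<times> UNIV"

lemma finite_cells: "finite cells"
  by (simp add: cells_def card_fib)

lemma cell_True: "cell \<alpha> True = dom \<alpha>" and cell_False: "cell \<alpha> False = antipodal ` dom \<alpha>"
  by (auto simp: cell_def dom_def kap_def image_iff)

lemma branch_nz: "\<alpha> \<in> fib \<Longrightarrow> \<zeta> \<in> strip \<Longrightarrow> branch \<alpha> \<zeta> \<noteq> 0"
  using branchD(2) upper_nz(2) by blast

lemma kap_deriv:
  assumes "\<alpha> \<in> fib" "\<zeta> \<in> strip"
  shows "(kap \<alpha> b has_derivative (\<lambda>h. kfac \<alpha> b \<zeta> * (if b then h else cnj h))) (at \<zeta>)"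
proof (cases b)
  case True
  have "kap \<alpha> True = branch \<alpha>" by (simp add: kap_def fun_eq_iff)
  then show ?thesis using branch_deriv[OF assms] True by (simp add: kfac_def has_field_derivative_def)
next
  case False
  have e: "kap \<alpha> False = (\<lambda>\<zeta>. antipodal (branch \<alpha> \<zeta>))" by (simp add: kap_def fun_eq_iff)
  have "(branch \<alpha> has_derivative (\<lambda>h. rr (branch \<alpha> \<zeta>) * h)) (at \<zeta>)"
    using branch_deriv[OF assms] by (simp add: has_field_derivative_def)
  from has_derivative_compose[OF this antipodal_deriv[OF branch_nz[OF assms]]]
  show ?thesis using False by (simp add: e kfac_def mult.assoc)
qed

lemma kap_conformal: "conformal_factor (\<lambda>h. kfac \<alpha> b \<zeta> * (if b then h else cnj h)) (kfac \<alpha> b \<zeta>)"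
  by (auto simp: conformal_factor_def)

lemma continuous_kfac:
  assumes "\<alpha> \<in> fib"
  shows "continuous_on strip (kfac \<alpha> b)"
proof -
  have "wr (branch \<alpha> \<zeta>) \<noteq> 0" if "\<zeta> \<in> strip" for \<zeta>
    using wr_nz upper_not_real branchD(2)[OF assms that] by blast
  then have r: "continuous_on strip (\<lambda>\<zeta>. rr (branch \<alpha> \<zeta>))"
    unfolding rr_def
    by (intro continuous_intros continuous_on_compose2[OF continuous_pa[of UNIV]] continuous_on_compose2[OF continuous_wr[of UNIV]]
        branchD(1)[OF assms]) auto
  show ?thesis
    unfolding kfac_def
    by (cases b) (auto intro!: continuous_intros r branchD(1)[OF assms] simp: branch_nz[OF assms])
qed

lemma continuous_kap: "\<alpha> \<in> fib \<Longrightarrow> continuous_on strip (kap \<alpha> b)"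
  using kap_deriv by (intro continuous_at_imp_continuous_on ballI has_derivative_continuous)

lemma kap_inj: "\<alpha> \<in> fib \<Longrightarrow> inj_on (kap \<alpha> b) strip"
  using branch_inj[of \<alpha>] unfolding kap_def inj_on_def by (cases b) (auto dest: arg_cong[of _ _ antipodal] simp: antipodal_involution)

lemma rho_kap:
  assumes "\<alpha> \<in> fib" "\<zeta> \<in> strip"
  shows "(cmod (kfac \<alpha> b \<zeta>))\<^sup>2 * rho (kap \<alpha> b \<zeta>) = 2 * sech2 \<zeta>"
proof (cases b)
  case True then show ?thesis using rho_branch[OF assms] by (simp add: kfac_def kap_def)
next
  case False
  define z where "z = branch \<alpha> \<zeta>"
  have z: "z \<noteq> 0" using branch_nz[OF assms] by (simp add: z_def)
  have "(cmod (kfac \<alpha> b \<zeta>))\<^sup>2 * rho (kap \<alpha> b \<zeta>) = (cmod (rr z))\<^sup>2 * (rho (antipodal z) / cmod z ^ 4)"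
    using False by (simp add: kfac_def kap_def z_def norm_divide norm_power power_divide power_mult[symmetric])
  then show ?thesis using rho_branch[OF assms] unfolding antipodal_rho[OF z] by (simp only: z_def)
qed

lemma open_cell: "\<alpha> \<in> fib \<Longrightarrow> open (cell \<alpha> b)"
  unfolding cell_def using continuous_kap kap_inj open_strip by (intro invariance_of_domain) auto

lemma cells_Union: "(\<Union>(\<alpha>, b)\<in>cells. cell \<alpha> b) = upper \<union> lower"
proof -
  have "(\<Union>(\<alpha>, b)\<in>cells. cell \<alpha> b) = (\<Union>\<alpha>\<in>fib. cell \<alpha> True) \<union> (\<Union>\<alpha>\<in>fib. cell \<alpha> False)"
    unfolding cells_def by (auto simp: UNIV_bool)
  also have "(\<Union>\<alpha>\<in>fib. cell \<alpha> True) = upper" using dom_cover by (simp add: cell_True)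
  also have "(\<Union>\<alpha>\<in>fib. cell \<alpha> False) = lower"
    unfolding cell_False lower_eq dom_cover[symmetric] by blast
  finally show ?thesis .
qed

lemma cell_subset: "\<alpha> \<in> fib \<Longrightarrow> cell \<alpha> b \<subseteq> (if b then upper else lower)"
  using dom_cover by (cases b) (auto simp: cell_True cell_False lower_eq)

lemma cells_disjoint:
  assumes "(\<alpha>, b) \<in> cells" "(\<beta>, c) \<in> cells" "(\<alpha>, b) \<noteq> (\<beta>, c)"
  shows "cell \<alpha> b \<inter> cell \<beta> c = {}"
proof (cases "b = c")
  case False
  have "upper \<inter> lower = {}" by (auto simp: upper_def lower_def)
  then show ?thesis using False cell_subset[of \<alpha> b] cell_subset[of \<beta> c] assms by (cases b; cases c) (auto simp: cells_def)
next
  case True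
  then have "dom \<alpha> \<inter> dom \<beta> = {}" using assms dom_disjoint by (auto simp: cells_def)
  moreover have "antipodal ` dom \<alpha> \<inter> antipodal ` dom \<beta> = antipodal ` (dom \<alpha> \<inter> dom \<beta>)"
    by (rule image_Int[symmetric]) (metis antipodal_involution(1) injI)
  ultimately show ?thesis using True by (cases b) (auto simp: cell_True cell_False)
qed

text \<open>Measurability is asked for on the cell only: the change of variables is applied to the
  extension of \<open>F\<close> by 0, which does not alter either integral.\<close>

lemma cell_integral:
  fixes F :: "complex \<Rightarrow> real"
  assumes a: "\<alpha> \<in> fib" and m: "(\<lambda>z. indicator (cell \<alpha> b) z * F z) \<in> borel_measurable borel"
  shows "set_integrable lborel strip (\<lambda>\<zeta>. (cmod (kfac \<alpha> b \<zeta>))\<^sup>2 * F (kap \<alpha> b \<zeta>)) \<longleftrightarrow> set_integrable lborel (cell \<alpha> b) F"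
    and "set_integrable lborel (cell \<alpha> b) F \<Longrightarrow>
      (LINT \<zeta>:strip|lborel. (cmod (kfac \<alpha> b \<zeta>))\<^sup>2 * F (kap \<alpha> b \<zeta>)) = (LINT z:cell \<alpha> b|lborel. F z)"
proof -
  let ?F = "\<lambda>z. indicator (cell \<alpha> b) z * F z"
  have C1: "set_integrable lborel strip (\<lambda>\<zeta>. (cmod (kfac \<alpha> b \<zeta>))\<^sup>2 * ?F (kap \<alpha> b \<zeta>)) \<longleftrightarrow>
      set_integrable lborel (cell \<alpha> b) ?F"
    unfolding cell_def[of \<alpha> b]
    by (rule conformal_change_of_variables(1)[OF open_strip m[unfolded cell_def] kap_deriv[OF a, of _ b] kap_conformal continuous_kfac[OF a] kap_inj[OF a]])
  have C2: "set_integrable lborel (cell \<alpha> b) ?F \<Longrightarrow>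
      (LINT \<zeta>:strip|lborel. (cmod (kfac \<alpha> b \<zeta>))\<^sup>2 * ?F (kap \<alpha> b \<zeta>)) = (LINT z:cell \<alpha> b|lborel. ?F z)"
    unfolding cell_def[of \<alpha> b]
    by (rule conformal_change_of_variables(2)[OF open_strip m[unfolded cell_def] kap_deriv[OF a, of _ b] kap_conformal continuous_kfac[OF a] kap_inj[OF a]])
  have e1: "set_integrable lborel strip (\<lambda>\<zeta>. (cmod (kfac \<alpha> b \<zeta>))\<^sup>2 * ?F (kap \<alpha> b \<zeta>)) =
      set_integrable lborel strip (\<lambda>\<zeta>. (cmod (kfac \<alpha> b \<zeta>))\<^sup>2 * F (kap \<alpha> b \<zeta>))"
    by (rule set_integrable_cong) (auto simp: cell_def)
  have e2: "set_integrable lborel (cell \<alpha> b) ?F = set_integrable lborel (cell \<alpha> b) F"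
    by (rule set_integrable_cong) auto
  have e3: "(LINT \<zeta>:strip|lborel. (cmod (kfac \<alpha> b \<zeta>))\<^sup>2 * ?F (kap \<alpha> b \<zeta>)) =
      (LINT \<zeta>:strip|lborel. (cmod (kfac \<alpha> b \<zeta>))\<^sup>2 * F (kap \<alpha> b \<zeta>))"
    by (rule set_lebesgue_integral_cong) (use open_strip in \<open>auto simp: cell_def\<close>)
  have e4: "(LINT z:cell \<alpha> b|lborel. ?F z) = (LINT z:cell \<alpha> b|lborel. F z)"
    by (rule set_lebesgue_integral_cong) (use open_cell[OF a] in auto)
  show "set_integrable lborel strip (\<lambda>\<zeta>. (cmod (kfac \<alpha> b \<zeta>))\<^sup>2 * F (kap \<alpha> b \<zeta>)) \<longleftrightarrow> set_integrable lborel (cell \<alpha> b) F"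
    using C1 unfolding e1 e2 .
  show "set_integrable lborel (cell \<alpha> b) F \<Longrightarrow>
      (LINT \<zeta>:strip|lborel. (cmod (kfac \<alpha> b \<zeta>))\<^sup>2 * F (kap \<alpha> b \<zeta>)) = (LINT z:cell \<alpha> b|lborel. F z)"
    using C2 unfolding e2 e3 e4 .
qed

lemma measurable_indicator_mult:
  fixes F :: "complex \<Rightarrow> real"
  assumes "F \<in> borel_measurable borel" "A \<in> sets borel"
  shows "(\<lambda>z. indicator A z * F z) \<in> borel_measurable borel"
  using assms by measurable

lemma measurable_rho: "rho \<in> borel_measurable borel" and measurable_el: "el \<in> borel_measurable borel"
  and measurable_gel: "gel \<in> borel_measurable borel"
  by (rule borel_measurable_continuous_onI; rule continuous_rho continuous_el continuous_gel)+

lemma cell_borel: "\<alpha> \<in> fib \<Longrightarrow> cell \<alpha> b \<in> sets borel"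
  using open_cell by auto

lemma integrable_rho_cell:
  assumes "\<alpha> \<in> fib"
  shows "set_integrable lborel (cell \<alpha> b) rho"
proof -
  have "set_integrable lborel strip (\<lambda>\<zeta>. 2 * sech2 \<zeta>)"
    using integrable_sech2 by (rule set_integrable_mult_right)
  also have "set_integrable lborel strip (\<lambda>\<zeta>. 2 * sech2 \<zeta>) = set_integrable lborel strip (\<lambda>\<zeta>. (cmod (kfac \<alpha> b \<zeta>))\<^sup>2 * rho (kap \<alpha> b \<zeta>))"
    by (rule set_integrable_cong) (auto simp: rho_kap[OF assms])
  also have "\<dots> = set_integrable lborel (cell \<alpha> b) rho"
    by (rule cell_integral(1)[OF assms measurable_indicator_mult[OF measurable_rho cell_borel[OF assms]]])
  finally show ?thesis .
qed

text \<open>The cells are disjoint and exhaust the plane up to the nodal set, which is a null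
  set.\<close>

lemma cells_integral:
  fixes F :: "complex \<Rightarrow> real"
  assumes F: "\<And>\<alpha> b. (\<alpha>, b) \<in> cells \<Longrightarrow> set_integrable lborel (cell \<alpha> b) F" and m: "F \<in> borel_measurable borel"
  shows "integrable lborel F" "(\<integral>z. F z \<partial>lborel) = (\<Sum>(\<alpha>, b)\<in>cells. LINT z:cell \<alpha> b|lborel. F z)"
proof -
  let ?G = "\<lambda>z. \<Sum>p\<in>cells. indicator (cell (fst p) (snd p)) z *\<^sub>R F z"
  have i: "integrable lborel (\<lambda>z. indicator (cell (fst p) (snd p)) z *\<^sub>R F z)" if "p \<in> cells" for p
    using F[of "fst p" "snd p"] that by (simp add: set_integrable_def)
  have iG: "integrable lborel ?G" by (rule Bochner_Integration.integrable_sum) (rule i)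
  have ae: "AE z in lborel. F z = ?G z"
    using AE_upper_lower
  proof eventually_elim
    fix z assume "z \<in> upper \<or> z \<in> lower"
    then have "z \<in> (\<Union>(\<alpha>, b)\<in>cells. cell \<alpha> b)" unfolding cells_Union by blast
    then obtain p where p: "p \<in> cells" "z \<in> cell (fst p) (snd p)" by force
    have "z \<notin> cell (fst q) (snd q)" if "q \<in> cells" "q \<noteq> p" for q
      using cells_disjoint[of "fst p" "snd p" "fst q" "snd q"] p that by auto
    then have "?G z = (\<Sum>q\<in>cells. if q = p then F z else 0)"
      using p by (intro sum.cong) (auto simp: indicator_def)
    then show "F z = ?G z" using p finite_cells by simp
  qed
  show "integrable lborel F"
    using iG ae m by (subst integrable_cong_AE[where g="?G"]) (auto intro: borel_measurable_integrable)
  have "(\<integral>z. F z \<partial>lborel) = (\<integral>z. ?G z \<partial>lborel)"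
    using ae m iG by (intro integral_cong_AE) auto
  also have "\<dots> = (\<Sum>p\<in>cells. \<integral>z. indicator (cell (fst p) (snd p)) z *\<^sub>R F z \<partial>lborel)"
    by (rule Bochner_Integration.integral_sum) (rule i)
  finally show "(\<integral>z. F z \<partial>lborel) = (\<Sum>(\<alpha>, b)\<in>cells. LINT z:cell \<alpha> b|lborel. F z)"
    by (simp add: set_lebesgue_integral_def split_beta)
qed

lemma integrable_rho: "integrable lborel rho"
  using integrable_rho_cell by (intro cells_integral measurable_rho) (auto simp: cells_def)

text \<open>The strip inequality carried over by the parametrisation: the energy is conformally
  invariant, and \<open>rho\<close> becomes \<open>2 * sech2\<close>. The constant 4 pi is the
  integral of \<open>rho\<close> over a cell.\<close>

lemma cell_inequality:
  fixes f :: "complex \<Rightarrow> real" and g :: "complex \<Rightarrow> complex"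
  assumes a: "\<alpha> \<in> fib"
    and f: "\<And>z. z \<in> cell \<alpha> b \<Longrightarrow> (f has_derivative (\<lambda>v. g z \<bullet> v)) (at z)"
    and g: "continuous_on UNIV g"
    and mf: "f \<in> borel_measurable borel"
    and i1: "set_integrable lborel (cell \<alpha> b) (\<lambda>z. (cmod (g z))\<^sup>2)"
    and i2: "set_integrable lborel (cell \<alpha> b) (\<lambda>z. rho z * (f z)\<^sup>2)"
  shows "set_integrable lborel (cell \<alpha> b) (\<lambda>z. rho z * f z)"
    and "(LINT z:cell \<alpha> b|lborel. rho z * (f z)\<^sup>2) \<le> (LINT z:cell \<alpha> b|lborel. (cmod (g z))\<^sup>2)
      + (LINT z:cell \<alpha> b|lborel. rho z * f z)\<^sup>2 / (4 * pi)"
proof -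
  define k where "k = kap \<alpha> b"
  define c where "c = kfac \<alpha> b"
  have kc: "k \<zeta> \<in> cell \<alpha> b" if "\<zeta> \<in> strip" for \<zeta> using that by (auto simp: cell_def k_def)
  \<comment> \<open>The gradient of the composition is the transposed derivative applied to
    \<open>g\<close>: multiplication by \<open>cnj (c \<zeta>)\<close> for a holomorphic
    parametrisation, with an extra conjugation for an antiholomorphic one.\<close>
  define G where "G \<zeta> = (if b then cnj (c \<zeta>) * g (k \<zeta>) else cnj (g (k \<zeta>)) * c \<zeta>)" for \<zeta>
  have d: "((\<lambda>\<zeta>. f (k \<zeta>)) has_derivative (\<lambda>v. G \<zeta> \<bullet> v)) (at \<zeta>)" if "\<zeta> \<in> strip" for \<zeta>
  proof -
    have "((\<lambda>\<zeta>. f (k \<zeta>)) has_derivative (\<lambda>h. g (k \<zeta>) \<bullet> (c \<zeta> * (if b then h else cnj h)))) (at \<zeta>)"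
      using has_derivative_compose[OF kap_deriv[OF a that, of b] f[OF kc[OF that], unfolded k_def]]
      by (simp add: k_def c_def)
    moreover have "g (k \<zeta>) \<bullet> (c \<zeta> * (if b then h else cnj h)) = G \<zeta> \<bullet> h" for h
      by (simp add: G_def inner_complex_def algebra_simps)
    ultimately show ?thesis by simp
  qed
  have cG: "continuous_on strip G"
    unfolding G_def k_def c_def
    by (cases b) (auto intro!: continuous_intros continuous_kfac[OF a] continuous_on_compose2[OF g continuous_kap[OF a]])
  have nG: "(cmod (G \<zeta>))\<^sup>2 = (cmod (c \<zeta>))\<^sup>2 * (cmod (g (k \<zeta>)))\<^sup>2" for \<zeta>
    by (simp add: G_def norm_mult power_mult_distrib)
  have mb: "(\<lambda>z. indicator (cell \<alpha> b) z * F z) \<in> borel_measurable borel" if "F \<in> borel_measurable borel" for F :: "complex \<Rightarrow> real"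
    by (rule measurable_indicator_mult[OF that cell_borel[OF a]])
  have mg: "g \<in> borel_measurable borel" by (rule borel_measurable_continuous_onI[OF g])
  have m1: "(\<lambda>z. (cmod (g z))\<^sup>2) \<in> borel_measurable borel" using mg by measurable
  have m2: "(\<lambda>z. rho z * (f z)\<^sup>2) \<in> borel_measurable borel" and m3: "(\<lambda>z. rho z * f z) \<in> borel_measurable borel"
    using mf measurable_rho by measurable
  have rk: "(cmod (c \<zeta>))\<^sup>2 * (rho (k \<zeta>) * x) = 2 * (sech2 \<zeta> * x)" if "\<zeta> \<in> strip" for \<zeta> x
    using rho_kap[OF a that, of b] by (simp add: c_def k_def mult.assoc[symmetric])
  have J1: "set_integrable lborel strip (\<lambda>\<zeta>. (cmod (G \<zeta>))\<^sup>2)"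
    using i1 cell_integral(1)[OF a mb[OF m1]] by (simp add: nG c_def k_def)
  have I1: "(LINT \<zeta>:strip|lborel. (cmod (G \<zeta>))\<^sup>2) = (LINT z:cell \<alpha> b|lborel. (cmod (g z))\<^sup>2)"
    using cell_integral(2)[OF a mb[OF m1] i1] by (simp add: nG c_def k_def)
  have eq: "set_integrable lborel strip (\<lambda>\<zeta>. (cmod (c \<zeta>))\<^sup>2 * (rho (k \<zeta>) * F \<zeta>)) = set_integrable lborel strip (\<lambda>\<zeta>. sech2 \<zeta> * F \<zeta>)" for F
  proof -
    have "set_integrable lborel strip (\<lambda>\<zeta>. (cmod (c \<zeta>))\<^sup>2 * (rho (k \<zeta>) * F \<zeta>)) = set_integrable lborel strip (\<lambda>\<zeta>. 2 * (sech2 \<zeta> * F \<zeta>))"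
      by (rule set_integrable_cong) (auto simp: rk)
    then show ?thesis by simp
  qed
  have eqi: "(LINT \<zeta>:strip|lborel. (cmod (c \<zeta>))\<^sup>2 * (rho (k \<zeta>) * F \<zeta>)) = 2 * (LINT \<zeta>:strip|lborel. sech2 \<zeta> * F \<zeta>)" for F
  proof -
    have "(LINT \<zeta>:strip|lborel. (cmod (c \<zeta>))\<^sup>2 * (rho (k \<zeta>) * F \<zeta>)) = (LINT \<zeta>:strip|lborel. 2 * (sech2 \<zeta> * F \<zeta>))"
      by (rule set_lebesgue_integral_cong) (use open_strip rk in auto)
    then show ?thesis by simp
  qed
  have J2: "set_integrable lborel strip (\<lambda>\<zeta>. sech2 \<zeta> * (f (k \<zeta>))\<^sup>2)"
    using i2 cell_integral(1)[OF a mb[OF m2]] eq[of "\<lambda>\<zeta>. (f (k \<zeta>))\<^sup>2"] by (simp add: c_def k_def)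
  note S = strip_inequality[OF d cG J1 J2]
  show i3: "set_integrable lborel (cell \<alpha> b) (\<lambda>z. rho z * f z)"
    using S(1) cell_integral(1)[OF a mb[OF m3]] eq[of "\<lambda>\<zeta>. f (k \<zeta>)"] by (simp add: c_def k_def)
  have I2: "2 * (LINT \<zeta>:strip|lborel. sech2 \<zeta> * (f (k \<zeta>))\<^sup>2) = (LINT z:cell \<alpha> b|lborel. rho z * (f z)\<^sup>2)"
    using cell_integral(2)[OF a mb[OF m2] i2] eqi[of "\<lambda>\<zeta>. (f (k \<zeta>))\<^sup>2"] by (simp add: c_def k_def)
  have I3: "2 * (LINT \<zeta>:strip|lborel. sech2 \<zeta> * f (k \<zeta>)) = (LINT z:cell \<alpha> b|lborel. rho z * f z)"
    using cell_integral(2)[OF a mb[OF m3] i3] eqi[of "\<lambda>\<zeta>. f (k \<zeta>)"] by (simp add: c_def k_def)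
  have "(LINT \<zeta>:strip|lborel. sech2 \<zeta> * f (k \<zeta>))\<^sup>2 / pi = (LINT z:cell \<alpha> b|lborel. rho z * f z)\<^sup>2 / (4 * pi)"
    unfolding I3[symmetric] by (simp add: power_mult_distrib)
  then show "(LINT z:cell \<alpha> b|lborel. rho z * (f z)\<^sup>2) \<le> (LINT z:cell \<alpha> b|lborel. (cmod (g z))\<^sup>2)
      + (LINT z:cell \<alpha> b|lborel. rho z * f z)\<^sup>2 / (4 * pi)"
    using S(2) unfolding I1 I2 by simp
qed

text \<open>The height above the equator of the stereographic preimage of
  \<open>\<i> * exp \<zeta>\<close>. In every cell \<open>el\<close> is plus or minus this one
  function.\<close>

definition hemi :: "complex \<Rightarrow> real" where
  "hemi \<zeta> = 2 * Im (\<i> * exp \<zeta>) / (1 + (cmod (exp \<zeta>))\<^sup>2)"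

definition c0 :: real where "c0 = (LINT \<zeta>:strip|lborel. 2 * sech2 \<zeta> * hemi \<zeta>)"

definition sgb :: "bool \<Rightarrow> real" where "sgb b = (if b then 1 else -1)"

lemma el_kap:
  assumes "\<alpha> \<in> fib" "\<zeta> \<in> strip"
  shows "el (kap \<alpha> b \<zeta>) = sgb b * hemi \<zeta>"
proof -
  define z where "z = branch \<alpha> \<zeta>"
  have z: "z \<in> upper" using branchD(2)[OF assms] by (simp add: z_def)
  define q where "q = (cmod (z - 1))\<^sup>2"
  have q: "q > 0" using upper_nz(1)[OF z] by (simp add: q_def)
  have p: "pa z = \<i> * exp \<zeta> * (z - 1)"
    using branchD(4)[OF assms] upper_nz(1)[OF z] by (simp add: z_def GG_def field_simps)
  have "pa z * cnj (z - 1) = \<i> * exp \<zeta> * of_real q"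
    unfolding p q_def complex_norm_square by simp
  then have 1: "Im (pa z * cnj (z - 1)) = Im (\<i> * exp \<zeta>) * q" by simp
  have 2: "sg z = (1 + (cmod (exp \<zeta>))\<^sup>2) * q"
  proof -
    have "(cmod (pa z))\<^sup>2 = (cmod (exp \<zeta>))\<^sup>2 * q"
      unfolding p q_def norm_mult power_mult_distrib by simp
    then show ?thesis unfolding sg_def q_def[symmetric] by (simp add: algebra_simps)
  qed
  have "el z = hemi \<zeta>"
    unfolding el_def 1 2 hemi_def using q by simp
  then show ?thesis
    using antipodal_el[OF upper_nz(2)[OF z]] by (simp add: kap_def sgb_def z_def)
qed

lemma integrable_rho_el: "integrable lborel (\<lambda>z. rho z * el z)" "integrable lborel (\<lambda>z. rho z * (el z)\<^sup>2)"
  "integrable lborel (\<lambda>z. (cmod (gel z))\<^sup>2)"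
proof -
  note [measurable] = measurable_rho measurable_el measurable_gel
  have "\<bar>el z\<bar> * \<bar>el z\<bar> \<le> 1" for z using mult_mono[OF el_bound[of z] el_bound[of z]] by simp
  then have b: "\<bar>el z\<bar>\<^sup>2 \<le> 1" for z by (simp only: power2_eq_square)
  show "integrable lborel (\<lambda>z. rho z * el z)"
    by (rule Bochner_Integration.integrable_bound[OF integrable_rho])
      (use el_bound rho_nonneg in \<open>auto simp: abs_mult intro!: mult_left_le\<close>)
  show "integrable lborel (\<lambda>z. rho z * (el z)\<^sup>2)"
    by (rule Bochner_Integration.integrable_bound[OF integrable_rho])
      (use b rho_nonneg in \<open>auto simp: abs_mult intro!: mult_left_le\<close>)
  have "(cmod (gel z))\<^sup>2 \<le> rho z" for z using gel_bound[of z] rho_nonneg[of z] by linarith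
  then show "integrable lborel (\<lambda>z. (cmod (gel z))\<^sup>2)"
    by (intro Bochner_Integration.integrable_bound[OF integrable_rho]) (auto simp: abs_of_nonneg[OF rho_nonneg])
qed

lemma set_integrable_of_integrable:
  fixes F :: "complex \<Rightarrow> 'b::{banach,second_countable_topology}"
  shows "integrable lborel F \<Longrightarrow> A \<in> sets borel \<Longrightarrow> set_integrable lborel A F"
  unfolding set_integrable_def by (rule integrable_mult_indicator) auto

lemma amp_el:
  assumes "\<alpha> \<in> fib"
  shows "(LINT z:cell \<alpha> b|lborel. rho z * el z) = sgb b * c0"
proof -
  note [measurable] = measurable_rho measurable_el
  have i: "set_integrable lborel (cell \<alpha> b) (\<lambda>z. rho z * el z)"
    by (rule set_integrable_of_integrable[OF integrable_rho_el(1) cell_borel[OF assms]])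
  have "(LINT z:cell \<alpha> b|lborel. rho z * el z) = (LINT \<zeta>:strip|lborel. (cmod (kfac \<alpha> b \<zeta>))\<^sup>2 * (rho (kap \<alpha> b \<zeta>) * el (kap \<alpha> b \<zeta>)))"
    by (rule cell_integral(2)[OF assms measurable_indicator_mult[OF _ cell_borel[OF assms]] i, symmetric]) measurable
  also have "\<dots> = (LINT \<zeta>:strip|lborel. sgb b * (2 * sech2 \<zeta> * hemi \<zeta>))"
    by (rule set_lebesgue_integral_cong)
      (use open_strip rho_kap[OF assms] el_kap[OF assms] in \<open>auto simp: mult.assoc[symmetric]\<close>)
  finally show ?thesis by (simp add: c0_def)
qed

lemma fib_nonempty: "\<exists>\<alpha>. \<alpha> \<in> fib"
  using card_fib m5 by (metis card.empty ex_in_conv not_numeral_le_zero)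

text \<open>The integrand is positive on a cell, which is open and nonempty. Hence a multiple of
  \<open>el\<close> can match any prescribed common value of the cell integrals.\<close>

lemma c0_pos: "c0 > 0"
proof -
  obtain \<alpha> where a: "\<alpha> \<in> fib" using fib_nonempty by blast
  have sub: "cell \<alpha> True \<subseteq> upper" using cell_subset[OF a, of True] by simp
  have pos: "rho z * el z > 0" if "z \<in> cell \<alpha> True" for z
  proof -
    have "z \<in> upper" using that sub by blast
    then show ?thesis using el_sign(1)[of z] wr_nz upper_not_real sg_pos[of z] by (simp add: rho_def)
  qed
  have i: "integrable lborel (\<lambda>z. indicator (cell \<alpha> True) z *\<^sub>R (rho z * el z))"
    using set_integrable_of_integrable[OF integrable_rho_el(1) cell_borel[OF a]] by (simp add: set_integrable_def)
  have nn: "0 \<le> indicator (cell \<alpha> True) z *\<^sub>R (rho z * el z)" for z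
    using pos[of z] by (auto simp: indicator_def less_imp_le)
  have "c0 \<noteq> 0"
  proof
    assume "c0 = 0"
    then have "(\<integral>z. indicator (cell \<alpha> True) z *\<^sub>R (rho z * el z) \<partial>lborel) = 0"
      using amp_el[OF a, of True] by (simp add: set_lebesgue_integral_def sgb_def)
    then have "AE z in lborel. indicator (cell \<alpha> True) z *\<^sub>R (rho z * el z) = 0"
      using integral_nonneg_eq_0_iff_AE[OF i] nn by simp
    then have "AE z in lborel. z \<notin> cell \<alpha> True"
      by eventually_elim (use pos in \<open>force simp: indicator_def\<close>)
    then have "cell \<alpha> True \<in> null_sets lborel"
      using cell_borel[OF a] by (simp add: AE_iff_null_sets)
    then have "negligible (cell \<alpha> True)"
      by (simp add: negligible_iff_null_sets null_sets_completionI)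
    moreover have "cell \<alpha> True \<noteq> {}" using strip_0 by (auto simp: cell_def)
    ultimately show False using open_cell[OF a] open_not_negligible by blast
  qed
  moreover have "c0 \<ge> 0"
  proof -
    have eq: "c0 = (\<integral>z. indicator (cell \<alpha> True) z *\<^sub>R (rho z * el z) \<partial>lborel)"
      using amp_el[OF a, of True] by (simp add: set_lebesgue_integral_def sgb_def)
    show ?thesis unfolding eq by (rule Bochner_Integration.integral_nonneg) (rule nn)
  qed
  ultimately show ?thesis by simp
qed

end

section \<open>Cutoffs near the nodal set\<close>

text \<open>As \<open>n\<close> grows, \<open>hc n t\<close> tends to \<open>t\<close>; since it vanishes for small \<open>t\<close>, the function
  \<open>hc n (el z)\<close> can be cut off along the zero set of \<open>el\<close>, and stays \<open>C\<^sup>1\<close>.\<close>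
definition hc :: "nat \<Rightarrow> real \<Rightarrow> real" where "hc n t = t * smooth_step (real n * t\<^sup>2 - 1)"

definition hc' :: "nat \<Rightarrow> real \<Rightarrow> real" where
  "hc' n t = smooth_step (real n * t\<^sup>2 - 1) + 2 * (real n * t\<^sup>2) * smooth_step' (real n * t\<^sup>2 - 1)"

lemma hc_deriv: "(hc n has_real_derivative hc' n t) (at t)"
  unfolding hc_def[abs_def] hc'_def
  by (rule derivative_eq_intros DERIV_chain2[OF smooth_step_deriv] refl)+ (simp add: power2_eq_square)

lemma continuous_smooth_step: "continuous_on A smooth_step"
  using smooth_step_deriv by (intro DERIV_continuous_on) (auto intro: has_field_derivative_at_within)

lemma continuous_hc: "continuous_on A (hc n)"
  using hc_deriv by (intro DERIV_continuous_on) (auto intro: has_field_derivative_at_within)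

lemma continuous_hc': "continuous_on A (hc' n)"
  unfolding hc'_def[abs_def]
  by (intro continuous_intros continuous_on_compose2[OF continuous_smooth_step[of UNIV]]
      continuous_on_compose2[OF smooth_step'_continuous]) auto

lemma hc_zero: "real n * t\<^sup>2 \<le> 1 \<Longrightarrow> hc n t = 0" "real n * t\<^sup>2 \<le> 1 \<Longrightarrow> hc' n t = 0"
  by (auto simp: hc_def hc'_def smooth_step_0)

lemma hc_minus: "hc n (- t) = - hc n t"
  by (simp add: hc_def)

lemma hc_bound: "\<bar>hc n t\<bar> \<le> \<bar>t\<bar>"
  using smooth_step_bounds[of "real n * t\<^sup>2 - 1"] by (simp add: hc_def abs_mult mult_left_le)

text \<open>The bound is independent of \<open>n\<close>: only x = n t^2 - 1 enters, and the
  derivative of the step decays like x^(-3), faster than its linear factor grows. It dominates the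
  gradients of all cutoffs.\<close>

lemma hc'_bound: "\<bar>hc' n t\<bar> \<le> 9"
proof -
  define x where "x = real n * t\<^sup>2 - 1"
  have e: "hc' n t = smooth_step x + 2 * (x + 1) * smooth_step' x" by (simp add: hc'_def x_def)
  have "0 \<le> 2 * (x + 1) * smooth_step' x \<and> 2 * (x + 1) * smooth_step' x \<le> 8"
  proof (cases "x \<le> 0")
    case True then show ?thesis by (simp add: smooth_step_0)
  next
    case False
    have p: "1 + x\<^sup>2 > 0" using zero_le_power2[of x] by linarith
    have "2 * (x + 1) * (2 * x) \<le> 8 * (1 + x\<^sup>2)\<^sup>2"
    proof -
      have "x \<le> 1 + x\<^sup>2"
      proof -
        have "0 \<le> (x - 1)\<^sup>2" by simp
        then have "2 * x \<le> 1 + x\<^sup>2" by (simp add: power2_eq_square algebra_simps)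
        then show ?thesis using False by linarith
      qed
      then have "4 * (x + 1) * x \<le> 8 * (1 + x\<^sup>2)"
        by (simp add: power2_eq_square algebra_simps)
      also have "\<dots> \<le> 8 * (1 + x\<^sup>2)\<^sup>2" using self_le_power[of "1 + x\<^sup>2" 2] by simp
      finally show ?thesis by (simp add: algebra_simps)
    qed
    then have "2 * (x + 1) * smooth_step' x \<le> 8"
      using False p by (simp add: smooth_step'_def divide_le_eq algebra_simps)
    moreover have "0 \<le> 2 * (x + 1) * smooth_step' x" using False by (simp add: smooth_step'_def)
    ultimately show ?thesis by simp
  qed
  then show ?thesis using smooth_step_bounds[of x] unfolding e by linarith
qed

lemma hc_tendsto:
  assumes t: "t \<noteq> 0"
  shows "(\<lambda>n. hc n t) \<longlonglongrightarrow> t" "(\<lambda>n. hc' n t) \<longlonglongrightarrow> 1"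
proof -
  have p: "t\<^sup>2 > 0" using t by simp
  define a where "a = t\<^sup>2"
  have a: "a > 0" using p by (simp add: a_def)
  have pos: "eventually (\<lambda>n. real n * a - 1 > 0) sequentially" using a by real_asymp
  have l1: "(\<lambda>n. (real n * a - 1)\<^sup>2 / (1 + (real n * a - 1)\<^sup>2)) \<longlonglongrightarrow> 1" using a by real_asymp
  have l2: "(\<lambda>n. 2 * (real n * a) * (2 * (real n * a - 1) / (1 + (real n * a - 1)\<^sup>2)\<^sup>2)) \<longlonglongrightarrow> 0" using a by real_asymp
  have s1: "(\<lambda>n. smooth_step (real n * a - 1)) \<longlonglongrightarrow> 1"
    by (rule Lim_transform_eventually[OF l1]) (use pos in eventually_elim, simp add: smooth_step_def)
  have s2: "(\<lambda>n. 2 * (real n * a) * smooth_step' (real n * a - 1)) \<longlonglongrightarrow> 0"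
    by (rule Lim_transform_eventually[OF l2]) (use pos in eventually_elim, simp add: smooth_step'_def)
  show "(\<lambda>n. hc n t) \<longlonglongrightarrow> t"
    using tendsto_mult[OF tendsto_const s1, of t] by (simp add: hc_def a_def)
  show "(\<lambda>n. hc' n t) \<longlonglongrightarrow> 1"
    using tendsto_add[OF s1 s2] by (simp add: hc'_def a_def)
qed

context oliveira
begin

text \<open>A union of nodal domains of \<open>el\<close>, described without reference to its
  boundary.\<close>

definition clopen_off_nodal :: "complex set \<Rightarrow> bool" where
  "clopen_off_nodal D \<longleftrightarrow> open D \<and> open ({z. el z \<noteq> 0} - D)"

definition cut :: "complex set \<Rightarrow> nat \<Rightarrow> complex \<Rightarrow> real" where
  "cut D n z = indicator D z * hc n (el z)"

definition gcut :: "complex set \<Rightarrow> nat \<Rightarrow> complex \<Rightarrow> complex" where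
  "gcut D n z = (indicator D z * hc' n (el z)) *\<^sub>R gel z"

definition ksupp :: "nat \<Rightarrow> complex set" where "ksupp n = {z. real n * (el z)\<^sup>2 \<ge> 1}"

text \<open>The Gauss map has a pole at infinity, so the height tends to 0 there; bounding
  \<open>pa\<close> below by |z|^2 is enough.\<close>

lemma el_decay: "cmod z \<ge> 2 \<Longrightarrow> \<bar>el z\<bar> \<le> 4 / cmod z"
proof -
  assume z: "cmod z \<ge> 2"
  have r: "cmod z > 0" using z by linarith
  have a: "cmod (z + 1) \<ge> 1" using norm_triangle_ineq2[of z "-1"] z by simp
  have "cmod z ^ 2 \<le> cmod z ^ (m - 1)" by (rule power_increasing) (use z m5 in auto)
  also have "\<dots> \<le> cmod (pa z)"
    unfolding pa_def norm_mult norm_power using a mult_left_mono[of 1 "cmod (z + 1)" "cmod z ^ (m - 1)"] by simp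
  finally have p: "cmod z ^ 2 \<le> cmod (pa z)" .
  then have p0: "cmod (pa z) > 0" using r by (meson less_le_trans zero_less_power)
  have b: "cmod (z - 1) \<le> 2 * cmod z" using norm_triangle_ineq4[of z 1] z by simp
  have "\<bar>el z\<bar> = 2 * \<bar>Im (pa z * cnj (z - 1))\<bar> / sg z"
    using sg_pos[of z] unfolding el_def abs_divide abs_mult by simp
  also have "\<dots> \<le> 2 * (cmod (pa z) * cmod (z - 1)) / (cmod (pa z))\<^sup>2"
  proof (rule frac_le)
    show "2 * \<bar>Im (pa z * cnj (z - 1))\<bar> \<le> 2 * (cmod (pa z) * cmod (z - 1))"
      using abs_Im_le_cmod[of "pa z * cnj (z - 1)"] by (simp only: norm_mult complex_mod_cnj)
    show "(cmod (pa z))\<^sup>2 \<le> sg z" by (simp add: sg_def)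
  qed (use p0 in auto)
  also have "\<dots> = 2 * cmod (z - 1) / cmod (pa z)" using p0 by (simp add: power2_eq_square)
  also have "\<dots> \<le> 2 * (2 * cmod z) / (cmod z ^ 2)"
    by (rule frac_le) (use b p r in auto)
  also have "\<dots> = 4 / cmod z" using r by (simp add: power2_eq_square)
  finally show ?thesis .
qed

text \<open>\<open>el\<close> tends to 0 at 0 and at infinity, the two ends of the double cover, so
  a cutoff along the nodal set is at the same time a cutoff at the ends.\<close>

lemma compact_ksupp: "compact (ksupp n)" "ksupp n \<subseteq> - {0}"
proof -
  have "closed (ksupp n)"
    unfolding ksupp_def by (intro closed_Collect_le continuous_intros continuous_el)
  moreover have "bounded (ksupp n)"
  proof -
    have "cmod z \<le> max 2 (4 * (real n + 1))" if "z \<in> ksupp n" for z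
    proof (rule ccontr)
      assume c: "\<not> ?thesis"
      then have z: "cmod z \<ge> 2" "cmod z > 4 * (real n + 1)" by auto
      have "\<bar>el z\<bar> \<le> 4 / cmod z" by (rule el_decay[OF z(1)])
      also have "\<dots> < 1 / (real n + 1)"
      proof -
        have "cmod z > 0" using z by linarith
        then show ?thesis using z by (simp add: divide_less_eq less_divide_eq algebra_simps)
      qed
      finally have e: "\<bar>el z\<bar> < 1 / (real n + 1)" .
      have "(el z)\<^sup>2 = \<bar>el z\<bar> * \<bar>el z\<bar>" by (simp add: power2_eq_square)
      also have "\<dots> \<le> \<bar>el z\<bar> * 1" using el_bound by (intro mult_left_mono) auto
      finally have "real n * (el z)\<^sup>2 \<le> real n * (1 / (real n + 1))" using e by (intro mult_left_mono) auto
      also have "\<dots> < 1" by (simp add: field_simps)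
      finally show False using that by (simp add: ksupp_def)
    qed
    then show ?thesis unfolding bounded_iff by blast
  qed
  ultimately show "compact (ksupp n)" by (simp add: compact_eq_bounded_closed)
  have "el 0 = 0" using m5 by (simp add: el_def pa_def)
  then show "ksupp n \<subseteq> - {0}" by (auto simp: ksupp_def)
qed

text \<open>Near every point the indicator can be replaced by a constant: 1 in \<open>D\<close>, 0
  in the other nodal domains, and 0 near a zero of \<open>el\<close>, where \<open>hc\<close>
  vanishes anyway. So cutting along the nodal set keeps the function C1.\<close>

lemma cut_local:
  assumes "clopen_off_nodal D"
  obtains U s where "open U" "z \<in> U" "\<And>y. y \<in> U \<Longrightarrow> cut D n y = s * hc n (el y)"
    "\<And>y. y \<in> U \<Longrightarrow> gcut D n y = (s * hc' n (el y)) *\<^sub>R gel y"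
proof -
  consider "z \<in> D" | "z \<in> {z. el z \<noteq> 0} - D" | "el z = 0" by blast
  then show thesis
  proof cases
    case 1
    show thesis by (rule that[of D 1]) (use 1 assms in \<open>auto simp: clopen_off_nodal_def cut_def gcut_def\<close>)
  next
    case 2
    show thesis by (rule that[of "{z. el z \<noteq> 0} - D" 0]) (use 2 assms in \<open>auto simp: clopen_off_nodal_def cut_def gcut_def\<close>)
  next
    case 3
    show thesis
    proof (rule that[of "{y. real n * (el y)\<^sup>2 < 1}" 0])
      show "open {y. real n * (el y)\<^sup>2 < 1}"
        by (intro open_Collect_less continuous_intros continuous_el)
    qed (use 3 in \<open>auto simp: cut_def gcut_def hc_zero\<close>)
  qed
qed

lemma cut_test:
  assumes D: "clopen_off_nodal D"
  shows "cut D n \<in> test_functions (- {0})" "grad (cut D n) = gcut D n" "z \<notin> ksupp n \<Longrightarrow> cut D n z = 0"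
proof -
  have d: "(cut D n has_derivative (\<lambda>v. gcut D n z \<bullet> v)) (at z)" for z
  proof -
    obtain U s where U: "open U" "z \<in> U" "\<And>y. y \<in> U \<Longrightarrow> cut D n y = s * hc n (el y)"
      "\<And>y. y \<in> U \<Longrightarrow> gcut D n y = (s * hc' n (el y)) *\<^sub>R gel y"
      by (rule cut_local[OF D, where z=z and n=n]) (rule that)
    have h: "(hc n has_derivative (\<lambda>t. hc' n (el z) * t)) (at (el z))"
      using hc_deriv[of n "el z"] unfolding has_field_derivative_def .
    have "((\<lambda>y. hc n (el y)) has_derivative (\<lambda>v. hc' n (el z) * (gel z \<bullet> v))) (at z)"
      by (rule has_derivative_compose[OF el_has_derivative h])
    then have "((\<lambda>y. s * hc n (el y)) has_derivative (\<lambda>v. s * (hc' n (el z) * (gel z \<bullet> v)))) (at z)"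
      by (rule has_derivative_mult_right)
    then have "((\<lambda>y. s * hc n (el y)) has_derivative (\<lambda>v. gcut D n z \<bullet> v)) (at z)"
      unfolding U(4)[OF U(2)] inner_scaleR_left mult.assoc .
    then show ?thesis by (rule has_derivative_transform_within_open[OF _ U(1,2)]) (simp add: U(3))
  qed
  have c: "continuous_on UNIV (gcut D n)"
    unfolding continuous_on_eq_continuous_at[OF open_UNIV]
  proof
    fix z
    obtain U s where U: "open U" "z \<in> U" "\<And>y. y \<in> U \<Longrightarrow> cut D n y = s * hc n (el y)"
      "\<And>y. y \<in> U \<Longrightarrow> gcut D n y = (s * hc' n (el y)) *\<^sub>R gel y"
      by (rule cut_local[OF D, where z=z and n=n]) (rule that)
    have "continuous_on UNIV (\<lambda>y. (s * hc' n (el y)) *\<^sub>R gel y)"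
      by (intro continuous_intros continuous_gel continuous_on_compose2[OF continuous_hc'[of UNIV]] continuous_el) auto
    then have c1: "isCont (\<lambda>y. (s * hc' n (el y)) *\<^sub>R gel y) z"
      by (simp add: continuous_on_eq_continuous_at)
    have ev: "eventually (\<lambda>y. gcut D n y = (s * hc' n (el y)) *\<^sub>R gel y) (nhds z)"
      using eventually_nhds_in_open[OF U(1,2)] by eventually_elim (rule U(4))
    show "isCont (gcut D n) z" using c1 isCont_cong[OF ev] by (simp only:)
  qed
  show k: "z \<notin> ksupp n \<Longrightarrow> cut D n z = 0" for z
    by (simp add: ksupp_def cut_def hc_zero)
  show "cut D n \<in> test_functions (- {0})"
    by (rule test_functionsI[OF d c compact_ksupp k])
  show "grad (cut D n) = gcut D n" using grad_eqI[OF d] by auto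
qed

lemma AE_el_nz: "AE z in lborel. el z \<noteq> 0"
  using AE_upper_lower by eventually_elim (use el_sign in force)

text \<open>Dominated convergence: off the nodal set \<open>hc\<close> and \<open>hc'\<close>
  converge pointwise, and both are bounded along \<open>el\<close> uniformly in
  \<open>n\<close>.\<close>

lemma cut_limits:
  assumes D: "clopen_off_nodal D"
    and \<psi>: "\<psi> \<in> borel_measurable borel" "integrable lborel (\<lambda>z. rho z * \<bar>\<psi> z\<bar>)"
    and V: "V \<in> borel_measurable borel" "integrable lborel (\<lambda>z. cmod (gel z) * cmod (V z))"
  shows "(\<lambda>n. \<integral>z. rho z * cut D n z * \<psi> z \<partial>lborel) \<longlonglongrightarrow> (\<integral>z. indicator D z * (rho z * el z * \<psi> z) \<partial>lborel)"
    and "(\<lambda>n. \<integral>z. gcut D n z \<bullet> V z \<partial>lborel) \<longlonglongrightarrow> (\<integral>z. indicator D z * (gel z \<bullet> V z) \<partial>lborel)"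
proof -
  have [measurable]: "D \<in> sets borel" using D by (auto simp: clopen_off_nodal_def)
  note [measurable] = measurable_rho measurable_el measurable_gel \<psi>(1) V(1)
  have [measurable]: "hc n \<in> borel_measurable borel" "hc' n \<in> borel_measurable borel" for n
    by (rule borel_measurable_continuous_onI; rule continuous_hc continuous_hc')+
  show "(\<lambda>n. \<integral>z. rho z * cut D n z * \<psi> z \<partial>lborel) \<longlonglongrightarrow> (\<integral>z. indicator D z * (rho z * el z * \<psi> z) \<partial>lborel)"
  proof (rule integral_dominated_convergence[OF _ _ \<psi>(2)])
    show "AE z in lborel. norm (rho z * cut D n z * \<psi> z) \<le> rho z * \<bar>\<psi> z\<bar>" for n
    proof (rule AE_I2)
      fix z
      have "\<bar>cut D n z\<bar> \<le> 1"
        using hc_bound[of n "el z"] el_bound[of z] by (auto simp: cut_def indicator_def)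
      then have "rho z * \<bar>cut D n z\<bar> * \<bar>\<psi> z\<bar> \<le> rho z * 1 * \<bar>\<psi> z\<bar>"
        using rho_nonneg by (intro mult_right_mono mult_left_mono) auto
      then show "norm (rho z * cut D n z * \<psi> z) \<le> rho z * \<bar>\<psi> z\<bar>"
        using rho_nonneg[of z] by (simp add: abs_mult)
    qed
    show "AE z in lborel. (\<lambda>n. rho z * cut D n z * \<psi> z) \<longlonglongrightarrow> indicator D z * (rho z * el z * \<psi> z)"
      using AE_el_nz
    proof eventually_elim
      fix z assume "el z \<noteq> 0"
      then have "(\<lambda>n. rho z * (indicator D z * hc n (el z)) * \<psi> z) \<longlonglongrightarrow> rho z * (indicator D z * el z) * \<psi> z"
        by (intro tendsto_intros hc_tendsto)
      then show "(\<lambda>n. rho z * cut D n z * \<psi> z) \<longlonglongrightarrow> indicator D z * (rho z * el z * \<psi> z)"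
        by (simp add: cut_def mult.commute mult.left_commute)
    qed
  qed (unfold cut_def, measurable)
  show "(\<lambda>n. \<integral>z. gcut D n z \<bullet> V z \<partial>lborel) \<longlonglongrightarrow> (\<integral>z. indicator D z * (gel z \<bullet> V z) \<partial>lborel)"
  proof (rule integral_dominated_convergence[where w="\<lambda>z. 9 * (cmod (gel z) * cmod (V z))"])
    show "integrable lborel (\<lambda>z. 9 * (cmod (gel z) * cmod (V z)))" using V(2) by simp
    show "AE z in lborel. norm (gcut D n z \<bullet> V z) \<le> 9 * (cmod (gel z) * cmod (V z))" for n
    proof (rule AE_I2)
      fix z
      have "\<bar>indicator D z * hc' n (el z)\<bar> * \<bar>gel z \<bullet> V z\<bar> \<le> 9 * (cmod (gel z) * cmod (V z))"
        using hc'_bound[of n "el z"] Cauchy_Schwarz_ineq2[of "gel z" "V z"]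
        by (intro mult_mono) (auto simp: indicator_def)
      then show "norm (gcut D n z \<bullet> V z) \<le> 9 * (cmod (gel z) * cmod (V z))"
        by (simp add: gcut_def abs_mult)
    qed
    show "AE z in lborel. (\<lambda>n. gcut D n z \<bullet> V z) \<longlonglongrightarrow> indicator D z * (gel z \<bullet> V z)"
      using AE_el_nz
    proof eventually_elim
      fix z assume "el z \<noteq> 0"
      then have "(\<lambda>n. indicator D z * hc' n (el z) * (gel z \<bullet> V z)) \<longlonglongrightarrow> indicator D z * 1 * (gel z \<bullet> V z)"
        by (intro tendsto_intros hc_tendsto)
      then show "(\<lambda>n. gcut D n z \<bullet> V z) \<longlonglongrightarrow> indicator D z * (gel z \<bullet> V z)"
        by (simp add: gcut_def)
    qed
  qed (unfold gcut_def, measurable)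
qed

text \<open>Green's formula for \<open>el\<close> on a union of nodal domains without any boundary
  regularity: the Jacobi equation is tested with the cut functions of \<open>D\<close>, and
  \<open>n\<close> tends to infinity.\<close>

lemma energy_el:
  assumes D: "clopen_off_nodal D"
  shows "(\<integral>z. indicator D z * (gel z \<bullet> gel z) \<partial>lborel) = (\<integral>z. indicator D z * (rho z * el z * el z) \<partial>lborel)"
proof (rule LIMSEQ_unique)
  have i: "integrable lborel (\<lambda>z. rho z * \<bar>el z\<bar>)" "integrable lborel (\<lambda>z. cmod (gel z) * cmod (gel z))"
  proof -
    have "integrable lborel (\<lambda>z. \<bar>rho z * el z\<bar>)" using integrable_rho_el(1) by (rule integrable_abs)
    then show "integrable lborel (\<lambda>z. rho z * \<bar>el z\<bar>)" using rho_nonneg by (simp add: abs_mult)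
    show "integrable lborel (\<lambda>z. cmod (gel z) * cmod (gel z))" using integrable_rho_el(3) by (simp only: power2_eq_square)
  qed
  note L = cut_limits[OF D measurable_el i(1) measurable_gel i(2)]
  show "(\<lambda>n. \<integral>z. gcut D n z \<bullet> gel z \<partial>lborel) \<longlonglongrightarrow> (\<integral>z. indicator D z * (gel z \<bullet> gel z) \<partial>lborel)"
    by (rule L(2))
  have "(\<integral>z. gcut D n z \<bullet> gel z \<partial>lborel) = (\<integral>z. rho z * cut D n z * el z \<partial>lborel)" for n
    using jacobi(3)[OF cut_test(1)[OF D, of n]] by (simp add: cut_test(2)[OF D] mult.commute mult.left_commute)
  then show "(\<lambda>n. \<integral>z. gcut D n z \<bullet> gel z \<partial>lborel) \<longlonglongrightarrow> (\<integral>z. indicator D z * (rho z * el z * el z) \<partial>lborel)"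
    using L(1) by simp
qed

section \<open>The upper bound\<close>

definition amp :: "complex \<Rightarrow> bool \<Rightarrow> (complex \<Rightarrow> real) \<Rightarrow> real" where
  "amp \<alpha> b u = (LINT z:cell \<alpha> b|lborel. rho z * u z)"

lemma test_integrable:
  assumes "\<phi> \<in> test_functions W"
  shows "integrable lborel (\<lambda>z. rho z * (\<phi> z)\<^sup>2)" "integrable lborel (\<lambda>z. (cmod (grad \<phi> z))\<^sup>2)"
    "integrable lborel (\<lambda>z. rho z * \<phi> z)"
proof -
  obtain K where K: "continuous_on UNIV (grad \<phi>)"
    "compact K" "\<And>z. z \<notin> K \<Longrightarrow> \<phi> z = 0" "\<And>z. z \<notin> K \<Longrightarrow> grad \<phi> z = 0"
    using test_functionsE[OF assms] by metis
  have c: "continuous_on UNIV \<phi>" by (rule test_continuous[OF assms])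
  show "integrable lborel (\<lambda>z. rho z * (\<phi> z)\<^sup>2)" "integrable lborel (\<lambda>z. (cmod (grad \<phi> z))\<^sup>2)"
    "integrable lborel (\<lambda>z. rho z * \<phi> z)"
    by (rule integrable_compact_support[OF _ K(2)]; use K c in \<open>auto intro!: continuous_intros continuous_rho\<close>)+
qed

text \<open>By \<open>jacobi\<close> and \<open>energy_el\<close> the function \<open>el\<close> is
  in the kernel of the form, so the form does not change when \<open>s * el z\<close> is subtracted
  from \<open>\<phi>\<close>. The cell inequality is summed for the difference, and \<open>s\<close>
  stays free to be chosen later.\<close>

theorem test_inequality:
  assumes \<phi>: "\<phi> \<in> test_functions W"
  shows "(\<integral>z. rho z * (\<phi> z)\<^sup>2 \<partial>lborel) \<le> (\<integral>z. (cmod (grad \<phi> z))\<^sup>2 \<partial>lborel)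
    + (\<Sum>(\<alpha>, b)\<in>cells. (amp \<alpha> b \<phi> - s * sgb b * c0)\<^sup>2) / (4 * pi)"
proof -
  obtain K where K: "\<And>z. (\<phi> has_derivative (\<lambda>v. grad \<phi> z \<bullet> v)) (at z)" "continuous_on UNIV (grad \<phi>)"
    using test_functionsE[OF \<phi>] by metis
  have cp: "continuous_on UNIV \<phi>" by (rule test_continuous[OF \<phi>])
  have mp [measurable]: "\<phi> \<in> borel_measurable borel" by (rule borel_measurable_continuous_onI[OF cp])
  note [measurable] = measurable_rho measurable_el measurable_gel
  have mg [measurable]: "grad \<phi> \<in> borel_measurable borel" by (rule borel_measurable_continuous_onI[OF K(2)])
  define f where "f z = \<phi> z - s * el z" for z
  define g where "g z = grad \<phi> z - s *\<^sub>R gel z" for z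
  have df: "(f has_derivative (\<lambda>v. g z \<bullet> v)) (at z)" for z
    unfolding f_def[abs_def] g_def
    by (rule has_derivative_eq_rhs[OF has_derivative_diff[OF K(1) has_derivative_mult_right[OF el_has_derivative]]])
      (simp add: fun_eq_iff inner_diff_left)
  have cg: "continuous_on UNIV g" unfolding g_def by (intro continuous_intros K(2) continuous_gel)
  have mf [measurable]: "f \<in> borel_measurable borel" unfolding f_def by measurable
  note T = test_integrable[OF \<phi>]
  note J = jacobi[OF \<phi>]
  have ef: "rho z * (f z)\<^sup>2 = rho z * (\<phi> z)\<^sup>2 - 2 * s * (rho z * el z * \<phi> z) + s\<^sup>2 * (rho z * (el z)\<^sup>2)" for z
    by (simp add: f_def power2_eq_square algebra_simps)
  have eg: "(cmod (g z))\<^sup>2 = (cmod (grad \<phi> z))\<^sup>2 - 2 * s * (grad \<phi> z \<bullet> gel z) + s\<^sup>2 * (cmod (gel z))\<^sup>2" for z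
    unfolding g_def power2_norm_eq_inner by (simp add: inner_diff_left inner_diff_right inner_commute power2_eq_square algebra_simps)
  have if1: "integrable lborel (\<lambda>z. rho z * (f z)\<^sup>2)" unfolding ef
    by (intro Bochner_Integration.integrable_add Bochner_Integration.integrable_diff integrable_mult_right T J integrable_rho_el)
  have ig1: "integrable lborel (\<lambda>z. (cmod (g z))\<^sup>2)" unfolding eg
    by (intro Bochner_Integration.integrable_add Bochner_Integration.integrable_diff integrable_mult_right T J integrable_rho_el)
  have Ef: "(\<integral>z. rho z * (f z)\<^sup>2 \<partial>lborel) = (\<integral>z. rho z * (\<phi> z)\<^sup>2 \<partial>lborel)
     - 2 * s * (\<integral>z. rho z * el z * \<phi> z \<partial>lborel) + s\<^sup>2 * (\<integral>z. rho z * (el z)\<^sup>2 \<partial>lborel)"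
    unfolding ef using T J integrable_rho_el by simp
  have Eg: "(\<integral>z. (cmod (g z))\<^sup>2 \<partial>lborel) = (\<integral>z. (cmod (grad \<phi> z))\<^sup>2 \<partial>lborel)
     - 2 * s * (\<integral>z. grad \<phi> z \<bullet> gel z \<partial>lborel) + s\<^sup>2 * (\<integral>z. (cmod (gel z))\<^sup>2 \<partial>lborel)"
    unfolding eg using T J integrable_rho_el by simp
  have "clopen_off_nodal UNIV" by (simp add: clopen_off_nodal_def)
  from energy_el[OF this] have E: "(\<integral>z. (cmod (gel z))\<^sup>2 \<partial>lborel) = (\<integral>z. rho z * (el z)\<^sup>2 \<partial>lborel)"
    unfolding power2_norm_eq_inner by (simp add: power2_eq_square mult.assoc)
  have cell: "(LINT z:cell \<alpha> b|lborel. rho z * (f z)\<^sup>2) \<le> (LINT z:cell \<alpha> b|lborel. (cmod (g z))\<^sup>2)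
      + (amp \<alpha> b \<phi> - s * sgb b * c0)\<^sup>2 / (4 * pi)" if "(\<alpha>, b) \<in> cells" for \<alpha> b
  proof -
    have a: "\<alpha> \<in> fib" using that by (simp add: cells_def)
    note si = set_integrable_of_integrable[OF _ cell_borel[OF a, of b]]
    have "(LINT z:cell \<alpha> b|lborel. rho z * f z) = (LINT z:cell \<alpha> b|lborel. rho z * \<phi> z - s * (rho z * el z))"
      by (simp add: f_def right_diff_distrib mult.left_commute)
    also have "\<dots> = amp \<alpha> b \<phi> - (LINT z:cell \<alpha> b|lborel. s * (rho z * el z))"
      unfolding amp_def by (rule set_integral_diff(2)) (intro si T integrable_mult_right integrable_rho_el)+
    also have "\<dots> = amp \<alpha> b \<phi> - s * sgb b * c0"
      using amp_el[OF a, of b] by simp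
    finally show ?thesis
      using cell_inequality(2)[OF a df cg mf si[OF ig1] si[OF if1]] by simp
  qed
  have "(\<integral>z. rho z * (f z)\<^sup>2 \<partial>lborel) = (\<Sum>(\<alpha>, b)\<in>cells. LINT z:cell \<alpha> b|lborel. rho z * (f z)\<^sup>2)"
    by (rule cells_integral(2)) (auto simp: cells_def intro!: set_integrable_of_integrable[OF if1] cell_borel)
  also have "\<dots> \<le> (\<Sum>(\<alpha>, b)\<in>cells. (LINT z:cell \<alpha> b|lborel. (cmod (g z))\<^sup>2)
      + (amp \<alpha> b \<phi> - s * sgb b * c0)\<^sup>2 / (4 * pi))"
    using cell by (intro sum_mono) auto
  also have "\<dots> = (\<Sum>(\<alpha>, b)\<in>cells. LINT z:cell \<alpha> b|lborel. (cmod (g z))\<^sup>2)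
      + (\<Sum>(\<alpha>, b)\<in>cells. (amp \<alpha> b \<phi> - s * sgb b * c0)\<^sup>2) / (4 * pi)"
    by (simp add: split_beta sum.distrib sum_divide_distrib)
  also have "(\<Sum>(\<alpha>, b)\<in>cells. LINT z:cell \<alpha> b|lborel. (cmod (g z))\<^sup>2) = (\<integral>z. (cmod (g z))\<^sup>2 \<partial>lborel)"
    by (rule cells_integral(2)[symmetric])
      (use cg in \<open>auto simp: cells_def intro!: set_integrable_of_integrable[OF ig1] cell_borel borel_measurable_continuous_onI continuous_intros\<close>)
  finally show ?thesis unfolding Ef Eg E J(3) by simp
qed

end

section \<open>Convergence in mean square\<close>

lemma sq_integrable_inner:
  fixes f g :: "'a \<Rightarrow> 'b::euclidean_space"
  assumes [measurable]: "f \<in> borel_measurable M" "g \<in> borel_measurable M"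
    and f: "integrable M (\<lambda>x. (norm (f x))\<^sup>2)" and g: "integrable M (\<lambda>x. (norm (g x))\<^sup>2)"
  shows "integrable M (\<lambda>x. f x \<bullet> g x)"
proof (rule Bochner_Integration.integrable_bound)
  show "integrable M (\<lambda>x. (norm (f x))\<^sup>2 + (norm (g x))\<^sup>2)" using f g by simp
  have "norm (f x \<bullet> g x) \<le> (norm (f x))\<^sup>2 + (norm (g x))\<^sup>2" for x
  proof -
    have "0 \<le> (norm (f x) - norm (g x))\<^sup>2" by simp
    then have "2 * (norm (f x) * norm (g x)) \<le> (norm (f x))\<^sup>2 + (norm (g x))\<^sup>2"
      by (simp add: power2_eq_square algebra_simps)
    moreover have "0 \<le> norm (f x) * norm (g x)" by simp
    ultimately show ?thesis using Cauchy_Schwarz_ineq2[of "f x" "g x"] unfolding real_norm_def by linarith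
  qed
  then show "AE x in M. norm (f x \<bullet> g x) \<le> norm ((norm (f x))\<^sup>2 + (norm (g x))\<^sup>2)"
    by (auto intro: order_trans[OF _ abs_ge_self])
qed simp

text \<open>Cauchy-Schwarz by way of a weighted inequality between arithmetic and geometric mean,
  with a weight that tends to 0 slowly compared with the mean square of the error.\<close>

lemma sq_limit_cross:
  fixes f :: "'a \<Rightarrow> 'b::euclidean_space" and e :: "nat \<Rightarrow> 'a \<Rightarrow> 'b"
  assumes [measurable]: "f \<in> borel_measurable M" "\<And>n. e n \<in> borel_measurable M"
    and f: "integrable M (\<lambda>x. (norm (f x))\<^sup>2)" and e: "\<And>n. integrable M (\<lambda>x. (norm (e n x))\<^sup>2)"
    and lim: "(\<lambda>n. \<integral>x. (norm (e n x))\<^sup>2 \<partial>M) \<longlonglongrightarrow> 0"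
  shows "\<And>n. integrable M (\<lambda>x. f x \<bullet> e n x)" "(\<lambda>n. \<integral>x. f x \<bullet> e n x \<partial>M) \<longlonglongrightarrow> 0"
proof -
  define A where "A = (\<integral>x. (norm (f x))\<^sup>2 \<partial>M)"
  define B where "B n = (\<integral>x. (norm (e n x))\<^sup>2 \<partial>M)" for n
  have A0: "A \<ge> 0" and B0: "B n \<ge> 0" for n
    by (simp_all add: A_def B_def)
  have pt: "norm (f x \<bullet> e n x) \<le> d * (norm (f x))\<^sup>2 + (norm (e n x))\<^sup>2 / d" if d: "d > 0" for d x n
  proof -
    have "0 \<le> (d * norm (f x) - norm (e n x))\<^sup>2 / d" using d by simp
    also have "\<dots> = d * (norm (f x))\<^sup>2 - 2 * (norm (f x) * norm (e n x)) + (norm (e n x))\<^sup>2 / d"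
      using d by (simp add: power2_eq_square field_simps)
    finally have 1: "2 * (norm (f x) * norm (e n x)) \<le> d * (norm (f x))\<^sup>2 + (norm (e n x))\<^sup>2 / d" by simp
    have "norm (f x \<bullet> e n x) \<le> norm (f x) * norm (e n x)"
      using Cauchy_Schwarz_ineq2[of "f x" "e n x"] by simp
    also have "\<dots> \<le> 2 * (norm (f x) * norm (e n x))" by simp
    finally show ?thesis using 1 by linarith
  qed
  have bi: "integrable M (\<lambda>x. d * (norm (f x))\<^sup>2 + (norm (e n x))\<^sup>2 / d)" for d n
    using f e by simp
  show i: "integrable M (\<lambda>x. f x \<bullet> e n x)" for n
    by (rule sq_integrable_inner[OF assms(1,2) f e])
  have bound: "norm (\<integral>x. f x \<bullet> e n x \<partial>M) \<le> d * A + B n / d" if d: "d > 0" for d n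
  proof -
    have "norm (\<integral>x. f x \<bullet> e n x \<partial>M) \<le> (\<integral>x. norm (f x \<bullet> e n x) \<partial>M)" by (rule integral_norm_bound)
    also have "\<dots> \<le> (\<integral>x. d * (norm (f x))\<^sup>2 + (norm (e n x))\<^sup>2 / d \<partial>M)"
      by (rule integral_mono[OF integrable_norm[OF i] bi]) (rule pt[OF d])
    also have "\<dots> = d * A + B n / d" using f e by (simp add: A_def B_def)
    finally show ?thesis .
  qed
  \<comment> \<open>The square root balances the two terms; the summand
    \<open>1 / (real n + 1)\<close> keeps the weight positive when \<open>B n\<close> is 0.\<close>
  define d where "d n = sqrt (B n) + 1 / (real n + 1)" for n
  have dpos: "d n > 0" for n using B0[of n] by (simp add: d_def add_nonneg_pos)
  have B: "B \<longlonglongrightarrow> 0" using lim by (simp add: B_def[abs_def])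
  have sB: "(\<lambda>n. sqrt (B n)) \<longlonglongrightarrow> 0" using tendsto_real_sqrt[OF B] by simp
  have z: "(\<lambda>n. 1 / (real n + 1)) \<longlonglongrightarrow> 0" by real_asymp
  have d0: "d \<longlonglongrightarrow> 0" using tendsto_add[OF sB z] by (simp add: d_def[abs_def])
  have le: "norm (\<integral>x. f x \<bullet> e n x \<partial>M) \<le> d n * A + sqrt (B n)" for n
  proof -
    have "sqrt (B n) \<le> d n" by (simp add: d_def)
    then have "sqrt (B n) * sqrt (B n) \<le> sqrt (B n) * d n" using B0 by (intro mult_left_mono) auto
    then have "B n / d n \<le> sqrt (B n)" using dpos[of n] B0[of n] by (simp add: divide_le_eq)
    then show ?thesis using bound[OF dpos[of n], of n] by linarith
  qed
  have "(\<lambda>n. d n * A + sqrt (B n)) \<longlonglongrightarrow> 0 * A + 0" by (intro tendsto_intros d0 sB)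
  then have g0: "(\<lambda>n. d n * A + sqrt (B n)) \<longlonglongrightarrow> 0" by simp
  show "(\<lambda>n. \<integral>x. f x \<bullet> e n x \<partial>M) \<longlonglongrightarrow> 0"
    by (rule Lim_null_comparison[OF always_eventually[OF allI[OF le]] g0])
qed

lemma sq_limit:
  fixes f :: "'a \<Rightarrow> 'b::euclidean_space" and e :: "nat \<Rightarrow> 'a \<Rightarrow> 'b"
  assumes m: "f \<in> borel_measurable M" "\<And>n. e n \<in> borel_measurable M"
    and f: "integrable M (\<lambda>x. (norm (f x))\<^sup>2)" and e: "\<And>n. integrable M (\<lambda>x. (norm (e n x))\<^sup>2)"
    and lim: "(\<lambda>n. \<integral>x. (norm (e n x))\<^sup>2 \<partial>M) \<longlonglongrightarrow> 0"
  shows "(\<lambda>n. \<integral>x. (norm (f x - e n x))\<^sup>2 \<partial>M) \<longlonglongrightarrow> (\<integral>x. (norm (f x))\<^sup>2 \<partial>M)"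
proof -
  note C = sq_limit_cross[OF m f e lim]
  have "(norm (f x - e n x))\<^sup>2 = (norm (f x))\<^sup>2 - 2 * (f x \<bullet> e n x) + (norm (e n x))\<^sup>2" for x n
    unfolding power2_norm_eq_inner by (simp add: inner_diff_left inner_diff_right inner_commute)
  then have "(\<integral>x. (norm (f x - e n x))\<^sup>2 \<partial>M) = (\<integral>x. (norm (f x))\<^sup>2 \<partial>M) - 2 * (\<integral>x. f x \<bullet> e n x \<partial>M) + (\<integral>x. (norm (e n x))\<^sup>2 \<partial>M)" for n
    using C(1)[of n] f e[of n] by simp
  moreover have "(\<lambda>n. (\<integral>x. (norm (f x))\<^sup>2 \<partial>M) - 2 * (\<integral>x. f x \<bullet> e n x \<partial>M) + (\<integral>x. (norm (e n x))\<^sup>2 \<partial>M)) \<longlonglongrightarrow>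
      (\<integral>x. (norm (f x))\<^sup>2 \<partial>M) - 2 * 0 + 0"
    by (intro tendsto_intros C lim)
  ultimately show ?thesis by simp
qed

text \<open>Exhaustion by finite unions of closed boxes, on each of which the function is integrable
  and therefore measurable.\<close>

lemma locally_integrable_measurable:
  fixes f :: "complex \<Rightarrow> 'b::{banach,second_countable_topology}"
  assumes W: "open W" and f: "locally_integrable_on f W"
  shows "(\<lambda>z. indicator W z *\<^sub>R f z) \<in> borel_measurable borel"
proof -
  obtain D where D: "countable D" "D \<subseteq> Pow W" "\<And>X. X \<in> D \<Longrightarrow> \<exists>a b. X = cbox a b" "\<Union>D = W"
    using open_countable_Union_open_cbox[OF W] by blast
  show ?thesis
  proof (cases "D = {}")
    case True
    then have "W = {}" using D by auto
    then show ?thesis by simp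
  next
    case False
    define C where "C n = (\<Union>i\<le>n. from_nat_into D i)" for n :: nat
    have inD: "from_nat_into D i \<in> D" for i using from_nat_into[OF False] .
    have cC: "compact (C n)" "C n \<subseteq> W" for n
    proof -
      have "compact (from_nat_into D i)" for i using D(3)[OF inD[of i]] by auto
      then show "compact (C n)" unfolding C_def by (intro compact_UN) auto
      show "C n \<subseteq> W" unfolding C_def using inD D(2) by blast
    qed
    show ?thesis
    proof (rule borel_measurable_LIMSEQ_metric)
      show "(\<lambda>z. indicator (C n) z *\<^sub>R f z) \<in> borel_measurable borel" for n
        using f cC[of n] unfolding locally_integrable_on_def set_integrable_def by auto
      fix z :: complex
      show "(\<lambda>n. indicator (C n) z *\<^sub>R f z) \<longlonglongrightarrow> indicator W z *\<^sub>R f z"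
      proof (cases "z \<in> W")
        case True
        then obtain X where "X \<in> D" "z \<in> X" using D(4) by blast
        then obtain i where "z \<in> from_nat_into D i" using from_nat_into_surj[OF D(1)] by metis
        then have "z \<in> C n" if "n \<ge> i" for n using that by (auto simp: C_def)
        then have "eventually (\<lambda>n. indicator (C n) z *\<^sub>R f z = indicator W z *\<^sub>R f z) sequentially"
          using True by (intro eventually_sequentiallyI[of i]) auto
        then show ?thesis by (rule tendsto_eventually)
      next
        case False
        then have "z \<notin> C n" for n using cC(2) by blast
        then show ?thesis using False by simp
      qed
    qed
  qed
qed

section \<open>From test functions to the Sobolev space, and the upper bound for the
  dimension\<close>

context oliveira
begin

lemma continuous_lam0: "continuous_on (- {0}) lam0"
  unfolding lam0_def[abs_def]
proof (intro continuous_intros continuous_sg ballI)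
  show "z ^ (m + 1) \<noteq> 0" if "z \<in> - {0}" for z :: complex using that by simp
qed simp

lemma lam0_pos: "z \<noteq> 0 \<Longrightarrow> lam0 z > 0"
proof -
  assume "z \<noteq> 0"
  then have "cmod (\<i> / z ^ (m + 1)) \<noteq> 0" by simp
  then have "cmod (\<i> / z ^ (m + 1)) * sg z / 2 \<noteq> 0" using sg_pos[of z] by simp
  then show ?thesis unfolding lam0_def by (rule zero_less_power2[THEN iffD2])
qed

text \<open>Open sets that stay away from both ends. There the curvature is bounded, so the
  \<open>H1\<close> norm controls the index form.\<close>

definition admissible :: "complex set \<Rightarrow> bool" where
  "admissible W \<longleftrightarrow> open W \<and> (\<exists>K. compact K \<and> K \<subseteq> - {0} \<and> W \<subseteq> K)"

text \<open>Conformal invariance: the area density cancels the factor in the norm of the gradient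
  and turns twice the curvature into \<open>- rho\<close>.\<close>

lemma index_form_eq:
  assumes "admissible W"
  shows "index_form X W u = (LINT z:W|lborel. (cmod (weak_gradient W u z))\<^sup>2 - rho z * (u z)\<^sup>2)"
  unfolding index_form_def
proof (rule set_lebesgue_integral_cong)
  show "W \<in> sets lborel" using assms by (auto simp: admissible_def)
  show "\<forall>z. z \<in> W \<longrightarrow> (covector_norm_sq X z (weak_gradient W u z) + 2 * gauss_curvature X z * (u z)\<^sup>2) * area_density X z
      = (cmod (weak_gradient W u z))\<^sup>2 - rho z * (u z)\<^sup>2"
  proof (intro allI impI)
    fix z assume "z \<in> W"
    then have z: "z \<noteq> 0" using assms by (auto simp: admissible_def)
    have "(covector_norm_sq X z (weak_gradient W u z) + 2 * gauss_curvature X z * (u z)\<^sup>2) * area_density X z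
      = covector_norm_sq X z (weak_gradient W u z) * area_density X z + 2 * gauss_curvature X z * area_density X z * (u z)\<^sup>2"
      by (simp add: algebra_simps)
    then show "(covector_norm_sq X z (weak_gradient W u z) + 2 * gauss_curvature X z * (u z)\<^sup>2) * area_density X z
      = (cmod (weak_gradient W u z))\<^sup>2 - rho z * (u z)\<^sup>2"
      unfolding covector_eq[OF z] gauss_eq[OF z] by simp
  qed
qed

lemma H1_iff:
  assumes W: "admissible W"
  shows "u \<in> H1 X W \<longleftrightarrow> (\<exists>p. has_weak_gradient_on u p W) \<and> set_integrable lborel W (\<lambda>z. lam0 z * (u z)\<^sup>2) \<and>
    set_integrable lborel W (\<lambda>z. (cmod (weak_gradient W u z))\<^sup>2)"
proof -
  have z: "z \<noteq> 0" if "z \<in> W" for z using W that by (auto simp: admissible_def)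
  have "set_integrable lborel W (\<lambda>z. (u z)\<^sup>2 * area_density X z) \<longleftrightarrow> set_integrable lborel W (\<lambda>z. lam0 z * (u z)\<^sup>2)"
    by (rule set_integrable_cong) (auto simp: area_eq z)
  moreover have "set_integrable lborel W (\<lambda>z. covector_norm_sq X z (weak_gradient W u z) * area_density X z)
      \<longleftrightarrow> set_integrable lborel W (\<lambda>z. (cmod (weak_gradient W u z))\<^sup>2)"
    by (rule set_integrable_cong) (auto simp: covector_eq z)
  ultimately show ?thesis by (simp add: H1_def)
qed

lemma H1_norm_sq_eq:
  assumes W: "admissible W"
  shows "H1_norm_sq X W u = (LINT z:W|lborel. lam0 z * (u z)\<^sup>2 + (cmod (weak_gradient W u z))\<^sup>2)"
  unfolding H1_norm_sq_def
proof (rule set_lebesgue_integral_cong)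
  show "W \<in> sets lborel" using assms by (auto simp: admissible_def)
  have z: "z \<noteq> 0" if "z \<in> W" for z using W that by (auto simp: admissible_def)
  show "\<forall>z. z \<in> W \<longrightarrow> ((u z)\<^sup>2 + covector_norm_sq X z (weak_gradient W u z)) * area_density X z
      = lam0 z * (u z)\<^sup>2 + (cmod (weak_gradient W u z))\<^sup>2"
  proof (intro allI impI)
    fix w assume w: "w \<in> W"
    show "((u w)\<^sup>2 + covector_norm_sq X w (weak_gradient W u w)) * area_density X w
      = lam0 w * (u w)\<^sup>2 + (cmod (weak_gradient W u w))\<^sup>2"
      unfolding distrib_right covector_eq[OF z[OF w]] unfolding area_eq[OF z[OF w]] by (simp add: mult.commute)
  qed
qed

text \<open>The quotient of \<open>rho\<close> by \<open>lam0\<close> is minus twice the Gauss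
  curvature, continuous on the compact set.\<close>

lemma rho_le_lam0:
  assumes W: "admissible W"
  obtains C where "C > 0" "\<And>z. z \<in> W \<Longrightarrow> rho z \<le> C * lam0 z"
proof -
  obtain K where K: "compact K" "K \<subseteq> - {0}" "W \<subseteq> K" using W by (auto simp: admissible_def)
  have nz: "lam0 z \<noteq> 0" if "z \<in> K" for z
  proof -
    have "z \<noteq> 0" using that K(2) by auto
    from lam0_pos[OF this] show ?thesis by simp
  qed
  have c: "continuous_on K (\<lambda>z. rho z / lam0 z)"
    by (intro continuous_on_divide continuous_rho continuous_on_subset[OF continuous_lam0 K(2)] ballI nz)
  then have "bounded ((\<lambda>z. rho z / lam0 z) ` K)"
    by (intro compact_imp_bounded compact_continuous_image c K(1))
  then obtain C where "C > 0" "\<forall>x\<in>(\<lambda>z. rho z / lam0 z) ` K. norm x \<le> C"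
    unfolding bounded_pos by blast
  then have C: "C > 0" "\<And>z. z \<in> K \<Longrightarrow> \<bar>rho z / lam0 z\<bar> \<le> C" by auto
  show thesis
  proof (rule that[OF C(1)])
    fix z assume z: "z \<in> W"
    then have "lam0 z > 0" using lam0_pos K by blast
    moreover have "rho z / lam0 z \<le> C"
      by (rule order_trans[OF abs_ge_self C(2)]) (use z K(3) in blast)
    ultimately show "rho z \<le> C * lam0 z" by (simp add: divide_le_eq)
  qed
qed

text \<open>The inequality holds for the approximating test functions and passes to the limit term
  by term: \<open>H1\<close> convergence gives mean square convergence of the gradients and of the
  functions multiplied by the root of \<open>rho\<close>, and the cell integrals converge because
  that root is itself square integrable.\<close>

theorem H10_inequality:
  assumes W: "admissible W" and u: "u \<in> H10 X W"
  defines "p \<equiv> weak_gradient W u"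
  shows "set_integrable lborel W (\<lambda>z. rho z * (u z)\<^sup>2)" "set_integrable lborel W (\<lambda>z. (cmod (p z))\<^sup>2)"
    "integrable lborel (\<lambda>z. rho z * (indicator W z * u z))"
    "(LINT z:W|lborel. rho z * (u z)\<^sup>2) \<le> (LINT z:W|lborel. (cmod (p z))\<^sup>2)
      + (\<Sum>(\<alpha>, b)\<in>cells. (amp \<alpha> b (\<lambda>z. indicator W z * u z) - s * sgb b * c0)\<^sup>2) / (4 * pi)"
proof -
  have oW: "open W" using W by (auto simp: admissible_def)
  have z0: "z \<noteq> 0" if "z \<in> W" for z using W that by (auto simp: admissible_def)
  have [measurable]: "W \<in> sets borel" using oW by simp
  obtain C where C: "C > 0" "\<And>z. z \<in> W \<Longrightarrow> rho z \<le> C * lam0 z" using rho_le_lam0[OF W] by blast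
  have uH: "u \<in> H1 X W" using u by (simp add: H10_def)
  then obtain p0 where p0: "has_weak_gradient_on u p0 W"
    and iu: "set_integrable lborel W (\<lambda>z. lam0 z * (u z)\<^sup>2)"
    and ip: "set_integrable lborel W (\<lambda>z. (cmod (p z))\<^sup>2)"
    using H1_iff[OF W] by (auto simp: p_def)
  show "set_integrable lborel W (\<lambda>z. (cmod (p z))\<^sup>2)" by (rule ip)
  have wp: "has_weak_gradient_on u p W" unfolding p_def by (rule weak_gradient_AE(2)[OF oW p0])
  \<comment> \<open>Values outside \<open>W\<close> are arbitrary, so \<open>u\<close> is extended
    by 0; test functions on \<open>W\<close> vanish there already.\<close>
  define U where "U z = indicator W z * u z" for z
  define P where "P z = indicator W z *\<^sub>R p z" for z
  have mU [measurable]: "U \<in> borel_measurable borel"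
    using locally_integrable_measurable[OF oW, of u] wp by (simp add: U_def[abs_def] has_weak_gradient_on_def)
  have mP [measurable]: "P \<in> borel_measurable borel"
    using locally_integrable_measurable[OF oW, of p] wp by (simp add: P_def[abs_def] has_weak_gradient_on_def)
  note [measurable] = measurable_rho measurable_el measurable_gel
  have msr [measurable]: "(\<lambda>z. sqrt (rho z)) \<in> borel_measurable borel" by measurable
  obtain \<phi> where \<phi>: "\<And>n::nat. \<phi> n \<in> test_functions W"
    and lim: "(\<lambda>n. H1_norm_sq X W (\<lambda>z. u z - \<phi> n z)) \<longlonglongrightarrow> 0"
    using u by (auto simp: H10_def)
  have c\<phi>: "continuous_on UNIV (\<phi> n)" "continuous_on UNIV (grad (\<phi> n))" for n
    using test_continuous[OF \<phi>] test_functionsE[OF \<phi>] by metis+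
  have m\<phi> [measurable]: "\<phi> n \<in> borel_measurable borel" "grad (\<phi> n) \<in> borel_measurable borel" for n
    by (rule borel_measurable_continuous_onI[OF c\<phi>(1)], rule borel_measurable_continuous_onI[OF c\<phi>(2)])
  have out: "\<phi> n z = 0 \<and> grad (\<phi> n) z = 0" if "z \<notin> W" for n z
    using that test_functionsE[OF \<phi>[of n]] by (metis subsetD)
  define E where "E n z = U z - \<phi> n z" for n z
  define Q where "Q n z = P z - grad (\<phi> n) z" for n z
  have [measurable]: "E n \<in> borel_measurable borel" "Q n \<in> borel_measurable borel" for n
    unfolding E_def[abs_def] Q_def[abs_def] by measurable
  have mlam: "(\<lambda>z. indicator W z * lam0 z) \<in> borel_measurable borel"
  proof -
    have "continuous_on W lam0" by (rule continuous_on_subset[OF continuous_lam0]) (use z0 in auto)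
    then show ?thesis using borel_measurable_continuous_on_indicator[of W lam0] by simp
  qed
  define L where "L z = indicator W z * lam0 z" for z
  have mL [measurable]: "L \<in> borel_measurable borel" using mlam by (simp add: L_def[abs_def])
  have L0: "L z \<ge> 0" for z using lam0_pos[OF z0, of z] by (auto simp: L_def indicator_def)
  have iU: "integrable lborel (\<lambda>z. L z * (U z)\<^sup>2)"
  proof -
    have "(\<lambda>z. indicator W z *\<^sub>R (lam0 z * (u z)\<^sup>2)) = (\<lambda>z. L z * (U z)\<^sup>2)"
      by (auto simp: L_def U_def indicator_def)
    then show ?thesis using iu by (simp add: set_integrable_def)
  qed
  have iP: "integrable lborel (\<lambda>z. (norm (P z))\<^sup>2)"
  proof -
    have "(\<lambda>z. indicator W z *\<^sub>R (cmod (p z))\<^sup>2) = (\<lambda>z. (norm (P z))\<^sup>2)"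
      by (auto simp: P_def indicator_def)
    then show ?thesis using ip by (simp add: set_integrable_def)
  qed
  have iL\<phi>: "integrable lborel (\<lambda>z. L z * (\<phi> n z)\<^sup>2)" for n
  proof -
    obtain K where K: "compact K" "K \<subseteq> W" "\<And>z. z \<notin> K \<Longrightarrow> \<phi> n z = 0" using test_functionsE[OF \<phi>[of n]] by metis
    have "continuous_on K (\<lambda>z. lam0 z * (\<phi> n z)\<^sup>2)"
      by (intro continuous_intros continuous_on_subset[OF continuous_lam0] continuous_on_subset[OF c\<phi>(1)]) (use K z0 in auto)
    then have "set_integrable lborel K (\<lambda>z. lam0 z * (\<phi> n z)\<^sup>2)"
      unfolding set_integrable_def by (rule borel_integrable_compact[OF K(1)])
    moreover have "(\<lambda>z. indicator K z *\<^sub>R (lam0 z * (\<phi> n z)\<^sup>2)) = (\<lambda>z. L z * (\<phi> n z)\<^sup>2)"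
    proof
      fix z
      show "indicator K z *\<^sub>R (lam0 z * (\<phi> n z)\<^sup>2) = L z * (\<phi> n z)\<^sup>2"
        using K(2) K(3)[of z] by (cases "z \<in> K") (auto simp: L_def)
    qed
    ultimately show ?thesis by (simp add: set_integrable_def)
  qed
  have sq2: "(a - b)\<^sup>2 \<le> 2 * a\<^sup>2 + 2 * b\<^sup>2" for a b :: real
    using zero_le_power2[of "a + b"] by (simp add: power2_eq_square algebra_simps)
  have iLE: "integrable lborel (\<lambda>z. L z * (E n z)\<^sup>2)" for n
  proof (rule Bochner_Integration.integrable_bound)
    show "integrable lborel (\<lambda>z. 2 * (L z * (U z)\<^sup>2) + 2 * (L z * (\<phi> n z)\<^sup>2))"
      using iU iL\<phi>[of n] by simp
    show "AE z in lborel. norm (L z * (E n z)\<^sup>2) \<le> norm (2 * (L z * (U z)\<^sup>2) + 2 * (L z * (\<phi> n z)\<^sup>2))"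
      using mult_left_mono[OF sq2[of "U _" "\<phi> n _"] L0] L0 by (intro AE_I2) (simp add: E_def algebra_simps)
  qed measurable
  have iQ: "integrable lborel (\<lambda>z. (norm (Q n z))\<^sup>2)" for n
  proof (rule Bochner_Integration.integrable_bound)
    show "integrable lborel (\<lambda>z. 2 * (norm (P z))\<^sup>2 + 2 * (cmod (grad (\<phi> n) z))\<^sup>2)"
      using iP test_integrable(2)[OF \<phi>[of n]] by simp
    have "(norm (x - y))\<^sup>2 \<le> 2 * (norm x)\<^sup>2 + 2 * (norm y)\<^sup>2" for x y :: complex
      using zero_le_power2[of "norm (x + y)"]
      unfolding power2_norm_eq_inner by (simp add: inner_add_left inner_add_right inner_diff_left inner_diff_right inner_commute)
    then show "AE z in lborel. norm ((norm (Q n z))\<^sup>2) \<le> norm (2 * (norm (P z))\<^sup>2 + 2 * (cmod (grad (\<phi> n) z))\<^sup>2)"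
      by (intro AE_I2) (simp add: Q_def)
  qed measurable
  \<comment> \<open>The weak gradient of the difference is a separate choice, which agrees only
    almost everywhere with the difference of the gradients.\<close>
  have norm_eq: "H1_norm_sq X W (\<lambda>z. u z - \<phi> n z) = (\<integral>z. L z * (E n z)\<^sup>2 \<partial>lborel) + (\<integral>z. (norm (Q n z))\<^sup>2 \<partial>lborel)" for n
  proof -
    have "has_weak_gradient_on (\<lambda>z. u z - \<phi> n z) (\<lambda>z. p z - grad (\<phi> n) z) W"
      by (rule has_weak_gradient_diff[OF wp has_weak_gradient_test[OF \<phi>]])
    note wg = weak_gradient_AE[OF oW this]
    let ?g = "weak_gradient W (\<lambda>z. u z - \<phi> n z)"
    define H where "H z = indicator W z *\<^sub>R ?g z" for z
    have mg [measurable]: "H \<in> borel_measurable borel"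
      using locally_integrable_measurable[OF oW, of ?g] wg(2) by (simp add: has_weak_gradient_on_def H_def[abs_def])
    have "H1_norm_sq X W (\<lambda>z. u z - \<phi> n z) = (\<integral>z. L z * (E n z)\<^sup>2 + (norm (H z))\<^sup>2 \<partial>lborel)"
      unfolding H1_norm_sq_eq[OF W] set_lebesgue_integral_def
    proof (rule Bochner_Integration.integral_cong)
      fix z
      show "indicator W z *\<^sub>R (lam0 z * (u z - \<phi> n z)\<^sup>2 + (cmod (?g z))\<^sup>2) =
          L z * (E n z)\<^sup>2 + (norm (H z))\<^sup>2"
        using out[of z n] by (cases "z \<in> W") (simp_all add: L_def E_def U_def H_def)
    qed simp
    also have "\<dots> = (\<integral>z. L z * (E n z)\<^sup>2 + (norm (Q n z))\<^sup>2 \<partial>lborel)"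
    proof (rule integral_cong_AE)
      have "H z = Q n z" if "z \<in> W \<longrightarrow> ?g z = p z - grad (\<phi> n) z" for z
      proof (cases "z \<in> W")
        case True
        then have "?g z = p z - grad (\<phi> n) z" using that by blast
        then show ?thesis using True by (simp add: Q_def P_def H_def)
      next
        case False
        then show ?thesis using out[of z n] by (simp add: Q_def P_def H_def)
      qed
      then have "AE z in lborel. H z = Q n z"
        using wg(1) by (auto elim: eventually_mono)
      then show "AE z in lborel. L z * (E n z)\<^sup>2 + (norm (H z))\<^sup>2 = L z * (E n z)\<^sup>2 + (norm (Q n z))\<^sup>2"
        by (rule eventually_mono) (simp only:)
      have mm: "E n \<in> borel_measurable lborel" "Q n \<in> borel_measurable lborel" "H \<in> borel_measurable lborel" "L \<in> borel_measurable lborel"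
        by measurable
      note mn = measurable_compose[OF mm(2) borel_measurable_norm] measurable_compose[OF mm(3) borel_measurable_norm]
      show "(\<lambda>z. L z * (E n z)\<^sup>2 + (norm (H z))\<^sup>2) \<in> borel_measurable lborel"
        by (intro borel_measurable_add borel_measurable_times borel_measurable_power mm mn)
      show "(\<lambda>z. L z * (E n z)\<^sup>2 + (norm (Q n z))\<^sup>2) \<in> borel_measurable lborel"
        by (intro borel_measurable_add borel_measurable_times borel_measurable_power mm mn)
    qed
    also have "\<dots> = (\<integral>z. L z * (E n z)\<^sup>2 \<partial>lborel) + (\<integral>z. (norm (Q n z))\<^sup>2 \<partial>lborel)"
      using iLE iQ by simp
    finally show ?thesis .
  qed
  have nnE: "(\<integral>z. L z * (E n z)\<^sup>2 \<partial>lborel) \<ge> 0" and nnQ: "(\<integral>z. (norm (Q n z))\<^sup>2 \<partial>lborel) \<ge> 0" for n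
    using L0 by (auto intro!: Bochner_Integration.integral_nonneg)
  have limE: "(\<lambda>n. \<integral>z. L z * (E n z)\<^sup>2 \<partial>lborel) \<longlonglongrightarrow> 0"
    by (rule tendsto_sandwich[OF _ _ tendsto_const lim]) (use nnE nnQ norm_eq in \<open>auto intro!: always_eventually\<close>)
  have limQ: "(\<lambda>n. \<integral>z. (norm (Q n z))\<^sup>2 \<partial>lborel) \<longlonglongrightarrow> 0"
    by (rule tendsto_sandwich[OF _ _ tendsto_const lim]) (use nnE nnQ norm_eq in \<open>auto intro!: always_eventually\<close>)
  \<comment> \<open>The root of the weight turns weighted mean squares into plain ones, to which
    \<open>sq_limit\<close> applies.\<close>
  define F where "F z = sqrt (rho z) * U z" for z
  define G where "G n z = sqrt (rho z) * E n z" for n z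
  have [measurable]: "F \<in> borel_measurable borel" "G n \<in> borel_measurable borel" for n
    unfolding F_def[abs_def] G_def[abs_def] by measurable
  have F2: "(norm (F z))\<^sup>2 = rho z * (U z)\<^sup>2" and G2: "(norm (G n z))\<^sup>2 = rho z * (E n z)\<^sup>2" for z n
    using rho_nonneg by (simp_all add: F_def G_def power_mult_distrib)
  have rC: "rho z * (x z)\<^sup>2 \<le> C * (L z * (x z)\<^sup>2)" if "\<And>z. z \<notin> W \<Longrightarrow> x z = 0" for x :: "complex \<Rightarrow> real" and z
    using mult_right_mono[OF C(2), of z "(x z)\<^sup>2"] that[of z] by (cases "z \<in> W") (auto simp: L_def mult.assoc)
  have UW: "U z = 0" and EW: "E n z = 0" if "z \<notin> W" for z n
    using that out by (auto simp: U_def E_def)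
  have iF: "integrable lborel (\<lambda>z. (norm (F z))\<^sup>2)"
  proof (rule Bochner_Integration.integrable_bound)
    show "integrable lborel (\<lambda>z. C * (L z * (U z)\<^sup>2))" using iU by simp
    show "AE z in lborel. norm ((norm (F z))\<^sup>2) \<le> norm (C * (L z * (U z)\<^sup>2))"
      using rC[of U, OF UW] L0 C(1) rho_nonneg unfolding F2 by (intro AE_I2) (simp add: abs_mult)
  qed measurable
  have iG: "integrable lborel (\<lambda>z. (norm (G n z))\<^sup>2)" for n
  proof (rule Bochner_Integration.integrable_bound)
    show "integrable lborel (\<lambda>z. C * (L z * (E n z)\<^sup>2))" using iLE by simp
    show "AE z in lborel. norm ((norm (G n z))\<^sup>2) \<le> norm (C * (L z * (E n z)\<^sup>2))"
      using rC[of "E n", OF EW] L0 C(1) rho_nonneg unfolding G2 by (intro AE_I2) (simp add: abs_mult)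
  qed measurable
  have limG: "(\<lambda>n. \<integral>z. (norm (G n z))\<^sup>2 \<partial>lborel) \<longlonglongrightarrow> 0"
  proof (rule tendsto_sandwich[OF _ _ tendsto_const])
    show "(\<lambda>n. C * (\<integral>z. L z * (E n z)\<^sup>2 \<partial>lborel)) \<longlonglongrightarrow> 0"
      using tendsto_mult_right_zero[OF limE] .
    have "(\<integral>z. (norm (G n z))\<^sup>2 \<partial>lborel) \<le> (\<integral>z. C * (L z * (E n z)\<^sup>2) \<partial>lborel)" for n
      unfolding G2 by (rule integral_mono[OF iG[unfolded G2]]) (use iLE rC[of "E n", OF EW] in auto)
    then show "eventually (\<lambda>n. (\<integral>z. (norm (G n z))\<^sup>2 \<partial>lborel) \<le> C * (\<integral>z. L z * (E n z)\<^sup>2 \<partial>lborel)) sequentially"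
      by simp
  qed simp
  have FW: "(\<integral>z. (norm (F z))\<^sup>2 \<partial>lborel) = (LINT z:W|lborel. rho z * (u z)\<^sup>2)"
    unfolding set_lebesgue_integral_def F2 by (rule Bochner_Integration.integral_cong) (auto simp: U_def indicator_def)
  have PW: "(\<integral>z. (norm (P z))\<^sup>2 \<partial>lborel) = (LINT z:W|lborel. (cmod (p z))\<^sup>2)"
    unfolding set_lebesgue_integral_def by (rule Bochner_Integration.integral_cong) (auto simp: P_def indicator_def)
  show "set_integrable lborel W (\<lambda>z. rho z * (u z)\<^sup>2)"
  proof -
    have "(\<lambda>z. indicator W z *\<^sub>R (rho z * (u z)\<^sup>2)) = (\<lambda>z. (norm (F z))\<^sup>2)"
      unfolding F2 by (auto simp: U_def indicator_def)
    then show ?thesis using iF by (simp add: set_integrable_def)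
  qed
  have lim1: "(\<lambda>n. \<integral>z. rho z * (\<phi> n z)\<^sup>2 \<partial>lborel) \<longlonglongrightarrow> (LINT z:W|lborel. rho z * (u z)\<^sup>2)"
  proof -
    have "(norm (F z - G n z))\<^sup>2 = rho z * (\<phi> n z)\<^sup>2" for z n
    proof -
      have "F z - G n z = sqrt (rho z) * \<phi> n z" by (simp add: F_def G_def E_def algebra_simps)
      then show ?thesis using rho_nonneg by (simp add: power_mult_distrib)
    qed
    then show ?thesis using sq_limit[OF _ _ iF iG limG] unfolding FW by simp
  qed
  have lim2: "(\<lambda>n. \<integral>z. (cmod (grad (\<phi> n) z))\<^sup>2 \<partial>lborel) \<longlonglongrightarrow> (LINT z:W|lborel. (cmod (p z))\<^sup>2)"
    using sq_limit[OF _ _ iP iQ limQ] unfolding PW by (simp add: Q_def)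
  define R where "R z = sqrt (rho z)" for z
  have iR: "integrable lborel (\<lambda>z. (norm (indicator A z * R z))\<^sup>2)" if [measurable]: "A \<in> sets borel" for A
  proof (rule Bochner_Integration.integrable_bound[OF integrable_rho])
    show "(\<lambda>z. (norm (indicator A z * R z))\<^sup>2) \<in> borel_measurable lborel" unfolding R_def by measurable
    show "AE z in lborel. norm ((norm (indicator A z * R z))\<^sup>2) \<le> norm (rho z)"
      using rho_nonneg by (intro AE_I2) (simp add: R_def indicator_def)
  qed
  have mR [measurable]: "R \<in> borel_measurable borel" unfolding R_def[abs_def] by measurable
  have RR: "R z * (R z * x) = rho z * x" for z x
    using rho_nonneg[of z] by (simp add: R_def mult.assoc[symmetric])
  have "integrable lborel (\<lambda>z. (indicator UNIV z * R z) \<bullet> F z)"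
    by (rule sq_integrable_inner[OF _ _ iR iF]) simp_all
  then show iRU: "integrable lborel (\<lambda>z. rho z * (indicator W z * u z))"
    using RR by (simp add: F_def R_def[symmetric] U_def)
  have lim3: "(\<lambda>n. amp \<alpha> b (\<phi> n)) \<longlonglongrightarrow> amp \<alpha> b (\<lambda>z. indicator W z * u z)" if a: "\<alpha> \<in> fib" for \<alpha> b
  proof -
    have cb [measurable]: "cell \<alpha> b \<in> sets borel" by (rule cell_borel[OF a])
    have mA: "(\<lambda>z. indicator (cell \<alpha> b) z * R z) \<in> borel_measurable lborel" by measurable
    have mG: "G n \<in> borel_measurable lborel" for n by measurable
    note X = sq_limit_cross[OF mA mG iR[OF cb] iG limG]
    have i1: "integrable lborel (\<lambda>z. indicator (cell \<alpha> b) z *\<^sub>R (rho z * U z))"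
      using set_integrable_of_integrable[OF iRU cb] by (simp add: set_integrable_def U_def)
    have "amp \<alpha> b (\<phi> n) = amp \<alpha> b U - (\<integral>z. (indicator (cell \<alpha> b) z * R z) \<bullet> G n z \<partial>lborel)" for n
    proof -
      have e: "indicator (cell \<alpha> b) z *\<^sub>R (rho z * \<phi> n z) =
          indicator (cell \<alpha> b) z *\<^sub>R (rho z * U z) - (indicator (cell \<alpha> b) z * R z) \<bullet> G n z" for z
      proof -
        have "R z * G n z = rho z * E n z" using RR[of z "E n z"] by (simp add: G_def R_def)
        then show ?thesis by (cases "z \<in> cell \<alpha> b") (simp_all add: E_def algebra_simps)
      qed
      show ?thesis
        unfolding amp_def set_lebesgue_integral_def e using i1 X(1)[of n] by simp
    qed
    moreover have "(\<lambda>n. amp \<alpha> b U - (\<integral>z. (indicator (cell \<alpha> b) z * R z) \<bullet> G n z \<partial>lborel)) \<longlonglongrightarrow> amp \<alpha> b U - 0"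
      by (intro tendsto_diff tendsto_const X(2))
    ultimately show ?thesis by (simp add: U_def[abs_def])
  qed
  show "(LINT z:W|lborel. rho z * (u z)\<^sup>2) \<le> (LINT z:W|lborel. (cmod (p z))\<^sup>2)
      + (\<Sum>(\<alpha>, b)\<in>cells. (amp \<alpha> b (\<lambda>z. indicator W z * u z) - s * sgb b * c0)\<^sup>2) / (4 * pi)"
  proof (rule LIMSEQ_le[OF lim1])
    have "(\<lambda>n. (amp (fst q) (snd q) (\<phi> n) - s * sgb (snd q) * c0)\<^sup>2) \<longlonglongrightarrow>
        (amp (fst q) (snd q) (\<lambda>z. indicator W z * u z) - s * sgb (snd q) * c0)\<^sup>2" if "q \<in> cells" for q
      by (intro tendsto_power tendsto_diff tendsto_const lim3) (use that in \<open>auto simp: cells_def\<close>)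
    then have sums: "(\<lambda>n. \<Sum>(\<alpha>, b)\<in>cells. (amp \<alpha> b (\<phi> n) - s * sgb b * c0)\<^sup>2) \<longlonglongrightarrow>
      (\<Sum>(\<alpha>, b)\<in>cells. (amp \<alpha> b (\<lambda>z. indicator W z * u z) - s * sgb b * c0)\<^sup>2)"
      unfolding split_beta by (intro tendsto_sum)
    show "(\<lambda>n. (\<integral>z. (cmod (grad (\<phi> n) z))\<^sup>2 \<partial>lborel) + (\<Sum>(\<alpha>, b)\<in>cells. (amp \<alpha> b (\<phi> n) - s * sgb b * c0)\<^sup>2) / (4 * pi))
      \<longlonglongrightarrow> (LINT z:W|lborel. (cmod (p z))\<^sup>2)
      + (\<Sum>(\<alpha>, b)\<in>cells. (amp \<alpha> b (\<lambda>z. indicator W z * u z) - s * sgb b * c0)\<^sup>2) / (4 * pi)"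
      by (rule tendsto_add[OF lim2 tendsto_divide[OF sums tendsto_const]]) simp
    show "\<exists>N. \<forall>n\<ge>N. (\<integral>z. rho z * (\<phi> n z)\<^sup>2 \<partial>lborel) \<le> (\<integral>z. (cmod (grad (\<phi> n) z))\<^sup>2 \<partial>lborel)
      + (\<Sum>(\<alpha>, b)\<in>cells. (amp \<alpha> b (\<phi> n) - s * sgb b * c0)\<^sup>2) / (4 * pi)"
      by (intro exI[of _ 0] allI impI test_inequality[OF \<phi>])
  qed
qed

lemma antipodal_measurable: "antipodal \<in> borel_measurable borel"
proof -
  have [measurable]: "cnj \<in> borel_measurable borel"
    by (intro borel_measurable_continuous_onI continuous_intros)
  show ?thesis unfolding antipodal_def[abs_def] by measurable
qed

text \<open>The two cells of a pair are parametrised by the same strip with the same pulled-back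
  weight, and \<open>antipodal\<close> exchanges the parametrisations; oddness leaves only a
  sign.\<close>

lemma amp_odd:
  assumes a: "\<alpha> \<in> fib" and mF: "F \<in> borel_measurable borel" and iF: "integrable lborel (\<lambda>z. rho z * F z)"
    and odd: "AE z in lborel. F (antipodal z) = - F z"
  shows "amp \<alpha> False F = - amp \<alpha> True F"
proof -
  have mF': "(\<lambda>z. F (antipodal z)) \<in> borel_measurable borel"
    using measurable_compose[OF antipodal_measurable mF] .
  have m1: "(\<lambda>z. rho z * F z) \<in> borel_measurable borel" and m2: "(\<lambda>z. rho z * F (antipodal z)) \<in> borel_measurable borel"
    by (rule borel_measurable_times[OF measurable_rho mF], rule borel_measurable_times[OF measurable_rho mF'])
  note mi1 = measurable_indicator_mult[OF m1 cell_borel[OF a]] and mi2 = measurable_indicator_mult[OF m2 cell_borel[OF a]]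
  have eq: "(cmod (kfac \<alpha> False \<zeta>))\<^sup>2 * (rho (kap \<alpha> False \<zeta>) * F (kap \<alpha> False \<zeta>)) =
      (cmod (kfac \<alpha> True \<zeta>))\<^sup>2 * (rho (kap \<alpha> True \<zeta>) * F (antipodal (kap \<alpha> True \<zeta>)))" if "\<zeta> \<in> strip" for \<zeta>
    using rho_kap[OF a that, of True] rho_kap[OF a that, of False]
    by (simp add: mult.assoc[symmetric]) (simp add: kap_def)
  have i: "set_integrable lborel (cell \<alpha> False) (\<lambda>z. rho z * F z)" "set_integrable lborel (cell \<alpha> True) (\<lambda>z. rho z * F z)"
    by (rule set_integrable_of_integrable[OF iF cell_borel[OF a]])+
  have "set_integrable lborel strip (\<lambda>\<zeta>. (cmod (kfac \<alpha> False \<zeta>))\<^sup>2 * (rho (kap \<alpha> False \<zeta>) * F (kap \<alpha> False \<zeta>)))"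
    using cell_integral(1)[OF a mi1] i(1) by blast
  also have "set_integrable lborel strip (\<lambda>\<zeta>. (cmod (kfac \<alpha> False \<zeta>))\<^sup>2 * (rho (kap \<alpha> False \<zeta>) * F (kap \<alpha> False \<zeta>))) =
      set_integrable lborel strip (\<lambda>\<zeta>. (cmod (kfac \<alpha> True \<zeta>))\<^sup>2 * (rho (kap \<alpha> True \<zeta>) * F (antipodal (kap \<alpha> True \<zeta>))))"
    by (rule set_integrable_cong) (use eq in auto)
  finally have i2: "set_integrable lborel (cell \<alpha> True) (\<lambda>z. rho z * F (antipodal z))"
    using cell_integral(1)[OF a mi2] by blast
  have "amp \<alpha> False F = (LINT \<zeta>:strip|lborel. (cmod (kfac \<alpha> False \<zeta>))\<^sup>2 * (rho (kap \<alpha> False \<zeta>) * F (kap \<alpha> False \<zeta>)))"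
    unfolding amp_def by (rule cell_integral(2)[OF a mi1 i(1), symmetric])
  also have "\<dots> = (LINT \<zeta>:strip|lborel. (cmod (kfac \<alpha> True \<zeta>))\<^sup>2 * (rho (kap \<alpha> True \<zeta>) * F (antipodal (kap \<alpha> True \<zeta>))))"
    by (rule set_lebesgue_integral_cong) (use open_strip eq in auto)
  also have "\<dots> = (LINT z:cell \<alpha> True|lborel. rho z * F (antipodal z))"
    by (rule cell_integral(2)[OF a mi2 i2])
  also have "\<dots> = (LINT z:cell \<alpha> True|lborel. - (rho z * F z))"
    unfolding set_lebesgue_integral_def
  proof (rule integral_cong_AE)
    show "(\<lambda>z. indicator (cell \<alpha> True) z *\<^sub>R (rho z * F (antipodal z))) \<in> borel_measurable lborel"
      using i2 by (auto simp: set_integrable_def)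
    have "integrable lborel (\<lambda>z. indicator (cell \<alpha> True) z *\<^sub>R (- (rho z * F z)))"
      using i(2) by (simp add: set_integrable_def)
    then show "(\<lambda>z. indicator (cell \<alpha> True) z *\<^sub>R (- (rho z * F z))) \<in> borel_measurable lborel"
      by (rule borel_measurable_integrable)
    show "AE z in lborel. indicator (cell \<alpha> True) z *\<^sub>R (rho z * F (antipodal z)) = indicator (cell \<alpha> True) z *\<^sub>R (- (rho z * F z))"
      using odd by (rule eventually_mono) simp
  qed
  also have "\<dots> = - amp \<alpha> True F"
    unfolding amp_def set_lebesgue_integral_def by simp
  finally show ?thesis .
qed

lemma fun_sum_apply: "(\<Sum>i\<in>I. f i) z = (\<Sum>i\<in>I. f i z)" for f :: "'i \<Rightarrow> complex \<Rightarrow> real"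
  by (induction I rule: infinite_finite_induct) auto

theorem upper_bound:
  assumes W: "admissible W" and inv: "\<And>z. antipodal z \<in> W \<longleftrightarrow> z \<in> W"
    and V: "V \<in> negative_spaces W antipodal X"
  shows "fun_space.dim V \<le> m - 1"
proof (rule ccontr)
  assume "\<not> ?thesis"
  then have dV: "fun_space.dim V \<ge> m" using m5 by linarith
  have sub: "fun_space.subspace V" and H: "\<And>u. u \<in> V \<Longrightarrow> u \<in> H10 X W" "\<And>u. u \<in> V \<Longrightarrow> odd_on W antipodal u"
    and neg: "\<And>u. u \<in> V \<Longrightarrow> u \<noteq> 0 \<Longrightarrow> index_form X W u < 0"
    using V by (auto simp: negative_spaces_def)
  obtain B where B: "B \<subseteq> V" "fun_space.independent B" "card B = fun_space.dim V"
    by (rule fun_space.basis_exists[of V]) (rule that)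
  have finB: "finite B" using B(3) dV m5 by (intro card_ge_0_finite) simp
  obtain \<alpha>0 where a0: "\<alpha>0 \<in> fib" using fib_nonempty by blast
  define A where "A \<alpha> b = amp \<alpha> True (\<lambda>z. indicator W z * b z)" for \<alpha> b
  \<comment> \<open>One equation for each branch other than \<open>\<alpha>0\<close>: the integral
    over its cell with flag \<open>True\<close> has to equal the one for
    \<open>\<alpha>0\<close>.\<close>
  have "card (fib - {\<alpha>0}) < card B" using card_fib a0 B(3) dV m5 by simp
  then obtain c where c: "\<exists>b\<in>B. c b \<noteq> 0" "\<forall>\<alpha>\<in>fib - {\<alpha>0}. (\<Sum>b\<in>B. c b * (A \<alpha> b - A \<alpha>0 b)) = 0"
    using homogeneous_system_nontrivial[of "fib - {\<alpha>0}" B "\<lambda>b \<alpha>. A \<alpha> b - A \<alpha>0 b"] finB card_fib(2) by auto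
  define u where "u = (\<Sum>b\<in>B. (\<lambda>z. c b * b z))"
  have uz: "u z = (\<Sum>b\<in>B. c b * b z)" for z by (simp add: u_def fun_sum_apply)
  have uV: "u \<in> V" unfolding u_def
    by (rule fun_space.subspace_sum[OF sub]) (use B(1) fun_space.subspace_scale[OF sub] in blast)
  have u0: "u \<noteq> 0"
  proof
    assume "u = 0"
    then have "c b = 0" if "b \<in> B" for b
      using fun_space.independentD[OF B(2) finB order_refl, of c b] that unfolding u_def by blast
    then show False using c(1) by blast
  qed
  have oW: "open W" using W by (auto simp: admissible_def)
  have int: "integrable lborel (\<lambda>z. rho z * (indicator W z * b z))" if "b \<in> V" for b
    by (rule H10_inequality(3)[OF W H(1)[OF that]])
  have lin: "A \<alpha> u = (\<Sum>b\<in>B. c b * A \<alpha> b)" if "\<alpha> \<in> fib" for \<alpha>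
  proof -
    have i: "integrable lborel (\<lambda>z. c b * (indicator (cell \<alpha> True) z *\<^sub>R (rho z * (indicator W z * b z))))" if "b \<in> B" for b
      using set_integrable_of_integrable[OF int cell_borel[OF \<open>\<alpha> \<in> fib\<close>], of b True] B(1) that
      by (intro integrable_mult_right) (auto simp: set_integrable_def)
    have "A \<alpha> u = (\<integral>z. (\<Sum>b\<in>B. c b * (indicator (cell \<alpha> True) z *\<^sub>R (rho z * (indicator W z * b z)))) \<partial>lborel)"
      unfolding A_def amp_def set_lebesgue_integral_def uz
      by (rule Bochner_Integration.integral_cong) (simp_all add: sum_distrib_left mult.commute mult.left_commute)
    also have "\<dots> = (\<Sum>b\<in>B. \<integral>z. c b * (indicator (cell \<alpha> True) z *\<^sub>R (rho z * (indicator W z * b z))) \<partial>lborel)"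
      by (rule Bochner_Integration.integral_sum) (rule i)
    also have "\<dots> = (\<Sum>b\<in>B. c b * A \<alpha> b)"
      unfolding A_def amp_def set_lebesgue_integral_def by simp
    finally show ?thesis .
  qed
  have eqA: "A \<alpha> u = A \<alpha>0 u" if "\<alpha> \<in> fib" for \<alpha>
  proof (cases "\<alpha> = \<alpha>0")
    case False
    then have "(\<Sum>b\<in>B. c b * (A \<alpha> b - A \<alpha>0 b)) = 0" using c(2) that by blast
    then show ?thesis using lin[OF that] lin[OF a0] by (simp add: right_diff_distrib sum_subtractf)
  qed simp
  define U where "U z = indicator W z * u z" for z
  have mU: "U \<in> borel_measurable borel"
  proof -
    obtain p where "has_weak_gradient_on u p W" using H(1)[OF uV] by (auto simp: H10_def H1_def)
    then show ?thesis
      using locally_integrable_measurable[OF oW, of u] by (simp add: has_weak_gradient_on_def U_def[abs_def])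
  qed
  have oddU: "AE z in lborel. U (antipodal z) = - U z"
    using H(2)[OF uV] unfolding odd_on_def
  proof (rule eventually_mono)
    fix z assume "z \<in> W \<longrightarrow> u (antipodal z) = - u z"
    then show "U (antipodal z) = - U z" using inv[of z] by (cases "z \<in> W") (auto simp: U_def)
  qed
  \<comment> \<open>With this multiple of \<open>el\<close> all corrected cell integrals vanish,
    those with flag \<open>False\<close> by oddness.\<close>
  define s where "s = A \<alpha>0 u / c0"
  have "amp \<alpha> b U - s * sgb b * c0 = 0" if "\<alpha> \<in> fib" for \<alpha> b
  proof -
    have 1: "amp \<alpha> True U = A \<alpha>0 u" using eqA[OF that] by (simp add: A_def U_def[abs_def])
    have 2: "amp \<alpha> False U = - amp \<alpha> True U"
      by (rule amp_odd[OF that mU _ oddU]) (use int[OF uV] in \<open>simp add: U_def\<close>)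
    show ?thesis using 1 2 c0_pos by (cases b) (simp_all add: s_def sgb_def)
  qed
  then have z: "(\<Sum>(\<alpha>, b)\<in>cells. (amp \<alpha> b (\<lambda>z. indicator W z * u z) - s * sgb b * c0)\<^sup>2) = 0"
    by (intro sum.neutral) (auto simp: cells_def U_def[abs_def])
  note HI = H10_inequality[OF W H(1)[OF uV]]
  have "(LINT z:W|lborel. rho z * (u z)\<^sup>2) \<le> (LINT z:W|lborel. (cmod (weak_gradient W u z))\<^sup>2)"
    using HI(4)[of s] unfolding z by simp
  moreover have "index_form X W u = (LINT z:W|lborel. (cmod (weak_gradient W u z))\<^sup>2) - (LINT z:W|lborel. rho z * (u z)\<^sup>2)"
    unfolding index_form_eq[OF W] by (rule set_integral_diff(2)[OF HI(2,1)])
  ultimately show False using neg[OF uV u0] by simp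
qed

section \<open>Test functions in the negative space\<close>

lemma test_weak_gradient:
  assumes W: "open W" and \<phi>: "\<phi> \<in> test_functions W"
  shows "AE z in lborel. z \<in> W \<longrightarrow> weak_gradient W \<phi> z = grad \<phi> z"
  by (rule weak_gradient_AE(1)[OF W has_weak_gradient_test[OF \<phi>]])

lemma test_set_integral:
  assumes W: "open W" and \<phi>: "\<phi> \<in> test_functions W"
  shows "set_integrable lborel W (\<lambda>z. (cmod (weak_gradient W \<phi> z))\<^sup>2)"
    "(LINT z:W|lborel. (cmod (weak_gradient W \<phi> z))\<^sup>2) = (\<integral>z. (cmod (grad \<phi> z))\<^sup>2 \<partial>lborel)"
proof -
  obtain K where K: "continuous_on UNIV (grad \<phi>)" "compact K" "K \<subseteq> W" "\<And>z. z \<notin> K \<Longrightarrow> grad \<phi> z = 0"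
    using test_functionsE[OF \<phi>] by metis
  let ?g = "weak_gradient W \<phi>"
  define H where "H z = indicator W z *\<^sub>R ?g z" for z
  have mH: "H \<in> borel_measurable lborel"
    using locally_integrable_measurable[OF W, of ?g] weak_gradient_AE(2)[OF W has_weak_gradient_test[OF \<phi>]]
    by (simp add: has_weak_gradient_on_def H_def[abs_def])
  have mg: "grad \<phi> \<in> borel_measurable lborel" using borel_measurable_continuous_onI[OF K(1)] by simp
  have "AE z in lborel. H z = grad \<phi> z"
    using test_weak_gradient[OF W \<phi>]
  proof (rule eventually_mono)
    fix z assume "z \<in> W \<longrightarrow> ?g z = grad \<phi> z"
    then show "H z = grad \<phi> z" using K(3) K(4)[of z] by (cases "z \<in> W") (auto simp: H_def)
  qed
  then have ae: "AE z in lborel. (cmod (H z))\<^sup>2 = (cmod (grad \<phi> z))\<^sup>2" by (rule eventually_mono) simp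
  have m: "(\<lambda>z. (cmod (H z))\<^sup>2) \<in> borel_measurable lborel" "(\<lambda>z. (cmod (grad \<phi> z))\<^sup>2) \<in> borel_measurable lborel"
    by (intro borel_measurable_power measurable_compose[OF mH borel_measurable_norm] measurable_compose[OF mg borel_measurable_norm])+
  have e: "(\<lambda>z. indicator W z *\<^sub>R (cmod (?g z))\<^sup>2) = (\<lambda>z. (cmod (H z))\<^sup>2)"
    by (auto simp: H_def indicator_def)
  show "set_integrable lborel W (\<lambda>z. (cmod (weak_gradient W \<phi> z))\<^sup>2)"
    unfolding set_integrable_def e integrable_cong_AE[OF m ae] by (rule test_integrable(2)[OF \<phi>])
  show "(LINT z:W|lborel. (cmod (weak_gradient W \<phi> z))\<^sup>2) = (\<integral>z. (cmod (grad \<phi> z))\<^sup>2 \<partial>lborel)"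
    unfolding set_lebesgue_integral_def e by (rule integral_cong_AE[OF m ae])
qed

text \<open>The constant sequence approximates the function; its distance is the norm of 0, whose
  chosen weak gradient vanishes almost everywhere.\<close>

lemma test_H10:
  assumes W: "admissible W" and \<phi>: "\<phi> \<in> test_functions W"
  shows "\<phi> \<in> H10 X W"
proof -
  have oW: "open W" using W by (auto simp: admissible_def)
  obtain K where K: "compact K" "K \<subseteq> W" "\<And>z. z \<notin> K \<Longrightarrow> \<phi> z = 0"
    using test_functionsE[OF \<phi>] by metis
  have z0: "W \<subseteq> - {0}" using W by (auto simp: admissible_def)
  have "continuous_on K (\<lambda>z. lam0 z * (\<phi> z)\<^sup>2)"
    by (intro continuous_intros continuous_on_subset[OF continuous_lam0] continuous_on_subset[OF test_continuous[OF \<phi>]])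
      (use K z0 in auto)
  then have "set_integrable lborel K (\<lambda>z. lam0 z * (\<phi> z)\<^sup>2)"
    unfolding set_integrable_def by (rule borel_integrable_compact[OF K(1)])
  then have "set_integrable lborel W (\<lambda>z. lam0 z * (\<phi> z)\<^sup>2)"
    using set_integral_compact_support(3,4)[OF K(2), of "\<lambda>z. lam0 z * (\<phi> z)\<^sup>2"] K(3) by simp
  then have H1: "\<phi> \<in> H1 X W"
    using H1_iff[OF W] has_weak_gradient_test[OF \<phi>] test_set_integral(1)[OF oW \<phi>] by blast
  have "grad (\<lambda>_. 0) z = 0" for z by (rule grad_eqI) simp
  then have "H1_norm_sq X W (\<lambda>z. \<phi> z - \<phi> z) = 0"
    unfolding H1_norm_sq_eq[OF W] using test_set_integral(2)[OF oW test_zero] by simp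
  then have "(\<lambda>n::nat. H1_norm_sq X W (\<lambda>z. \<phi> z - \<phi> z)) \<longlonglongrightarrow> 0" by simp
  then show ?thesis unfolding H10_def using H1 \<phi> by (intro CollectI conjI exI[of _ "\<lambda>_. \<phi>"]) auto
qed

lemma test_index_form:
  assumes W: "admissible W" and \<phi>: "\<phi> \<in> test_functions W"
  shows "index_form X W \<phi> = (\<integral>z. (cmod (grad \<phi> z))\<^sup>2 - rho z * (\<phi> z)\<^sup>2 \<partial>lborel)"
proof -
  have oW: "open W" using W by (auto simp: admissible_def)
  obtain K where K: "compact K" "K \<subseteq> W" "\<And>z. z \<notin> K \<Longrightarrow> \<phi> z = 0"
    using test_functionsE[OF \<phi>] by metis
  note T = test_integrable[OF \<phi>]
  have "set_integrable lborel W (\<lambda>z. rho z * (\<phi> z)\<^sup>2)"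
    "(LINT z:W|lborel. rho z * (\<phi> z)\<^sup>2) = (\<integral>z. rho z * (\<phi> z)\<^sup>2 \<partial>lborel)"
    using set_integral_compact_support(1,3)[OF K(2), of "\<lambda>z. rho z * (\<phi> z)\<^sup>2"] K(3) T(1) by simp_all
  then show ?thesis
    unfolding index_form_eq[OF W] using test_set_integral[OF oW \<phi>] T by (simp add: set_integral_diff)
qed

end

text \<open>A radial C1 bump: its gradient is a nonpositive multiple of \<open>z - q\<close>, so the
  sign of its product with a given field can be read off.\<close>

lemma bump_test:
  fixes q :: complex
  assumes r: "r > 0" and W: "cball q r \<subseteq> W"
  defines "\<psi> \<equiv> \<lambda>z. smooth_step (r\<^sup>2 - (z - q) \<bullet> (z - q))"
  shows "\<psi> \<in> test_functions W" "grad \<psi> z = (- 2 * smooth_step' (r\<^sup>2 - (z - q) \<bullet> (z - q))) *\<^sub>R (z - q)"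
proof -
  have d: "(\<psi> has_derivative (\<lambda>v. ((- 2 * smooth_step' (r\<^sup>2 - (z - q) \<bullet> (z - q))) *\<^sub>R (z - q)) \<bullet> v)) (at z)" for z
  proof -
    have i: "((\<lambda>z. r\<^sup>2 - (z - q) \<bullet> (z - q)) has_derivative (\<lambda>v. - 2 * ((z - q) \<bullet> v))) (at z)"
      by (rule derivative_eq_intros refl)+ (simp add: inner_commute)
    have s: "(smooth_step has_derivative (\<lambda>t. smooth_step' (r\<^sup>2 - (z - q) \<bullet> (z - q)) * t)) (at (r\<^sup>2 - (z - q) \<bullet> (z - q)))"
      using smooth_step_deriv unfolding has_field_derivative_def .
    show ?thesis unfolding \<psi>_def
      by (rule has_derivative_eq_rhs[OF has_derivative_compose[OF i s]]) (simp add: fun_eq_iff)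
  qed
  show "grad \<psi> z = (- 2 * smooth_step' (r\<^sup>2 - (z - q) \<bullet> (z - q))) *\<^sub>R (z - q)"
    by (rule grad_eqI[OF d])
  have c: "continuous_on UNIV (\<lambda>z. (- 2 * smooth_step' (r\<^sup>2 - (z - q) \<bullet> (z - q))) *\<^sub>R (z - q))"
    by (intro continuous_intros continuous_on_compose2[OF smooth_step'_continuous]) auto
  have o: "\<psi> z = 0" if "z \<notin> cball q r" for z
  proof -
    have "r \<le> cmod (z - q)" using that by (simp add: dist_norm norm_minus_commute)
    then have "r\<^sup>2 \<le> (cmod (z - q))\<^sup>2" using r by (intro power_mono) auto
    then have "r\<^sup>2 \<le> (z - q) \<bullet> (z - q)" by (simp only: power2_norm_eq_inner)
    then show ?thesis unfolding \<psi>_def by (intro smooth_step_0) simp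
  qed
  show "\<psi> \<in> test_functions W"
    by (rule test_functionsI[OF d c compact_cball W o])
qed

context oliveira
begin

section \<open>The nodal domains modulo the involution\<close>

text \<open>The preimage in the double cover of one nodal domain of the quotient.\<close>

definition petal :: "complex \<Rightarrow> complex set" where "petal \<alpha> = cell \<alpha> True \<union> cell \<alpha> False"

lemma open_petal: "\<alpha> \<in> fib \<Longrightarrow> open (petal \<alpha>)"
  unfolding petal_def by (intro open_Un open_cell)

lemma petal_Union: "(\<Union>\<alpha>\<in>fib. petal \<alpha>) = {z. el z \<noteq> 0}"
proof -
  have "(\<Union>\<alpha>\<in>fib. petal \<alpha>) = (\<Union>(\<alpha>, b)\<in>cells. cell \<alpha> b)"
    by (auto simp: cells_def petal_def UNIV_bool)
  also have "\<dots> = {z. el z \<noteq> 0}" unfolding cells_Union using el_sign by force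
  finally show ?thesis .
qed

lemma petal_disjoint:
  assumes "\<alpha> \<in> fib" "\<beta> \<in> fib" "\<alpha> \<noteq> \<beta>"
  shows "petal \<alpha> \<inter> petal \<beta> = {}"
proof -
  have "cell \<alpha> b \<inter> cell \<beta> c = {}" for b c
    by (rule cells_disjoint) (use assms in \<open>auto simp: cells_def\<close>)
  then show ?thesis unfolding petal_def by (simp add: Int_Un_distrib Int_Un_distrib2)
qed

text \<open>The petals are open and disjoint and fill the complement of the nodal set, so removing
  one leaves the union of the others.\<close>

lemma petal_clopen:
  assumes "\<alpha> \<in> fib"
  shows "clopen_off_nodal (petal \<alpha>)"
proof -
  have "{z. el z \<noteq> 0} - petal \<alpha> = (\<Union>\<beta>\<in>fib - {\<alpha>}. petal \<beta>)"
    unfolding petal_Union[symmetric] using petal_disjoint assms by fast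
  then show ?thesis using open_petal assms by (auto simp: clopen_off_nodal_def)
qed

lemma petal_antipodal: "antipodal z \<in> petal \<alpha> \<longleftrightarrow> z \<in> petal \<alpha>"
proof -
  have "antipodal x \<in> antipodal ` D \<longleftrightarrow> x \<in> D" for x D
    using antipodal_involution(1) by (intro inj_image_mem_iff inj_on_inverseI)
  from this[of z "dom \<alpha>"] this[of "antipodal z" "dom \<alpha>"] show ?thesis
    unfolding petal_def cell_True cell_False antipodal_involution(1) Un_iff by blast
qed

lemma antipodal_0: "antipodal 0 = 0" by (simp add: antipodal_def)

lemma el_0: "el 0 = 0" using m5 by (simp add: el_def pa_def)

lemma cut_petal_odd: "cut (petal \<alpha>) n (antipodal z) = - cut (petal \<alpha>) n z"
proof (cases "z = 0")
  case True then show ?thesis by (simp add: antipodal_0 cut_def el_0 hc_def)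
next
  case False
  then show ?thesis by (simp add: cut_def antipodal_el hc_minus indicator_def petal_antipodal)
qed

text \<open>The involution exchanges the two half planes and preserves petals, and no point of
  \<open>upper\<close> is real.\<close>

lemma petal_upper_half: "\<alpha> \<in> fib \<Longrightarrow> \<exists>z. z \<in> petal \<alpha> \<and> Im z > 0"
proof -
  assume a: "\<alpha> \<in> fib"
  have "\<alpha> \<in> cell \<alpha> True" using strip_0 branchD(3)[OF a] by (force simp: cell_def kap_def)
  then have p: "\<alpha> \<in> petal \<alpha>" by (simp add: petal_def)
  have u: "\<alpha> \<in> upper" using a by (simp add: fib_def)
  have "Im (antipodal \<alpha>) = - Im \<alpha> / (cmod \<alpha>)\<^sup>2"
    by (simp add: antipodal_def Im_divide cmod_power2)
  moreover have "(cmod \<alpha>)\<^sup>2 > 0" using upper_nz(2)[OF u] by simp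
  ultimately have "Im \<alpha> > 0 \<or> Im (antipodal \<alpha>) > 0"
    using upper_not_real[OF u] by (cases "Im \<alpha> > 0") (auto simp: divide_neg_pos)
  then show ?thesis using p petal_antipodal by blast
qed

lemma connected_subset_petal:
  assumes "connected C" "C \<subseteq> {z. el z \<noteq> 0}"
  shows "\<exists>\<alpha>\<in>fib. C \<subseteq> petal \<alpha>"
proof (cases "C = {}")
  case True then show ?thesis using fib_nonempty by blast
next
  case False
  then obtain z where z: "z \<in> C" by blast
  then obtain \<alpha> where a: "\<alpha> \<in> fib" "z \<in> petal \<alpha>" using assms(2) petal_Union by blast
  have "petal \<alpha> \<inter> C = {} \<or> ({z. el z \<noteq> 0} - petal \<alpha>) \<inter> C = {}"
    by (rule connectedD[OF assms(1)]) (use petal_clopen[OF a(1)] assms(2) in \<open>auto simp: clopen_off_nodal_def\<close>)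
  then have "C \<subseteq> petal \<alpha>" using z a(2) assms(2) by blast
  then show ?thesis using a(1) by blast
qed

text \<open>At a nonreal point the Gauss map is a local homeomorphism. The two sides of the nodal
  set correspond to the two halves of a disc, which are connected and so each lie in one petal; the
  two petals may coincide.\<close>

lemma nodal_crossing:
  assumes p: "Im p > 0" and e: "el p = 0"
  obtains N \<alpha> \<beta> where "open N" "p \<in> N" "\<alpha> \<in> fib" "\<beta> \<in> fib"
    "\<And>z. z \<in> N \<Longrightarrow> el z > 0 \<Longrightarrow> z \<in> petal \<alpha>" "\<And>z. z \<in> N \<Longrightarrow> el z < 0 \<Longrightarrow> z \<in> petal \<beta>"
proof -
  have p1: "p \<noteq> 1" using p by auto
  have hol: "GG holomorphic_on - {1}"
    using GG_deriv by (auto simp: holomorphic_on_open open_Compl)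
  have dn: "deriv GG p \<noteq> 0" using DERIV_imp_deriv[OF GG_deriv[OF p1]] wr_nz[of p] p p1 by simp
  obtain r where r: "r > 0" "ball p r \<subseteq> - {1}" "inj_on GG (ball p r)"
    using has_complex_derivative_locally_injective[OF hol _ _ dn] p1 by (auto simp: open_Compl)
  have holr: "GG holomorphic_on ball p r" by (rule holomorphic_on_subset[OF hol r(2)])
  obtain g where g: "g holomorphic_on (GG ` ball p r)" "\<And>z. z \<in> ball p r \<Longrightarrow> g (GG z) = z"
    by (rule holomorphic_has_inverse[OF holr open_ball r(3)]) (rule that)
  have op: "open (GG ` ball p r)"
    by (rule invariance_of_domain[OF holomorphic_on_imp_continuous_on[OF holr] open_ball r(3)])
  then obtain s where s: "s > 0" "ball (GG p) s \<subseteq> GG ` ball p r"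
    using r(1) unfolding open_contains_ball by (meson centre_in_ball image_eqI)
  have cg: "continuous_on (ball (GG p) s) g"
    using holomorphic_on_imp_continuous_on[OF g(1)] s(2) by (rule continuous_on_subset)
  define N where "N = ball p r \<inter> GG -` ball (GG p) s"
  have oN: "open N" unfolding N_def
    by (rule continuous_open_preimage[OF holomorphic_on_imp_continuous_on[OF holr] open_ball open_ball])
  have pN: "p \<in> N" using r(1) s(1) by (simp add: N_def)
  have sign: "(el z > 0 \<longleftrightarrow> Im (GG z) > 0) \<and> (el z < 0 \<longleftrightarrow> Im (GG z) < 0)" if "z \<in> ball p r" for z
  proof -
    have z1: "z \<noteq> 1" using that r(2) by auto
    then have "(cmod (z - 1))\<^sup>2 > 0" by simp
    then show ?thesis
      unfolding el_sign Im_GG[OF z1] upper_def lower_def by (simp add: zero_less_divide_iff divide_less_0_iff)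
  qed
  have gG: "g w \<in> ball p r \<and> GG (g w) = w" if "w \<in> ball (GG p) s" for w
    using that s(2) g(2) by auto
  have half: "\<exists>\<alpha>\<in>fib. g ` (ball (GG p) s \<inter> H) \<subseteq> petal \<alpha>" if H: "convex H" "\<And>w. w \<in> H \<Longrightarrow> Im w \<noteq> 0" for H
  proof (rule connected_subset_petal)
    have "connected (ball (GG p) s \<inter> H)" using H(1) by (intro convex_connected convex_Int convex_ball)
    then show "connected (g ` (ball (GG p) s \<inter> H))"
      using cg by (intro connected_continuous_image) (auto elim: continuous_on_subset)
    show "g ` (ball (GG p) s \<inter> H) \<subseteq> {z. el z \<noteq> 0}"
    proof
      fix z assume "z \<in> g ` (ball (GG p) s \<inter> H)"
      then obtain w where w: "w \<in> ball (GG p) s" "w \<in> H" "z = g w" by blast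
      then have "z \<in> ball p r" "Im (GG z) \<noteq> 0" using gG[OF w(1)] H(2) by auto
      then show "z \<in> {z. el z \<noteq> 0}" using sign[of z] by (cases "Im (GG z) > 0") auto
    qed
  qed
  obtain \<alpha> where a: "\<alpha> \<in> fib" "g ` (ball (GG p) s \<inter> {w. Im w > 0}) \<subseteq> petal \<alpha>"
    using half[of "{w. Im w > 0}"] by (auto simp: convex_halfspace_Im_gt)
  obtain \<beta> where b: "\<beta> \<in> fib" "g ` (ball (GG p) s \<inter> {w. Im w < 0}) \<subseteq> petal \<beta>"
    using half[of "{w. Im w < 0}"] by (auto simp: convex_halfspace_Im_lt)
  show thesis
  proof (rule that[OF oN pN a(1) b(1)])
    fix z assume z: "z \<in> N"
    then have zb: "z \<in> ball p r" "GG z \<in> ball (GG p) s" by (auto simp: N_def)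
    note eq = g(2)[OF zb(1)]
    show "z \<in> petal \<alpha>" if "el z > 0"
    proof -
      have "GG z \<in> ball (GG p) s \<inter> {w. Im w > 0}" using zb that sign[OF zb(1)] by auto
      then have "g (GG z) \<in> petal \<alpha>" using a(2) by blast
      then show ?thesis by (simp only: eq)
    qed
    show "z \<in> petal \<beta>" if "el z < 0"
    proof -
      have "GG z \<in> ball (GG p) s \<inter> {w. Im w < 0}" using zb that sign[OF zb(1)] by auto
      then have "g (GG z) \<in> petal \<beta>" using b(2) by blast
      then show ?thesis by (simp only: eq)
    qed
  qed
qed

section \<open>The flux functionals\<close>

text \<open>Formally \<open>fluxd \<psi>\<close> is the divergence of \<open>\<psi> grad el\<close>, since \<open>el\<close> is a Jacobi function.\<close>
definition fluxd :: "(complex \<Rightarrow> real) \<Rightarrow> complex \<Rightarrow> real" where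
  "fluxd \<psi> z = gel z \<bullet> grad \<psi> z - rho z * el z * \<psi> z"

text \<open>Formally the flux of \<open>\<psi>\<close> times the gradient of \<open>el\<close>
  through the boundary of the petal; as a plane integral it makes sense whatever that boundary looks
  like.\<close>

definition flux :: "complex \<Rightarrow> (complex \<Rightarrow> real) \<Rightarrow> real" where
  "flux \<alpha> \<psi> = (\<integral>z. indicator (petal \<alpha>) z * fluxd \<psi> z \<partial>lborel)"

definition odd_tests :: "(complex \<Rightarrow> real) set" where
  "odd_tests = {\<psi> \<in> test_functions (- {0}). \<forall>z. \<psi> (antipodal z) = - \<psi> z}"

lemma integrable_fluxd:
  assumes "\<psi> \<in> test_functions W"
  shows "integrable lborel (fluxd \<psi>)" "\<alpha> \<in> fib \<Longrightarrow> integrable lborel (\<lambda>z. indicator (petal \<alpha>) z * fluxd \<psi> z)"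
proof -
  obtain K where K: "continuous_on UNIV (grad \<psi>)" "compact K" "\<And>z. z \<notin> K \<Longrightarrow> \<psi> z = 0" "\<And>z. z \<notin> K \<Longrightarrow> grad \<psi> z = 0"
    using test_functionsE[OF assms] by metis
  have c: "continuous_on UNIV (fluxd \<psi>)"
    unfolding fluxd_def[abs_def] by (intro continuous_intros continuous_gel continuous_rho continuous_el K test_continuous[OF assms])
  show i: "integrable lborel (fluxd \<psi>)"
    by (rule integrable_compact_support[OF c K(2)]) (simp add: fluxd_def K)
  show "integrable lborel (\<lambda>z. indicator (petal \<alpha>) z * fluxd \<psi> z)" if "\<alpha> \<in> fib"
    using integrable_mult_indicator[OF _ i, of "petal \<alpha>"] open_petal[OF that] by simp
qed

lemma flux_lin:
  assumes "\<alpha> \<in> fib" "f \<in> test_functions W" "g \<in> test_functions W"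
  shows "flux \<alpha> (\<lambda>z. f z + s * g z) = flux \<alpha> f + s * flux \<alpha> g"
proof -
  have "indicator (petal \<alpha>) z * fluxd (\<lambda>z. f z + s * g z) z
      = indicator (petal \<alpha>) z * fluxd f z + s * (indicator (petal \<alpha>) z * fluxd g z)" for z
    unfolding fluxd_def test_lin(2)[OF assms(2,3)] by (simp add: inner_add_right algebra_simps)
  then show ?thesis
    unfolding flux_def using integrable_fluxd(2)[OF assms(2,1)] integrable_fluxd(2)[OF assms(3,1)] by simp
qed

text \<open>The petals exhaust the plane up to a null set, and the total is 0 by the weak Jacobi
  equation. Formally, the fluxes through a common boundary cancel.\<close>

lemma flux_sum:
  assumes "\<psi> \<in> test_functions W"
  shows "(\<Sum>\<alpha>\<in>fib. flux \<alpha> \<psi>) = 0"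
proof -
  have "(\<Sum>\<alpha>\<in>fib. flux \<alpha> \<psi>) = (\<integral>z. (\<Sum>\<alpha>\<in>fib. indicator (petal \<alpha>) z * fluxd \<psi> z) \<partial>lborel)"
    unfolding flux_def using integrable_fluxd(2)[OF assms] by (intro Bochner_Integration.integral_sum[symmetric])
  also have "\<dots> = (\<integral>z. fluxd \<psi> z \<partial>lborel)"
  proof (rule integral_cong_AE)
    show "AE z in lborel. (\<Sum>\<alpha>\<in>fib. indicator (petal \<alpha>) z * fluxd \<psi> z) = fluxd \<psi> z"
      using AE_el_nz
    proof eventually_elim
      fix z assume "el z \<noteq> 0"
      then obtain \<alpha> where a: "\<alpha> \<in> fib" "z \<in> petal \<alpha>" using petal_Union by blast
      have "(\<Sum>\<beta>\<in>fib. indicator (petal \<beta>) z * fluxd \<psi> z) = (\<Sum>\<beta>\<in>fib. if \<beta> = \<alpha> then fluxd \<psi> z else 0)"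
        using a petal_disjoint[OF a(1)] by (intro sum.cong) (auto simp: indicator_def)
      then show "(\<Sum>\<beta>\<in>fib. indicator (petal \<beta>) z * fluxd \<psi> z) = fluxd \<psi> z"
        using a card_fib(2) by simp
    qed
    show "(\<lambda>z. \<Sum>\<alpha>\<in>fib. indicator (petal \<alpha>) z * fluxd \<psi> z) \<in> borel_measurable lborel"
      by (intro borel_measurable_sum borel_measurable_integrable integrable_fluxd(2)[OF assms])
    show "fluxd \<psi> \<in> borel_measurable lborel" by (rule borel_measurable_integrable[OF integrable_fluxd(1)[OF assms]])
  qed
  also have "\<dots> = 0"
    unfolding fluxd_def using jacobi[OF assms] by (simp add: inner_commute)
  finally show ?thesis .
qed

lemma antipodal_has_derivative:
  assumes z: "z \<noteq> 0" and f: "(f has_derivative (\<lambda>v. g \<bullet> v)) (at (antipodal z))"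
  shows "((\<lambda>w. f (antipodal w)) has_derivative (\<lambda>v. (cnj g / (cnj z)\<^sup>2) \<bullet> v)) (at z)"
proof (rule has_derivative_eq_rhs[OF has_derivative_compose[OF antipodal_deriv[OF z] f]], rule ext)
  fix v
  have "g \<bullet> (a * cnj v) = (cnj g * a) \<bullet> v" for a by (simp add: inner_complex_def algebra_simps)
  from this[of "1 / (cnj z)\<^sup>2"] show "g \<bullet> (1 / (cnj z)\<^sup>2 * cnj v) = (cnj g / (cnj z)\<^sup>2) \<bullet> v"
    by (simp only: times_divide_eq_right mult_1_right)
qed

lemma antipodal_gel:
  assumes z: "z \<noteq> 0"
  shows "gel z = - cnj (gel (antipodal z)) / (cnj z)\<^sup>2"
proof -
  have "((\<lambda>w. el (antipodal w)) has_derivative (\<lambda>v. (cnj (gel (antipodal z)) / (cnj z)\<^sup>2) \<bullet> v)) (at z)"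
    by (rule antipodal_has_derivative[OF z el_has_derivative])
  then have 1: "((\<lambda>w. - el w) has_derivative (\<lambda>v. (cnj (gel (antipodal z)) / (cnj z)\<^sup>2) \<bullet> v)) (at z)"
    by (rule has_derivative_transform_within_open[of _ _ _ _ "- {0}"]) (use z antipodal_el in \<open>auto simp: open_Compl\<close>)
  have 2: "((\<lambda>w. - el w) has_derivative (\<lambda>v. (- gel z) \<bullet> v)) (at z)"
    by (rule has_derivative_eq_rhs[OF has_derivative_minus[OF el_has_derivative]]) simp
  have "- gel z = cnj (gel (antipodal z)) / (cnj z)\<^sup>2"
    using grad_eqI[OF 1] grad_eqI[OF 2] by simp
  then show ?thesis by (metis minus_divide_left minus_minus)
qed

text \<open>The delicate point is 0, which is mapped to itself by convention: the support of
  \<open>\<psi>\<close> is bounded, so the composition vanishes in a disc around 0.\<close>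

lemma antipodal_test:
  assumes \<psi>: "\<psi> \<in> test_functions (- {0})"
  shows "(\<lambda>z. \<psi> (antipodal z)) \<in> test_functions (- {0})"
    "grad (\<lambda>z. \<psi> (antipodal z)) z = cnj (grad \<psi> (antipodal z)) / (cnj z)\<^sup>2"
proof -
  obtain K where K: "\<And>z. (\<psi> has_derivative (\<lambda>v. grad \<psi> z \<bullet> v)) (at z)" "continuous_on UNIV (grad \<psi>)"
    "compact K" "K \<subseteq> - {0}" "\<And>z. z \<notin> K \<Longrightarrow> \<psi> z = 0" "\<And>z. z \<notin> K \<Longrightarrow> grad \<psi> z = 0"
    by (rule test_functionsE[OF \<psi>]) (rule that)
  obtain R where R: "R > 0" "\<And>z. z \<in> K \<Longrightarrow> cmod z \<le> R"
    using compact_imp_bounded[OF K(3)] unfolding bounded_pos by blast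
  let ?f = "\<lambda>z. \<psi> (antipodal z)" and ?g = "\<lambda>z. cnj (grad \<psi> (antipodal z)) / (cnj z)\<^sup>2"
  define U where "U = ball (0::complex) (1 / R)"
  have U: "antipodal z \<notin> K" if "z \<in> U" for z
  proof (cases "z = 0")
    case True then show ?thesis using K(4) by (auto simp: antipodal_0)
  next
    case False
    then have "cmod z < 1 / R" "cmod z > 0" using that by (auto simp: U_def)
    then have "cmod (antipodal z) > R" using R(1) by (simp add: antipodal_def norm_divide field_simps)
    then show ?thesis using R(2) by force
  qed
  have oU: "open U" "0 \<in> U" using R(1) by (auto simp: U_def)
  have d: "(?f has_derivative (\<lambda>v. ?g z \<bullet> v)) (at z)" for z
  proof (cases "z = 0")
    case True
    have "((\<lambda>z::complex. 0::real) has_derivative (\<lambda>v. 0)) (at 0)" by simp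
    then have "(?f has_derivative (\<lambda>v. 0)) (at 0)"
      by (rule has_derivative_transform_within_open[OF _ oU]) (use U K(5) in auto)
    then show ?thesis using True by simp
  next
    case False then show ?thesis by (rule antipodal_has_derivative[OF _ K(1)])
  qed
  show g: "grad ?f z = ?g z" for z by (rule grad_eqI[OF d])
  have cU: "continuous_on U ?g"
    using U K(6) by (subst continuous_on_cong[OF refl, of _ _ "\<lambda>_. 0"]) auto
  have ca: "continuous_on (- {0}) antipodal"
    unfolding antipodal_def[abs_def] by (intro continuous_intros) auto
  have cN: "continuous_on (- {0}) ?g"
    by (intro continuous_intros continuous_on_compose2[OF K(2) ca]) auto
  have "continuous_on (U \<union> - {0}) ?g"
    by (rule continuous_on_open_Un[OF oU(1) _ cU cN]) (auto simp: open_Compl)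
  moreover have "U \<union> - {0} = UNIV" using oU(2) by auto
  ultimately have c: "continuous_on UNIV ?g" by simp
  show "?f \<in> test_functions (- {0})"
  proof (rule test_functionsI[OF d c])
    show "compact (antipodal ` K)"
      by (rule compact_continuous_image[OF continuous_on_subset[OF ca K(4)] K(3)])
    show "antipodal ` K \<subseteq> - {0}"
    proof (rule image_subsetI)
      fix x assume "x \<in> K"
      then have "x \<noteq> 0" using K(4) by blast
      then show "antipodal x \<in> - {0}" by (simp add: antipodal_involution(2))
    qed
    show "?f z = 0" if "z \<notin> antipodal ` K" for z
    proof (rule K(5), rule notI)
      assume "antipodal z \<in> K"
      then have "antipodal (antipodal z) \<in> antipodal ` K" by (rule imageI)
      then show False using that by (simp only: antipodal_involution(1))
    qed
  qed
qed

text \<open>The flux density is conformally natural, so composition with \<open>antipodal\<close>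
  produces the Jacobian 1 / |z|^4; since \<open>el\<close> is odd it also produces a sign, which the
  factor -1 compensates. Hence the two contributions do not cancel but have equal signs.\<close>

lemma odd_part:
  assumes \<psi>: "\<psi> \<in> test_functions (- {0})"
  shows "(\<lambda>z. \<psi> z + (-1) * \<psi> (antipodal z)) \<in> odd_tests"
    "z \<noteq> 0 \<Longrightarrow> fluxd (\<lambda>z. \<psi> z + (-1) * \<psi> (antipodal z)) z = fluxd \<psi> z + fluxd \<psi> (antipodal z) / cmod z ^ 4"
proof -
  note T = test_lin[OF \<psi> antipodal_test(1)[OF \<psi>], of "-1"]
  show "(\<lambda>z. \<psi> z + (-1) * \<psi> (antipodal z)) \<in> odd_tests"
    unfolding odd_tests_def using T(1) antipodal_involution(1) by simp
  assume z: "z \<noteq> 0"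
  define a where "a = antipodal z"
  have inn: "(cnj x / w) \<bullet> (cnj y / w) = (x \<bullet> y) / (cmod w)\<^sup>2" for x y w :: complex
  proof -
    have u: "(a * u) \<bullet> (b * u) = (a \<bullet> b) * (cmod u)\<^sup>2" for a b u :: complex
      unfolding cmod_power2 by (simp add: inner_complex_def power2_eq_square algebra_simps)
    have "(cnj x / w) \<bullet> (cnj y / w) = (cnj x \<bullet> cnj y) * (cmod (inverse w))\<^sup>2"
      unfolding divide_inverse u ..
    also have "\<dots> = (x \<bullet> y) / (cmod w)\<^sup>2"
      by (simp add: inner_complex_def norm_inverse power_inverse divide_inverse)
    finally show ?thesis .
  qed
  have g: "gel z \<bullet> (cnj (grad \<psi> a) / (cnj z)\<^sup>2) = - (gel a \<bullet> grad \<psi> a) / cmod z ^ 4"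
  proof -
    have e: "gel z = - (cnj (gel a) / (cnj z)\<^sup>2)" using antipodal_gel[OF z] by (simp add: a_def)
    have c4: "(cmod ((cnj z)\<^sup>2))\<^sup>2 = cmod z ^ 4" by (simp add: norm_power power_mult[symmetric])
    show ?thesis unfolding e inner_minus_left inn c4 by simp
  qed
  have e: "el a = - el z" and r: "rho a / cmod z ^ 4 = rho z"
    using antipodal_el[OF z] antipodal_rho[OF z] by (simp_all add: a_def)
  have "fluxd (\<lambda>z. \<psi> z + (-1) * \<psi> (antipodal z)) z = gel z \<bullet> grad \<psi> z - gel z \<bullet> (cnj (grad \<psi> a) / (cnj z)\<^sup>2)
      - rho z * el z * (\<psi> z - \<psi> a)"
    unfolding fluxd_def T(2) antipodal_test(2)[OF \<psi>] by (simp add: inner_diff_right a_def)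
  also have "\<dots> = fluxd \<psi> z + (gel a \<bullet> grad \<psi> a) / cmod z ^ 4 + (rho a / cmod z ^ 4) * el z * \<psi> a"
    unfolding g fluxd_def r by (simp add: algebra_simps)
  also have "\<dots> = fluxd \<psi> z + fluxd \<psi> a / cmod z ^ 4"
    unfolding fluxd_def[of \<psi> a] e by (simp add: diff_divide_distrib add_divide_distrib)
  finally show "fluxd (\<lambda>z. \<psi> z + (-1) * \<psi> (antipodal z)) z = fluxd \<psi> z + fluxd \<psi> (antipodal z) / cmod z ^ 4"
    by (simp add: a_def)
qed

text \<open>The mean value inequality for \<open>el\<close> minus its linear part at
  \<open>p\<close>.\<close>

lemma el_linear:
  assumes p: "el p = 0" and b: "\<And>z. z \<in> ball p R \<Longrightarrow> cmod (gel z - gel p) \<le> \<epsilon>" and z: "z \<in> ball p R"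
  shows "\<bar>el z - gel p \<bullet> (z - p)\<bar> \<le> \<epsilon> * cmod (z - p)"
proof -
  have R: "R > 0" using z by (metis mem_ball dist_commute le_less_trans zero_le_dist)
  have d: "((\<lambda>z. el z - gel p \<bullet> z) has_derivative (\<lambda>v. (gel x - gel p) \<bullet> v)) (at x within ball p R)" for x
    by (rule has_derivative_eq_rhs[OF has_derivative_diff[OF has_derivative_at_withinI[OF el_has_derivative]
          has_derivative_inner_right[OF has_derivative_ident]]]) (simp add: inner_diff_left)
  have o: "onorm (\<lambda>v. (gel x - gel p) \<bullet> v) \<le> \<epsilon>" if "x \<in> ball p R" for x
  proof (rule onorm_le)
    fix v
    have "norm ((gel x - gel p) \<bullet> v) \<le> cmod (gel x - gel p) * cmod v"
      using Cauchy_Schwarz_ineq2[of "gel x - gel p" v] by simp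
    also have "\<dots> \<le> \<epsilon> * cmod v" using b[OF that] by (intro mult_right_mono) auto
    finally show "norm ((gel x - gel p) \<bullet> v) \<le> \<epsilon> * norm v" .
  qed
  have "norm ((el z - gel p \<bullet> z) - (el p - gel p \<bullet> p)) \<le> \<epsilon> * norm (z - p)"
    by (rule differentiable_bound[OF convex_ball d o z]) (use R in auto)
  then show ?thesis using p by (simp add: inner_diff_right algebra_simps)
qed

text \<open>The gradient vanishes only at critical points of the Gauss map, which are real, and at
  Gauss values \<i> and -\<i>, where the height is extremal and not 0.\<close>

lemma gel_nz: "Im z \<noteq> 0 \<Longrightarrow> el z = 0 \<Longrightarrow> gel z \<noteq> 0"
proof
  assume z: "Im z \<noteq> 0" "el z = 0" and g: "gel z = 0"
  have s: "sg z > 0" by (rule sg_pos)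
  have z1: "z - 1 \<noteq> 0" using z by auto
  have "wr z \<noteq> 0" using z wr_nz by blast
  then have "(pa z)\<^sup>2 + (z - 1)\<^sup>2 = 0" using g s by (simp add: gel_def)
  then have "(GG z)\<^sup>2 = - 1" using z1 by (simp add: GG_def power_divide eq_neg_iff_add_eq_0 divide_eq_eq field_simps)
  then have "GG z = \<i> \<or> GG z = - \<i>" by (metis power2_eq_iff power2_i)
  moreover have "Im (GG z) = 0"
  proof -
    have "Im (pa z * cnj (z - 1)) = 0" using z(2) s by (simp add: el_def)
    then show ?thesis using Im_GG[of z] z1 by simp
  qed
  ultimately show False by auto
qed

text \<open>The bump is centred slightly on the side where \<open>el < 0\<close>, so that on its support both
  terms of the flux density are negative wherever \<open>el > 0\<close>.\<close>
lemma bump_fluxd: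
  assumes p: "Im p > 0" "el p = 0" and N: "open N" "p \<in> N"
  obtains \<psi> U where "\<psi> \<in> test_functions (- {0})" "open U" "U \<subseteq> N" "\<exists>z\<in>U. el z > 0"
    "\<And>z. z \<in> U \<Longrightarrow> el z > 0 \<Longrightarrow> fluxd \<psi> z < 0" "\<And>z. z \<notin> U \<Longrightarrow> fluxd \<psi> z = 0"
proof -
  define g where "g = cmod (gel p)"
  have g: "g > 0" using gel_nz[of p] p by (simp add: g_def)
  define \<nu> where "\<nu> = gel p /\<^sub>R g"
  have nu: "cmod \<nu> = 1" "gel p = g *\<^sub>R \<nu>" using g by (auto simp: \<nu>_def g_def)
  \<comment> \<open>The tolerance g / 8 keeps \<open>gel\<close> close to constant; against vectors
    shorter than r it costs at most g r / 8, less than the g r / 4 gained below from the shifted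
    centre.\<close>
  define S where "S = N \<inter> {z. Im z > 0} \<inter> {z. cmod (gel z - gel p) < g / 8}"
  have "open S" unfolding S_def
    by (intro open_Int N(1) open_halfspace_Im_gt open_Collect_less continuous_intros continuous_gel)
  moreover have "p \<in> S" using N(2) p g by (simp add: S_def)
  ultimately obtain R where R: "R > 0" "ball p R \<subseteq> S" by (meson open_contains_ball)
  define r where "r = R / 2"
  have r: "r > 0" using R(1) by (simp add: r_def)
  \<comment> \<open>The centre is moved by r / 2 against the gradient, little enough for
    \<open>ball q r\<close> to keep points where \<open>el\<close> is positive.\<close>
  define q where "q = p - (r / 2) *\<^sub>R \<nu>"
  have pq: "cmod (p - q) = r / 2" using nu r by (simp add: q_def)
  have sub: "cball q r \<subseteq> ball p R"
  proof
    fix z assume "z \<in> cball q r"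
    then have "cmod (z - q) \<le> r" by (simp add: dist_norm norm_minus_commute)
    then have "cmod ((z - q) - (p - q)) < R" using norm_triangle_ineq4[of "z - q" "p - q"] pq r by (simp add: r_def)
    then show "z \<in> ball p R" by (simp add: dist_norm norm_minus_commute)
  qed
  have W: "cball q r \<subseteq> - {0}"
  proof -
    have "0 \<notin> S" by (simp add: S_def)
    then show ?thesis using sub R(2) by blast
  qed
  have gb: "cmod (gel z - gel p) \<le> g / 8" if "z \<in> ball p R" for z
    using that R(2) by (auto simp: S_def less_imp_le)
  have lin: "\<bar>el z - gel p \<bullet> (z - p)\<bar> \<le> g / 8 * cmod (z - p)" if "z \<in> ball p R" for z
    by (rule el_linear[OF p(2) _ that]) (rule gb)
  define \<psi> where "\<psi> = (\<lambda>z. smooth_step (r\<^sup>2 - (z - q) \<bullet> (z - q)))"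
  note B = bump_test[OF r W, folded \<psi>_def]
  have sq: "z \<in> ball q r \<longleftrightarrow> r\<^sup>2 - (z - q) \<bullet> (z - q) > 0" for z
  proof -
    have "z \<in> ball q r \<longleftrightarrow> cmod (z - q) < r" by (simp add: dist_norm norm_minus_commute)
    also have "\<dots> \<longleftrightarrow> (cmod (z - q))\<^sup>2 < r\<^sup>2" using r by (auto intro: power_strict_mono dest: power_less_imp_less_base)
    finally show ?thesis by (simp add: power2_norm_eq_inner)
  qed
  have neg: "fluxd \<psi> z < 0" if z: "z \<in> ball q r" and e: "el z > 0" for z
  proof -
    define x where "x = r\<^sup>2 - (z - q) \<bullet> (z - q)"
    have x: "x > 0" using sq z by (simp add: x_def)
    have zR: "z \<in> ball p R" using z sub by (auto simp: subset_iff)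
    have d: "cmod (z - q) < r" using z by (simp add: dist_norm norm_minus_commute)
    have dp: "cmod (z - p) < 3 * r / 2" using norm_triangle_ineq4[of "z - q" "p - q"] pq d by simp
    have "gel p \<bullet> (z - p) = g * (\<nu> \<bullet> (z - p))" by (simp add: nu(2))
    then have "0 < g * (\<nu> \<bullet> (z - p)) + g / 8 * cmod (z - p)" using lin[OF zR] e by linarith
    then have "0 < g * (\<nu> \<bullet> (z - p) + cmod (z - p) / 8)" by (simp add: algebra_simps)
    then have 1: "\<nu> \<bullet> (z - p) > - (cmod (z - p) / 8)" using g by (simp add: zero_less_mult_iff)
    have "\<nu> \<bullet> (z - q) = \<nu> \<bullet> (z - p) + r / 2 * (\<nu> \<bullet> \<nu>)" by (simp add: q_def algebra_simps)
    moreover have "\<nu> \<bullet> \<nu> = 1" using nu(1) by (simp add: power2_norm_eq_inner[symmetric])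
    \<comment> \<open>The shift contributes r / 2, and the deviation of the nodal line from its
      tangent costs at most 3 r / 16.\<close>
    ultimately have 2: "\<nu> \<bullet> (z - q) > r / 4" using 1 dp r by simp
    have "gel p \<bullet> (z - q) = g * (\<nu> \<bullet> (z - q))" by (simp add: nu(2))
    moreover have "g * (\<nu> \<bullet> (z - q)) > g * (r / 4)" using 2 g by (intro mult_strict_left_mono)
    moreover have "\<bar>(gel z - gel p) \<bullet> (z - q)\<bar> \<le> g / 8 * r"
      using mult_mono[OF gb[OF zR] less_imp_le[OF d]] g
      by (intro order_trans[OF Cauchy_Schwarz_ineq2]) simp
    moreover have "g * r > 0" using g r by simp
    moreover have "(gel z - gel p) \<bullet> (z - q) = gel z \<bullet> (z - q) - gel p \<bullet> (z - q)" by (rule inner_diff_left)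
    ultimately have 3: "gel z \<bullet> (z - q) > 0" by linarith
    have s: "smooth_step' x > 0" using x by (simp add: smooth_step'_def power2_eq_square add_pos_nonneg)
    have "fluxd \<psi> z = - (2 * smooth_step' x * (gel z \<bullet> (z - q))) - rho z * el z * smooth_step x"
      unfolding fluxd_def B(2) by (simp add: \<psi>_def x_def)
    moreover have "2 * smooth_step' x * (gel z \<bullet> (z - q)) > 0" using s 3 by simp
    moreover have "rho z * el z * smooth_step x \<ge> 0" using rho_nonneg e smooth_step_bounds by simp
    ultimately show ?thesis by linarith
  qed
  have zero: "fluxd \<psi> z = 0" if "z \<notin> ball q r" for z
  proof -
    have "r\<^sup>2 - (z - q) \<bullet> (z - q) \<le> 0" using sq that by force
    then show ?thesis unfolding fluxd_def B(2) by (simp add: \<psi>_def smooth_step_0)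
  qed
  have pos: "\<exists>z\<in>ball q r. el z > 0"
  proof (rule bexI[of _ "p + (r / 4) *\<^sub>R \<nu>"])
    define z where "z = p + (r / 4) *\<^sub>R \<nu>"
    have "z - q = (3 / 4 * r) *\<^sub>R \<nu>" by (simp add: z_def q_def scaleR_left_distrib[symmetric])
    then have "cmod (z - q) = 3 / 4 * r" using nu r by simp
    then show zb: "p + (r / 4) *\<^sub>R \<nu> \<in> ball q r" unfolding z_def[symmetric] using r by (simp add: dist_norm norm_minus_commute)
    then have zR: "z \<in> ball p R" using sub by (auto simp: subset_iff z_def)
    have "\<nu> \<bullet> \<nu> = 1" using nu(1) by (simp add: power2_norm_eq_inner[symmetric])
    then have e: "gel p \<bullet> (z - p) = g * (r / 4)" "cmod (z - p) = r / 4" using nu r by (simp_all add: z_def)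
    have "g * r > 0" using g r by simp
    then show "el (p + (r / 4) *\<^sub>R \<nu>) > 0" using lin[OF zR] unfolding z_def[symmetric] e by linarith
  qed
  have "ball q r \<subseteq> N"
  proof
    fix z assume "z \<in> ball q r"
    then have "z \<in> ball p R" using sub by (auto simp: subset_iff)
    then show "z \<in> N" using R(2) by (auto simp: S_def)
  qed
  from that[OF B(1) open_ball this pos neg zero] show thesis .
qed

text \<open>Inside the petal \<alpha> the bump is seen only where \<open>el\<close> is positive,
  because the other side belongs to \<beta>. There its density is negative, and making the bump odd
  adds a term of the same sign. The other petals do not meet the support.\<close>

lemma flux_crossing:
  assumes p: "Im p > 0" "el p = 0" and N: "open N" "p \<in> N" and ab: "\<alpha> \<in> fib" "\<beta> \<in> fib" "\<alpha> \<noteq> \<beta>"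
    and up: "\<And>z. z \<in> N \<Longrightarrow> el z > 0 \<Longrightarrow> z \<in> petal \<alpha>" and low: "\<And>z. z \<in> N \<Longrightarrow> el z < 0 \<Longrightarrow> z \<in> petal \<beta>"
  obtains \<psi> where "\<psi> \<in> odd_tests" "flux \<alpha> \<psi> < 0" "\<And>\<gamma>. \<gamma> \<in> fib \<Longrightarrow> \<gamma> \<noteq> \<alpha> \<Longrightarrow> \<gamma> \<noteq> \<beta> \<Longrightarrow> flux \<gamma> \<psi> = 0"
proof -
  obtain \<phi> U where \<phi>: "\<phi> \<in> test_functions (- {0})" and U: "open U" "U \<subseteq> N" "\<exists>z\<in>U. el z > 0"
    and neg: "\<And>z. z \<in> U \<Longrightarrow> el z > 0 \<Longrightarrow> fluxd \<phi> z < 0" and zero: "\<And>z. z \<notin> U \<Longrightarrow> fluxd \<phi> z = 0"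
    by (rule bump_fluxd[OF p N]) (rule that)
  define \<psi> where "\<psi> = (\<lambda>z. \<phi> z + (-1) * \<phi> (antipodal z))"
  note P = odd_part[OF \<phi>, folded \<psi>_def]
  have t: "\<psi> \<in> test_functions (- {0})" using P(1) by (simp add: odd_tests_def)
  have nz: "z \<noteq> 0" "el z \<noteq> 0" if "z \<in> petal \<gamma>" "\<gamma> \<in> fib" for z \<gamma>
  proof -
    show "el z \<noteq> 0" using that petal_Union by blast
    then show "z \<noteq> 0" using el_0 by auto
  qed
  have sgn: "fluxd \<phi> z \<le> 0" "z \<in> U \<Longrightarrow> fluxd \<phi> z < 0" if "z \<in> petal \<alpha>" for z
  proof -
    show *: "fluxd \<phi> z < 0" if "z \<in> U"
    proof (rule neg[OF that])
      have "\<not> el z < 0" using low[of z] that U(2) petal_disjoint[OF ab] \<open>z \<in> petal \<alpha>\<close> by blast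
      then show "el z > 0" using nz(2)[OF \<open>z \<in> petal \<alpha>\<close> ab(1)] by linarith
    qed
    then show "fluxd \<phi> z \<le> 0" using zero[of z] by (cases "z \<in> U") auto
  qed
  have f: "flux \<gamma> \<psi> = 0" if "\<gamma> \<in> fib" "\<gamma> \<noteq> \<alpha>" "\<gamma> \<noteq> \<beta>" for \<gamma>
  proof -
    have 0: "fluxd \<phi> z = 0" if z: "z \<in> petal \<gamma>" for z
    proof (rule zero, rule notI)
      assume "z \<in> U"
      then have "z \<in> N" using U(2) by blast
      then have "z \<in> petal \<alpha> \<or> z \<in> petal \<beta>" using up[of z] low[of z] nz(2)[OF z \<open>\<gamma> \<in> fib\<close>] by linarith
      then show False
        using petal_disjoint[OF ab(1) \<open>\<gamma> \<in> fib\<close>] petal_disjoint[OF ab(2) \<open>\<gamma> \<in> fib\<close>] \<open>\<gamma> \<noteq> \<alpha>\<close> \<open>\<gamma> \<noteq> \<beta>\<close> z by blast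
    qed
    have e: "indicator (petal \<gamma>) z * fluxd \<psi> z = 0" for z
      using P(2)[of z] 0[of z] 0[of "antipodal z"] nz(1)[of z \<gamma>] \<open>\<gamma> \<in> fib\<close> petal_antipodal[of z \<gamma>]
      by (cases "z \<in> petal \<gamma>") auto
    show ?thesis unfolding flux_def e by simp
  qed
  define h where "h z = indicator (petal \<alpha>) z * fluxd \<psi> z" for z
  have h0: "h z \<le> 0" for z
  proof (cases "z \<in> petal \<alpha>")
    case True
    then have "fluxd \<psi> z = fluxd \<phi> z + fluxd \<phi> (antipodal z) / cmod z ^ 4" using P(2) nz(1) ab(1) by blast
    moreover have "fluxd \<phi> (antipodal z) / cmod z ^ 4 \<le> 0"
      using sgn(1)[of "antipodal z"] True petal_antipodal by (intro divide_nonpos_nonneg) auto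
    ultimately show ?thesis using sgn(1)[OF True] by (simp add: h_def True)
  qed (simp add: h_def)
  have hneg: "h z < 0" if "z \<in> petal \<alpha> \<inter> U" for z
  proof -
    have z: "z \<in> petal \<alpha>" "z \<in> U" using that by auto
    then have "fluxd \<psi> z = fluxd \<phi> z + fluxd \<phi> (antipodal z) / cmod z ^ 4" using P(2) nz(1) ab(1) by blast
    moreover have "fluxd \<phi> (antipodal z) / cmod z ^ 4 \<le> 0"
      using sgn(1)[of "antipodal z"] z(1) petal_antipodal by (intro divide_nonpos_nonneg) auto
    ultimately show ?thesis using sgn(2)[OF z] by (simp add: h_def z(1))
  qed
  have ih: "integrable lborel h" unfolding h_def[abs_def] by (rule integrable_fluxd(2)[OF t ab(1)])
  have "(\<integral>z. - h z \<partial>lborel) \<noteq> 0"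
  proof
    assume "(\<integral>z. - h z \<partial>lborel) = 0"
    then have "AE z in lborel. - h z = 0"
      using integral_nonneg_eq_0_iff_AE[OF integrable_minus[OF ih]] h0 by simp
    then have "AE z in lborel. z \<notin> petal \<alpha> \<inter> U"
      by (rule eventually_mono) (use hneg in force)
    moreover have o: "open (petal \<alpha> \<inter> U)" using open_petal[OF ab(1)] U(1) by (rule open_Int)
    ultimately have "petal \<alpha> \<inter> U \<in> null_sets lborel" by (simp add: AE_iff_null_sets)
    then have "negligible (petal \<alpha> \<inter> U)"
      by (simp add: negligible_iff_null_sets null_sets_completionI)
    moreover have "petal \<alpha> \<inter> U \<noteq> {}" using U(2,3) up by blast
    ultimately show False using o open_not_negligible by blast
  qed
  moreover have "(\<integral>z. - h z \<partial>lborel) \<ge> 0" using h0 by (intro Bochner_Integration.integral_nonneg) simp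
  ultimately have "(\<integral>z. h z \<partial>lborel) < 0" by simp
  then have "flux \<alpha> \<psi> < 0" by (simp add: flux_def h_def)
  from that[OF P(1) this f] show thesis .
qed

text \<open>At a nonreal nodal point the relation forces equal coefficients on the two adjacent
  petals, because some odd test function pairs with these two only, and with opposite values. So the
  coefficient is locally constant along the upper half plane, which is connected and meets every
  petal.\<close>

lemma flux_independent:
  assumes c: "\<And>\<psi>. \<psi> \<in> odd_tests \<Longrightarrow> (\<Sum>\<alpha>\<in>fib. c \<alpha> * flux \<alpha> \<psi>) = 0"
    and a0: "\<alpha>0 \<in> fib" "\<alpha> \<in> fib"
  shows "c \<alpha> = (c \<alpha>0 :: real)"
proof -
  \<comment> \<open>The points near which every petal carries the coefficient \<open>v\<close>.
    These sets are open and pairwise disjoint and cover the upper half plane.\<close>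
  define A where "A v = {p. \<exists>N. open N \<and> p \<in> N \<and> (\<forall>\<gamma>\<in>fib. N \<inter> petal \<gamma> \<noteq> {} \<longrightarrow> c \<gamma> = v)}" for v
  have cover: "\<exists>v. p \<in> A v" if p: "Im p > 0" for p
  proof (cases "el p = 0")
    case False
    then obtain \<gamma> where g: "\<gamma> \<in> fib" "p \<in> petal \<gamma>" using petal_Union by blast
    then have "p \<in> A (c \<gamma>)"
      unfolding A_def using open_petal[OF g(1)] petal_disjoint[OF g(1)] by blast
    then show ?thesis by blast
  next
    case True
    obtain N \<alpha> \<beta> where N: "open N" "p \<in> N" and ab: "\<alpha> \<in> fib" "\<beta> \<in> fib"
      and up: "\<And>z. z \<in> N \<Longrightarrow> el z > 0 \<Longrightarrow> z \<in> petal \<alpha>" and low: "\<And>z. z \<in> N \<Longrightarrow> el z < 0 \<Longrightarrow> z \<in> petal \<beta>"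
      by (rule nodal_crossing[OF p True]) (rule that)
    have cab: "c \<alpha> = c \<beta>"
    proof (cases "\<alpha> = \<beta>")
      case False
      obtain \<psi> where \<psi>: "\<psi> \<in> odd_tests" "flux \<alpha> \<psi> < 0" "\<And>\<gamma>. \<gamma> \<in> fib \<Longrightarrow> \<gamma> \<noteq> \<alpha> \<Longrightarrow> \<gamma> \<noteq> \<beta> \<Longrightarrow> flux \<gamma> \<psi> = 0"
        by (rule flux_crossing[OF p True N ab False]) (rule up, assumption, assumption, rule low, assumption, assumption, rule that)
      have two: "(\<Sum>\<gamma>\<in>fib. d \<gamma> * flux \<gamma> \<psi>) = d \<alpha> * flux \<alpha> \<psi> + d \<beta> * flux \<beta> \<psi>" for d :: "complex \<Rightarrow> real"
      proof -
        have "(\<Sum>\<gamma>\<in>fib. d \<gamma> * flux \<gamma> \<psi>) = (\<Sum>\<gamma>\<in>{\<alpha>, \<beta>}. d \<gamma> * flux \<gamma> \<psi>)"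
          by (rule sum.mono_neutral_right) (use card_fib(2) ab \<psi>(3) in auto)
        then show ?thesis using False by simp
      qed
      have "\<psi> \<in> test_functions (- {0})" using \<psi>(1) by (simp add: odd_tests_def)
      from flux_sum[OF this] have "flux \<beta> \<psi> = - flux \<alpha> \<psi>" using two[of "\<lambda>_. 1"] by simp
      then have "(c \<alpha> - c \<beta>) * flux \<alpha> \<psi> = 0" using c[OF \<psi>(1)] two[of c] by (simp add: algebra_simps)
      then show ?thesis using \<psi>(2) by simp
    qed simp
    have "c \<gamma> = c \<alpha>" if g: "\<gamma> \<in> fib" "N \<inter> petal \<gamma> \<noteq> {}" for \<gamma>
    proof -
      obtain z where z: "z \<in> N" "z \<in> petal \<gamma>" using g(2) by blast
      have "el z \<noteq> 0" using z(2) g(1) petal_Union by blast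
      then have "z \<in> petal \<alpha> \<or> z \<in> petal \<beta>" using up[OF z(1)] low[OF z(1)] by linarith
      then have "\<gamma> = \<alpha> \<or> \<gamma> = \<beta>" using z(2) petal_disjoint[OF g(1) ab(1)] petal_disjoint[OF g(1) ab(2)] by blast
      then show ?thesis using cab by auto
    qed
    then have "p \<in> A (c \<alpha>)" unfolding A_def using N by blast
    then show ?thesis by blast
  qed
  have oA: "open (A v)" for v
  proof (subst open_subopen, intro ballI)
    fix p assume "p \<in> A v"
    then obtain N where N: "open N" "p \<in> N" "\<forall>\<gamma>\<in>fib. N \<inter> petal \<gamma> \<noteq> {} \<longrightarrow> c \<gamma> = v" unfolding A_def by blast
    have "N \<subseteq> A v" unfolding A_def using N(1,3) by blast
    then show "\<exists>T. open T \<and> p \<in> T \<and> T \<subseteq> A v" using N(1,2) by blast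
  qed
  \<comment> \<open>The nodal set has no interior, so two neighbourhoods of a point always meet a
    common petal.\<close>
  have disj: "v = w" if p: "p \<in> A v" "p \<in> A w" for p v w
  proof -
    obtain N where N: "open N" "p \<in> N" "\<forall>\<gamma>\<in>fib. N \<inter> petal \<gamma> \<noteq> {} \<longrightarrow> c \<gamma> = v" using p(1) unfolding A_def by blast
    obtain M where M: "open M" "p \<in> M" "\<forall>\<gamma>\<in>fib. M \<inter> petal \<gamma> \<noteq> {} \<longrightarrow> c \<gamma> = w" using p(2) unfolding A_def by blast
    have "\<not> N \<inter> M \<subseteq> {z. el z = 0}"
      using open_not_negligible[of "N \<inter> M"] N(1,2) M(1,2) negligible_subset[OF nodal_negligible, of "N \<inter> M"] by blast
    then obtain z where z: "z \<in> N" "z \<in> M" "el z \<noteq> 0" by blast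
    then obtain \<gamma> where g: "\<gamma> \<in> fib" "z \<in> petal \<gamma>" using petal_Union by blast
    then show ?thesis using N(3) M(3) z(1,2) by blast
  qed
  have val: "z \<in> A (c \<gamma>)" if "\<gamma> \<in> fib" "z \<in> petal \<gamma>" for z \<gamma>
    unfolding A_def using open_petal[OF that(1)] petal_disjoint[OF that(1)] that by blast
  obtain z0 where z0: "z0 \<in> petal \<alpha>0" "Im z0 > 0" using petal_upper_half[OF a0(1)] by blast
  obtain z1 where z1: "z1 \<in> petal \<alpha>" "Im z1 > 0" using petal_upper_half[OF a0(2)] by blast
  have "A (c \<alpha>0) \<inter> {z. Im z > 0} = {} \<or> (\<Union>v\<in>- {c \<alpha>0}. A v) \<inter> {z. Im z > 0} = {}"
  proof (rule connectedD[of "{z. Im z > 0}"])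
    show "connected {z. Im z > 0}" by (intro convex_connected convex_halfspace_Im_gt)
    show "open (\<Union>v\<in>- {c \<alpha>0}. A v)" using oA by blast
    show "A (c \<alpha>0) \<inter> (\<Union>v\<in>- {c \<alpha>0}. A v) \<inter> {z. Im z > 0} = {}" using disj by blast
    show "{z. Im z > 0} \<subseteq> A (c \<alpha>0) \<union> (\<Union>v\<in>- {c \<alpha>0}. A v)" using cover by blast
  qed (rule oA)
  then have "z1 \<notin> (\<Union>v\<in>- {c \<alpha>0}. A v)" using val[OF a0(1) z0(1)] z0(2) z1(2) by blast
  then show ?thesis using val[OF a0(2) z1(1)] by blast
qed

end

text \<open>A crude bound on the operator norm, sufficient because the matrix in question will be of
  second order in a small parameter.\<close>

lemma quadratic_form_bound:
  fixes M :: "'i \<Rightarrow> 'i \<Rightarrow> real"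
  assumes "finite I"
  shows "(\<Sum>i\<in>I. \<Sum>j\<in>I. x i * x j * M i j) \<le> (\<Sum>i\<in>I. \<Sum>j\<in>I. \<bar>M i j\<bar>) * (\<Sum>k\<in>I. (x k)\<^sup>2)"
proof -
  define S where "S = (\<Sum>k\<in>I. (x k)\<^sup>2)"
  have "x i * x j * M i j \<le> \<bar>M i j\<bar> * S" if "i \<in> I" "j \<in> I" for i j
  proof -
    have "(x k)\<^sup>2 \<le> S" if "k \<in> I" for k
      unfolding S_def by (rule member_le_sum) (use that assms in auto)
    then have s: "(x i)\<^sup>2 \<le> S" "(x j)\<^sup>2 \<le> S" using that by auto
    have "2 * \<bar>x i * x j\<bar> \<le> (x i)\<^sup>2 + (x j)\<^sup>2"
      using zero_le_power2[of "\<bar>x i\<bar> - \<bar>x j\<bar>"] by (simp add: power2_diff abs_mult)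
    then have "\<bar>x i * x j\<bar> \<le> S" using s by linarith
    then have "\<bar>x i * x j\<bar> * \<bar>M i j\<bar> \<le> S * \<bar>M i j\<bar>" by (intro mult_right_mono) auto
    moreover have "x i * x j * M i j \<le> \<bar>x i * x j\<bar> * \<bar>M i j\<bar>" unfolding abs_mult[symmetric] by (rule abs_ge_self)
    ultimately show ?thesis by (simp only: mult.commute)
  qed
  then have "(\<Sum>i\<in>I. \<Sum>j\<in>I. x i * x j * M i j) \<le> (\<Sum>i\<in>I. \<Sum>j\<in>I. \<bar>M i j\<bar> * S)" by (intro sum_mono) auto
  then show ?thesis by (simp add: sum_distrib_right S_def)
qed

lemma test_sum:
  assumes "finite I" "\<And>i. i \<in> I \<Longrightarrow> v i \<in> test_functions W"
  shows "(\<lambda>z. \<Sum>i\<in>I. x i * v i z) \<in> test_functions W"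
  using assms
proof (induction I)
  case empty
  then show ?case by (simp add: test_zero)
next
  case (insert a I)
  have "(\<lambda>z. (\<Sum>i\<in>I. x i * v i z) + x a * v a z) \<in> test_functions W"
    by (rule test_lin(1)) (use insert in auto)
  then show ?case using insert.hyps by (simp add: add.commute)
qed

text \<open>Both \<open>z\<close> and \<open>inverse z\<close> are bounded on the compact
  set.\<close>

lemma compact_subset_annulus:
  assumes K: "compact K" "K \<subseteq> - {0::complex}"
  shows "\<exists>R>1. K \<subseteq> {z. 1 / R < cmod z \<and> cmod z < R}"
proof -
  obtain a where a: "\<And>z. z \<in> K \<Longrightarrow> cmod z \<le> a"
    using compact_imp_bounded[OF K(1)] unfolding bounded_iff by blast
  have "compact (inverse ` K)"
    by (rule compact_continuous_image[OF _ K(1)]) (use K(2) in \<open>auto intro!: continuous_intros\<close>)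
  then have "bounded (inverse ` K)" by (rule compact_imp_bounded)
  then obtain b where b: "\<And>z. z \<in> K \<Longrightarrow> cmod (inverse z) \<le> b"
    unfolding bounded_iff by blast
  define R where "R = \<bar>a\<bar> + \<bar>b\<bar> + 2"
  have "1 / R < cmod z \<and> cmod z < R" if z: "z \<in> K" for z
  proof -
    have nz: "cmod z > 0" using z K(2) by auto
    have "cmod (inverse z) = 1 / cmod z" by (simp add: norm_inverse divide_inverse)
    then have "1 / cmod z < R" using b[OF z] abs_ge_self[of b] abs_ge_zero[of a] unfolding R_def by linarith
    moreover have "R > 0" by (simp add: R_def)
    ultimately have "1 / R < cmod z" using nz by (simp add: divide_less_eq mult.commute)
    moreover have "cmod z < R" using a[OF z] by (simp add: R_def)
    ultimately show ?thesis by blast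
  qed
  moreover have "R > 1" by (simp add: R_def)
  ultimately show ?thesis by blast
qed

context oliveira
begin

section \<open>The lower bound\<close>

definition qf :: "(complex \<Rightarrow> real) \<Rightarrow> (complex \<Rightarrow> real) \<Rightarrow> real" where
  "qf f g = (\<integral>z. grad f z \<bullet> grad g z - rho z * f z * g z \<partial>lborel)"

lemma qf_sym: "qf f g = qf g f"
  unfolding qf_def by (simp add: inner_commute mult.commute mult.left_commute)

lemma qf_integrable:
  assumes f: "f \<in> test_functions W" and g: "g \<in> test_functions W"
  shows "integrable lborel (\<lambda>z. grad f z \<bullet> grad g z)" "integrable lborel (\<lambda>z. rho z * f z * g z)"
    "integrable lborel (\<lambda>z. cmod (gel z) * cmod (grad f z))"
proof -
  obtain K where K: "continuous_on UNIV (grad f)" "compact K" "\<And>z. z \<notin> K \<Longrightarrow> f z = 0" "\<And>z. z \<notin> K \<Longrightarrow> grad f z = 0"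
    using test_functionsE[OF f] by metis
  have c: "continuous_on UNIV (grad g)" "continuous_on UNIV g" "continuous_on UNIV f"
    using test_functionsE[OF g] test_continuous[OF f] test_continuous[OF g] by metis+
  show "integrable lborel (\<lambda>z. grad f z \<bullet> grad g z)" "integrable lborel (\<lambda>z. rho z * f z * g z)"
    "integrable lborel (\<lambda>z. cmod (gel z) * cmod (grad f z))"
    by (rule integrable_compact_support[OF _ K(2)]; use K c in \<open>auto intro!: continuous_intros continuous_rho continuous_gel\<close>)+
qed

lemma qf_lin:
  assumes f: "f \<in> test_functions W" and g: "g \<in> test_functions W" and h: "h \<in> test_functions W"
  shows "qf (\<lambda>z. f z + s * g z) h = qf f h + s * qf g h"
proof -
  have "grad (\<lambda>z. f z + s * g z) z \<bullet> grad h z - rho z * (f z + s * g z) * h z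
    = (grad f z \<bullet> grad h z - rho z * f z * h z) + s * (grad g z \<bullet> grad h z - rho z * g z * h z)" for z
    unfolding test_lin(2)[OF f g] by (simp add: inner_add_left algebra_simps)
  then show ?thesis
    unfolding qf_def using qf_integrable(1,2)[OF f h] qf_integrable(1,2)[OF g h] by simp
qed

lemma qf_zero: "qf (\<lambda>_. 0) h = 0"
proof -
  have "grad (\<lambda>_. 0) z = 0" for z by (rule grad_eqI) simp
  then show ?thesis by (simp add: qf_def)
qed

lemma qf_sum:
  assumes "finite I" "\<And>i. i \<in> I \<Longrightarrow> v i \<in> test_functions W" and h: "h \<in> test_functions W"
  shows "qf (\<lambda>z. \<Sum>i\<in>I. x i * v i z) h = (\<Sum>i\<in>I. x i * qf (v i) h)"
  using assms(1,2)
proof (induction I)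
  case empty
  then show ?case by (simp add: qf_zero)
next
  case (insert a I)
  have t: "(\<lambda>z. \<Sum>i\<in>I. x i * v i z) \<in> test_functions W" by (rule test_sum) (use insert in auto)
  have "qf (\<lambda>z. (\<Sum>i\<in>I. x i * v i z) + x a * v a z) h = (\<Sum>i\<in>I. x i * qf (v i) h) + x a * qf (v a) h"
    using qf_lin[OF t _ h, of "v a" "x a"] insert by simp
  then show ?case using insert.hyps by (simp add: add.commute)
qed

lemma qf_sum2:
  assumes I: "finite I" "\<And>i. i \<in> I \<Longrightarrow> v i \<in> test_functions W"
  shows "qf (\<lambda>z. \<Sum>i\<in>I. x i * v i z) (\<lambda>z. \<Sum>i\<in>I. x i * v i z) = (\<Sum>i\<in>I. \<Sum>j\<in>I. x i * x j * qf (v i) (v j))"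
proof -
  let ?u = "\<lambda>z. \<Sum>i\<in>I. x i * v i z"
  have t: "?u \<in> test_functions W" by (rule test_sum[OF I(1)]) (rule I(2))
  have s: "qf ?u h = (\<Sum>i\<in>I. x i * qf (v i) h)" if "h \<in> test_functions W" for h
    by (rule qf_sum[OF I(1) _ that]) (rule I(2))
  have "qf (v i) (\<lambda>z. \<Sum>j\<in>I. x j * v j z) = (\<Sum>j\<in>I. x j * qf (v i) (v j))" if "i \<in> I" for i
    using s[OF I(2)[OF that]] by (simp add: qf_sym[of "v i"])
  then show ?thesis unfolding s[OF t] by (simp add: sum_distrib_left mult.assoc)
qed

text \<open>In the limit the cut function is \<open>el\<close> restricted to the petal, and the
  integrand of the form becomes the flux density there.\<close>

lemma qf_cut_limit:
  assumes D: "\<alpha> \<in> fib" and \<psi>: "\<psi> \<in> test_functions (- {0})"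
  shows "(\<lambda>n. qf (cut (petal \<alpha>) n) \<psi>) \<longlonglongrightarrow> flux \<alpha> \<psi>"
proof -
  let ?D = "petal \<alpha>"
  note cl = petal_clopen[OF D]
  obtain K where K: "continuous_on UNIV (grad \<psi>)" using test_functionsE[OF \<psi>] by metis
  have mp: "\<psi> \<in> borel_measurable borel" by (rule borel_measurable_continuous_onI[OF test_continuous[OF \<psi>]])
  have mg: "grad \<psi> \<in> borel_measurable borel" by (rule borel_measurable_continuous_onI[OF K])
  have i1: "integrable lborel (\<lambda>z. rho z * \<bar>\<psi> z\<bar>)"
    using integrable_abs[OF test_integrable(3)[OF \<psi>]] rho_nonneg by (simp add: abs_mult)
  note L = cut_limits[OF cl mp i1 mg qf_integrable(3)[OF \<psi> \<psi>]]
  have 1: "qf (cut ?D n) \<psi> = (\<integral>z. gcut ?D n z \<bullet> grad \<psi> z \<partial>lborel) - (\<integral>z. rho z * cut ?D n z * \<psi> z \<partial>lborel)" for n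
    unfolding qf_def using qf_integrable(1,2)[OF cut_test(1)[OF cl, of n] \<psi>] cut_test(2)[OF cl, of n]
    by (simp add: Bochner_Integration.integral_diff)
  have b: "?D \<in> sets borel" using open_petal[OF D] by simp
  have i2: "integrable lborel (\<lambda>z. indicator ?D z * (gel z \<bullet> grad \<psi> z))"
    using integrable_mult_indicator[OF _ jacobi(1)[OF \<psi>], of ?D] b by (simp add: inner_commute)
  have i3: "integrable lborel (\<lambda>z. indicator ?D z * (rho z * el z * \<psi> z))"
    using integrable_mult_indicator[OF _ jacobi(2)[OF \<psi>], of ?D] b by simp
  have 2: "flux \<alpha> \<psi> = (\<integral>z. indicator ?D z * (gel z \<bullet> grad \<psi> z) \<partial>lborel) - (\<integral>z. indicator ?D z * (rho z * el z * \<psi> z) \<partial>lborel)"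
    unfolding flux_def fluxd_def right_diff_distrib by (rule Bochner_Integration.integral_diff[OF i2 i3])
  show ?thesis unfolding 1 2 by (rule tendsto_diff[OF L(2,1)])
qed

text \<open>Cut functions of different petals have disjoint supports. For one petal the limit is the
  form of the restriction of \<open>el\<close>, which is 0 by \<open>energy_el\<close>.\<close>

lemma qf_cut_cut_limit:
  assumes D: "\<alpha> \<in> fib" "\<beta> \<in> fib"
  shows "(\<lambda>n. qf (cut (petal \<alpha>) n) (cut (petal \<beta>) n)) \<longlonglongrightarrow> 0"
proof (cases "\<alpha> = \<beta>")
  case False
  have "qf (cut (petal \<alpha>) n) (cut (petal \<beta>) n) = 0" for n
  proof -
    have "grad (cut (petal \<alpha>) n) z \<bullet> grad (cut (petal \<beta>) n) z - rho z * cut (petal \<alpha>) n z * cut (petal \<beta>) n z = 0" for z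
      using petal_disjoint[OF D False] unfolding cut_test(2)[OF petal_clopen[OF D(1)]] cut_test(2)[OF petal_clopen[OF D(2)]]
      by (auto simp: gcut_def cut_def indicator_def)
    then show ?thesis unfolding qf_def by simp
  qed
  then show ?thesis by simp
next
  case True
  define E where "E = petal \<alpha>"
  have cl: "clopen_off_nodal E" using petal_clopen[OF D(1)] by (simp add: E_def)
  have [measurable]: "E \<in> sets borel" using open_petal[OF D(1)] by (simp add: E_def)
  note [measurable] = measurable_rho measurable_el measurable_gel
  have [measurable]: "hc n \<in> borel_measurable borel" "hc' n \<in> borel_measurable borel" for n
    by (rule borel_measurable_continuous_onI; rule continuous_hc continuous_hc')+
  have A: "(\<lambda>n. \<integral>z. gcut E n z \<bullet> gcut E n z \<partial>lborel) \<longlonglongrightarrow> (\<integral>z. indicator E z * (gel z \<bullet> gel z) \<partial>lborel)"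
  proof (rule integral_dominated_convergence[where w="\<lambda>z. 81 * (cmod (gel z))\<^sup>2"])
    show "integrable lborel (\<lambda>z. 81 * (cmod (gel z))\<^sup>2)" using integrable_rho_el(3) by simp
    show "AE z in lborel. norm (gcut E n z \<bullet> gcut E n z) \<le> 81 * (cmod (gel z))\<^sup>2" for n
    proof (rule AE_I2)
      fix z
      have "\<bar>indicator E z * hc' n (el z)\<bar> \<le> 9" using hc'_bound[of n "el z"] by (auto simp: indicator_def)
      then have "cmod (gcut E n z) \<le> 9 * cmod (gel z)" unfolding gcut_def norm_scaleR by (rule mult_right_mono) simp
      then have "(cmod (gcut E n z))\<^sup>2 \<le> (9 * cmod (gel z))\<^sup>2" by (intro power_mono) auto
      then show "norm (gcut E n z \<bullet> gcut E n z) \<le> 81 * (cmod (gel z))\<^sup>2"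
        by (simp add: power2_norm_eq_inner[symmetric] power_mult_distrib)
    qed
    show "AE z in lborel. (\<lambda>n. gcut E n z \<bullet> gcut E n z) \<longlonglongrightarrow> indicator E z * (gel z \<bullet> gel z)"
      using AE_el_nz
    proof eventually_elim
      fix z assume "el z \<noteq> 0"
      then have "(\<lambda>n. (indicator E z * hc' n (el z)) * (indicator E z * hc' n (el z)) * (gel z \<bullet> gel z))
          \<longlonglongrightarrow> (indicator E z * 1) * (indicator E z * 1) * (gel z \<bullet> gel z)"
        by (intro tendsto_intros hc_tendsto)
      then show "(\<lambda>n. gcut E n z \<bullet> gcut E n z) \<longlonglongrightarrow> indicator E z * (gel z \<bullet> gel z)"
        by (cases "z \<in> E") (simp_all add: gcut_def mult.assoc)
    qed
  qed (unfold gcut_def, measurable)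
  have B: "(\<lambda>n. \<integral>z. rho z * cut E n z * cut E n z \<partial>lborel) \<longlonglongrightarrow> (\<integral>z. indicator E z * (rho z * el z * el z) \<partial>lborel)"
  proof (rule integral_dominated_convergence[OF _ _ integrable_rho])
    show "AE z in lborel. norm (rho z * cut E n z * cut E n z) \<le> rho z" for n
    proof (rule AE_I2)
      fix z
      have c: "\<bar>cut E n z\<bar> \<le> 1"
        using hc_bound[of n "el z"] el_bound[of z] by (auto simp: cut_def indicator_def)
      have "\<bar>cut E n z\<bar> * \<bar>cut E n z\<bar> \<le> 1 * 1" using c by (intro mult_mono) auto
      then have "rho z * (\<bar>cut E n z\<bar> * \<bar>cut E n z\<bar>) \<le> rho z * 1" using rho_nonneg by (intro mult_left_mono) auto
      then show "norm (rho z * cut E n z * cut E n z) \<le> rho z"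
        using rho_nonneg[of z] by (simp add: abs_mult mult.assoc)
    qed
    show "AE z in lborel. (\<lambda>n. rho z * cut E n z * cut E n z) \<longlonglongrightarrow> indicator E z * (rho z * el z * el z)"
      using AE_el_nz
    proof eventually_elim
      fix z assume "el z \<noteq> 0"
      then have "(\<lambda>n. rho z * (indicator E z * hc n (el z)) * (indicator E z * hc n (el z)))
          \<longlonglongrightarrow> rho z * (indicator E z * el z) * (indicator E z * el z)"
        by (intro tendsto_intros hc_tendsto)
      then show "(\<lambda>n. rho z * cut E n z * cut E n z) \<longlonglongrightarrow> indicator E z * (rho z * el z * el z)"
        by (cases "z \<in> E") (simp_all add: cut_def)
    qed
  qed (unfold cut_def, measurable)
  have "qf (cut E n) (cut E n) = (\<integral>z. gcut E n z \<bullet> gcut E n z \<partial>lborel) - (\<integral>z. rho z * cut E n z * cut E n z \<partial>lborel)" for n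
    unfolding qf_def using qf_integrable(1,2)[OF cut_test(1)[OF cl, of n] cut_test(1)[OF cl, of n]] cut_test(2)[OF cl, of n]
    by (simp add: Bochner_Integration.integral_diff)
  then show ?thesis using tendsto_diff[OF A B] energy_el[OF cl] True by (simp add: E_def)
qed

text \<open>By \<open>flux_independent\<close> a relation between the functionals has equal
  coefficients, so leaving out one petal makes the others independent.\<close>

lemma flux_dual_basis:
  assumes a0: "\<alpha>0 \<in> fib"
  obtains \<psi> where "\<And>j. j \<in> fib - {\<alpha>0} \<Longrightarrow> \<psi> j \<in> odd_tests"
    "\<And>i j. i \<in> fib - {\<alpha>0} \<Longrightarrow> j \<in> fib - {\<alpha>0} \<Longrightarrow> flux i (\<psi> j) = (if i = j then 1 else 0)"
proof -
  have "\<exists>\<psi>. \<forall>j\<in>fib - {\<alpha>0}. \<psi> j \<in> odd_tests \<and> (\<forall>i\<in>fib - {\<alpha>0}. flux i (\<psi> j) = (if i = j then 1 else 0))"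
  proof (rule dual_basis_exists)
    show "finite (fib - {\<alpha>0})" using card_fib by simp
    show "(\<lambda>_. 0) \<in> odd_tests" by (simp add: odd_tests_def test_zero)
    show "(\<lambda>z. f z + s * g z) \<in> odd_tests" if "f \<in> odd_tests" "g \<in> odd_tests" for f g s
      using that test_lin(1) by (simp add: odd_tests_def)
    show "flux i (\<lambda>z. f z + s * g z) = flux i f + s * flux i g"
      if "i \<in> fib - {\<alpha>0}" "f \<in> odd_tests" "g \<in> odd_tests" for i f g s
      by (rule flux_lin[of _ _ "- {0}"]) (use that in \<open>auto simp: odd_tests_def\<close>)
    fix c assume c: "\<forall>f\<in>odd_tests. (\<Sum>i\<in>fib - {\<alpha>0}. c i * flux i f) = 0"
    \<comment> \<open>The omitted petal gets the coefficient 0; as all coefficients agree, they all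
      vanish.\<close>
    define d where "d = c(\<alpha>0 := 0)"
    have h: "(\<Sum>\<alpha>\<in>fib. d \<alpha> * flux \<alpha> f) = 0" if "f \<in> odd_tests" for f
    proof -
      have "(\<Sum>\<alpha>\<in>fib. d \<alpha> * flux \<alpha> f) = (\<Sum>i\<in>fib - {\<alpha>0}. c i * flux i f)"
        using card_fib a0 by (simp add: sum.remove[of fib \<alpha>0] d_def)
      then show ?thesis using c that by simp
    qed
    show "\<forall>i\<in>fib - {\<alpha>0}. c i = 0"
    proof
      fix i assume i: "i \<in> fib - {\<alpha>0}"
      then have "d i = d \<alpha>0" by (intro flux_independent[OF h a0]) auto
      then show "c i = 0" using i by (simp add: d_def)
    qed
  qed
  then show thesis using that by blast
qed

text \<open>As \<open>n\<close> grows, the matrix of the form tends to - 2 t times the identity plus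
  t^2 times the matrix of the dual family. For small t the first part dominates, and then
  \<open>n\<close> is taken large.\<close>

lemma negative_family:
  obtains v :: "complex \<Rightarrow> complex \<Rightarrow> real" and I where "finite I" "card I = m - 1" "\<And>i. i \<in> I \<Longrightarrow> v i \<in> odd_tests"
    "\<And>x. (\<exists>i\<in>I. x i \<noteq> 0) \<Longrightarrow> (\<Sum>i\<in>I. \<Sum>j\<in>I. x i * x j * qf (v i) (v j)) < 0"
proof -
  obtain \<alpha>0 where a0: "\<alpha>0 \<in> fib" using fib_nonempty by blast
  define I where "I = fib - {\<alpha>0}"
  have fI: "finite I" "card I = m - 1" using card_fib a0 by (simp_all add: I_def)
  have If: "i \<in> fib" if "i \<in> I" for i using that by (simp add: I_def)
  obtain \<psi> where \<psi>: "\<And>j. j \<in> I \<Longrightarrow> \<psi> j \<in> odd_tests"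
    "\<And>i j. i \<in> I \<Longrightarrow> j \<in> I \<Longrightarrow> flux i (\<psi> j) = (if i = j then 1 else 0)"
    by (rule flux_dual_basis[OF a0, folded I_def]) (rule that)
  have t\<psi>: "\<psi> j \<in> test_functions (- {0})" if "j \<in> I" for j using \<psi>(1)[OF that] by (simp add: odd_tests_def)
  define C where "C = (\<Sum>i\<in>I. \<Sum>j\<in>I. \<bar>qf (\<psi> i) (\<psi> j)\<bar>)"
  have C: "C \<ge> 0" by (simp add: C_def sum_nonneg)
  \<comment> \<open>This choice makes t C less than 1, so the second order part, at most t^2 C,
    stays below the 2 t on the diagonal.\<close>
  define t where "t = 1 / (C + 1)"
  have t: "t > 0" "t * C < 1" using C by (simp_all add: t_def divide_less_eq)
  define v where "v n j = (\<lambda>z. cut (petal j) n z + (- t) * \<psi> j z)" for n j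
  have tc: "cut (petal j) n \<in> test_functions (- {0})" if "j \<in> I" for j n
    by (rule cut_test(1)[OF petal_clopen[OF If[OF that]]])
  have tv: "v n j \<in> test_functions (- {0})" if "j \<in> I" for n j
    unfolding v_def by (rule test_lin(1)[OF tc[OF that] t\<psi>[OF that]])
  have ov: "v n j \<in> odd_tests" if "j \<in> I" for n j
    using tv[OF that] \<psi>(1)[OF that] cut_petal_odd by (simp add: odd_tests_def v_def)
  have exp: "qf (v n i) (v n j) = qf (cut (petal i) n) (cut (petal j) n) - t * qf (cut (petal i) n) (\<psi> j)
      - t * (qf (cut (petal j) n) (\<psi> i) - t * qf (\<psi> i) (\<psi> j))" if i: "i \<in> I" and j: "j \<in> I" for n i j
  proof -
    have 1: "qf (v n i) (v n j) = qf (cut (petal i) n) (v n j) + (- t) * qf (\<psi> i) (v n j)"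
      unfolding v_def[of n i] by (rule qf_lin[OF tc[OF i] t\<psi>[OF i] tv[OF j]])
    have 2: "qf (v n j) h = qf (cut (petal j) n) h + (- t) * qf (\<psi> j) h" if "h \<in> test_functions (- {0})" for h
      unfolding v_def by (rule qf_lin[OF tc[OF j] t\<psi>[OF j] that])
    have 3: "qf (cut (petal i) n) (v n j) = qf (cut (petal i) n) (cut (petal j) n) - t * qf (cut (petal i) n) (\<psi> j)"
      using 2[OF tc[OF i, of n]] by (simp add: qf_sym[of "cut (petal i) n"])
    have 4: "qf (\<psi> i) (v n j) = qf (cut (petal j) n) (\<psi> i) - t * qf (\<psi> i) (\<psi> j)"
      using 2[OF t\<psi>[OF i]] by (simp add: qf_sym[of "\<psi> i"])
    show ?thesis unfolding 1 3 4 by simp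
  qed
  \<comment> \<open>Adding 2 t on the diagonal removes the negative leading part; what remains must
    only be small compared with 2 t.\<close>
  define M where "M n i j = qf (v n i) (v n j) + (if i = j then 2 * t else 0)" for n i j
  have lim: "(\<lambda>n. M n i j) \<longlonglongrightarrow> t * (t * qf (\<psi> i) (\<psi> j))" if i: "i \<in> I" and j: "j \<in> I" for i j
  proof -
    have "(\<lambda>n. qf (v n i) (v n j) + (if i = j then 2 * t else 0)) \<longlonglongrightarrow> 0 - t * flux i (\<psi> j) - t * (flux j (\<psi> i) - t * qf (\<psi> i) (\<psi> j))
        + (if i = j then 2 * t else 0)"
      unfolding exp[OF i j]
      by (intro tendsto_intros qf_cut_cut_limit qf_cut_limit If i j t\<psi>)
    moreover have "0 - t * flux i (\<psi> j) - t * (flux j (\<psi> i) - t * qf (\<psi> i) (\<psi> j)) + (if i = j then 2 * t else 0)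
        = t * (t * qf (\<psi> i) (\<psi> j))"
      using \<psi>(2)[OF i j] \<psi>(2)[OF j i] by (simp add: algebra_simps)
    ultimately show ?thesis by (simp only: M_def)
  qed
  have "(\<lambda>n. \<Sum>i\<in>I. \<Sum>j\<in>I. \<bar>M n i j\<bar>) \<longlonglongrightarrow> (\<Sum>i\<in>I. \<Sum>j\<in>I. \<bar>t * (t * qf (\<psi> i) (\<psi> j))\<bar>)"
    by (intro tendsto_sum tendsto_rabs lim)
  also have "(\<Sum>i\<in>I. \<Sum>j\<in>I. \<bar>t * (t * qf (\<psi> i) (\<psi> j))\<bar>) = t * (t * C)"
    using t(1) by (simp add: C_def abs_mult sum_distrib_left)
  finally have "(\<lambda>n. \<Sum>i\<in>I. \<Sum>j\<in>I. \<bar>M n i j\<bar>) \<longlonglongrightarrow> t * (t * C)" .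
  moreover have "t * (t * C) < 2 * t"
    using mult_strict_left_mono[OF t(2) t(1)] t(1) by linarith
  ultimately have "eventually (\<lambda>n. (\<Sum>i\<in>I. \<Sum>j\<in>I. \<bar>M n i j\<bar>) < 2 * t) sequentially"
    by (rule order_tendstoD)
  then obtain n where n: "(\<Sum>i\<in>I. \<Sum>j\<in>I. \<bar>M n i j\<bar>) < 2 * t"
    using eventually_happens'[OF sequentially_bot] by blast
  have "(\<Sum>i\<in>I. \<Sum>j\<in>I. x i * x j * qf (v n i) (v n j)) < 0" if x: "\<exists>i\<in>I. x i \<noteq> 0" for x
  proof -
    define S where "S = (\<Sum>k\<in>I. (x k)\<^sup>2)"
    have S: "S > 0"
    proof -
      obtain i where "i \<in> I" "x i \<noteq> 0" using x by blast
      then show ?thesis unfolding S_def by (intro sum_pos2[OF fI(1)]) auto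
    qed
    have "(\<Sum>i\<in>I. \<Sum>j\<in>I. x i * x j * M n i j)
        = (\<Sum>i\<in>I. \<Sum>j\<in>I. x i * x j * qf (v n i) (v n j) + (if i = j then 2 * t * (x i)\<^sup>2 else 0))"
      by (intro sum.cong refl) (simp add: M_def distrib_left power2_eq_square)
    also have "\<dots> = (\<Sum>i\<in>I. \<Sum>j\<in>I. x i * x j * qf (v n i) (v n j)) + 2 * t * S"
      using fI(1) by (simp add: sum.distrib S_def sum_distrib_left)
    finally have "(\<Sum>i\<in>I. \<Sum>j\<in>I. x i * x j * qf (v n i) (v n j)) = (\<Sum>i\<in>I. \<Sum>j\<in>I. x i * x j * M n i j) - 2 * t * S"
      by simp
    also have "\<dots> \<le> (\<Sum>i\<in>I. \<Sum>j\<in>I. \<bar>M n i j\<bar>) * S - 2 * t * S"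
      using quadratic_form_bound[OF fI(1), of x "M n"] by (simp add: S_def)
    also have "\<dots> < 0" using mult_strict_right_mono[OF n S] by simp
    finally show ?thesis .
  qed
  from that[OF fI ov this] show thesis .
qed

text \<open>The finitely many compact supports fit into one annulus. Injectivity of \<open>v\<close>
  and linear independence come from negativity itself: a vanishing combination would have the form
  value 0.\<close>

theorem lower_bound:
  obtains R V where "R > 1" "V \<in> negative_spaces {z. 1 / R < cmod z \<and> cmod z < R} antipodal X"
    "fun_space.dim V = m - 1"
proof -
  obtain I and v :: "complex \<Rightarrow> complex \<Rightarrow> real" where I: "finite I" "card I = m - 1" and v: "\<And>i. i \<in> I \<Longrightarrow> v i \<in> odd_tests"
    and neg: "\<And>x. (\<exists>i\<in>I. x i \<noteq> 0) \<Longrightarrow> (\<Sum>i\<in>I. \<Sum>j\<in>I. x i * x j * qf (v i) (v j)) < 0"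
    by (rule negative_family) (rule that)
  have "\<exists>K. compact K \<and> K \<subseteq> - {0} \<and> (\<forall>z. z \<notin> K \<longrightarrow> v i z = 0)" if "i \<in> I" for i
    using v[OF that] by (simp add: odd_tests_def test_functions_def)
  then obtain K where K: "\<And>i. i \<in> I \<Longrightarrow> compact (K i) \<and> K i \<subseteq> - {0} \<and> (\<forall>z. z \<notin> K i \<longrightarrow> v i z = 0)" by metis
  have "compact (\<Union>i\<in>I. K i)" "(\<Union>i\<in>I. K i) \<subseteq> - {0}" using K I(1) by (blast intro: compact_UN)+
  from compact_subset_annulus[OF this] obtain R where R: "R > 1" "(\<Union>i\<in>I. K i) \<subseteq> {z. 1 / R < cmod z \<and> cmod z < R}" by blast
  define W where "W = {z. 1 / R < cmod z \<and> cmod z < R}"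
  have W: "admissible W"
  proof -
    have "open W" unfolding W_def by (intro open_Collect_conj open_Collect_less continuous_intros)
    moreover have "compact (cball 0 R - ball (0::complex) (1 / R))" by (intro compact_diff) auto
    moreover have "cball 0 R - ball (0::complex) (1 / R) \<subseteq> - {0}" using R(1) by auto
    moreover have "W \<subseteq> cball 0 R - ball (0::complex) (1 / R)" by (auto simp: W_def)
    ultimately show ?thesis unfolding admissible_def by blast
  qed
  have tv: "v i \<in> test_functions W" if "i \<in> I" for i
  proof -
    have "K i \<subseteq> W" using R(2) that by (auto simp: W_def)
    then show ?thesis using v[OF that] K[OF that] unfolding odd_tests_def test_functions_def by blast
  qed
  define u where "u x = (\<lambda>z. \<Sum>i\<in>I. x i * v i z)" for x
  have u: "(\<Sum>i\<in>I. (\<lambda>z. x i * v i z)) = u x" for x by (simp add: fun_eq_iff fun_sum_apply u_def)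
  have tu: "u x \<in> test_functions W" for x unfolding u_def by (rule test_sum[OF I(1) tv])
  have quu: "qf (u x) (u x) = (\<Sum>i\<in>I. \<Sum>j\<in>I. x i * x j * qf (v i) (v j))" for x
    unfolding u_def by (rule qf_sum2[OF I(1)]) (rule tv)
  have iu: "index_form X W (u x) = (\<Sum>i\<in>I. \<Sum>j\<in>I. x i * x j * qf (v i) (v j))" for x
  proof -
    have "index_form X W (u x) = qf (u x) (u x)"
      unfolding test_index_form[OF W tu] qf_def power2_norm_eq_inner by (simp add: power2_eq_square mult.assoc)
    then show ?thesis unfolding quu .
  qed
  have nz: "u x \<noteq> 0" if "\<exists>i\<in>I. x i \<noteq> 0" for x
  proof
    assume "u x = 0"
    then have "qf (u x) (u x) = 0" using qf_zero by (simp add: zero_fun_def)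
    then show False using neg[OF that] unfolding quu by simp
  qed
  have inj: "inj_on v I"
  proof (rule inj_onI, rule ccontr)
    fix i j assume ij: "i \<in> I" "j \<in> I" "v i = v j" "i \<noteq> j"
    define x :: "complex \<Rightarrow> real" where "x k = (if k = i then 1 else 0) - (if k = j then 1 else 0)" for k
    have "u x z = v i z - v j z" for z
    proof -
      have "u x z = (\<Sum>k\<in>I. (if k = i then v k z else 0) - (if k = j then v k z else 0))"
        unfolding u_def x_def by (intro sum.cong) auto
      then show ?thesis using I(1) ij by (simp add: sum_subtractf)
    qed
    then have "u x = 0" using ij(3) by (simp add: fun_eq_iff)
    moreover have "\<exists>i\<in>I. x i \<noteq> 0" using ij by (auto simp: x_def intro!: bexI[of _ i])
    ultimately show False using nz by blast
  qed
  define V where "V = fun_space.span (v ` I)"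
  have repr: "\<exists>x. f = u x" if "f \<in> V" for f
  proof -
    have "f \<in> range (\<lambda>c. \<Sum>b\<in>v ` I. (\<lambda>z. c b * b z))"
      using that fun_space.span_finite[of "v ` I"] I(1) by (simp add: V_def)
    then obtain c where "f = (\<Sum>b\<in>v ` I. (\<lambda>z. c b * b z))" by blast
    also have "\<dots> = (\<Sum>i\<in>I. (\<lambda>z. c (v i) * v i z))" using inj by (simp add: sum.reindex)
    also have "\<dots> = u (\<lambda>i. c (v i))" by (rule u)
    finally show ?thesis by blast
  qed
  have ind: "fun_space.independent (v ` I)"
  proof
    assume "fun_space.dependent (v ` I)"
    then obtain c where c: "\<exists>b\<in>v ` I. c b \<noteq> 0" "(\<Sum>b\<in>v ` I. (\<lambda>z. c b * b z)) = 0"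
      using fun_space.dependent_finite[of "v ` I"] I(1) by blast
    have "(\<Sum>b\<in>v ` I. (\<lambda>z. c b * b z)) = u (\<lambda>i. c (v i))"
      using inj u[of "\<lambda>i. c (v i)"] by (simp add: sum.reindex)
    then show False using nz[of "\<lambda>i. c (v i)"] c by auto
  qed
  have "V \<in> negative_spaces W antipodal X"
    unfolding negative_spaces_def
  proof (intro CollectI conjI ballI impI)
    show "fun_space.subspace V" by (simp add: V_def)
    show "\<exists>B. finite B \<and> V = fun_space.span B" using I(1) by (intro exI[of _ "v ` I"]) (simp add: V_def)
    fix f assume "f \<in> V"
    then obtain x where x: "f = u x" using repr by blast
    show "f \<in> H10 X W" unfolding x by (rule test_H10[OF W tu])
    have "u x (antipodal z) = - u x z" for z
      using v by (simp add: u_def odd_tests_def sum_negf)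
    then show "odd_on W antipodal f" by (simp add: odd_on_def x)
    show "index_form X W f < 0" if "f \<noteq> 0"
    proof -
      have "\<exists>i\<in>I. x i \<noteq> 0"
      proof (rule ccontr)
        assume "\<not> ?thesis"
        then have "u x = 0" by (simp add: u_def fun_eq_iff)
        then show False using that x by simp
      qed
      then show ?thesis unfolding x iu by (rule neg)
    qed
  qed
  moreover have "fun_space.dim V = m - 1"
    unfolding V_def fun_space.dim_span_eq_card_independent[OF ind] using inj I(2) by (simp add: card_image)
  ultimately show thesis using that[OF R(1)] by (simp add: W_def)
qed

end

section \<open>Relatively compact domains of the quotient\<close>

definition annulus :: "real \<Rightarrow> complex set" where
  "annulus R = {z. 1 / R < cmod z \<and> cmod z < R}"

definition closed_annulus :: "real \<Rightarrow> complex set" where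
  "closed_annulus R = {z. 1 / R \<le> cmod z \<and> cmod z \<le> R}"

lemma sheet_proj_eq_iff: "sheet_proj antipodal z = sheet_proj antipodal w \<longleftrightarrow> w = z \<or> w = antipodal z"
  unfolding sheet_proj_def using antipodal_involution(1) by (metis insert_commute insert_iff singletonD)

lemma antipodal_annulus:
  assumes "R > 0"
  shows "antipodal z \<in> annulus R \<longleftrightarrow> z \<in> annulus R" "antipodal z \<in> closed_annulus R \<longleftrightarrow> z \<in> closed_annulus R"
proof -
  have n: "cmod (antipodal z) = 1 / cmod z" by (simp add: antipodal_def norm_divide)
  have "cmod z = 0 \<or> cmod z > 0" by auto
  then show "antipodal z \<in> annulus R \<longleftrightarrow> z \<in> annulus R" "antipodal z \<in> closed_annulus R \<longleftrightarrow> z \<in> closed_annulus R"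
    unfolding annulus_def closed_annulus_def mem_Collect_eq n using assms
    by (elim disjE; auto simp: divide_less_eq less_divide_eq divide_le_eq le_divide_eq mult.commute)+
qed

lemma open_annulus: "open (annulus R)"
  unfolding annulus_def by (intro open_Collect_conj open_Collect_less continuous_intros)

lemma annulus_nonzero: "R > 0 \<Longrightarrow> annulus R \<subseteq> - {0}" "R > 0 \<Longrightarrow> closed_annulus R \<subseteq> - {0}"
  by (auto simp: annulus_def closed_annulus_def)

lemma compact_closed_annulus: "compact (closed_annulus R)"
proof -
  have "closed_annulus R = cball 0 R - ball 0 (1 / R)" by (auto simp: closed_annulus_def)
  then show ?thesis by (simp add: compact_diff)
qed

lemma sheet_preimage:
  assumes "A \<subseteq> - {0}" "\<And>z. antipodal z \<in> A \<longleftrightarrow> z \<in> A"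
  shows "{z \<in> - {0}. sheet_proj antipodal z \<in> sheet_proj antipodal ` A} = A"
  using assms by (auto simp: sheet_proj_eq_iff image_iff)

lemma openin_sheet_image:
  assumes "open A" "A \<subseteq> - {0}" "\<And>z. antipodal z \<in> A \<longleftrightarrow> z \<in> A"
  shows "openin (quotient_surface (- {0}) antipodal) (sheet_proj antipodal ` A)"
  unfolding openin_quotient_surface sheet_preimage[OF assms(2,3)]
  using assms by (auto simp: openin_open_eq open_Compl)

lemma topspace_quotient_surface: "topspace (quotient_surface S \<tau>) = sheet_proj \<tau> ` S"
  using quotient_imp_surjective_map[OF quotient_map_sheet_proj[of S \<tau>]] by simp

text \<open>The images of the annuli are an increasing open cover of the quotient; compactness of
  the closure of \<Omega> leaves finitely many of them, and the largest one suffices.\<close>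

lemma domain_preimage:
  assumes \<Omega>: "relatively_compact_domain (quotient_surface (- {0}) antipodal) \<Omega>"
  defines "W \<equiv> {z \<in> - {0}. sheet_proj antipodal z \<in> \<Omega>}"
  shows "open W" "antipodal z \<in> W \<longleftrightarrow> z \<in> W" "\<exists>R>1. W \<subseteq> annulus R"
proof -
  let ?Q = "quotient_surface (- {0}) antipodal" and ?p = "sheet_proj antipodal"
  have o: "openin ?Q \<Omega>" and c: "compactin ?Q (?Q closure_of \<Omega>)"
    using \<Omega> by (auto simp: relatively_compact_domain_def)
  show "open W" using o by (simp add: openin_quotient_surface W_def openin_open_eq open_Compl)
  have "?p (antipodal z) = ?p z" by (simp add: sheet_proj_eq_iff antipodal_involution)
  then show "antipodal z \<in> W \<longleftrightarrow> z \<in> W" by (simp add: W_def antipodal_involution)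
  define U where "U n = ?p ` annulus (real n + 2)" for n
  have oU: "openin ?Q (U n)" for n
    unfolding U_def by (rule openin_sheet_image[OF open_annulus annulus_nonzero(1) antipodal_annulus(1)]) auto
  have "?Q closure_of \<Omega> \<subseteq> \<Union>(range U)"
  proof
    fix x assume "x \<in> ?Q closure_of \<Omega>"
    then have "x \<in> topspace ?Q" using closure_of_subset_topspace[of ?Q \<Omega>] by (rule rev_subsetD)
    then obtain z where z: "z \<noteq> 0" "x = ?p z" by (auto simp: topspace_quotient_surface)
    obtain R where R: "R > 1" "{z} \<subseteq> annulus R"
      using compact_subset_annulus[of "{z}"] z(1) by (auto simp: annulus_def)
    obtain n :: nat where n: "R \<le> real n" using real_arch_simple by blast
    have "1 / (real n + 2) \<le> 1 / R" using n R(1) by (intro divide_left_mono) auto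
    then have "z \<in> annulus (real n + 2)" using R(2) n by (auto simp: annulus_def)
    then show "x \<in> \<Union>(range U)" using z(2) by (auto simp: U_def)
  qed
  then obtain \<F> where F: "finite \<F>" "\<F> \<subseteq> range U" "?Q closure_of \<Omega> \<subseteq> \<Union>\<F>"
    using compactinD[OF c, of "range U"] oU by auto
  obtain C where C: "finite C" "\<F> = U ` C" using finite_subset_image[OF F(1,2)] by blast
  obtain N where N: "\<And>n. n \<in> C \<Longrightarrow> n \<le> N" using C(1) unfolding finite_nat_set_iff_bounded_le by blast
  have "W \<subseteq> annulus (real N + 2)"
  proof
    fix z assume "z \<in> W"
    then have "?p z \<in> \<Omega>" by (simp add: W_def)
    then have "?p z \<in> ?Q closure_of \<Omega>" using closure_of_subset[OF openin_subset[OF o]] by blast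
    then obtain n where n: "n \<in> C" "?p z \<in> U n" using F(3) C(2) by blast
    then obtain w where w: "w \<in> annulus (real n + 2)" "?p z = ?p w" by (auto simp: U_def)
    have "z \<in> annulus (real n + 2)"
      using w antipodal_annulus(1)[of "real n + 2" z] unfolding sheet_proj_eq_iff by auto
    moreover have "1 / (real N + 2) \<le> 1 / (real n + 2)" "real n \<le> real N" using N[OF n(1)] by (auto intro!: divide_left_mono)
    ultimately show "z \<in> annulus (real N + 2)" by (auto simp: annulus_def)
  qed
  then show "\<exists>R>1. W \<subseteq> annulus R" by (intro exI[of _ "real N + 2"]) auto
qed

lemma connected_plane_annulus: "connected (annulus R)"
  using connected_annulus(1)[of "1 / R" "0::complex" R] by (simp add: annulus_def)

text \<open>The closure lies in the image of the closed annulus, which is compact, and closed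
  because its complement is the image of an open invariant set.\<close>

lemma annulus_domain:
  assumes R: "R > 1"
  shows "relatively_compact_domain (quotient_surface (- {0}) antipodal) (sheet_proj antipodal ` annulus R)"
proof -
  let ?Q = "quotient_surface (- {0}) antipodal" and ?p = "sheet_proj antipodal" and ?S = "- {0::complex}"
  have R0: "R > 0" using R by simp
  have cont: "continuous_map (top_of_set ?S) ?Q ?p" by (rule quotient_imp_continuous_map[OF quotient_map_sheet_proj])
  have "1 \<in> annulus R" using R by (simp add: annulus_def)
  then have "?p ` annulus R \<noteq> {}" by blast
  moreover have "openin ?Q (?p ` annulus R)"
    by (rule openin_sheet_image[OF open_annulus annulus_nonzero(1)[OF R0] antipodal_annulus(1)[OF R0]])
  moreover have "connectedin ?Q (?p ` annulus R)"
    by (rule connectedin_continuous_map_image[OF cont])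
      (use connected_plane_annulus annulus_nonzero(1)[OF R0] in \<open>simp add: connectedin_subtopology\<close>)
  moreover have "compactin ?Q (?Q closure_of (?p ` annulus R))"
  proof (rule closed_compactin)
    show "compactin ?Q (?p ` closed_annulus R)"
      by (rule image_compactin[OF _ cont])
        (use compact_closed_annulus annulus_nonzero(2)[OF R0] in \<open>simp add: compactin_subtopology\<close>)
    show "?Q closure_of (?p ` annulus R) \<subseteq> ?p ` closed_annulus R"
    proof (rule closure_of_minimal)
      show "?p ` annulus R \<subseteq> ?p ` closed_annulus R" by (auto simp: annulus_def closed_annulus_def)
      have "topspace ?Q - ?p ` closed_annulus R = ?p ` (?S - closed_annulus R)"
        unfolding topspace_quotient_surface
        using sheet_preimage[OF annulus_nonzero(2)[OF R0] antipodal_annulus(2)[OF R0]] by blast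
      moreover have "openin ?Q (?p ` (?S - closed_annulus R))"
        by (rule openin_sheet_image)
          (use antipodal_annulus(2)[OF R0] compact_imp_closed[OF compact_closed_annulus] in
            \<open>auto simp: antipodal_involution open_Compl open_Diff\<close>)
      ultimately show "closedin ?Q (?p ` closed_annulus R)"
        unfolding closedin_def using annulus_nonzero(2)[OF R0] by (auto simp: topspace_quotient_surface)
    qed
  qed simp
  ultimately show ?thesis by (simp add: relatively_compact_domain_def)
qed

theorem theoremD:
  fixes m :: nat
  assumes "odd m" and "m \<ge> 5"
  shows "morse_index (- {0}) antipodal (oliveira_immersion m) = enat (m - 1)"
proof -
  interpret oliveira m using assms by unfold_locales
  show ?thesis
    unfolding morse_index_def
  proof (rule antisym)
    show "(SUP \<Omega>\<in>{\<Omega>. relatively_compact_domain (quotient_surface (- {0}) antipodal) \<Omega>}.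
        SUP V\<in>negative_spaces {z \<in> - {0}. sheet_proj antipodal z \<in> \<Omega>} antipodal X. enat (fun_space.dim V)) \<le> enat (m - 1)"
    proof (intro SUP_least)
      fix \<Omega> V
      assume "\<Omega> \<in> {\<Omega>. relatively_compact_domain (quotient_surface (- {0}) antipodal) \<Omega>}"
      then have \<Omega>: "relatively_compact_domain (quotient_surface (- {0}) antipodal) \<Omega>" by simp
      assume V: "V \<in> negative_spaces {z \<in> - {0}. sheet_proj antipodal z \<in> \<Omega>} antipodal X"
      obtain R where R: "R > 1" "{z \<in> - {0}. sheet_proj antipodal z \<in> \<Omega>} \<subseteq> annulus R"
        using domain_preimage(3)[OF \<Omega>] by blast
      have "annulus R \<subseteq> closed_annulus R" by (auto simp: annulus_def closed_annulus_def)
      then have "admissible {z \<in> - {0}. sheet_proj antipodal z \<in> \<Omega>}"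
        unfolding admissible_def using domain_preimage(1)[OF \<Omega>] R compact_closed_annulus[of R] annulus_nonzero(2)[of R]
        by (intro conjI exI[of _ "closed_annulus R"]) auto
      from upper_bound[OF this domain_preimage(2)[OF \<Omega>] V] show "enat (fun_space.dim V) \<le> enat (m - 1)" by simp
    qed
    \<comment> \<open>A single annulus already attains the value, and its image is one of the
      domains of the supremum.\<close>
    obtain R V where R: "R > 1" and V: "V \<in> negative_spaces {z. 1 / R < cmod z \<and> cmod z < R} antipodal X"
      and dim: "fun_space.dim V = m - 1"
      by (rule lower_bound) (rule that)
    have R0: "R > 0" using R by simp
    have "V \<in> negative_spaces {z \<in> - {0}. sheet_proj antipodal z \<in> sheet_proj antipodal ` annulus R} antipodal X"
      using V unfolding sheet_preimage[OF annulus_nonzero(1)[OF R0] antipodal_annulus(1)[OF R0]] by (simp add: annulus_def)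
    then show "enat (m - 1) \<le> (SUP \<Omega>\<in>{\<Omega>. relatively_compact_domain (quotient_surface (- {0}) antipodal) \<Omega>}.
        SUP V\<in>negative_spaces {z \<in> - {0}. sheet_proj antipodal z \<in> \<Omega>} antipodal X. enat (fun_space.dim V))"
      using annulus_domain[OF R] dim
      by (intro SUP_upper2[of "sheet_proj antipodal ` annulus R"] SUP_upper2[of V]) auto
  qed
qed

end
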